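(* Let $F(\cdot;\xi)$, $f(x)=\mathbb{E}_\xi[F(x;\xi)]$, $L$, $f^*=\inf_{x\in\mathbb{R}^d} f(x)>-\infty$ be as in the context (stochastic components Lipschitz with $\mathbb{E}_\xi[L(\xi)^2]\le L^2$, and $f$ bounded below), let $\delta,\epsilon>0$, $x_0\in\mathbb{R}^d$, and let $\Delta=f(x_0)-f^*$. Run the algorithm GFM$^+$ (defined in the context) from $x_0$ with smoothing parameter $\delta$ and parameters $$T=\left\lceil \frac{4\Delta_\delta}{\eta\epsilon^2}\right\rceil,\quad b'=\left\lceil\frac{2\sigma_\delta^2}{\epsilon^2}\right\rceil,\quad b=\left\lceil\frac{2b'}{m}\right\rceil,\quad \eta=\frac{\sqrt{b'}}{mM_\delta},\quad m=\left\lceil\frac{L_\delta\sqrt{b'}}{M_\delta}\right\rceil ,$$ where $L_\delta=c\sqrt{d}L/\delta$, $\sigma_\delta^2=16\sqrt{2\pi}\,dL^2$, $M_\delta=dL/\delta$, $\Delta_\delta=\Delta+L\delta$. Then its output $x_{\rm out}$ is a $(\delta,\epsilon)$-Goldstein stationary point of $f$ in expectation, i.e. $\mathbb{E}\,\mathrm{dist}(0,\partial_\delta f(x_{\rm out}))\le\epsilon$, and the total stochastic zeroth-order oracle complexity is at most $$\mathcal{O}\left(d^{3/2}\left(\frac{L^3}{\epsilon^3}+\frac{\Delta L^2}{\delta\epsilon^3}\right)\right).$$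
   Context: Setting. $f:\mathbb{R}^d\to\mathbb{R}$ has the form $f(x)=\mathbb{E}_\xi[F(x;\xi)]$ with $\xi$ a random index. For every $\xi$, $|F(x;\xi)-F(y;\xi)|\le L(\xi)\|x-y\|$ for all $x,y\in\mathbb{R}^d$ (Euclidean norm), and $\mathbb{E}_\xi[L(\xi)^2]\le L^2$ for a constant $L>0$. $f$ is bounded below, $f^*=\inf_x f(x)$. Goldstein subdifferential. For Lipschitz $f$, the Clarke subdifferential is $\partial f(x)=\mathrm{conv}\{g: g=\lim_{x_k\to x}\nabla f(x_k)\}$ (limits along sequences of differentiability points), and $\partial_\delta f(x)=\mathrm{conv}\big(\bigcup_{\|y-x\|\le\delta}\partial f(y)\big)$. $\mathrm{dist}(x,A)=\inf_{y\in A}\|x-y\|$. A point $x$ is $(\delta,\epsilon)$-Goldstein stationary if $\mathrm{dist}(0,\partial_\delta f(x))\le\epsilon$. Smoothing. $f_\delta(x)=\mathbb{E}_u[f(x+\delta u)]$ with $u$ uniform on the unit Euclidean ball. $c>0$ is some numeric constant (independent of $d,L,\delta,f$) such that for every $L$-Lipschitz $f:\mathbb{R}^d\to\mathbb{R}$ the gradient of $f_\delta$ is $c\sqrt{d}L\delta^{-1}$-Lipschitz. Gradient estimators. For $w$ in the unit sphere $\mathbb{S}\subset\mathbb{R}^d$, $g(x;w,\xi)=\frac{d}{2\delta}\big(F(x+\delta w;\xi)-F(x-\delta w;\xi)\big)w$. For $S=\{(\xi_i,w_i)\}_{i=1}^b$ with $\xi_i$ i.i.d. copies of $\xi$ and $w_i$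 i.i.d. uniform on $\mathbb{S}$, $g(x;S)=\frac1b\sum_{i=1}^b g(x;w_i,\xi_i)$. Algorithm GFM$^+(x_0,\eta,T,m,b,b')$. For $t=0,1,\dots,T-1$: if $t \bmod m=0$, draw a fresh sample $S'=\{(\xi_i,w_i)\}_{i=1}^{b'}$ and set $v_t=g(x_t;S')$; otherwise draw a fresh sample $S=\{(\xi_i,w_i)\}_{i=1}^{b}$ and set $v_t=v_{t-1}+g(x_t;S)-g(x_{t-1};S)$ (same $S$ in both terms); then set $x_{t+1}=x_t-\eta v_t$. Return $x_{\rm out}$ chosen uniformly at random from $\{x_t\}_{t=0}^{T-1}$. The stochastic zeroth-order oracle complexity is the number of evaluations of values $F(x;\xi)$. $\mathcal{O}(\cdot)$ is the usual asymptotic notation for small target accuracy, hiding only numeric constants. *)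

theory Defs
  imports "HOL-Probability.Probability"
begin

subsection \<open>Goldstein subdifferential\<close>

definition clarke :: "('a::euclidean_space \<Rightarrow> real) \<Rightarrow> 'a \<Rightarrow> 'a set" where
  "clarke f x = convex hull
     {g. \<exists>X G. X \<longlonglongrightarrow> x \<and> (\<forall>k::nat. GDERIV f (X k) :> G k) \<and> G \<longlonglongrightarrow> g}"

definition goldstein :: "real \<Rightarrow> ('a::euclidean_space \<Rightarrow> real) \<Rightarrow> 'a \<Rightarrow> 'a set" where
  "goldstein \<delta> f x = convex hull (\<Union>y\<in>cball x \<delta>. clarke f y)"

subsection \<open>Objective and randomized smoothing\<close>

definition objective :: "'xi measure \<Rightarrow> ('a \<Rightarrow> 'xi \<Rightarrow> real) \<Rightarrow> 'a \<Rightarrow> real" where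
  "objective \<Xi> F x = (\<integral>\<xi>. F x \<xi> \<partial>\<Xi>)"

definition unif_ball :: "'a::euclidean_space measure" where
  "unif_ball = uniform_measure lborel (cball 0 1)"

text \<open>The uniform distribution on the unit sphere, as the law of \<open>u / norm u\<close> for \<open>u\<close> uniform on
  the unit ball. The origin, which \<^const>\<open>sgn\<close> maps to \<open>0\<close>, has probability \<open>0\<close>.\<close>

definition unif_sphere :: "'a::euclidean_space measure" where
  "unif_sphere = distr unif_ball borel sgn"

definition smoothing :: "real \<Rightarrow> ('a::euclidean_space \<Rightarrow> real) \<Rightarrow> 'a \<Rightarrow> real" where
  "smoothing \<delta> f x = (\<integral>u. f (x + \<delta> *\<^sub>R u) \<partial>unif_ball)"

subsection \<open>Zeroth-order gradient estimators\<close>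

definition zo_grad ::
    "('a::euclidean_space \<Rightarrow> 'xi \<Rightarrow> real) \<Rightarrow> real \<Rightarrow> 'a \<Rightarrow> 'xi \<times> 'a \<Rightarrow> 'a" where
  "zo_grad F \<delta> x = (\<lambda>(\<xi>, w).
     (real DIM('a) / (2 * \<delta>) * (F (x + \<delta> *\<^sub>R w) \<xi> - F (x - \<delta> *\<^sub>R w) \<xi>)) *\<^sub>R w)"

definition zo_batch ::
    "('a::euclidean_space \<Rightarrow> 'xi \<Rightarrow> real) \<Rightarrow> real \<Rightarrow> 'a \<Rightarrow> ('xi \<times> 'a) list \<Rightarrow> 'a" where
  "zo_batch F \<delta> x S = (1 / real (length S)) *\<^sub>R (\<Sum>s\<leftarrow>S. zo_grad F \<delta> x s)"

text \<open>The pairs \<open>(y, \<xi>)\<close> at which the value \<open>F y \<xi>\<close> is requested in order to form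
  \<open>zo_batch F \<delta> x S\<close>.\<close>

definition zo_queries ::
    "real \<Rightarrow> 'a::euclidean_space \<Rightarrow> ('xi \<times> 'a) list \<Rightarrow> ('a \<times> 'xi) list" where
  "zo_queries \<delta> x S = concat (map (\<lambda>(\<xi>, w). [(x + \<delta> *\<^sub>R w, \<xi>), (x - \<delta> *\<^sub>R w, \<xi>)]) S)"

subsection \<open>The algorithm\<close>

text \<open>A run is driven by a realization \<open>z\<close> of the samples: \<open>z t i\<close> is the \<open>i\<close>-th pair
  \<open>(\<xi>, w)\<close> drawn in iteration \<open>t\<close>. The state after \<open>t\<close> updates is the pair of the iterate \<open>x\<^sub>t\<close> and
  the gradient estimate \<open>v\<^sub>t\<close>.\<close>

definition sample :: "(nat \<Rightarrow> nat \<Rightarrow> 's) \<Rightarrow> nat \<Rightarrow> nat \<Rightarrow> 's list" where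
  "sample z t n = map (z t) [0..<n]"

primrec gfm_plus ::
    "('a::euclidean_space \<Rightarrow> 'xi \<Rightarrow> real) \<Rightarrow> real \<Rightarrow> 'a \<Rightarrow> real \<Rightarrow> nat \<Rightarrow> nat \<Rightarrow> nat \<Rightarrow>
     (nat \<Rightarrow> nat \<Rightarrow> 'xi \<times> 'a) \<Rightarrow> nat \<Rightarrow> 'a \<times> 'a" where
  "gfm_plus F \<delta> x0 \<eta> m b b' z 0 = (x0, zo_batch F \<delta> x0 (sample z 0 b'))"
| "gfm_plus F \<delta> x0 \<eta> m b b' z (Suc t) =
     (let (x, v) = gfm_plus F \<delta> x0 \<eta> m b b' z t;
          x' = x - \<eta> *\<^sub>R v
      in (x', if Suc t mod m = 0 then zo_batch F \<delta> x' (sample z (Suc t) b')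
              else v + zo_batch F \<delta> x' (sample z (Suc t) b)
                     - zo_batch F \<delta> x (sample z (Suc t) b)))"

definition gfm_iterate ::
    "('a::euclidean_space \<Rightarrow> 'xi \<Rightarrow> real) \<Rightarrow> real \<Rightarrow> 'a \<Rightarrow> real \<Rightarrow> nat \<Rightarrow> nat \<Rightarrow> nat \<Rightarrow>
     (nat \<Rightarrow> nat \<Rightarrow> 'xi \<times> 'a) \<Rightarrow> nat \<Rightarrow> 'a" where
  "gfm_iterate F \<delta> x0 \<eta> m b b' z t = fst (gfm_plus F \<delta> x0 \<eta> m b b' z t)"

text \<open>All oracle queries, with repetitions, made in the iterations \<open>0, \<dots>, T - 1\<close>.\<close>

definition gfm_queries ::
    "('a::euclidean_space \<Rightarrow> 'xi \<Rightarrow> real) \<Rightarrow> real \<Rightarrow> 'a \<Rightarrow> real \<Rightarrow> nat \<Rightarrow> nat \<Rightarrow> nat \<Rightarrow>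
     (nat \<Rightarrow> nat \<Rightarrow> 'xi \<times> 'a) \<Rightarrow> nat \<Rightarrow> ('a \<times> 'xi) list" where
  "gfm_queries F \<delta> x0 \<eta> m b b' z T =
     (let x = gfm_iterate F \<delta> x0 \<eta> m b b' z in
      concat (map (\<lambda>t. if t mod m = 0 then zo_queries \<delta> (x t) (sample z t b')
                       else zo_queries \<delta> (x t) (sample z t b)
                            @ zo_queries \<delta> (x (t - 1)) (sample z t b)) [0..<T]))"

text \<open>The length of \<open>gfm_queries\<close> as a function of the integer parameters only: it makes sense for all
  dimensions at once, which is needed to state a bound with a dimension-free constant.\<close>

definition gfm_cost :: "nat \<Rightarrow> nat \<Rightarrow> nat \<Rightarrow> nat \<Rightarrow> nat" where
  "gfm_cost T m b b' = (\<Sum>t<T. if t mod m = 0 then 2 * b' else 4 * b)"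

subsection \<open>Parameters\<close>

text \<open>\<open>sm_lip\<close> is \<open>L\<^sub>\<delta>\<close>, a Lipschitz constant of the gradient of the smoothed objective; \<open>est_var\<close> is
  \<open>\<sigma>\<^sub>\<delta>\<^sup>2\<close>, a variance bound for \<open>zo_grad\<close>; \<open>est_lip\<close> is \<open>M\<^sub>\<delta>\<close>, a mean-square Lipschitz constant of
  \<open>zo_grad\<close>. The roundings by \<open>nat\<close> are harmless, since all arguments are nonnegative.\<close>

definition sm_lip :: "real \<Rightarrow> nat \<Rightarrow> real \<Rightarrow> real \<Rightarrow> real" where
  "sm_lip c d L \<delta> = c * sqrt (real d) * L / \<delta>"

definition est_var :: "nat \<Rightarrow> real \<Rightarrow> real" where
  "est_var d L = 16 * sqrt (2 * pi) * real d * L\<^sup>2"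

definition est_lip :: "nat \<Rightarrow> real \<Rightarrow> real \<Rightarrow> real" where
  "est_lip d L \<delta> = real d * L / \<delta>"

definition par_b' :: "nat \<Rightarrow> real \<Rightarrow> real \<Rightarrow> nat" where
  "par_b' d L \<epsilon> = nat \<lceil>2 * est_var d L / \<epsilon>\<^sup>2\<rceil>"

definition par_m :: "real \<Rightarrow> nat \<Rightarrow> real \<Rightarrow> real \<Rightarrow> real \<Rightarrow> nat" where
  "par_m c d L \<delta> \<epsilon> = nat \<lceil>sm_lip c d L \<delta> * sqrt (real (par_b' d L \<epsilon>)) / est_lip d L \<delta>\<rceil>"

definition par_b :: "real \<Rightarrow> nat \<Rightarrow> real \<Rightarrow> real \<Rightarrow> real \<Rightarrow> nat" where
  "par_b c d L \<delta> \<epsilon> = nat \<lceil>2 * real (par_b' d L \<epsilon>) / real (par_m c d L \<delta> \<epsilon>)\<rceil>"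

definition par_eta :: "real \<Rightarrow> nat \<Rightarrow> real \<Rightarrow> real \<Rightarrow> real \<Rightarrow> real" where
  "par_eta c d L \<delta> \<epsilon> =
     sqrt (real (par_b' d L \<epsilon>)) / (real (par_m c d L \<delta> \<epsilon>) * est_lip d L \<delta>)"

definition par_T :: "real \<Rightarrow> nat \<Rightarrow> real \<Rightarrow> real \<Rightarrow> real \<Rightarrow> real \<Rightarrow> nat" where
  "par_T c d L \<delta> \<epsilon> \<Delta> = nat \<lceil>4 * (\<Delta> + L * \<delta>) / (par_eta c d L \<delta> \<epsilon> * \<epsilon>\<^sup>2)\<rceil>"

end

theory Submission
  imports Defs
begin

text \<open>Polar coordinates give \<open>grad f\<^sub>\<delta> x = (d / \<delta>) E (f (x + \<delta> w) w)\<close>, so the estimators are unbiased. Almost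
  everywhere differentiability along lines (Vitali) and vanishing ball averages of
  \<open>D\<^sub>v f - \<langle>grad f, v\<rangle>\<close> yield Rademacher's theorem, whence \<open>grad f\<^sub>\<delta> x\<close> averages gradients of \<open>f\<close> over the
  \<open>\<delta>\<close>-ball; separating it from the compact convex set \<open>goldstein \<delta> f x\<close> shows that it belongs to it. It
  remains to bound the mean of \<open>E (norm (grad f\<^sub>\<delta> x\<^sub>t))\<close> over \<open>t < T\<close>.

  The step size may be as large as \<open>1 / L\<^sub>\<delta>\<close>, which leaves no slack in the usual descent inequality. Inside
  an epoch it is replaced by the interpolation inequality for functions with Lipschitz gradient, together
  with \<open>E \<langle>g\<^sub>t\<^sub>+\<^sub>1, e\<^sub>t\<^sub>+\<^sub>1\<rangle> = E \<langle>g\<^sub>t\<^sub>+\<^sub>1, e\<^sub>t\<rangle>\<close> for the errors \<open>e\<^sub>t = v\<^sub>t - g\<^sub>t\<close>, since a fresh batch is centred given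
  the past. What is still lost at the start of each epoch is recovered from a sharper variance bound,
  \<open>\<pi>\<^sup>2 d L\<^sup>2\<close> instead of \<open>\<sigma>\<^sub>\<delta>\<^sup>2\<close>.\<close>

section \<open>Directional derivatives almost everywhere\<close>

text \<open>One computation stands in for the divergence theorem and for integration by parts: the
  difference quotient of a ball average of a Lipschitz function tends to a sphere integral that is
  linear in the direction. It serves Rademacher's theorem, the unbiasedness of the estimator and the
  second moments of the sphere. Without rounding in \<open>m\<close>, \<open>\<eta>\<close> equals
  \<open>1 / L_\<delta>\<close>, and the usual descent inequality retains no negative multiple of
  \<open>(norm v)\<^sup>2\<close> to pay for the error that the update steps accumulate. The
  interpolation inequality supplies a quarter of the mean of \<open>(norm v)\<^sup>2\<close> at the
  new iterate, and the choice of \<open>b\<close> fixes the noise at \<open>1 / (2 * m)\<close>,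
  which this quarter can absorb throughout an epoch. At the start of an epoch the quarter is a debt.
  The budget then closes only if the restart error is at most
  \<open>2 / 15 * \<epsilon>\<^sup>2\<close>. The nominal
  \<open>\<sigma>\<^sub>\<delta>\<^sup>2\<close> would give \<open>\<epsilon>\<^sup>2 / 2\<close>;
  the bound with \<open>pi\<^sup>2\<close> suffices because
  \<open>15 * pi\<^sup>2 \<le> 64 * sqrt (2 * pi)\<close>. The \<open>pi\<close> is the total angle
  of a path from a point to its antipode.\<close>

lemma vitali_intervals:
  fixes A U :: "real set"
  assumes "open U" "A \<subseteq> U"
    and fine: "\<And>x d. x \<in> A \<Longrightarrow> 0 < d \<Longrightarrow> \<exists>l u. l < u \<and> x \<in> {l..u} \<and> u - l < d \<and> P l u"
  obtains C where "countable C" "\<And>l u. (l, u) \<in> C \<Longrightarrow> l < u \<and> {l..u} \<subseteq> U \<and> P l u"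
    "disjoint_family_on (\<lambda>(l, u). {l..u}) C"
    "negligible (A - (\<Union>(l, u)\<in>C. {l..u}))"
proof -
  \<comment> \<open>The covering theorem speaks of indexed balls; the intervals themselves are the
    indices, with midpoint and half length as centre and radius.\<close>
  let ?K = "{(l, u). l < u \<and> {l..u} \<subseteq> U \<and> P l u}"
  let ?a = "\<lambda>(l, u). (l + u) / 2 :: real" and ?r = "\<lambda>(l, u). (u - l) / 2 :: real"
  have cb: "cball (?a i) (?r i) = (case i of (l, u) \<Rightarrow> {l..u})" for i
    by (cases i) (auto simp: cball_def dist_real_def abs_le_iff field_simps)
  have r: "0 < ?r i" if "i \<in> ?K" for i using that by auto
  have S: "\<exists>i. i \<in> ?K \<and> x \<in> cball (?a i) (?r i) \<and> ?r i < d" if x: "x \<in> A" and d: "0 < d" for x d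
  proof -
    obtain e where e: "e > 0" "ball x e \<subseteq> U" using assms x by (meson openE subsetD)
    obtain l u where lu: "l < u" "x \<in> {l..u}" "u - l < min d e" "P l u"
      using fine[OF x, of "min d e"] d e by auto
    have "{l..u} \<subseteq> ball x e" using lu by (auto simp: dist_real_def)
    then have "(l, u) \<in> ?K" using lu e by auto
    moreover have "?r (l, u) < d" using lu d by auto
    moreover have "x \<in> cball (?a (l, u)) (?r (l, u))" unfolding cb using lu(2) by simp
    ultimately show ?thesis by blast
  qed
  obtain C where C: "countable C" "C \<subseteq> ?K"
     "pairwise (\<lambda>i j. disjnt (cball (?a i) (?r i)) (cball (?a j) (?r j))) C"
     "negligible (A - (\<Union>i \<in> C. cball (?a i) (?r i)))"
    by (rule Vitali_covering_theorem_cballs[of ?K ?r A ?a, OF r S])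
  show thesis
  proof (rule that[of C])
    show "disjoint_family_on (\<lambda>(l, u). {l..u}) C"
      using C(3) unfolding cb pairwise_def disjoint_family_on_def disjnt_def .
    show "negligible (A - (\<Union>(l, u)\<in>C. {l..u}))"
      using C(4) unfolding cb .
    show "l < u \<and> {l..u} \<subseteq> U \<and> P l u" if "(l, u) \<in> C" for l u
      using subsetD[OF C(2) that] by simp
  qed (rule C(1))
qed

text \<open>At \<open>h = 0\<close> the value is \<open>0\<close> by the convention for division, so
  that \<open>slope_bound\<close> holds for every \<open>h\<close>.\<close>

definition slope :: "('a::real_vector \<Rightarrow> real) \<Rightarrow> 'a \<Rightarrow> 'a \<Rightarrow> real \<Rightarrow> real" where
  "slope f v x h = (f (x + h *\<^sub>R v) - f x) / h"

text \<open>Frequently small and frequently large quotients replace lower and upper limits, which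
  avoids extended reals: bounded quotients converge at \<open>x\<close> once \<open>x\<close> lies
  in no such set with rational \<open>p < q\<close>.\<close>

definition osc_set :: "('a::real_vector \<Rightarrow> real) \<Rightarrow> 'a \<Rightarrow> real \<Rightarrow> real \<Rightarrow> 'a set" where
  "osc_set f v p q = {x. (\<exists>\<^sub>F h in at 0. slope f v x h < p) \<and> (\<exists>\<^sub>F h in at 0. slope f v x h > q)}"

section \<open>Measurability of the oscillation sets\<close>

lemma rational_in_open:
  assumes "open (S::real set)" "S \<noteq> {}"
  shows "\<exists>r\<in>\<rat>. r \<in> S"
proof -
  obtain x e where x: "e > 0" "ball x e \<subseteq> S" using assms by (meson all_not_in_conv openE)
  obtain r where "r \<in> \<rat>" "x < r" "r < x + e" using Rats_dense_in_real[of x "x + e"] x by auto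
  then show ?thesis using x by (intro bexI[of _ r]) (auto simp: dist_real_def subset_iff)
qed

text \<open>If some increment satisfies \<open>P\<close>, openness provides a rational one within
  the same distance of \<open>0\<close>. Only countably many increments remain, which makes
  \<open>osc_set\<close> a Borel set.\<close>

lemma frequently_at_0_rational:
  assumes "open {h::real. h \<noteq> 0 \<and> P h}"
  shows "(\<exists>\<^sub>F h in at 0. P h) \<longleftrightarrow> (\<forall>n::nat. \<exists>h\<in>{h\<in>\<rat>. h \<noteq> 0 \<and> \<bar>h\<bar> < 1 / Suc n}. P h)"
proof
  assume fr: "\<exists>\<^sub>F h in at 0. P h"
  show "\<forall>n::nat. \<exists>h\<in>{h\<in>\<rat>. h \<noteq> 0 \<and> \<bar>h\<bar> < 1 / Suc n}. P h"
  proof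
    fix n
    obtain h where "h \<noteq> 0" "\<bar>h\<bar> < 1 / Suc n" "P h"
      using fr[unfolded frequently_at, rule_format, of "1 / real (Suc n)"] by auto
    then have "{h. h \<noteq> 0 \<and> P h} \<inter> ball 0 (1 / Suc n) \<noteq> {}" by auto
    then show "\<exists>h\<in>{h\<in>\<rat>. h \<noteq> 0 \<and> \<bar>h\<bar> < 1 / Suc n}. P h"
      using rational_in_open[of "{h. h \<noteq> 0 \<and> P h} \<inter> ball 0 (1 / Suc n)"] assms by auto
  qed
next
  assume *: "\<forall>n::nat. \<exists>h\<in>{h\<in>\<rat>. h \<noteq> 0 \<and> \<bar>h\<bar> < 1 / Suc n}. P h"
  show "\<exists>\<^sub>F h in at 0. P h"
    unfolding frequently_at
  proof (intro allI impI)
    fix d :: real assume "d > 0"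
    then obtain n :: nat where "1 / Suc n < d" by (meson nat_approx_posE)
    then show "\<exists>h\<in>UNIV. h \<noteq> 0 \<and> dist h 0 < d \<and> P h" using *[rule_format, of n] by force
  qed
qed

lemma open_slope:
  fixes f :: "'a::real_normed_vector \<Rightarrow> real"
  assumes "continuous_on UNIV f" "open T"
  shows "open {h. h \<noteq> 0 \<and> slope f v x h \<in> T}"
proof -
  have "continuous_on (- {0}) (slope f v x)"
    unfolding slope_def by (intro continuous_intros continuous_on_compose2[OF assms(1)]) auto
  then have "open (slope f v x -` T \<inter> - {0})"
    using assms(2) by (subst (asm) continuous_on_open_vimage) auto
  also have "slope f v x -` T \<inter> - {0} = {h. h \<noteq> 0 \<and> slope f v x h \<in> T}" by auto
  finally show ?thesis .
qed



lemma osc_set_borel [measurable]: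
  fixes f :: "'a::euclidean_space \<Rightarrow> real"
  assumes cont: "continuous_on UNIV f"
  shows "osc_set f v p q \<in> sets borel"
proof -
  have [measurable]: "f \<in> borel_measurable borel" using cont by (rule borel_measurable_continuous_onI)
  have fr: "(\<exists>\<^sub>F h in at 0. slope f v x h < p) \<longleftrightarrow> (\<forall>n::nat. \<exists>h\<in>{h\<in>\<rat>. h \<noteq> 0 \<and> \<bar>h\<bar> < 1 / Suc n}. slope f v x h < p)"
    "(\<exists>\<^sub>F h in at 0. q < slope f v x h) \<longleftrightarrow> (\<forall>n::nat. \<exists>h\<in>{h\<in>\<rat>. h \<noteq> 0 \<and> \<bar>h\<bar> < 1 / Suc n}. q < slope f v x h)" for x
    using open_slope[OF cont open_lessThan, of v x p] open_slope[OF cont open_greaterThan, of v x q]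
    by (intro frequently_at_0_rational; simp)+
  have [measurable]: "(\<lambda>x. slope f v x h) \<in> borel_measurable borel" for h
    unfolding slope_def by measurable
  have "{x \<in> space borel. slope f v x h < p} \<in> sets borel" "{x \<in> space borel. q < slope f v x h} \<in> sets borel" for h
    by measurable
  then have S: "{x. slope f v x h < p} \<in> sets borel" "{x. q < slope f v x h} \<in> sets borel" for h
    by (simp_all only: space_borel UNIV_I simp_thms)
  define R where "R n = {h\<in>\<rat>. h \<noteq> 0 \<and> \<bar>h\<bar> < 1 / real (Suc n)}" for n :: nat
  have Q: "countable (R n)" for n
    unfolding R_def using countable_rat by (rule countable_subset[rotated]) auto
  have eq: "osc_set f v p q = (\<Inter>n. \<Union>h\<in>R n. {x. slope f v x h < p}) \<inter> (\<Inter>n. \<Union>h\<in>R n. {x. q < slope f v x h})"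
    unfolding osc_set_def fr R_def[symmetric] by blast
  have "UNIV \<in> sets (borel :: 'a measure)" by (metis sets.top space_borel)
  then show ?thesis unfolding eq
    by (intro sets.Int; rule sets.countable_INT''[OF _ countableI_type]; assumption?)
      (rule sets.countable_UN''[OF Q], rule S)+
qed

text \<open>A quotient with increment \<open>h < 0\<close> is the slope over an interval that has
  \<open>x\<close> as its right end. This is why \<open>x\<close> is only asked to lie in the closed
  interval.\<close>

lemma osc_set_interval:
  fixes g :: "real \<Rightarrow> real"
  assumes x: "x \<in> osc_set g 1 p q" and "d > 0"
  shows "\<exists>l u. l < u \<and> x \<in> {l..u} \<and> u - l < d \<and> g u - g l < p * (u - l)"
    and "\<exists>l u. l < u \<and> x \<in> {l..u} \<and> u - l < d \<and> g u - g l > q * (u - l)"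
proof -

  have slope: "\<exists>l u. l < u \<and> x \<in> {l..u} \<and> u - l < d \<and> slope g 1 x h = (g u - g l) / (u - l)"
    if "h \<noteq> 0" "\<bar>h\<bar> < d" for h
  proof (cases "h > 0")
    case True
    then show ?thesis using that by (intro exI[of _ x] exI[of _ "x + h"]) (auto simp: slope_def)
  next
    case False
    have "(g (x + h) - g x) / h = (g x - g (x + h)) / (- h)"
      using that by (simp add: field_simps)
    then show ?thesis using that False
      by (intro exI[of _ "x + h"] exI[of _ x]) (auto simp: slope_def)
  qed
  obtain h where h: "h \<noteq> 0" "\<bar>h\<bar> < d" "slope g 1 x h < p"
    using x \<open>d > 0\<close> unfolding osc_set_def frequently_at by auto
  show "\<exists>l u. l < u \<and> x \<in> {l..u} \<and> u - l < d \<and> g u - g l < p * (u - l)"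
    using slope[OF h(1,2)] h(3) by (fastforce simp: pos_divide_less_eq)
  obtain h where h: "h \<noteq> 0" "\<bar>h\<bar> < d" "slope g 1 x h > q"
    using x \<open>d > 0\<close> unfolding osc_set_def frequently_at by auto
  show "\<exists>l u. l < u \<and> x \<in> {l..u} \<and> u - l < d \<and> g u - g l > q * (u - l)"
    using slope[OF h(1,2)] h(3) by (fastforce simp: pos_less_divide_eq)
qed

text \<open>Near a point of the set there are arbitrarily short intervals on which \<open>g\<close> grows by less than \<open>p\<close>
  times their length, and others on which it grows by more than \<open>q\<close> times. Covering the set
  \<open>A\<close> first by the former and then, within these, by the latter gives \<open>q |A| \<le> p (|A| + e)\<close>.\<close>

lemma osc_set_mono_null:
  fixes g :: "real \<Rightarrow> real"
  assumes mono: "mono g" and cont: "continuous_on UNIV g" and pq: "0 < p" "p < q"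
  shows "emeasure lborel (osc_set g 1 p q \<inter> {a<..<b}) = 0"
proof -
  \<comment> \<open>The Stieltjes measure of \<open>g\<close> turns increments over intervals into
    masses, which add up over countable disjoint families.\<close>
  define M where "M = interval_measure g"
  define A where "A = osc_set g 1 p q \<inter> {a<..<b}"
  have gm: "\<And>x y. x \<le> y \<Longrightarrow> g x \<le> g y" using mono by (auto simp: mono_def)
  have Am [measurable]: "A \<in> sets borel" unfolding A_def using osc_set_borel[OF cont] by auto
  have MIcc: "emeasure M {l..u} = ennreal (g u - g l)" if "l \<le> u" for l u
    unfolding M_def using that gm cont by (intro emeasure_interval_measure_Icc) auto
  have Mset [measurable_cong]: "sets M = sets borel" unfolding M_def by simp
  have "A \<subseteq> {a..b}" unfolding A_def by auto
  then have "emeasure lborel A \<le> emeasure lborel {a..b}" by (intro emeasure_mono) auto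
  also have "\<dots> < \<infinity>" by (simp add: emeasure_lborel_Icc_eq)
  finally have fin: "emeasure lborel A < \<infinity>" .
  have main: "ennreal q * emeasure lborel A \<le> ennreal p * (emeasure lborel A + ennreal e)" if "e > 0" for e
  proof -
    obtain U where U: "open U" "A \<subseteq> U" "emeasure lebesgue (U - A) < ennreal e"
      using sets_lebesgue_outer_open[of A e] \<open>e > 0\<close> by (auto simp: Am)
    have Um [measurable]: "U \<in> sets borel" using U by auto
    obtain C where C: "countable C"
      "\<And>l u. (l, u) \<in> C \<Longrightarrow> l < u \<and> {l..u} \<subseteq> U \<and> g u - g l < p * (u - l)"
      "disjoint_family_on (\<lambda>(l, u). {l..u}) C" "negligible (A - (\<Union>(l, u)\<in>C. {l..u}))"
    proof (rule vitali_intervals[OF U(1,2), of "\<lambda>l u. g u - g l < p * (u - l)"])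
      show "\<exists>l u. l < u \<and> x \<in> {l..u} \<and> u - l < d \<and> g u - g l < p * (u - l)"
        if "x \<in> A" "0 < d" for x d
        using that by (intro osc_set_interval(1)[of _ g p q]) (auto simp: A_def)
    qed (rule that, assumption+)
    \<comment> \<open>Interiors, because the second covering has to take place inside an open set;
      only countably many endpoints are lost, which \<open>N\<close> collects below.\<close>
    define V where "V = (\<Union>(l, u)\<in>C. {l<..<u})"
    have Vo: "open V" unfolding V_def by auto
    have V[measurable]: "V \<in> sets borel" using Vo by auto
    have "emeasure M V \<le> emeasure M (\<Union>(l, u)\<in>C. {l..u})"
    proof (rule emeasure_mono)
      show "V \<subseteq> (\<Union>(l, u)\<in>C. {l..u})" unfolding V_def by fastforce
      show "(\<Union>(l, u)\<in>C. {l..u}) \<in> sets M" unfolding Mset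
        using C(1) by (intro sets.countable_UN'') auto
    qed
    also have "\<dots> = (\<integral>\<^sup>+i. emeasure M (case i of (l, u) \<Rightarrow> {l..u}) \<partial>count_space C)"
      using C by (intro emeasure_UN_countable) (auto simp: Mset)
    also have "\<dots> \<le> (\<integral>\<^sup>+i. ennreal p * emeasure lborel (case i of (l, u) \<Rightarrow> {l..u}) \<partial>count_space C)"
    proof (rule nn_integral_mono)
      fix i assume "i \<in> space (count_space C)"
      then obtain l u where i: "i = (l, u)" "(l, u) \<in> C" by (cases i) auto
      then show "emeasure M (case i of (l, u) \<Rightarrow> {l..u}) \<le> ennreal p * emeasure lborel (case i of (l, u) \<Rightarrow> {l..u})"
        using C(2)[OF i(2)] pq by (auto simp: MIcc ennreal_mult[symmetric] intro!: ennreal_leI)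
    qed
    also have "\<dots> = ennreal p * (\<integral>\<^sup>+i. emeasure lborel (case i of (l, u) \<Rightarrow> {l..u}) \<partial>count_space C)"
      by (rule nn_integral_cmult) auto
    also have "(\<integral>\<^sup>+i. emeasure lborel (case i of (l, u) \<Rightarrow> {l..u}) \<partial>count_space C) =
        emeasure lborel (\<Union>(l, u)\<in>C. {l..u})"
      using C by (intro emeasure_UN_countable[symmetric]) auto
    also have "\<dots> \<le> emeasure lborel U"
      using C(2) by (intro emeasure_mono) auto
    also have "emeasure lborel U = emeasure lborel A + emeasure lborel (U - A)"
      using U(2) by (subst plus_emeasure) (auto simp: Un_absorb1)
    also have "emeasure lborel (U - A) \<le> ennreal e"
      using U(3) by (simp add: less_imp_le)
    finally have MV: "emeasure M V \<le> ennreal p * (emeasure lborel A + ennreal e)"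
      by (simp add: add_left_mono mult_left_mono)
    have "A \<inter> V \<subseteq> V" by auto
    obtain C' where C': "countable C'"
      "\<And>l u. (l, u) \<in> C' \<Longrightarrow> l < u \<and> {l..u} \<subseteq> V \<and> g u - g l > q * (u - l)"
      "disjoint_family_on (\<lambda>(l, u). {l..u}) C'" "negligible (A \<inter> V - (\<Union>(l, u)\<in>C'. {l..u}))"
    proof (rule vitali_intervals[OF Vo \<open>A \<inter> V \<subseteq> V\<close>, of "\<lambda>l u. g u - g l > q * (u - l)"])
      show "\<exists>l u. l < u \<and> x \<in> {l..u} \<and> u - l < d \<and> g u - g l > q * (u - l)"
        if "x \<in> A \<inter> V" "0 < d" for x d
        using that by (intro osc_set_interval(2)[of _ g p q]) (auto simp: A_def)
    qed (rule that, assumption+)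
    have W: "(\<Union>(l, u)\<in>C'. {l..u}) \<in> sets borel" "(\<Union>(l, u)\<in>C. {l..u}) \<in> sets borel"
      using C C' by (auto intro!: sets.countable_UN'')
    have "countable (fst ` C \<union> snd ` C)" using C by auto
    then have n1: "fst ` C \<union> snd ` C \<in> null_sets lborel" by (rule countable_imp_null_set_lborel)
    have null: "X \<in> null_sets lborel" if "negligible X" "X \<in> sets borel" for X :: "real set"
      using that by (simp add: null_sets_def negligible_iff_null_sets)
    have n2: "A - (\<Union>(l, u)\<in>C. {l..u}) \<in> null_sets lborel"
      by (intro null C sets.Diff W Am)
    have n3: "A \<inter> V - (\<Union>(l, u)\<in>C'. {l..u}) \<in> null_sets lborel"
      by (intro null C' sets.Diff sets.Int W Am V)
    define N where "N = (A - (\<Union>(l, u)\<in>C. {l..u})) \<union>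
        ((A \<inter> V - (\<Union>(l, u)\<in>C'. {l..u})) \<union> (fst ` C \<union> snd ` C))"
    have N: "N \<in> null_sets lborel" unfolding N_def by (intro null_sets.Un n1 n2 n3)
    have "A \<subseteq> (\<Union>(l, u)\<in>C'. {l..u}) \<union> N"
    proof
      fix x assume x: "x \<in> A"
      show "x \<in> (\<Union>(l, u)\<in>C'. {l..u}) \<union> N"
      proof (cases "x \<in> V")
        case True then show ?thesis using x unfolding N_def by blast
      next
        case False
        show ?thesis
        proof (cases "x \<in> (\<Union>(l, u)\<in>C. {l..u})")
          case True
          then obtain l u where lu: "(l, u) \<in> C" "x \<in> {l..u}" by auto
          moreover have "x \<notin> {l<..<u}" using False lu(1) unfolding V_def by auto
          ultimately have "x = l \<or> x = u" by auto
          then show ?thesis using lu(1) unfolding N_def by force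
        qed (use x in \<open>simp add: N_def\<close>)
      qed
    qed
    then have "emeasure lborel A \<le> emeasure lborel ((\<Union>(l, u)\<in>C'. {l..u}) \<union> N)"
      using N W by (intro emeasure_mono sets.Un) (auto dest: null_setsD2)
    also have "\<dots> = emeasure lborel (\<Union>(l, u)\<in>C'. {l..u})"
      using W(1) N by (intro emeasure_Un_null_set) simp_all
    also have "\<dots> = (\<integral>\<^sup>+i. emeasure lborel (case i of (l, u) \<Rightarrow> {l..u}) \<partial>count_space C')"
      using C' by (intro emeasure_UN_countable) auto
    finally have "ennreal q * emeasure lborel A \<le>
        ennreal q * (\<integral>\<^sup>+i. emeasure lborel (case i of (l, u) \<Rightarrow> {l..u}) \<partial>count_space C')"
      by (rule mult_left_mono) simp
    also have "\<dots> = (\<integral>\<^sup>+i. ennreal q * emeasure lborel (case i of (l, u) \<Rightarrow> {l..u}) \<partial>count_space C')"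
      by (rule nn_integral_cmult[symmetric]) auto
    also have "\<dots> \<le> (\<integral>\<^sup>+i. emeasure M (case i of (l, u) \<Rightarrow> {l..u}) \<partial>count_space C')"
    proof (rule nn_integral_mono)
      fix i assume "i \<in> space (count_space C')"
      then obtain l u where i: "i = (l, u)" "(l, u) \<in> C'" by (cases i) auto
      then show "ennreal q * emeasure lborel (case i of (l, u) \<Rightarrow> {l..u}) \<le> emeasure M (case i of (l, u) \<Rightarrow> {l..u})"
        using C'(2)[OF i(2)] pq by (auto simp: MIcc ennreal_mult[symmetric] intro!: ennreal_leI)
    qed
    also have "\<dots> = emeasure M (\<Union>(l, u)\<in>C'. {l..u})"
      using C' by (intro emeasure_UN_countable[symmetric]) (auto simp: Mset)
    also have "\<dots> \<le> emeasure M V"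
      using C'(2) V by (intro emeasure_mono) (auto simp: Mset)
    finally show ?thesis using MV by (rule order_trans)
  qed
  define z where "z = measure lborel A"
  have z: "emeasure lborel A = ennreal z" "z \<ge> 0"
    unfolding z_def using fin by (simp_all add: emeasure_eq_ennreal_measure top.not_eq_extremum)
  have "q * z \<le> p * (z + e)" if "e > 0" for e
  proof -
    have "ennreal (q * z) \<le> ennreal (p * (z + e))"
      using main[OF that] pq z(2) that unfolding z(1) by (simp add: ennreal_mult ennreal_plus)
    then show ?thesis using pq z(2) that by (subst (asm) ennreal_le_iff) auto
  qed
  note ineq = this
  have "z = 0"
  proof (rule ccontr)
    assume "z \<noteq> 0"
    then have "z > 0" using z by simp
    \<comment> \<open>With this \<open>e\<close> the right side is the mean of \<open>p * z\<close>
      and \<open>q * z\<close>, hence below \<open>q * z\<close>.\<close>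
    have "q * z \<le> p * (z + (q - p) * z / (2 * p))" using \<open>z > 0\<close> pq by (intro ineq) auto
    also have "\<dots> = (p + q) / 2 * z" using pq by (simp add: field_simps)
    finally show False using \<open>z > 0\<close> pq by (simp add: field_simps)
  qed
  then show ?thesis using z unfolding A_def by simp
qed

lemma osc_set_lipschitz_null:
  fixes g :: "real \<Rightarrow> real"
  assumes lip: "K-lipschitz_on UNIV g" and pq: "p < q"
  shows "osc_set g 1 p q \<in> null_sets lborel"
proof -
  \<comment> \<open>\<open>K\<close> makes \<open>g'\<close> increasing, and
    \<open>1 + \<bar>p\<bar>\<close> makes the shifted lower threshold \<open>p + k\<close>
    positive, as the monotone case requires.\<close>
  define k where "k = K + 1 + \<bar>p\<bar>"
  define g' where "g' x = g x + k * x" for x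
  have K: "K \<ge> 0" using lip lipschitz_on_nonneg by blast
  have cont: "continuous_on UNIV g" using lip by (rule lipschitz_on_continuous_on)
  have mono: "mono g'"
  proof (rule monoI)
    fix x y :: real assume "x \<le> y"
    have "g x - g y \<le> K * (y - x)"
      using lipschitz_onD[OF lip, of x y] \<open>x \<le> y\<close> by (auto simp: dist_real_def)
    also have "\<dots> \<le> k * (y - x)" unfolding k_def using \<open>x \<le> y\<close> by (intro mult_right_mono) auto
    finally show "g' x \<le> g' y" unfolding g'_def by (simp add: algebra_simps)
  qed
  have cont': "continuous_on UNIV g'" unfolding g'_def by (intro continuous_intros cont)
  have slope: "slope g' 1 x h = slope g 1 x h + k" if "h \<noteq> 0" for x h
    using that by (simp add: slope_def g'_def field_simps)
  have "(\<exists>\<^sub>F h in at 0. slope g 1 x h < p) \<longleftrightarrow> (\<exists>\<^sub>F h in at 0. slope g' 1 x h < p + k)"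
    "(\<exists>\<^sub>F h in at 0. slope g 1 x h > q) \<longleftrightarrow> (\<exists>\<^sub>F h in at 0. slope g' 1 x h > q + k)" for x
    using slope by (intro frequently_cong; force simp: eventually_at_filter)+
  then have eq: "osc_set g 1 p q = osc_set g' 1 (p + k) (q + k)"
    unfolding osc_set_def by presburger
  have "emeasure lborel (osc_set g' 1 (p + k) (q + k) \<inter> {- real n<..<real n}) = 0" for n
    using K pq by (intro osc_set_mono_null mono cont') (auto simp: k_def)
  then have "(\<Union>n. osc_set g 1 p q \<inter> {- real n<..<real n}) \<in> null_sets lborel"
    unfolding eq[symmetric] using osc_set_borel[OF cont] by (intro null_sets_UN) (auto simp: null_sets_def)
  moreover have "(\<Union>n. osc_set g 1 p q \<inter> {- real n<..<real n}) = osc_set g 1 p q"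
  proof -
    have "\<exists>n. x \<in> {- real n<..<real n}" for x
      using reals_Archimedean2[of "\<bar>x\<bar>"] by (force simp: abs_less_iff)
    then show ?thesis by blast
  qed
  ultimately show ?thesis by simp
qed

text \<open>No coordinates adapted to \<open>v\<close> are introduced. The indicator of
  \<open>x + t *\<^sub>R v \<in> N\<close> is integrated over all \<open>x\<close> and over
  \<open>t\<close> in the unit interval: the integral over \<open>t\<close> vanishes for each
  \<open>x\<close>, while translation invariance makes the integral over \<open>x\<close> the
  measure of \<open>N\<close> for each such \<open>t\<close>.\<close>

lemma null_set_of_line_sections:
  fixes N :: "'a::euclidean_space set"
  assumes [measurable]: "N \<in> sets borel" and sec: "\<And>x. {t. x + t *\<^sub>R v \<in> N} \<in> null_sets lborel"
  shows "N \<in> null_sets lborel"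
proof -
  have "(\<integral>\<^sup>+x. (\<integral>\<^sup>+t. indicator N (x + t *\<^sub>R v) * indicator {0..1} t \<partial>lborel) \<partial>lborel) = 0"
  proof -
    have "(\<integral>\<^sup>+t. indicator N (x + t *\<^sub>R v) * indicator {0..1} t \<partial>lborel) = 0" for x
    proof -
      have "AE t in lborel. indicator N (x + t *\<^sub>R v) * indicator {0..1} t = (0::ennreal)"
        using AE_not_in[OF sec[of x]] by eventually_elim auto
      then show ?thesis by (subst nn_integral_0_iff_AE) auto
    qed
    then show ?thesis by simp
  qed
  moreover have "(\<integral>\<^sup>+x. (\<integral>\<^sup>+t. indicator N (x + t *\<^sub>R v) * indicator {0..1} t \<partial>lborel) \<partial>lborel) =
    (\<integral>\<^sup>+t. (\<integral>\<^sup>+x. indicator N (x + t *\<^sub>R v) * indicator {0..1} t \<partial>lborel) \<partial>lborel)"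
    by (rule lborel_pair.Fubini'[symmetric]) measurable
  moreover have "(\<integral>\<^sup>+x. indicator N (x + t *\<^sub>R v) * indicator {0..1} t \<partial>lborel) =
      emeasure lborel N * indicator {0..1} t" for t
  proof -
    have "(\<integral>\<^sup>+x. indicator N (x + t *\<^sub>R v) \<partial>lborel) = (\<integral>\<^sup>+x. indicator N x \<partial>distr lborel borel ((+) (t *\<^sub>R v)))"
      by (subst nn_integral_distr) (auto simp: add.commute)
    also have "\<dots> = emeasure lborel N" unfolding lborel_distr_plus by simp
    finally show ?thesis by (subst nn_integral_multc) auto
  qed
  ultimately have "(\<integral>\<^sup>+t. emeasure lborel N * indicator {0..1::real} t \<partial>lborel) = 0" by simp
  then have "emeasure lborel N = 0" by (subst (asm) nn_integral_cmult_indicator) auto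
  then show ?thesis by (simp add: null_sets_def)
qed

lemma lipschitz_on_line:
  fixes f :: "'a::real_normed_vector \<Rightarrow> real"
  assumes "K-lipschitz_on UNIV f"
  shows "(K * norm v)-lipschitz_on UNIV (\<lambda>t. f (x + t *\<^sub>R v))"
proof (rule lipschitz_onI)
  show "0 \<le> K * norm v" using lipschitz_on_nonneg[OF assms] by simp
  fix s t :: real
  have "dist (f (x + s *\<^sub>R v)) (f (x + t *\<^sub>R v)) \<le> K * dist (x + s *\<^sub>R v) (x + t *\<^sub>R v)"
    by (rule lipschitz_onD[OF assms]) auto
  also have "dist (x + s *\<^sub>R v) (x + t *\<^sub>R v) = norm v * dist s t"
    by (simp add: dist_norm scaleR_diff_left[symmetric] mult.commute)
  finally show "dist (f (x + s *\<^sub>R v)) (f (x + t *\<^sub>R v)) \<le> K * norm v * dist s t" by (simp add: mult.assoc)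
qed

lemma osc_set_null:
  fixes f :: "'a::euclidean_space \<Rightarrow> real"
  assumes lip: "K-lipschitz_on UNIV f" and pq: "p < q"
  shows "osc_set f v p q \<in> null_sets lborel"
proof (rule null_set_of_line_sections)
  show "osc_set f v p q \<in> sets borel"
    by (rule osc_set_borel) (rule lipschitz_on_continuous_on[OF lip])
  fix x
  have "slope f v (x + t *\<^sub>R v) h = slope (\<lambda>t. f (x + t *\<^sub>R v)) 1 t h" for t h
    by (simp add: slope_def algebra_simps)
  then have "{t. x + t *\<^sub>R v \<in> osc_set f v p q} = osc_set (\<lambda>t. f (x + t *\<^sub>R v)) 1 p q"
    unfolding osc_set_def by simp
  then show "{t. x + t *\<^sub>R v \<in> osc_set f v p q} \<in> null_sets lborel"
    using osc_set_lipschitz_null[OF lipschitz_on_line[OF lip] pq] by simp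
qed

lemma slope_bound:
  assumes lip: "K-lipschitz_on UNIV f"
  shows "\<bar>slope f v x h\<bar> \<le> K * norm v"
proof (cases "h = 0")
  case True then show ?thesis using lipschitz_on_nonneg[OF lip] by (simp add: slope_def)
next
  case False
  have "\<bar>f (x + h *\<^sub>R v) - f x\<bar> \<le> K * norm v * \<bar>h\<bar>"
    using lipschitz_onD[OF lip, of "x + h *\<^sub>R v" x] by (simp add: dist_norm mult_ac)
  then show ?thesis using False by (simp add: slope_def field_simps)
qed

lemma slope_convergent:
  fixes f :: "'a::real_normed_vector \<Rightarrow> real"
  assumes lip: "K-lipschitz_on UNIV f"
    and x: "\<And>p q. p \<in> \<rat> \<Longrightarrow> q \<in> \<rat> \<Longrightarrow> p < q \<Longrightarrow> x \<notin> osc_set f v p q"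
  shows "\<exists>D. (slope f v x \<longlongrightarrow> D) (at 0)"
proof -
  \<comment> \<open>\<open>Sup S\<close> is the lower limit of the quotients, the only candidate for
    their limit.\<close>
  define S where "S = {p. \<forall>\<^sub>F h in at 0. slope f v x h \<ge> p}"
  define k where "k = K * norm v"
  have b: "- k \<le> slope f v x h" "slope f v x h \<le> k" for h
    using slope_bound[OF lip, of v x h] unfolding k_def by auto
  have S1: "- k \<in> S" unfolding S_def using b by simp
  have "p \<le> k" if "p \<in> S" for p
  proof -
    have "\<forall>\<^sub>F h::real in at 0. p \<le> k"
      using that unfolding S_def mem_Collect_eq by eventually_elim (use b order_trans in blast)
    then show ?thesis by (simp add: eventually_const trivial_limit_at)
  qed
  then have bdd: "bdd_above S" by (intro bdd_aboveI[of S k]) auto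
  have "(slope f v x \<longlongrightarrow> Sup S) (at 0)"
  proof (rule order_tendstoI)
    fix a assume "a < Sup S"
    then obtain p where p: "p \<in> S" "a < p" using less_cSup_iff[OF _ bdd] S1 by blast
    show "\<forall>\<^sub>F h in at 0. a < slope f v x h"
      using p(1) unfolding S_def mem_Collect_eq by eventually_elim (use p in auto)
  next
    fix a assume a: "Sup S < a"
    obtain q where q: "q \<in> \<rat>" "Sup S < q" "q < a" using Rats_dense_in_real[OF a] by auto
    obtain p where p: "p \<in> \<rat>" "Sup S < p" "p < q" using Rats_dense_in_real[OF q(2)] by auto
    \<comment> \<open>Since \<open>p\<close> exceeds \<open>Sup S\<close>, quotients below
      \<open>p\<close> recur near \<open>0\<close>. Quotients above \<open>q\<close> cannot recur as
      well, or \<open>x\<close> would lie in \<open>osc_set f v p q\<close>.\<close>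
    have "p \<notin> S" using cSup_upper[OF _ bdd] p(2) by force
    then have "\<exists>\<^sub>F h in at 0. slope f v x h < p"
      unfolding S_def by (simp add: not_eventually not_le)
    then have "\<not> (\<exists>\<^sub>F h in at 0. slope f v x h > q)"
      using x[OF p(1) q(1) p(3)] unfolding osc_set_def by auto
    then have "\<forall>\<^sub>F h in at 0. slope f v x h \<le> q" by (simp add: not_frequently not_less)
    then show "\<forall>\<^sub>F h in at 0. slope f v x h < a" by eventually_elim (use q in auto)
  qed
  then show ?thesis by blast
qed

lemma AE_slope_convergent:
  fixes f :: "'a::euclidean_space \<Rightarrow> real"
  assumes lip: "K-lipschitz_on UNIV f"
  shows "AE x in lborel. \<exists>D. (slope f v x \<longlongrightarrow> D) (at 0)"
proof -
  have "AE x in lborel. \<forall>p\<in>\<rat>. \<forall>q\<in>\<rat>. p < q \<longrightarrow> x \<notin> osc_set f v p q"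
    using osc_set_null[OF lip, of _ _ v]
    by (subst AE_ball_countable[OF countable_rat])+ (auto intro: AE_not_in)
  then show ?thesis by eventually_elim (use slope_convergent[OF lip] in auto)
qed

section \<open>Polar coordinates\<close>

lemma nn_integral_lborel_scaleR:
  fixes f :: "'a::euclidean_space \<Rightarrow> ennreal"
  assumes [measurable]: "f \<in> borel_measurable borel" and c: "c \<noteq> 0"
  shows "(\<integral>\<^sup>+x. f x \<partial>lborel) = ennreal (\<bar>c\<bar> ^ DIM('a)) * (\<integral>\<^sup>+x. f (c *\<^sub>R x) \<partial>lborel)"
  by (subst lborel_affine[OF c, of 0])
     (simp add: nn_integral_density nn_integral_distr nn_integral_cmult)

lemma emeasure_cball_pos: "r > 0 \<Longrightarrow> 0 < emeasure lborel (cball (x::'a::euclidean_space) r)"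
  by (simp add: emeasure_cball ennreal_zero_less_mult_iff)

section \<open>The joint law of norm and direction\<close>

lemma borel_measurable_sgn_euclidean [measurable]:
  "(sgn :: 'a::euclidean_space \<Rightarrow> 'a) \<in> borel_measurable borel"
  unfolding sgn_div_norm[abs_def] by measurable

lemma emeasure_unif_sphere:
  fixes B :: "'a::euclidean_space set"
  assumes [measurable]: "B \<in> sets borel"
  shows "emeasure unif_sphere B =
    emeasure lborel (cball 0 1 \<inter> sgn -` B) / emeasure lborel (cball (0::'a) 1)"
proof -
  have [measurable]: "sgn -` B \<in> sets borel"
    by (rule measurable_sets_borel[OF borel_measurable_sgn_euclidean assms])
  show ?thesis
    unfolding unif_sphere_def unif_ball_def
    by (subst emeasure_distr) (auto simp: measurable_cong_sets[OF sets_uniform_measure refl])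
qed

lemma prob_space_unif_ball: "prob_space (unif_ball :: 'a::euclidean_space measure)"
  unfolding unif_ball_def using emeasure_cball_pos[of 1 "0::'a"] emeasure_lborel_cball_finite[of "0::'a" 1]
  by (intro prob_space_uniform_measure) auto

lemma sets_unif_ball [simp, measurable_cong]: "sets unif_ball = sets borel"
  by (simp add: unif_ball_def)

lemma sets_unif_sphere [simp, measurable_cong]: "sets unif_sphere = sets borel"
  by (simp add: unif_sphere_def)

lemma space_unif_sphere [simp]: "space unif_sphere = UNIV"
  by (simp add: unif_sphere_def)

lemma space_unif_ball [simp]: "space unif_ball = UNIV"
  by (simp add: unif_ball_def)

lemma prob_space_unif_sphere: "prob_space (unif_sphere :: 'a::euclidean_space measure)"
  unfolding unif_sphere_def
  by (intro prob_space.prob_space_distr prob_space_unif_ball) (simp add: measurable_cong_sets[OF sets_unif_ball refl])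

text \<open>\<open>sgn\<close> ignores positive scaling, so a sector of radius \<open>r\<close> is a
  scaled unit sector, and \<open>unif_sphere\<close> is defined through the latter. Negative and
  zero radii give \<open>0\<close> on both sides.\<close>

lemma emeasure_cball_sector:
  fixes B :: "'a::euclidean_space set"
  assumes [measurable]: "B \<in> sets borel"
  shows "emeasure lborel (norm -` {..r} \<inter> sgn -` B) = emeasure lborel (norm -` {..r} :: 'a set) * emeasure unif_sphere B"
proof -
  have [measurable]: "norm -` {..r} \<in> sets (borel :: 'a measure)" for r
    by (rule measurable_sets_borel[OF borel_measurable_norm]) simp
  have [measurable]: "sgn -` B \<in> sets borel"
    by (rule measurable_sets_borel[OF borel_measurable_sgn_euclidean assms])
  have cb: "norm -` {..r} = cball (0::'a) r" for r by (auto simp: cball_def dist_norm)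
  have scale: "emeasure lborel (norm -` {..r} \<inter> sgn -` B) = ennreal (r ^ DIM('a)) * emeasure lborel (norm -` {..1} \<inter> sgn -` B)"
    if r: "r > 0" and [measurable]: "B \<in> sets borel" for B :: "'a set"
  proof -
    have [measurable]: "sgn -` B \<in> sets borel" using that(2) by (rule measurable_sets_borel[rotated]) simp
    have "emeasure lborel (norm -` {..r} \<inter> sgn -` B) = (\<integral>\<^sup>+x. indicator (norm -` {..r} \<inter> sgn -` B) x \<partial>lborel)"
      by simp
    also have "\<dots> = ennreal (\<bar>r\<bar> ^ DIM('a)) * (\<integral>\<^sup>+x. indicator (norm -` {..r} \<inter> sgn -` B) (r *\<^sub>R x) \<partial>lborel)"
      using r by (intro nn_integral_lborel_scaleR) auto
    also have "(\<lambda>x. indicator (norm -` {..r} \<inter> sgn -` B) (r *\<^sub>R x) :: ennreal) = indicator (norm -` {..1} \<inter> sgn -` B)"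
      using r by (auto simp: fun_eq_iff indicator_def sgn_scaleR)
    finally show ?thesis using r by simp
  qed
  consider "r < 0" | "r = 0" | "r > 0" by linarith
  then show ?thesis
  proof cases
    case 1
    then have "norm -` {..r} = ({} :: 'a set)" by (auto simp: not_le) (smt (verit) norm_ge_zero)
    then show ?thesis by simp
  next
    case 2
    then have "norm -` {..r} = {0 :: 'a}" by auto
    then have "emeasure lborel (norm -` {..r} :: 'a set) = 0" by simp
    moreover have "emeasure lborel (norm -` {..r} \<inter> sgn -` B) \<le> emeasure lborel (norm -` {..r} :: 'a set)"
      by (intro emeasure_mono) auto
    ultimately show ?thesis by simp
  next
    case 3
    have c: "0 < emeasure lborel (cball (0::'a) 1)" "emeasure lborel (cball (0::'a) 1) < \<infinity>"
      using emeasure_cball_pos[of 1 "0::'a"] emeasure_lborel_cball_finite[of "0::'a" 1] by auto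
    have "emeasure lborel (norm -` {..r} :: 'a set) = ennreal (r ^ DIM('a)) * emeasure lborel (cball (0::'a) 1)"
      using scale[OF 3, of UNIV] by (simp add: cb)
    moreover have "c * (a / c) = a" if "0 < c" "c < \<infinity>" for a c :: ennreal
      using that by (simp add: ennreal_times_divide mult.commute[of c] ennreal_mult_divide_eq)
    from this[OF c] have "emeasure lborel (cball 0 1 \<inter> sgn -` B) =
        emeasure lborel (cball (0::'a) 1) * emeasure unif_sphere B"
      unfolding emeasure_unif_sphere[OF assms] by simp
    ultimately show ?thesis using scale[OF 3, of B] by (simp add: cb mult.assoc)
  qed
qed

text \<open>Both sides are measures in \<open>A\<close>. They agree on the half-lines
  \<open>{..r}\<close> by the sector formula, and these are closed under intersection and generate
  the Borel sets.\<close>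

lemma emeasure_norm_sgn:
  fixes B :: "'a::euclidean_space set"
  assumes [measurable]: "A \<in> sets borel" "B \<in> sets borel"
  shows "emeasure lborel (norm -` A \<inter> sgn -` B) = emeasure lborel (norm -` A :: 'a set) * emeasure unif_sphere B"
proof -
  have [measurable]: "sgn -` B \<in> sets borel" by (rule measurable_sets_borel[OF borel_measurable_sgn_euclidean assms(2)])
  have nm: "norm -` A \<in> sets (borel :: 'a measure)" if "A \<in> sets borel" for A
    by (rule measurable_sets_borel[OF _ that]) auto
  define M where "M = distr (density lborel (indicator (sgn -` B))) borel (norm :: 'a \<Rightarrow> real)"
  define N where "N = density (distr lborel borel (norm :: 'a \<Rightarrow> real)) (\<lambda>_. emeasure unif_sphere B)"
  have M: "emeasure M A = emeasure lborel (norm -` A \<inter> sgn -` B)" if A[measurable]: "A \<in> sets borel" for A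
  proof -
    note nm[OF A, measurable]
    have "emeasure M A = emeasure (density lborel (indicator (sgn -` B))) (norm -` A)"
      unfolding M_def by (subst emeasure_distr) (simp_all add: measurable_cong_sets[OF sets_density refl])
    also have "\<dots> = (\<integral>\<^sup>+x. indicator (sgn -` B) x * indicator (norm -` A) x \<partial>lborel)"
      by (subst emeasure_density) auto
    also have "\<dots> = (\<integral>\<^sup>+x. indicator (norm -` A \<inter> sgn -` B) x \<partial>lborel)"
      by (intro nn_integral_cong) (auto simp: indicator_def)
    finally show ?thesis by simp
  qed
  have N: "emeasure N A = emeasure lborel (norm -` A :: 'a set) * emeasure unif_sphere B" if A[measurable]: "A \<in> sets borel" for A
  proof -
    have "emeasure N A = emeasure unif_sphere B * emeasure (distr lborel borel (norm :: 'a \<Rightarrow> real)) A"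
      unfolding N_def by (subst emeasure_density) (auto simp: nn_integral_cmult)
    then show ?thesis by (simp add: emeasure_distr mult.commute)
  qed
  have "M = N"
  proof (rule measure_eqI_generator_eq[where E="range atMost" and \<Omega>=UNIV and A="\<lambda>n::nat. {..real n}"])
    show "Int_stable (range (atMost :: real \<Rightarrow> real set))"
      by (rule Int_stableI) (auto intro: image_eqI[where x="min _ _"])
    show "sets M = sigma_sets UNIV (range atMost)" "sets N = sigma_sets UNIV (range atMost)"
      unfolding M_def N_def by (simp_all add: borel_eq_atMost)
    show "emeasure M X = emeasure N X" if "X \<in> range atMost" for X
      using that emeasure_cball_sector[OF assms(2)] by (auto simp: M N)
    show "(\<Union>i. {..real i}) = UNIV" using real_arch_simple by auto
    show "emeasure M {..real i} \<noteq> \<infinity>" for i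
    proof -
      have "emeasure M {..real i} \<le> emeasure lborel (cball (0::'a) i)"
        by (subst M) (auto intro!: emeasure_mono)
      then show ?thesis using emeasure_lborel_cball_finite[of "0::'a" i] by (auto simp: top_unique)
    qed
  qed auto
  then show ?thesis using M[of A] N[of A] by simp
qed

lemma sigma_finite_distr_norm:
  "sigma_finite_measure (distr lborel borel (norm :: 'a::euclidean_space \<Rightarrow> real))" (is "sigma_finite_measure ?N")
proof
  have "emeasure ?N {..real n} \<noteq> \<infinity>" for n
  proof -
    have "norm -` {..real n} = cball (0::'a) n" by (auto simp: cball_def dist_norm)
    then show ?thesis using emeasure_lborel_cball_finite[of "0::'a" n]
      by (subst emeasure_distr) (auto simp del: emeasure_lborel_cball_finite)
  qed
  moreover have "(\<Union>i. {..real i}) = UNIV" using real_arch_simple by auto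
  ultimately show "\<exists>A. countable A \<and> A \<subseteq> sets ?N \<and> \<Union> A = space ?N \<and> (\<forall>a\<in>A. emeasure ?N a \<noteq> \<infinity>)"
    by (intro exI[of _ "range (\<lambda>n::nat. {..real n})"]) auto
qed

lemma distr_norm_sgn:
  "distr lborel (borel \<Otimes>\<^sub>M borel) (\<lambda>x::'a::euclidean_space. (norm x, sgn x)) =
    distr lborel borel (norm :: 'a \<Rightarrow> real) \<Otimes>\<^sub>M unif_sphere" (is "?D = ?N \<Otimes>\<^sub>M _")
proof (rule pair_measure_eqI[symmetric])
  show "sigma_finite_measure ?N" by (rule sigma_finite_distr_norm)
  show "sigma_finite_measure (unif_sphere :: 'a measure)"
    using prob_space_unif_sphere by (intro prob_space_imp_sigma_finite)
  show "sets (?N \<Otimes>\<^sub>M unif_sphere) = sets ?D"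
    by (simp cong: sets_pair_measure_cong)
  fix A :: "real set" and B :: "'a set"
  assume "A \<in> sets ?N" "B \<in> sets unif_sphere"
  then have AB[measurable]: "A \<in> sets borel" "B \<in> sets borel" by auto
  have "(\<lambda>x::'a. (norm x, sgn x)) -` (A \<times> B) = norm -` A \<inter> sgn -` B" by auto
  then show "emeasure ?N A * emeasure unif_sphere B = emeasure ?D (A \<times> B)"
    by (simp add: emeasure_distr emeasure_norm_sgn[OF AB])
qed

lemma nn_integral_polar:
  fixes f :: "real \<times> 'a::euclidean_space \<Rightarrow> ennreal"
  assumes [measurable]: "f \<in> borel_measurable (borel \<Otimes>\<^sub>M borel)"
  shows "(\<integral>\<^sup>+x. f (norm x, sgn x) \<partial>lborel) = (\<integral>\<^sup>+w. (\<integral>\<^sup>+x. f (norm (x::'a), w) \<partial>lborel) \<partial>unif_sphere)"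
proof -
  interpret S: prob_space "unif_sphere :: 'a measure" by (rule prob_space_unif_sphere)
  interpret N: sigma_finite_measure "distr lborel borel (norm :: 'a \<Rightarrow> real)"
    by (rule sigma_finite_distr_norm)
  interpret P: pair_sigma_finite "distr lborel borel (norm :: 'a \<Rightarrow> real)" "unif_sphere :: 'a measure" ..
  have f: "f \<in> borel_measurable (distr lborel borel (norm :: 'a \<Rightarrow> real) \<Otimes>\<^sub>M unif_sphere)"
    using assms by (simp cong: measurable_cong_sets sets_pair_measure_cong)
  have "(\<integral>\<^sup>+x. f (norm x, sgn x) \<partial>lborel) = (\<integral>\<^sup>+z. f z \<partial>distr lborel (borel \<Otimes>\<^sub>M borel) (\<lambda>x::'a. (norm x, sgn x)))"
    by (subst nn_integral_distr) auto
  also have "\<dots> = (\<integral>\<^sup>+w. (\<integral>\<^sup>+r. f (r, w) \<partial>distr lborel borel (norm :: 'a \<Rightarrow> real)) \<partial>unif_sphere)"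
    unfolding distr_norm_sgn by (rule P.nn_integral_snd[symmetric]) (rule f)
  also have "\<dots> = (\<integral>\<^sup>+w. (\<integral>\<^sup>+x. f (norm (x::'a), w) \<partial>lborel) \<partial>unif_sphere)"
    by (intro nn_integral_cong) (subst nn_integral_distr, auto)
  finally show ?thesis .
qed

lemma AE_unif_sphere_norm: "AE w in (unif_sphere :: 'a::euclidean_space measure). norm w = 1"
proof -
  have "AE u in (unif_ball :: 'a measure). u \<noteq> 0"
    unfolding unif_ball_def
    using AE_lborel_singleton[of "0::'a"] by (intro AE_uniform_measureI) auto
  then have "AE u in (unif_ball :: 'a measure). norm (sgn u) = 1"
    by eventually_elim (simp add: norm_sgn)
  then show ?thesis unfolding unif_sphere_def
    by (subst AE_distr_iff) (auto simp: measurable_cong_sets[OF sets_unif_ball refl])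
qed

lemma emeasure_norm_le:
  assumes "r \<ge> 0"
  shows "emeasure lborel {x::'a::euclidean_space. norm x \<le> r} = ennreal (measure lborel (cball (0::'a) 1) * r ^ DIM('a))"
proof -
  have "{x::'a. norm x \<le> r} = cball 0 r" by (auto simp: cball_def dist_norm)
  then show ?thesis using assms by (simp add: emeasure_cball content_cball)
qed

text \<open>The region is star-shaped about the origin with radial function \<open>\<rho>\<close>.
  For a fixed direction \<open>w\<close> the inner integral is the volume of a ball of radius
  \<open>\<rho> w\<close>, hence the power \<open>DIM('a)\<close>.\<close>

lemma nn_integral_polar_radius:
  fixes \<psi> :: "'a::euclidean_space \<Rightarrow> real" and \<rho> :: "'a \<Rightarrow> real"
  assumes [measurable]: "\<psi> \<in> borel_measurable borel" "\<rho> \<in> borel_measurable borel"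
    and pos: "\<And>w. norm w = 1 \<Longrightarrow> 0 \<le> \<psi> w" "\<And>w. norm w = 1 \<Longrightarrow> 0 \<le> \<rho> w"
  shows "(\<integral>\<^sup>+x. ennreal (\<psi> (sgn x) * indicator {x. norm x \<le> \<rho> (sgn x)} x) \<partial>lborel) =
    (\<integral>\<^sup>+w. ennreal (measure lborel (cball (0::'a) 1) * (\<psi> w * \<rho> w ^ DIM('a))) \<partial>unif_sphere)"
proof -
  have "(\<integral>\<^sup>+x. ennreal (\<psi> (sgn x) * indicator {x. norm x \<le> \<rho> (sgn x)} x) \<partial>lborel) =
    (\<integral>\<^sup>+x. (\<lambda>(r, w). ennreal (\<psi> w) * indicator {(r, w). r \<le> \<rho> w} (r, w)) (norm x, sgn x) \<partial>lborel)"
    by (intro nn_integral_cong) (auto simp: indicator_def)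
  also have "\<dots> = (\<integral>\<^sup>+w. (\<integral>\<^sup>+x. (\<lambda>(r, w). ennreal (\<psi> w) * indicator {(r, w). r \<le> \<rho> w} (r, w)) (norm (x::'a), w) \<partial>lborel) \<partial>unif_sphere)"
    by (rule nn_integral_polar) measurable
  also have "\<dots> = (\<integral>\<^sup>+w. ennreal (measure lborel (cball (0::'a) 1) * (\<psi> w * \<rho> w ^ DIM('a))) \<partial>unif_sphere)"
  proof (rule nn_integral_cong_AE)
    show "AE w in unif_sphere. (\<integral>\<^sup>+x. (\<lambda>(r, w). ennreal (\<psi> w) * indicator {(r, w). r \<le> \<rho> w} (r, w)) (norm (x::'a), w) \<partial>lborel) =
      ennreal (measure lborel (cball (0::'a) 1) * (\<psi> w * \<rho> w ^ DIM('a)))"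
      using AE_unif_sphere_norm
    proof eventually_elim
      case (elim w)
      have "(\<integral>\<^sup>+x. (\<lambda>(r, w). ennreal (\<psi> w) * indicator {(r, w). r \<le> \<rho> w} (r, w)) (norm (x::'a), w) \<partial>lborel) =
        (\<integral>\<^sup>+x. ennreal (\<psi> w) * indicator {x::'a. norm x \<le> \<rho> w} x \<partial>lborel)"
        by (intro nn_integral_cong) (auto simp: indicator_def)
      also have "\<dots> = ennreal (\<psi> w) * emeasure lborel {x::'a. norm x \<le> \<rho> w}"
        by (rule nn_integral_cmult_indicator) measurable
      also have "\<dots> = ennreal (measure lborel (cball (0::'a) 1) * (\<psi> w * \<rho> w ^ DIM('a)))"
        using pos[OF elim] by (simp add: emeasure_norm_le ennreal_mult[symmetric] mult_ac)
      finally show ?case .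
    qed
  qed
  finally show ?thesis .
qed

text \<open>A signed \<open>\<psi>\<close> is written as \<open>(\<psi> + C) - C\<close>, both parts
  being nonnegative on the sphere.\<close>

lemma has_bochner_integral_polar_radius:
  fixes \<psi> :: "'a::euclidean_space \<Rightarrow> real" and \<rho> :: "'a \<Rightarrow> real"
  assumes [measurable]: "\<psi> \<in> borel_measurable borel" "\<rho> \<in> borel_measurable borel"
    and bnd: "\<And>w. norm w = 1 \<Longrightarrow> \<bar>\<psi> w\<bar> \<le> C" and pos: "\<And>w. norm w = 1 \<Longrightarrow> 0 \<le> \<rho> w"
    and le: "\<And>w. norm w = 1 \<Longrightarrow> \<rho> w \<le> R"
  shows "has_bochner_integral lborel (\<lambda>x. \<psi> (sgn x) * indicator {x. norm x \<le> \<rho> (sgn x)} x)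
    (measure lborel (cball (0::'a) 1) * (\<integral>w. \<psi> w * \<rho> w ^ DIM('a) \<partial>unif_sphere))"
proof -
  interpret S: prob_space "unif_sphere :: 'a measure" by (rule prob_space_unif_sphere)
  let ?c = "measure lborel (cball (0::'a) 1)"
  have sm: "borel_measurable unif_sphere = (borel_measurable borel :: ('a \<Rightarrow> real) set)"
    by (rule measurable_cong_sets) simp_all
  have int: "integrable unif_sphere (\<lambda>w. f w * \<rho> w ^ DIM('a))"
    if [measurable]: "f \<in> borel_measurable borel" and f: "\<And>w. norm w = 1 \<Longrightarrow> \<bar>f w\<bar> \<le> D" for f :: "'a \<Rightarrow> real" and D
  proof (rule S.integrable_const_bound[where B="D * R ^ DIM('a)"])
    show "AE w in unif_sphere. norm (f w * \<rho> w ^ DIM('a)) \<le> D * R ^ DIM('a)"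
      using AE_unif_sphere_norm
    proof eventually_elim
      case (elim w)
      have "\<bar>\<rho> w\<bar> ^ DIM('a) \<le> R ^ DIM('a)" using pos[OF elim] le[OF elim] by (intro power_mono) auto
      then show ?case using f[OF elim] pos[OF elim]
        by (simp add: abs_mult power_abs) (intro mult_mono, auto)
    qed
  qed (simp add: sm)
  have *: "has_bochner_integral lborel (\<lambda>x. f (sgn x) * indicator {x. norm x \<le> \<rho> (sgn x)} x)
    (?c * (\<integral>w. f w * \<rho> w ^ DIM('a) \<partial>unif_sphere))"
    if [measurable]: "f \<in> borel_measurable borel" and f: "\<And>w. norm w = 1 \<Longrightarrow> \<bar>f w\<bar> \<le> D"
      "\<And>w. norm w = 1 \<Longrightarrow> 0 \<le> f w" for f :: "'a \<Rightarrow> real" and D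
  proof (rule has_bochner_integral_nn_integral)
    have AEp: "AE w in unif_sphere. 0 \<le> ?c * (f w * \<rho> w ^ DIM('a))"
      using AE_unif_sphere_norm by eventually_elim (use f pos in auto)
    have AEp': "AE w in unif_sphere. 0 \<le> f w * \<rho> w ^ DIM('a)"
      using AE_unif_sphere_norm by eventually_elim (use f pos in auto)
    show "AE x in lborel. 0 \<le> f (sgn x) * indicator {x. norm x \<le> \<rho> (sgn x)} x"
      using AE_lborel_singleton[of "0::'a"] by eventually_elim (use f in \<open>auto simp: norm_sgn indicator_def\<close>)
    have "(\<integral>\<^sup>+x. ennreal (f (sgn x) * indicator {x. norm x \<le> \<rho> (sgn x)} x) \<partial>lborel) =
      (\<integral>\<^sup>+w. ennreal (?c * (f w * \<rho> w ^ DIM('a))) \<partial>unif_sphere)"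
      using f pos by (intro nn_integral_polar_radius) auto
    also have "\<dots> = ennreal (\<integral>w. ?c * (f w * \<rho> w ^ DIM('a)) \<partial>unif_sphere)"
      using int[OF that(1) f(1)] AEp by (intro nn_integral_eq_integral) auto
    finally show "(\<integral>\<^sup>+x. ennreal (f (sgn x) * indicator {x. norm x \<le> \<rho> (sgn x)} x) \<partial>lborel) =
      ennreal (?c * (\<integral>w. f w * \<rho> w ^ DIM('a) \<partial>unif_sphere))" by simp
    show "0 \<le> ?c * (\<integral>w. f w * \<rho> w ^ DIM('a) \<partial>unif_sphere)"
      using AEp' by (intro mult_nonneg_nonneg integral_nonneg_AE) auto
  qed measurable
  \<comment> \<open>A basis vector witnesses that the unit sphere is nonempty.\<close>
  have C: "0 \<le> C"
    using bnd[of "SOME b. b \<in> Basis"] by (metis SOME_Basis abs_ge_zero norm_Basis order_trans)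
  have bC: "0 \<le> \<psi> w + C" "\<bar>\<psi> w + C\<bar> \<le> 2 * C" if "norm w = 1" for w
    using bnd[OF that] by linarith+
  have 1: "has_bochner_integral lborel (\<lambda>x. (\<psi> (sgn x) + C) * indicator {x. norm x \<le> \<rho> (sgn x)} x)
    (?c * (\<integral>w. (\<psi> w + C) * \<rho> w ^ DIM('a) \<partial>unif_sphere))"
    using bC by (intro *[of _ "2 * C"]) auto
  have 2: "has_bochner_integral lborel (\<lambda>x. C * indicator {x. norm x \<le> \<rho> (sgn x)} x)
    (?c * (\<integral>w. C * \<rho> w ^ DIM('a) \<partial>unif_sphere))"
    using C by (intro *[of _ C]) auto
  have "(\<integral>w. (\<psi> w + C) * \<rho> w ^ DIM('a) \<partial>unif_sphere) - (\<integral>w. C * \<rho> w ^ DIM('a) \<partial>unif_sphere) =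
    (\<integral>w. (\<psi> w + C) * \<rho> w ^ DIM('a) - C * \<rho> w ^ DIM('a) \<partial>unif_sphere)"
    using int[of "\<lambda>w. \<psi> w + C" "2 * C"] int[of "\<lambda>w. C" "C"] bC C
    by (intro Bochner_Integration.integral_diff[symmetric]) auto
  then show ?thesis
    using has_bochner_integral_diff[OF 1 2] by (simp add: algebra_simps right_diff_distrib[symmetric] del: right_diff_distrib)
qed

section \<open>Differentiating the smoothed function\<close>

text \<open>Since \<open>norm v < 1\<close>, the unit ball about \<open>v\<close> contains the
  origin. The ray in direction \<open>w\<close> leaves it at the larger root of
  \<open>r\<^sup>2 - 2 * r * (w \<bullet> v) + (norm v)\<^sup>2 = 1\<close>; the other root is
  negative.\<close>

lemma sphere_radius_iff:
  fixes v w :: "'a::real_inner"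
  assumes w: "norm w = 1" and v: "norm v < 1" and r: "0 \<le> r"
  shows "norm (r *\<^sub>R w - v) \<le> 1 \<longleftrightarrow> r \<le> w \<bullet> v + sqrt (1 - (norm v)\<^sup>2 + (w \<bullet> v)\<^sup>2)"
proof -
  define a where "a = w \<bullet> v"
  define b where "b = sqrt (1 - (norm v)\<^sup>2 + a\<^sup>2)"
  have v2: "(norm v)\<^sup>2 < 1" using v by (simp add: power_less_one_iff)
  have b2: "b\<^sup>2 = 1 - (norm v)\<^sup>2 + a\<^sup>2" unfolding b_def using v2 by (simp add: add_nonneg_nonneg)
  have b: "b > \<bar>a\<bar>" unfolding b_def using v2 by (metis add_less_cancel_right less_diff_eq real_less_rsqrt add_0 power2_abs)
  have "(norm (r *\<^sub>R w - v))\<^sup>2 = r\<^sup>2 - 2 * r * a + (norm v)\<^sup>2"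
    using w unfolding a_def power2_norm_eq_inner norm_eq_1
    by (simp add: inner_diff_left inner_diff_right inner_commute power2_eq_square algebra_simps)
  then have "norm (r *\<^sub>R w - v) \<le> 1 \<longleftrightarrow> r\<^sup>2 - 2 * r * a + (norm v)\<^sup>2 \<le> 1"
    by (metis abs_norm_cancel one_power2 abs_one abs_le_square_iff)
  also have "\<dots> \<longleftrightarrow> (r - a)\<^sup>2 \<le> b\<^sup>2" unfolding b2 by (simp add: power2_eq_square algebra_simps)
  also have "\<dots> \<longleftrightarrow> r - a \<le> b"
    using b r unfolding abs_le_square_iff[symmetric] by auto
  finally show ?thesis unfolding a_def b_def by linarith
qed

text \<open>A crude factor is enough: it only provides the dominating constant when the difference
  quotient of \<open>\<rho> ^ d\<close> passes to the limit under the integral.\<close>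

lemma abs_power_minus_one_le:
  fixes x :: real
  assumes "\<bar>x - 1\<bar> \<le> s" "s \<le> 1"
  shows "\<bar>x ^ n - 1\<bar> \<le> real n * 2 ^ n * s"
proof (induction n)
  case (Suc n)
  have x: "\<bar>x\<bar> \<le> 2" "0 \<le> s" using assms by linarith+
  have "\<bar>x ^ Suc n - 1\<bar> = \<bar>x * (x ^ n - 1) + (x - 1)\<bar>" by (simp add: algebra_simps)
  also have "\<dots> \<le> \<bar>x\<bar> * \<bar>x ^ n - 1\<bar> + \<bar>x - 1\<bar>" by (metis abs_mult abs_triangle_ineq)
  also have "\<dots> \<le> 2 * (real n * 2 ^ n * s) + 2 ^ Suc n * s"
  proof (rule add_mono)
    have "1 * s \<le> 2 ^ Suc n * s" using x by (intro mult_right_mono one_le_power) auto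
    then show "\<bar>x - 1\<bar> \<le> 2 ^ Suc n * s" using assms by linarith
  qed (use Suc x in \<open>auto intro!: mult_mono\<close>)
  also have "\<dots> = real (Suc n) * 2 ^ Suc n * s" by (simp add: algebra_simps)
  finally show ?case .
qed simp

lemma smoothing_eq_integral:
  fixes f :: "'a::euclidean_space \<Rightarrow> real"
  assumes "continuous_on UNIV f"
  shows "smoothing 1 f v = (\<integral>y. f y * indicator {y. norm (y - v) \<le> 1} y \<partial>lborel) / measure lborel (cball (0::'a) 1)"
proof -
  have [measurable]: "f \<in> borel_measurable borel" using assms by (rule borel_measurable_continuous_onI)
  let ?c = "measure lborel (cball (0::'a) 1)"
  have e: "emeasure lborel (cball (0::'a) 1) = ennreal ?c" "?c > 0"
    using emeasure_lborel_cball_finite[of "0::'a" 1]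
    by (intro emeasure_eq_ennreal_measure; simp) simp
  have [measurable]: "(\<lambda>x. indicat_real (cball (0::'a) 1) x / ?c) \<in> borel_measurable borel"
    by (intro borel_measurable_divide borel_measurable_indicator) auto
  have "smoothing 1 f v = (\<integral>u. f (v + u) \<partial>density lborel (\<lambda>u. ennreal (indicator (cball 0 1) u / ?c)))"
    unfolding smoothing_def unif_ball_def uniform_measure_def using e
    by (intro arg_cong2[where f="integral\<^sup>L"] arg_cong2[where f=density])
      (auto simp: fun_eq_iff divide_ennreal[symmetric] ennreal_indicator)
  also have "\<dots> = (\<integral>u. (indicator (cball 0 1) u / ?c) *\<^sub>R f (v + u) \<partial>lborel)"
    using e by (intro integral_density) (auto intro!: AE_I2)
  also have "\<dots> = (\<integral>u. f (v + u) * indicator {y. norm (y - v) \<le> 1} (v + u) / ?c \<partial>lborel)"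
    by (intro Bochner_Integration.integral_cong) (auto simp: indicator_def)
  also have "\<dots> = (\<integral>y. f y * indicator {y. norm (y - v) \<le> 1} y / ?c \<partial>distr lborel borel ((+) v))"
    by (subst integral_distr) auto
  also have "\<dots> = (\<integral>y. f y * indicator {y. norm (y - v) \<le> 1} y / ?c \<partial>lborel)"
    by (simp only: lborel_distr_plus)
  finally show ?thesis by simp
qed

lemma integrable_continuous_ball:
  fixes f :: "'a::euclidean_space \<Rightarrow> real"
  assumes "continuous_on UNIV f"
  shows "integrable lborel (\<lambda>y. f y * indicator {y. norm (y - v) \<le> r} y)"
proof -
  have "{y. norm (y - v) \<le> r} = cball v r" by (auto simp: cball_def dist_norm norm_minus_commute)
  then show ?thesis
    using borel_integrable_compact[of "cball v r" f] assms
    by (auto simp: mult.commute intro: continuous_on_subset)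
qed

text \<open>An integrand that depends on the direction alone sees the two unit balls only through
  their radial functions \<open>\<rho>\<close> and \<open>1\<close>. These differ by at most
  \<open>norm v\<close> because the shifted ball contains the ball of radius
  \<open>1 - norm v\<close> about the origin and is contained in that of radius
  \<open>1 + norm v\<close>.\<close>

lemma integral_polar_smoothing_difference:
  fixes \<psi> :: "'a::euclidean_space \<Rightarrow> real" and v :: 'a
  assumes [measurable]: "\<psi> \<in> borel_measurable borel"
    and bnd: "\<And>w. norm w = 1 \<Longrightarrow> \<bar>\<psi> w\<bar> \<le> C" and v: "norm v < 1"
  defines "\<rho> \<equiv> (\<lambda>w. w \<bullet> v + sqrt (1 - (norm v)\<^sup>2 + (w \<bullet> v)\<^sup>2))"
  shows "has_bochner_integral lborel
     (\<lambda>y. \<psi> (sgn y) * (indicator {y. norm (y - v) \<le> 1} y - indicator {y. norm y \<le> 1} y))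
     (measure lborel (cball (0::'a) 1) * (\<integral>w. \<psi> w * (\<rho> w ^ DIM('a) - 1) \<partial>unif_sphere))"
    and "\<And>w. norm w = 1 \<Longrightarrow> \<bar>\<rho> w - 1\<bar> \<le> norm v"
    and "integrable unif_sphere (\<lambda>w. \<psi> w * (\<rho> w ^ DIM('a) - 1))"
proof -
  interpret S: prob_space "unif_sphere :: 'a measure" by (rule prob_space_unif_sphere)
  have sm: "borel_measurable unif_sphere = (borel_measurable borel :: ('a \<Rightarrow> real) set)"
    by (rule measurable_cong_sets) simp_all
  have rm[measurable]: "\<rho> \<in> borel_measurable borel" unfolding \<rho>_def by measurable
  have iff: "norm (r *\<^sub>R w - v) \<le> 1 \<longleftrightarrow> r \<le> \<rho> w" if "norm w = 1" "0 \<le> r" for r w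
    unfolding \<rho>_def using sphere_radius_iff[OF that(1) v that(2)] .
  show b: "\<bar>\<rho> w - 1\<bar> \<le> norm v" if w: "norm w = 1" for w
  proof -
    have "norm ((1 - norm v) *\<^sub>R w - v) \<le> norm ((1 - norm v) *\<^sub>R w) + norm v" by (rule norm_triangle_ineq4)
    also have "\<dots> = 1" using w v by simp
    finally have 1: "1 - norm v \<le> \<rho> w" using iff[OF w, of "1 - norm v"] v by simp
    then have "norm (\<rho> w *\<^sub>R w - v) \<le> 1" using iff[OF w, of "\<rho> w"] v by simp
    then have "norm (\<rho> w *\<^sub>R w) \<le> 1 + norm v"
      using norm_triangle_sub[of "\<rho> w *\<^sub>R w" v] by linarith
    then have "\<rho> w \<le> 1 + norm v" using w by simp
    then show ?thesis using 1 by linarith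
  qed
  have rho: "0 \<le> \<rho> w" "\<rho> w \<le> 2" if "norm w = 1" for w using b[OF that] v by auto
  have C: "0 \<le> C"
    using bnd[of "SOME b. b \<in> Basis"] by (metis SOME_Basis abs_ge_zero norm_Basis order_trans)
  have i1: "integrable unif_sphere (\<lambda>w. \<psi> w * \<rho> w ^ DIM('a))"
  proof (rule S.integrable_const_bound[where B="C * 2 ^ DIM('a)"])
    show "AE w in unif_sphere. norm (\<psi> w * \<rho> w ^ DIM('a)) \<le> C * 2 ^ DIM('a)"
      using AE_unif_sphere_norm
    proof eventually_elim
      case (elim w)
      have "\<bar>\<rho> w\<bar> ^ DIM('a) \<le> 2 ^ DIM('a)" using rho[OF elim] by (intro power_mono) auto
      then show ?case using bnd[OF elim] C by (simp add: abs_mult power_abs) (intro mult_mono, auto)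
    qed
  qed (simp add: sm)
  have i2: "integrable unif_sphere \<psi>"
  proof (rule S.integrable_const_bound[where B=C])
    show "AE w in unif_sphere. norm (\<psi> w) \<le> C"
      using AE_unif_sphere_norm by eventually_elim (use bnd in auto)
  qed (simp add: sm)
  show "integrable unif_sphere (\<lambda>w. \<psi> w * (\<rho> w ^ DIM('a) - 1))"
    using i1 i2 by (simp add: right_diff_distrib)
  have h1: "has_bochner_integral lborel (\<lambda>x. \<psi> (sgn x) * indicator {x. norm x \<le> \<rho> (sgn x)} x)
    (measure lborel (cball (0::'a) 1) * (\<integral>w. \<psi> w * \<rho> w ^ DIM('a) \<partial>unif_sphere))"
    using bnd rho by (intro has_bochner_integral_polar_radius) auto
  have "has_bochner_integral lborel (\<lambda>x. \<psi> (sgn x) * indicator {x. norm x \<le> (\<lambda>_. 1) (sgn x)} x)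
    (measure lborel (cball (0::'a) 1) * (\<integral>w. \<psi> w * (\<lambda>_. 1) w ^ DIM('a) \<partial>unif_sphere))"
    using bnd by (intro has_bochner_integral_polar_radius) auto
  then have h2: "has_bochner_integral lborel (\<lambda>x. \<psi> (sgn x) * indicator {x. norm x \<le> 1} x)
    (measure lborel (cball (0::'a) 1) * (\<integral>w. \<psi> w \<partial>unif_sphere))" by simp
  have h3: "has_bochner_integral lborel
     (\<lambda>y. \<psi> (sgn y) * indicator {x. norm x \<le> \<rho> (sgn x)} y - \<psi> (sgn y) * indicator {y. norm y \<le> 1} y)
     (measure lborel (cball (0::'a) 1) * (\<integral>w. \<psi> w * (\<rho> w ^ DIM('a) - 1) \<partial>unif_sphere))"
    using has_bochner_integral_diff[OF h1 h2] i1 i2 by (simp add: right_diff_distrib)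
  have sgnm[measurable]: "(\<lambda>y. \<psi> (sgn y)) \<in> borel_measurable borel" by measurable
  show "has_bochner_integral lborel
     (\<lambda>y. \<psi> (sgn y) * (indicator {y. norm (y - v) \<le> 1} y - indicator {y. norm y \<le> 1} y))
     (measure lborel (cball (0::'a) 1) * (\<integral>w. \<psi> w * (\<rho> w ^ DIM('a) - 1) \<partial>unif_sphere))"
  proof (rule has_bochner_integralI_AE[OF h3])
    show "(\<lambda>y. \<psi> (sgn y) * (indicator {y. norm (y - v) \<le> 1} y - indicator {y. norm y \<le> 1} y)) \<in> borel_measurable lborel"
      by measurable
    show "AE y in lborel. \<psi> (sgn y) * indicator {x. norm x \<le> \<rho> (sgn x)} y - \<psi> (sgn y) * indicator {y. norm y \<le> 1} y =
       \<psi> (sgn y) * (indicator {y. norm (y - v) \<le> 1} y - indicator {y. norm y \<le> 1} y)"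
      using AE_lborel_singleton[of "0::'a"]
    proof eventually_elim
      case (elim y)
      then have y: "norm (sgn y) = 1" "norm y *\<^sub>R sgn y = y" by (auto simp: norm_sgn sgn_div_norm)
      have "norm (y - v) \<le> 1 \<longleftrightarrow> norm y \<le> \<rho> (sgn y)"
        using iff[OF y(1), of "norm y"] y(2) by simp
      then show ?case by (simp add: indicator_def algebra_simps)
    qed
  qed
qed

text \<open>The shifted and the unshifted ball differ only in a shell between the radii
  \<open>1 - norm v\<close> and \<open>1 + norm v\<close>. There \<open>f\<close> is replaced by its
  value at \<open>sgn y\<close>, an error of at most \<open>K * norm v\<close> on a set whose volume
  is itself of order \<open>norm v\<close>. The total is of second order and disappears from the
  difference quotient.\<close>

lemma smoothing_difference_approx:
  fixes f :: "'a::euclidean_space \<Rightarrow> real" and v :: 'a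
  assumes lip: "K-lipschitz_on UNIV f" and v: "norm v < 1"
  shows "\<bar>smoothing 1 f v - smoothing 1 f 0 -
      (\<integral>w. f w * ((w \<bullet> v + sqrt (1 - (norm v)\<^sup>2 + (w \<bullet> v)\<^sup>2)) ^ DIM('a) - 1) \<partial>unif_sphere)\<bar>
    \<le> K * norm v * ((1 + norm v) ^ DIM('a) - (1 - norm v) ^ DIM('a))"
proof -
  let ?c = "measure lborel (cball (0::'a) 1)"
  let ?s = "norm v"
  define ch where "ch y = (indicator {y. norm (y - v) \<le> 1} y - indicator {y. norm y \<le> 1} y :: real)" for y
  have K: "0 \<le> K" by (rule lipschitz_on_nonneg[OF lip])
  have cont: "continuous_on UNIV f" by (rule lipschitz_on_continuous_on[OF lip])
  have [measurable]: "f \<in> borel_measurable borel" using cont by (rule borel_measurable_continuous_onI)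
  have bnd: "\<bar>f w\<bar> \<le> \<bar>f 0\<bar> + K" if "norm w = 1" for w
    using lipschitz_onD[OF lip, of w 0] that by (auto simp: dist_norm)
  have c: "?c > 0" by simp
  have i1: "integrable lborel (\<lambda>y. f y * indicator {y. norm (y - v) \<le> 1} y)"
    "integrable lborel (\<lambda>y. f y * indicator {y. norm y \<le> 1} y)"
    using integrable_continuous_ball[OF cont, of v 1] integrable_continuous_ball[OF cont, of 0 1] by simp_all
  have int1: "has_bochner_integral lborel (\<lambda>y. f y * ch y) (?c * (smoothing 1 f v - smoothing 1 f 0))"
    unfolding has_bochner_integral_iff ch_def smoothing_eq_integral[OF cont] using i1 c
    by (simp add: right_diff_distrib)
  have int2: "has_bochner_integral lborel (\<lambda>y. f (sgn y) * ch y)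
      (?c * (\<integral>w. f w * ((w \<bullet> v + sqrt (1 - (norm v)\<^sup>2 + (w \<bullet> v)\<^sup>2)) ^ DIM('a) - 1) \<partial>unif_sphere))"
    unfolding ch_def by (rule integral_polar_smoothing_difference(1)[OF _ bnd v]) simp_all
  have em: "emeasure lborel {x::'a. norm x \<le> r} < \<infinity>" for r :: real
    using emeasure_lborel_cball_finite[of "0::'a" r] by (simp add: cball_def dist_norm)
  have ms: "measure lborel {x::'a. norm x \<le> r} = ?c * r ^ DIM('a)" if "r \<ge> 0" for r
    using that by (intro measure_eq_emeasure_eq_ennreal emeasure_norm_le) auto
  have int3: "has_bochner_integral lborel (\<lambda>y::'a. K * ?s * (indicator {y. norm y \<le> 1 + ?s} y - indicator {y. norm y \<le> 1 - ?s} y))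
      (K * ?s * (?c * (1 + ?s) ^ DIM('a) - ?c * (1 - ?s) ^ DIM('a)))"
    using has_bochner_integral_real_indicator[OF _ em, of "1 + ?s"] has_bochner_integral_real_indicator[OF _ em, of "1 - ?s"] v
    by (intro has_bochner_integral_mult_right has_bochner_integral_diff) (simp_all add: ms)
  have ptw: "\<bar>f y * ch y - f (sgn y) * ch y\<bar> \<le> K * ?s * (indicator {y. norm y \<le> 1 + ?s} y - indicator {y. norm y \<le> 1 - ?s} y)"
    if "y \<noteq> 0" for y
  proof -
    consider "norm y \<le> 1 - ?s" | "norm y > 1 + ?s" | "1 - ?s < norm y" "norm y \<le> 1 + ?s" by linarith
    then show ?thesis
    proof cases
      case 1
      then have "norm (y - v) \<le> 1" "norm y \<le> 1" using norm_triangle_ineq4[of y v] norm_ge_zero[of v] by linarith+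
      then have "ch y = 0" by (simp add: ch_def)
      moreover have "norm y \<le> 1 + ?s" using \<open>norm y \<le> 1\<close> norm_ge_zero[of v] by linarith
      ultimately show ?thesis using 1 by simp
    next
      case 2
      then have "\<not> norm (y - v) \<le> 1" "\<not> norm y \<le> 1" "\<not> norm y \<le> 1 - ?s"
        using norm_triangle_sub[of y v] norm_ge_zero[of v] by linarith+
      then show ?thesis using 2 by (simp add: ch_def)
    next
      case 3
      have "\<bar>ch y\<bar> \<le> 1" by (simp add: ch_def indicator_def)
      moreover have "\<bar>f y - f (sgn y)\<bar> \<le> K * ?s"
      proof -
        have "norm y *\<^sub>R sgn y = y" using that by (simp add: sgn_div_norm)
        then have "y - sgn y = (norm y - 1) *\<^sub>R sgn y" by (simp only: scaleR_diff_left scaleR_one)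
        then have "norm (y - sgn y) = \<bar>norm y - 1\<bar>" using that by (simp add: norm_sgn)
        also have "\<dots> \<le> ?s" using 3 by linarith
        finally have "K * norm (y - sgn y) \<le> K * ?s" using K by (rule mult_left_mono)
        then show ?thesis using lipschitz_onD[OF lip, of y "sgn y"] by (simp add: dist_norm)
      qed
      ultimately have "\<bar>f y - f (sgn y)\<bar> * \<bar>ch y\<bar> \<le> K * ?s * 1" using K by (intro mult_mono) auto
      then show ?thesis using 3 by (simp add: left_diff_distrib[symmetric] abs_mult)
    qed
  qed
  have "\<bar>?c * (smoothing 1 f v - smoothing 1 f 0) -
      ?c * (\<integral>w. f w * ((w \<bullet> v + sqrt (1 - (norm v)\<^sup>2 + (w \<bullet> v)\<^sup>2)) ^ DIM('a) - 1) \<partial>unif_sphere)\<bar>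
    = \<bar>\<integral>y. f y * ch y - f (sgn y) * ch y \<partial>lborel\<bar>"
    using has_bochner_integral_diff[OF int1 int2] by (simp add: has_bochner_integral_iff)
  also have "\<dots> \<le> (\<integral>y. \<bar>f y * ch y - f (sgn y) * ch y\<bar> \<partial>lborel)" by (rule integral_abs_bound)
  also have "\<dots> \<le> (\<integral>y. K * ?s * (indicator {y::'a. norm y \<le> 1 + ?s} y - indicator {y. norm y \<le> 1 - ?s} y) \<partial>lborel)"
  proof (rule integral_mono_AE)
    show "AE y in lborel. \<bar>f y * ch y - f (sgn y) * ch y\<bar> \<le> K * ?s * (indicator {y::'a. norm y \<le> 1 + ?s} y - indicator {y. norm y \<le> 1 - ?s} y)"
      using AE_lborel_singleton[of "0::'a"] by eventually_elim (rule ptw)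
  qed (use has_bochner_integral_diff[OF int1 int2] int3 in \<open>auto simp: has_bochner_integral_iff\<close>)
  also have "\<dots> = ?c * (K * ?s * ((1 + ?s) ^ DIM('a) - (1 - ?s) ^ DIM('a)))"
    using int3 by (simp add: has_bochner_integral_iff algebra_simps)
  finally show ?thesis using c by (simp add: right_diff_distrib[symmetric] abs_mult del: right_diff_distrib)
qed

text \<open>This is the boundary integral that the divergence theorem would give. After
  \<open>smoothing_difference_approx\<close> only the factor \<open>\<rho> ^ d - 1\<close> depends
  on the increment, and its derivative at \<open>0\<close> is
  \<open>d * (w \<bullet> v)\<close>.\<close>

lemma smoothing_slope_at_0:
  fixes f :: "'a::euclidean_space \<Rightarrow> real"
  assumes lip: "K-lipschitz_on UNIV f"
  shows "(slope (smoothing 1 f) v 0 \<longlongrightarrow> DIM('a) * (\<integral>w. f w * (w \<bullet> v) \<partial>unif_sphere)) (at 0)"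
proof -
  interpret S: prob_space "unif_sphere :: 'a measure" by (rule prob_space_unif_sphere)
  define d where "d = DIM('a)"
  define \<rho> where "\<rho> t w = w \<bullet> (t *\<^sub>R v) + sqrt (1 - (norm (t *\<^sub>R v))\<^sup>2 + (w \<bullet> (t *\<^sub>R v))\<^sup>2)" for t :: real and w
  define J where "J t = (\<integral>w. f w * (\<rho> t w ^ d - 1) \<partial>unif_sphere) / t" for t :: real
  have K: "0 \<le> K" by (rule lipschitz_on_nonneg[OF lip])
  have cont: "continuous_on UNIV f" by (rule lipschitz_on_continuous_on[OF lip])
  have fm[measurable]: "f \<in> borel_measurable borel" using cont by (rule borel_measurable_continuous_onI)
  have sm: "borel_measurable unif_sphere = (borel_measurable borel :: ('a \<Rightarrow> real) set)"
    by (rule measurable_cong_sets) simp_all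
  define C where "C = \<bar>f 0\<bar> + K"
  have bnd: "\<bar>f w\<bar> \<le> C" if "norm w = 1" for w
    using lipschitz_onD[OF lip, of w 0] that by (auto simp: dist_norm C_def)
  have C: "0 \<le> C" using K by (simp add: C_def)
  have small: "\<forall>\<^sub>F t in at 0. norm (t *\<^sub>R v) < 1"
  proof -
    have "((\<lambda>t. norm (t *\<^sub>R v)) \<longlongrightarrow> norm (0 *\<^sub>R v)) (at 0)" by (intro tendsto_intros)
    then show ?thesis by (rule order_tendstoD) simp
  qed
  have J: "(J \<longlongrightarrow> DIM('a) * (\<integral>w. f w * (w \<bullet> v) \<partial>unif_sphere)) (at 0)"
    unfolding tendsto_at_iff_sequentially comp_def
  proof (intro allI impI)
    fix X :: "nat \<Rightarrow> real" assume X: "\<forall>i. X i \<in> UNIV - {0}" "X \<longlonglongrightarrow> 0"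
    have "\<forall>\<^sub>F i in sequentially. norm (X i *\<^sub>R v) < 1"
      by (rule eventually_compose_filterlim[OF small]) (use X in \<open>auto simp: filterlim_at\<close>)
    then obtain N where N: "\<And>i. i \<ge> N \<Longrightarrow> norm (X i *\<^sub>R v) < 1" unfolding eventually_sequentially by blast
    \<comment> \<open>The estimate of \<open>\<rho>\<close> needs
      \<open>norm (t *\<^sub>R v) < 1\<close>; dropping the first \<open>N\<close> terms makes it
      available at every index, as domination demands.\<close>
    define Y where "Y i = X (i + N)" for i
    have Y: "Y i \<noteq> 0" "norm (Y i *\<^sub>R v) < 1" "Y \<longlonglongrightarrow> 0" for i
      using X N unfolding Y_def by (auto intro: LIMSEQ_ignore_initial_segment)
    have "(\<lambda>i. \<integral>w. f w * ((\<rho> (Y i) w ^ d - 1) / Y i) \<partial>unif_sphere) \<longlonglongrightarrow> (\<integral>w. f w * (d * (w \<bullet> v)) \<partial>unif_sphere)"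
    proof (rule integral_dominated_convergence[where w="\<lambda>_. C * (real d * 2 ^ d * norm v)"])
      show "(\<lambda>w. f w * (real d * (w \<bullet> v))) \<in> borel_measurable unif_sphere" unfolding sm by measurable
      show "(\<lambda>w. f w * ((\<rho> (Y i) w ^ d - 1) / Y i)) \<in> borel_measurable unif_sphere" for i
        unfolding sm \<rho>_def by measurable
      show "AE w in unif_sphere. (\<lambda>i. f w * ((\<rho> (Y i) w ^ d - 1) / Y i)) \<longlonglongrightarrow> f w * (d * (w \<bullet> v))"
      proof (intro AE_I2)
        fix w :: 'a
        have "((\<lambda>t. \<rho> t w ^ d) has_real_derivative (real d * (w \<bullet> v))) (at 0)"
        proof -
          \<comment> \<open>Under the root \<open>t\<close> enters only through its square, so the
            linear part alone contributes to the derivative at \<open>0\<close>.\<close>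
          have "\<rho> = (\<lambda>t w. t * (w \<bullet> v) + sqrt (1 - t\<^sup>2 * (norm v)\<^sup>2 + t\<^sup>2 * (w \<bullet> v)\<^sup>2))"
            by (simp add: \<rho>_def fun_eq_iff power_mult_distrib)
          then show ?thesis by (auto intro!: derivative_eq_intros)
        qed
        then have "((\<lambda>t. (\<rho> t w ^ d - 1) / t) \<longlongrightarrow> real d * (w \<bullet> v)) (at 0)"
          unfolding has_field_derivative_iff by (simp add: \<rho>_def)
        then have "(\<lambda>i. (\<rho> (Y i) w ^ d - 1) / Y i) \<longlonglongrightarrow> real d * (w \<bullet> v)"
          unfolding tendsto_at_iff_sequentially comp_def using Y by auto
        then show "(\<lambda>i. f w * ((\<rho> (Y i) w ^ d - 1) / Y i)) \<longlonglongrightarrow> f w * (d * (w \<bullet> v))"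
          by (rule tendsto_mult_left)
      qed
      show "AE w in unif_sphere. norm (f w * ((\<rho> (Y i) w ^ d - 1) / Y i)) \<le> C * (real d * 2 ^ d * norm v)" for i
        using AE_unif_sphere_norm
      proof eventually_elim
        case (elim w)
        have "\<bar>\<rho> (Y i) w - 1\<bar> \<le> norm (Y i *\<^sub>R v)"
          unfolding \<rho>_def by (rule integral_polar_smoothing_difference(2)[OF fm bnd Y(2) elim])
        then have "\<bar>\<rho> (Y i) w ^ d - 1\<bar> \<le> real d * 2 ^ d * norm (Y i *\<^sub>R v)"
          using Y(2)[of i] by (intro abs_power_minus_one_le) auto
        then have "\<bar>(\<rho> (Y i) w ^ d - 1) / Y i\<bar> \<le> real d * 2 ^ d * norm v"
          using Y(1)[of i] by (simp add: field_simps)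
        then show ?case using bnd[OF elim] C unfolding real_norm_def abs_mult by (intro mult_mono) auto
      qed
    qed simp
    moreover have "(\<integral>w. f w * (d * (w \<bullet> v)) \<partial>unif_sphere) = DIM('a) * (\<integral>w. f w * (w \<bullet> v) \<partial>unif_sphere)"
      unfolding d_def by (subst integral_mult_right_zero[symmetric]) (simp add: mult_ac)
    ultimately have "(\<lambda>i. J (Y i)) \<longlonglongrightarrow> DIM('a) * (\<integral>w. f w * (w \<bullet> v) \<partial>unif_sphere)"
      unfolding J_def by simp
    then show "(\<lambda>i. J (X i)) \<longlonglongrightarrow> DIM('a) * (\<integral>w. f w * (w \<bullet> v) \<partial>unif_sphere)"
      unfolding Y_def by (rule LIMSEQ_offset)
  qed
  have "((\<lambda>t. slope (smoothing 1 f) v 0 t - J t) \<longlongrightarrow> 0) (at 0)"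
  proof (rule Lim_null_comparison)
    have "((\<lambda>t. K * norm v * ((1 + norm (t *\<^sub>R v)) ^ d - (1 - norm (t *\<^sub>R v)) ^ d)) \<longlongrightarrow>
      K * norm v * ((1 + norm (0 *\<^sub>R v)) ^ d - (1 - norm (0 *\<^sub>R v)) ^ d)) (at 0)"
      by (intro tendsto_intros)
    then show "((\<lambda>t. K * norm v * ((1 + norm (t *\<^sub>R v)) ^ d - (1 - norm (t *\<^sub>R v)) ^ d)) \<longlongrightarrow> 0) (at 0)" by simp
    have "\<forall>\<^sub>F t::real in at 0. t \<noteq> 0" by (simp add: eventually_at_filter)
    with small show "\<forall>\<^sub>F t in at 0. norm (slope (smoothing 1 f) v 0 t - J t) \<le>
       K * norm v * ((1 + norm (t *\<^sub>R v)) ^ d - (1 - norm (t *\<^sub>R v)) ^ d)"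
    proof eventually_elim
      case (elim t)
      have "slope (smoothing 1 f) v 0 t - J t =
        (smoothing 1 f (t *\<^sub>R v) - smoothing 1 f 0 - (\<integral>w. f w * (\<rho> t w ^ d - 1) \<partial>unif_sphere)) / t"
        unfolding slope_def J_def by (simp add: diff_divide_distrib)
      then have "norm (slope (smoothing 1 f) v 0 t - J t) =
        \<bar>smoothing 1 f (t *\<^sub>R v) - smoothing 1 f 0 - (\<integral>w. f w * (\<rho> t w ^ d - 1) \<partial>unif_sphere)\<bar> / \<bar>t\<bar>" by simp
      also have "\<dots> \<le> (K * norm (t *\<^sub>R v) * ((1 + norm (t *\<^sub>R v)) ^ d - (1 - norm (t *\<^sub>R v)) ^ d)) / \<bar>t\<bar>"
        unfolding \<rho>_def d_def by (intro divide_right_mono smoothing_difference_approx lip elim) auto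
      also have "\<dots> = K * norm v * ((1 + norm (t *\<^sub>R v)) ^ d - (1 - norm (t *\<^sub>R v)) ^ d)"
        using elim by simp
      finally show ?case .
    qed
  qed
  from tendsto_add[OF this J] show ?thesis by simp
qed

lemma lipschitz_on_scale_shift:
  fixes f :: "'a::real_normed_vector \<Rightarrow> real"
  assumes "K-lipschitz_on UNIV f"
  shows "(K * \<bar>\<delta>\<bar>)-lipschitz_on UNIV (\<lambda>u. f (x + \<delta> *\<^sub>R u))"
proof (rule lipschitz_onI)
  show "0 \<le> K * \<bar>\<delta>\<bar>" using lipschitz_on_nonneg[OF assms] by simp
  fix u v :: 'a
  have "dist (f (x + \<delta> *\<^sub>R u)) (f (x + \<delta> *\<^sub>R v)) \<le> K * dist (x + \<delta> *\<^sub>R u) (x + \<delta> *\<^sub>R v)"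
    by (rule lipschitz_onD[OF assms]) auto
  also have "dist (x + \<delta> *\<^sub>R u) (x + \<delta> *\<^sub>R v) = \<bar>\<delta>\<bar> * dist u v"
    by (simp add: dist_norm scaleR_diff_right[symmetric])
  finally show "dist (f (x + \<delta> *\<^sub>R u)) (f (x + \<delta> *\<^sub>R v)) \<le> K * \<bar>\<delta>\<bar> * dist u v" by (simp add: mult.assoc)
qed

lemma smoothing_slope:
  fixes f :: "'a::euclidean_space \<Rightarrow> real"
  assumes lip: "K-lipschitz_on UNIV f" and d: "\<delta> > 0"
  shows "(slope (smoothing \<delta> f) v x \<longlongrightarrow> DIM('a) / \<delta> * (\<integral>w. f (x + \<delta> *\<^sub>R w) * (w \<bullet> v) \<partial>unif_sphere)) (at 0)"
proof -
  let ?g = "\<lambda>u. f (x + \<delta> *\<^sub>R u)"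
  have "slope (smoothing \<delta> f) v x = slope (smoothing 1 ?g) (v /\<^sub>R \<delta>) 0"
  proof (rule ext)
    fix t
    have "x + \<delta> *\<^sub>R (t *\<^sub>R (v /\<^sub>R \<delta>) + u) = x + t *\<^sub>R v + \<delta> *\<^sub>R u" for u
      using d by (simp add: scaleR_add_right)
    then show "slope (smoothing \<delta> f) v x t = slope (smoothing 1 ?g) (v /\<^sub>R \<delta>) 0 t"
      by (simp add: slope_def smoothing_def add.assoc)
  qed
  moreover have "(slope (smoothing 1 ?g) (v /\<^sub>R \<delta>) 0 \<longlongrightarrow> DIM('a) * (\<integral>w. ?g w * (w \<bullet> (v /\<^sub>R \<delta>)) \<partial>unif_sphere)) (at 0)"
    by (rule smoothing_slope_at_0[OF lipschitz_on_scale_shift[OF lip]])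
  ultimately show ?thesis using d by (simp add: divide_inverse mult_ac)
qed

section \<open>Rademacher's theorem\<close>

text \<open>A weak form of Lebesgue differentiation. On the bounded set \<open>S\<close> where
  \<open>g\<close> exceeds \<open>h\<close> by at least \<open>e\<close>, disjoint Vitali balls
  inside a slightly larger open \<open>U\<close> carry equal masses of both densities. The excess,
  at least \<open>e\<close> times the measure of \<open>S\<close>, must then come from the mass of
  \<open>h\<close> on \<open>U - S\<close>, which is at most \<open>C\<close> times a small
  measure.\<close>

lemma AE_le_of_cball_integrals:
  fixes g h :: "'a::euclidean_space \<Rightarrow> real"
  assumes [measurable]: "g \<in> borel_measurable borel" "h \<in> borel_measurable borel"
    and bnd: "\<And>x. 0 \<le> g x" "\<And>x. 0 \<le> h x" "\<And>x. h x \<le> C"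
    and eq: "\<And>x r. r > 0 \<Longrightarrow> emeasure (density lborel g) (cball x r) = emeasure (density lborel h) (cball x r)"
  shows "AE x in lborel. g x \<le> h x"
proof -
  have C: "0 \<le> C" using bnd(2,3) by (meson order_trans)
  have null: "{x. norm x < real n \<and> h x + 1 / Suc k \<le> g x} \<in> null_sets lborel" (is "?S \<in> _") for n k
  proof -
    define S where "S = ?S"
    define e where "e = (1 / Suc k :: real)"
    have e: "e > 0" by (simp add: e_def)
    have "{x \<in> space borel. norm x < real n \<and> h x + e \<le> g x} \<in> sets borel" by measurable
    then have Sm[measurable]: "S \<in> sets borel" unfolding S_def e_def by (simp only: space_borel UNIV_I simp_thms)
    have "emeasure lborel S \<le> emeasure lborel (ball (0::'a) (real n))" unfolding S_def by (intro emeasure_mono) auto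
    also have "\<dots> < \<infinity>" by (rule emeasure_lborel_ball_finite)
    finally have fin: "emeasure lborel S < \<infinity>" .
    have main: "ennreal e * emeasure lborel S \<le> ennreal C * ennreal d" if d: "d > 0" for d
    proof -
      obtain U where U: "open U" "S \<subseteq> U" "emeasure lebesgue (U - S) < ennreal d"
        using sets_lebesgue_outer_open[of S d] d by (auto simp: Sm)
      let ?K = "{(x, r). 0 < r \<and> cball x r \<subseteq> U}"
      have K1: "0 < snd i" if "i \<in> ?K" for i using that by auto
      have K2: "\<exists>i. i \<in> ?K \<and> x \<in> cball (fst i) (snd i) \<and> snd i < d" if x: "x \<in> S" and d: "0 < d" for x d
      proof -
        obtain r where r: "r > 0" "cball x r \<subseteq> U" using U x by (meson open_contains_cball subsetD)
        have "cball x (min r (d/2)) \<subseteq> cball x r" by (rule subset_cball) simp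
        then have "(x, min r (d / 2)) \<in> ?K" using r d by auto
        then show ?thesis using r d by (intro exI[of _ "(x, min r (d / 2))"]) auto
      qed
      obtain F where F: "countable F" "F \<subseteq> ?K"
        "pairwise (\<lambda>i j. disjnt (cball (fst i) (snd i)) (cball (fst j) (snd j))) F"
        "negligible (S - (\<Union>i\<in>F. cball (fst i) (snd i)))"
        by (rule Vitali_covering_theorem_cballs[of ?K snd S fst, OF K1 K2])
      define W where "W = (\<Union>i\<in>F. cball (fst i) (snd i))"
      have disj: "disjoint_family_on (\<lambda>i. cball (fst i) (snd i)) F"
        using F(3) unfolding pairwise_def disjoint_family_on_def disjnt_def .
      have Wm[measurable]: "W \<in> sets borel" unfolding W_def using F(1) by (intro sets.countable_UN'') auto
      have "cball (fst i) (snd i) \<subseteq> U" if "i \<in> F" for i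
        using subsetD[OF F(2) that] by (cases i) simp
      then have WU: "W \<subseteq> U" unfolding W_def by blast
      have [measurable]: "U \<in> sets borel" using U by auto
      have "emeasure (density lborel g) W = (\<integral>\<^sup>+i. emeasure (density lborel g) (cball (fst i) (snd i)) \<partial>count_space F)"
        unfolding W_def using F(1) disj by (intro emeasure_UN_countable) auto
      also have "\<dots> = (\<integral>\<^sup>+i. emeasure (density lborel h) (cball (fst i) (snd i)) \<partial>count_space F)"
        using F(2) by (intro nn_integral_cong eq) auto
      also have "\<dots> = emeasure (density lborel h) W"
        unfolding W_def using F(1) disj by (intro emeasure_UN_countable[symmetric]) auto
      finally have W: "(\<integral>\<^sup>+x. ennreal (g x) * indicator W x \<partial>lborel) = (\<integral>\<^sup>+x. ennreal (h x) * indicator W x \<partial>lborel)"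
        by (simp add: emeasure_density)
      define I where "I = (\<integral>\<^sup>+x. ennreal (h x) * indicator S x \<partial>lborel)"
      have "I \<le> (\<integral>\<^sup>+x. ennreal C * indicator S x \<partial>lborel)"
        unfolding I_def using bnd by (intro nn_integral_mono) (auto simp: indicator_def ennreal_leI)
      also have "\<dots> = ennreal C * emeasure lborel S" by (simp add: nn_integral_cmult_indicator)
      finally have If: "I < \<infinity>" using fin by (simp add: ennreal_mult_less_top order_le_less_trans)
      have "S - W \<in> null_sets lborel"
        using F(4) unfolding W_def[symmetric] by (simp add: null_sets_def negligible_iff_null_sets)
      then have AEW: "AE x in lborel. x \<notin> S - W" by (rule AE_not_in)
      have "ennreal e * emeasure lborel S + I = (\<integral>\<^sup>+x. (ennreal e + ennreal (h x)) * indicator S x \<partial>lborel)"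
        unfolding I_def by (simp add: nn_integral_cmult_indicator nn_integral_add distrib_right)
      also have "\<dots> \<le> (\<integral>\<^sup>+x. ennreal (g x) * indicator W x \<partial>lborel)"
      proof (rule nn_integral_mono_AE)
        show "AE x in lborel. (ennreal e + ennreal (h x)) * indicator S x \<le> ennreal (g x) * indicator W x"
          using AEW
        proof eventually_elim
          case (elim x)
          show ?case
          proof (cases "x \<in> S")
            case True
            then have "e + h x \<le> g x" unfolding S_def e_def by auto
            then show ?thesis using True elim e bnd by (auto simp: ennreal_plus[symmetric] simp del: ennreal_plus intro!: ennreal_leI)
          qed simp
        qed
      qed
      also have "\<dots> \<le> (\<integral>\<^sup>+x. ennreal (h x) * indicator S x + ennreal C * indicator (U - S) x \<partial>lborel)"
        unfolding W using WU bnd by (intro nn_integral_mono) (auto simp: indicator_def ennreal_leI)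
      also have "\<dots> = I + ennreal C * emeasure lborel (U - S)"
        unfolding I_def by (subst nn_integral_add) (auto simp: nn_integral_cmult_indicator)
      also have "\<dots> \<le> I + ennreal C * ennreal d"
        using U(3) by (intro add_left_mono mult_left_mono) (auto simp: less_imp_le)
      finally show ?thesis using If
        by (metis add.commute ennreal_add_left_cancel_le infinity_ennreal_def not_le)
    qed
    define z where "z = measure lborel S"
    have z: "emeasure lborel S = ennreal z" "z \<ge> 0"
      unfolding z_def using fin by (simp_all add: emeasure_eq_ennreal_measure top.not_eq_extremum)
    have "z \<le> t" if "t > 0" for t
    proof -
      \<comment> \<open>The denominator \<open>C + 1\<close> instead of \<open>C\<close> covers the
        case \<open>C = 0\<close>.\<close>
      have "ennreal (e * z) \<le> ennreal (C * (e * t / (C + 1)))"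
        using main[of "e * t / (C + 1)"] e C z that by (subst (1 2) ennreal_mult) auto
      then have "e * z \<le> C * (e * t / (C + 1))" using e C that by (subst (asm) ennreal_le_iff) auto
      also have "\<dots> = e * t * (C / (C + 1))" by simp
      also have "\<dots> \<le> e * t * 1" using e C that by (intro mult_left_mono) auto
      finally show ?thesis using e by simp
    qed
    then have "z = 0" using z(2) by (metis dense not_le order_le_less)
    then show ?thesis using z unfolding S_def[symmetric] by (simp add: null_sets_def)
  qed
  have "AE x in lborel. \<forall>n k. x \<notin> {x. norm x < real n \<and> h x + 1 / Suc k \<le> g x}"
    unfolding AE_all_countable by (intro allI AE_not_in null)
  then show ?thesis
  proof eventually_elim
    case (elim x)
    obtain n where n: "norm x < real n" using reals_Archimedean2 by blast
    show ?case
    proof (rule ccontr)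
      assume "\<not> g x \<le> h x"
      then obtain k :: nat where "1 / Suc k < g x - h x" by (metis diff_gt_0_iff_gt nat_approx_posE not_le)
      then show False using elim[rule_format, of n k] n by (auto simp: field_simps)
    qed
  qed
qed

lemma nn_integral_cball:
  fixes h :: "'a::euclidean_space \<Rightarrow> ennreal"
  assumes [measurable]: "h \<in> borel_measurable borel" and r: "r > 0"
  shows "(\<integral>\<^sup>+y. h y * indicator (cball x r) y \<partial>lborel) =
    ennreal (r ^ DIM('a)) * (emeasure lborel (cball (0::'a) 1) * (\<integral>\<^sup>+u. h (x + r *\<^sub>R u) \<partial>unif_ball))"
proof -
  have [measurable]: "cball x r \<in> sets borel" by simp
  have "(\<integral>\<^sup>+y. h y * indicator (cball x r) y \<partial>lborel) = (\<integral>\<^sup>+y. h y * indicator (cball x r) y \<partial>distr lborel borel ((+) x))"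
    by (simp only: lborel_distr_plus)
  also have "\<dots> = (\<integral>\<^sup>+y. h (x + y) * indicator (cball x r) (x + y) \<partial>lborel)"
    by (subst nn_integral_distr) auto
  also have "\<dots> = ennreal (\<bar>r\<bar> ^ DIM('a)) * (\<integral>\<^sup>+u. h (x + r *\<^sub>R u) * indicator (cball x r) (x + r *\<^sub>R u) \<partial>lborel)"
    using r by (intro nn_integral_lborel_scaleR) auto
  also have "(\<lambda>u. h (x + r *\<^sub>R u) * indicator (cball x r) (x + r *\<^sub>R u)) = (\<lambda>u. h (x + r *\<^sub>R u) * indicator (cball 0 1) u)"
    using r by (auto simp: fun_eq_iff indicator_def dist_norm)
  also have "(\<integral>\<^sup>+u. h (x + r *\<^sub>R u) * indicator (cball 0 1) u \<partial>lborel) =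
    emeasure lborel (cball (0::'a) 1) * (\<integral>\<^sup>+u. h (x + r *\<^sub>R u) \<partial>unif_ball)"
  proof -
    have "0 < emeasure lborel (cball (0::'a) 1)" "emeasure lborel (cball (0::'a) 1) \<noteq> \<top>"
      using emeasure_cball_pos[of 1 "0::'a"] emeasure_lborel_cball_finite[of "0::'a" 1] by auto
    then show ?thesis unfolding unif_ball_def
      by (subst nn_integral_uniform_measure)
        (auto simp: ennreal_times_divide mult.commute[of "emeasure lborel (cball (0::'a) 1)"] ennreal_mult_divide_eq)
  qed
  finally show ?thesis using r by simp
qed

lemma measurable_unif_ball: "borel_measurable unif_ball = (borel_measurable borel :: ('a::euclidean_space \<Rightarrow> 'b::topological_space) set)"
  by (rule measurable_cong_sets) simp_all

lemma AE_unif_ball_norm: "AE u in (unif_ball :: 'a::euclidean_space measure). norm u \<le> 1"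
  unfolding unif_ball_def by (rule AE_uniform_measureI) auto

lemma AE_unif_ball_affine:
  fixes x :: "'a::euclidean_space"
  assumes P: "AE x in lborel. P x" and r: "r > 0"
  shows "AE u in unif_ball. P (x + r *\<^sub>R u)"
proof -
  obtain N where N: "{x. \<not> P x} \<subseteq> N" "N \<in> null_sets lborel"
    using P unfolding eventually_ae_filter by auto
  then have [measurable]: "N \<in> sets borel" by auto
  have [measurable]: "cball x r \<in> sets borel" by simp
  have "AE y in lborel. y \<notin> N" using N(2) by (rule AE_not_in)
  then have "(\<integral>\<^sup>+y. indicator N y * indicator (cball x r) y \<partial>lborel) = (0::ennreal)"
    by (subst nn_integral_0_iff_AE) (auto elim: eventually_mono)
  then have "(\<integral>\<^sup>+u. indicator N (x + r *\<^sub>R u) \<partial>unif_ball) = (0::ennreal)"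
    using r emeasure_cball_pos[of 1 "0::'a", THEN less_imp_neq, symmetric] by (subst (asm) nn_integral_cball) auto
  then have "AE u in unif_ball. indicator N (x + r *\<^sub>R u) = (0::ennreal)"
    by (subst (asm) nn_integral_0_iff_AE) (auto simp: measurable_unif_ball)
  then show ?thesis by eventually_elim (use N(1) in \<open>auto simp: indicator_def split: if_splits\<close>)
qed

text \<open>Adding a constant \<open>k\<close> makes \<open>k + g\<close> and \<open>k - g\<close>
  nonnegative densities with the same ball masses as \<open>k\<close>, so the preceding comparison
  bounds \<open>g\<close> by \<open>0\<close> from both sides. The bound on \<open>g\<close> holds
  only almost everywhere, whence the truncation \<open>f\<close>.\<close>

lemma AE_zero_of_ball_averages:
  fixes g :: "'a::euclidean_space \<Rightarrow> real"
  assumes [measurable]: "g \<in> borel_measurable borel" and bnd: "AE x in lborel. \<bar>g x\<bar> \<le> C"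
    and avg: "\<And>x r. r > 0 \<Longrightarrow> (\<integral>u. g (x + r *\<^sub>R u) \<partial>unif_ball) = 0"
  shows "AE x in lborel. g x = 0"
proof -
  interpret U: prob_space "unif_ball :: 'a measure" by (rule prob_space_unif_ball)
  note um = measurable_unif_ball
  define k where "k = \<bar>C\<bar>"
  define f where "f x = max (- k) (min k (g x))" for x
  have k: "0 \<le> k" by (simp add: k_def)
  have fm[measurable]: "f \<in> borel_measurable borel" unfolding f_def by measurable
  have fb: "\<bar>f x\<bar> \<le> k" for x unfolding f_def using k by auto
  have fg: "AE x in lborel. f x = g x" using bnd by eventually_elim (auto simp: f_def k_def)
  have avgf: "(\<integral>u. f (x + r *\<^sub>R u) \<partial>unif_ball) = 0" if r: "r > 0" for x r
  proof -
    have "(\<integral>u. f (x + r *\<^sub>R u) \<partial>unif_ball) = (\<integral>u. g (x + r *\<^sub>R u) \<partial>unif_ball)"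
      using AE_unif_ball_affine[OF fg r, of x] by (intro integral_cong_AE) (auto simp: um)
    then show ?thesis using avg[OF r] by simp
  qed
  have em: "emeasure (density lborel (\<lambda>x. k + s * f x)) (cball x r) = emeasure (density lborel (\<lambda>x. k)) (cball x r)"
    if r: "r > 0" and s: "\<bar>s\<bar> = 1" for s x r
  proof -
    have pos: "0 \<le> k + s * f x" for x
      using fb[of x] s by (auto simp: abs_if split: if_splits)
    have "(\<integral>\<^sup>+u. ennreal (k + s * f (x + r *\<^sub>R u)) \<partial>unif_ball) = ennreal (\<integral>u. k + s * f (x + r *\<^sub>R u) \<partial>unif_ball)"
      using pos fb k by (intro nn_integral_eq_integral Bochner_Integration.integrable_add integrable_mult_right U.integrable_const_bound[where B=k])
        (auto simp: um)
    also have "(\<integral>u. k + s * f (x + r *\<^sub>R u) \<partial>unif_ball) = k + s * (\<integral>u. f (x + r *\<^sub>R u) \<partial>unif_ball)"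
      using fb U.prob_space by (subst Bochner_Integration.integral_add) (auto intro!: integrable_mult_right U.integrable_const_bound[where B=k] simp: um)
    finally have 1: "(\<integral>\<^sup>+u. ennreal (k + s * f (x + r *\<^sub>R u)) \<partial>unif_ball) = ennreal k" using avgf[OF r] by simp
    show ?thesis
      using r by (simp add: emeasure_density nn_integral_cball 1 U.emeasure_space_1[simplified])
  qed
  have half: "AE x in lborel. k + s * f x \<le> k" if s: "\<bar>s\<bar> = 1" for s
  proof (rule AE_le_of_cball_integrals[where C=k])
    show "0 \<le> k + s * f x" for x using fb[of x] s by (auto simp: abs_if split: if_splits)
  qed (use em s k in auto)
  have "AE x in lborel. k + 1 * f x \<le> k" "AE x in lborel. k + (- 1) * f x \<le> k"
    by (rule half; simp)+
  with fg show ?thesis by eventually_elim auto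
qed

text \<open>Convergence is uniform over finitely many directions. Compactness of the sphere yields a
  finite net from \<open>V\<close>; passing from a unit direction to a net vector costs at most
  \<open>K\<close> times the mesh for \<open>f\<close> and \<open>norm G\<close> times the mesh for
  the linear part.\<close>

lemma lipschitz_GDERIV_of_dense_directions:
  fixes f :: "'a::euclidean_space \<Rightarrow> real"
  assumes lip: "K-lipschitz_on UNIV f"
    and dense: "\<And>X. open X \<Longrightarrow> X \<noteq> {} \<Longrightarrow> \<exists>v\<in>V. v \<in> X"
    and dir: "\<And>v. v \<in> V \<Longrightarrow> (slope f v x \<longlongrightarrow> G \<bullet> v) (at 0)"
  shows "GDERIV f x :> G"
  unfolding gderiv_def has_derivative_at_alt
proof (intro conjI allI impI)
  show "bounded_linear (\<lambda>h. h \<bullet> G)" by (rule bounded_linear_inner_left)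
  fix e :: real assume e: "0 < e"
  have K: "0 \<le> K" by (rule lipschitz_on_nonneg[OF lip])
  \<comment> \<open>The mesh is such that both replacements together cost at most
    \<open>e / 2\<close>; the other half is left for the quotients in the net directions.\<close>
  define e' where "e' = e / (2 * (K + norm G + 1))"
  have e': "e' > 0" "(K + norm G) * e' \<le> e / 2"
    unfolding e'_def using e K by (auto simp: field_simps add_pos_nonneg add_nonneg_pos)
  have cover: "sphere 0 1 \<subseteq> (\<Union>v\<in>V. ball v e')"
  proof
    fix w :: 'a
    obtain v where "v \<in> V" "v \<in> ball w e'" using dense[of "ball w e'"] e' by auto
    then show "w \<in> (\<Union>v\<in>V. ball v e')" by (auto simp: dist_commute)
  qed
  obtain F where F: "F \<subseteq> V" "finite F" "sphere 0 1 \<subseteq> (\<Union>v\<in>F. ball v e')"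
    using compactE_image[OF compact_sphere _ cover] by (metis open_ball)
  have "\<forall>\<^sub>F h in at 0. \<forall>v\<in>F. \<bar>slope f v x h - G \<bullet> v\<bar> < e / 2"
  proof (intro eventually_ball_finite F(2) ballI)
    fix v assume "v \<in> F"
    then show "\<forall>\<^sub>F h in at 0. \<bar>slope f v x h - G \<bullet> v\<bar> < e / 2"
      using tendstoD[OF dir, of v "e / 2"] F(1) e by (auto simp: dist_real_def)
  qed
  then obtain d where d: "d > 0" "\<And>h v. h \<noteq> 0 \<Longrightarrow> \<bar>h\<bar> < d \<Longrightarrow> v \<in> F \<Longrightarrow> \<bar>slope f v x h - G \<bullet> v\<bar> < e / 2"
    unfolding eventually_at by (auto simp: dist_real_def)
  show "\<exists>d>0. \<forall>y. norm (y - x) < d \<longrightarrow> norm (f y - f x - (y - x) \<bullet> G) \<le> e * norm (y - x)"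
  proof (intro exI[of _ d] conjI allI impI d(1))
    fix y assume y: "norm (y - x) < d"
    show "norm (f y - f x - (y - x) \<bullet> G) \<le> e * norm (y - x)"
    proof (cases "y = x")
      case False
      define h where "h = norm (y - x)"
      define w where "w = sgn (y - x)"
      have h: "h > 0" "h < d" using False y by (auto simp: h_def)
      have w: "norm w = 1" "y = x + h *\<^sub>R w" using False by (auto simp: w_def h_def norm_sgn sgn_div_norm)
      obtain v where v: "v \<in> F" "norm (w - v) < e'" using F(3) w(1) by (auto simp: subset_iff dist_norm norm_minus_commute)
      have "f (x + h *\<^sub>R v) - f x = h * slope f v x h" using h by (simp add: slope_def)
      then have eq: "f y - f x - (y - x) \<bullet> G = (f y - f (x + h *\<^sub>R v)) + h * (slope f v x h - G \<bullet> v) + h * ((v - w) \<bullet> G)"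
        by (simp add: w(2) algebra_simps inner_commute)
      have "\<bar>f y - f (x + h *\<^sub>R v)\<bar> \<le> K * norm (y - (x + h *\<^sub>R v))"
        using lipschitz_onD[OF lip, of y "x + h *\<^sub>R v"] by (simp add: dist_norm)
      also have "y - (x + h *\<^sub>R v) = h *\<^sub>R (w - v)" by (simp add: w(2) scaleR_diff_right)
      also have "K * norm (h *\<^sub>R (w - v)) \<le> h * (K * e')"
        using h v(2) K by (simp add: mult_left_mono mult.left_commute)
      finally have 1: "\<bar>f y - f (x + h *\<^sub>R v)\<bar> \<le> h * (K * e')" .
      have 2: "\<bar>h * (slope f v x h - G \<bullet> v)\<bar> \<le> h * (e / 2)"
        using d(2)[of h v] h v by (simp add: abs_mult less_imp_le)
      have "\<bar>(v - w) \<bullet> G\<bar> \<le> norm (v - w) * norm G" by (rule Cauchy_Schwarz_ineq2)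
      also have "\<dots> \<le> e' * norm G" using v(2) by (intro mult_right_mono) (auto simp: norm_minus_commute)
      finally have 3: "\<bar>h * ((v - w) \<bullet> G)\<bar> \<le> h * (e' * norm G)" using h by (simp add: abs_mult)
      have "norm (f y - f x - (y - x) \<bullet> G) \<le> h * (K * e') + h * (e / 2) + h * (e' * norm G)"
        unfolding eq real_norm_def using 1 2 3 by linarith
      also have "\<dots> = h * ((K + norm G) * e' + e / 2)" by (simp add: algebra_simps)
      also have "\<dots> \<le> h * e" using e'(2) h by (intro mult_left_mono) auto
      finally show ?thesis by (simp add: h_def mult.commute)
    qed simp
  qed
qed

text \<open>A sequence of increments makes measurability immediate. Where the two-sided limit exists
  this is its value, and for Lipschitz \<open>f\<close> that is almost everywhere.\<close>

definition ddir :: "('a::real_vector \<Rightarrow> real) \<Rightarrow> 'a \<Rightarrow> 'a \<Rightarrow> real" where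
  "ddir f v x = lim (\<lambda>n. slope f v x (1 / Suc n))"

lemma ddir_eq:
  assumes "(slope f v x \<longlongrightarrow> D) (at 0)"
  shows "(\<lambda>n. slope f v x (1 / Suc n)) \<longlonglongrightarrow> D" "ddir f v x = D"
proof -
  have "(\<lambda>n. 1 / real (Suc n)) \<longlonglongrightarrow> 0" using LIMSEQ_inverse_real_of_nat by (simp add: inverse_eq_divide)
  then show "(\<lambda>n. slope f v x (1 / Suc n)) \<longlonglongrightarrow> D"
    using assms unfolding tendsto_at_iff_sequentially comp_def by auto
  then show "ddir f v x = D" unfolding ddir_def by (rule limI)
qed

lemma ddir_measurable:
  fixes f :: "'a::euclidean_space \<Rightarrow> real"
  assumes "continuous_on UNIV f"
  shows "ddir f v \<in> borel_measurable borel"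
proof -
  have [measurable]: "f \<in> borel_measurable borel" using assms by (rule borel_measurable_continuous_onI)
  show ?thesis unfolding ddir_def[abs_def] slope_def by measurable
qed

lemma AE_ddir:
  fixes f :: "'a::euclidean_space \<Rightarrow> real"
  assumes lip: "K-lipschitz_on UNIV f"
  shows "AE x in lborel. (slope f v x \<longlongrightarrow> ddir f v x) (at 0) \<and> \<bar>ddir f v x\<bar> \<le> K * norm v"
  using AE_slope_convergent[OF lip, of v]
proof eventually_elim
  case (elim x)
  then obtain D where D: "(slope f v x \<longlongrightarrow> D) (at 0)" by blast
  have "\<bar>D\<bar> \<le> K * norm v"
    by (rule LIMSEQ_le_const2[OF tendsto_rabs[OF ddir_eq(1)[OF D]]]) (use slope_bound[OF lip] in auto)
  then show ?case using D ddir_eq(2)[OF D] by simp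
qed

lemma integrable_unif_ball_lipschitz:
  fixes f :: "'a::euclidean_space \<Rightarrow> real"
  assumes lip: "K-lipschitz_on UNIV f"
  shows "integrable unif_ball (\<lambda>u. f (x + r *\<^sub>R u))"
proof -
  interpret U: prob_space "unif_ball :: 'a measure" by (rule prob_space_unif_ball)
  have K: "0 \<le> K" by (rule lipschitz_on_nonneg[OF lip])
  have [measurable]: "f \<in> borel_measurable borel"
    using lip by (intro borel_measurable_continuous_onI lipschitz_on_continuous_on)
  show ?thesis
  proof (rule U.integrable_const_bound[where B="\<bar>f x\<bar> + K * \<bar>r\<bar>"])
    show "AE u in unif_ball. norm (f (x + r *\<^sub>R u)) \<le> \<bar>f x\<bar> + K * \<bar>r\<bar>"
      using AE_unif_ball_norm
    proof eventually_elim
      case (elim u)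
      have "\<bar>f (x + r *\<^sub>R u) - f x\<bar> \<le> K * (\<bar>r\<bar> * norm u)"
        using lipschitz_onD[OF lip, of "x + r *\<^sub>R u" x] by (simp add: dist_norm)
      also have "\<dots> \<le> K * (\<bar>r\<bar> * 1)" using elim K by (intro mult_left_mono) auto
      finally show ?case by simp
    qed
  qed (simp add: measurable_unif_ball)
qed

lemma slope_smoothing:
  fixes f :: "'a::euclidean_space \<Rightarrow> real"
  assumes lip: "K-lipschitz_on UNIV f"
  shows "slope (smoothing \<delta> f) v x t = (\<integral>u. slope f v (x + \<delta> *\<^sub>R u) t \<partial>unif_ball)"
proof -
  have "(\<integral>u. f (x + t *\<^sub>R v + \<delta> *\<^sub>R u) - f (x + \<delta> *\<^sub>R u) \<partial>unif_ball) =
    (\<integral>u. f (x + t *\<^sub>R v + \<delta> *\<^sub>R u) \<partial>unif_ball) - (\<integral>u. f (x + \<delta> *\<^sub>R u) \<partial>unif_ball)"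
    by (intro Bochner_Integration.integral_diff integrable_unif_ball_lipschitz[OF lip])
  then show ?thesis unfolding slope_def smoothing_def by (simp add: algebra_simps)
qed

text \<open>Both quantities are limits of the same quotients of \<open>smoothing \<delta> f\<close>:
  the ball average by dominated convergence, the sphere integral by \<open>smoothing_slope\<close>.
  The gain is that the sphere integral is linear in \<open>v\<close>.\<close>

lemma integral_ddir_ball:
  fixes f :: "'a::euclidean_space \<Rightarrow> real"
  assumes lip: "K-lipschitz_on UNIV f" and d: "\<delta> > 0"
  shows "has_bochner_integral unif_ball (\<lambda>u. ddir f v (x + \<delta> *\<^sub>R u))
    (DIM('a) / \<delta> * (\<integral>w. f (x + \<delta> *\<^sub>R w) * (w \<bullet> v) \<partial>unif_sphere))"
proof -
  interpret U: prob_space "unif_ball :: 'a measure" by (rule prob_space_unif_ball)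
  have cont: "continuous_on UNIV f" by (rule lipschitz_on_continuous_on[OF lip])
  have [measurable]: "f \<in> borel_measurable borel" using cont by (rule borel_measurable_continuous_onI)
  have [measurable]: "ddir f v \<in> borel_measurable borel" by (rule ddir_measurable[OF cont])
  have AE: "AE u in unif_ball. (slope f v (x + \<delta> *\<^sub>R u) \<longlongrightarrow> ddir f v (x + \<delta> *\<^sub>R u)) (at 0) \<and> \<bar>ddir f v (x + \<delta> *\<^sub>R u)\<bar> \<le> K * norm v"
    by (rule AE_unif_ball_affine[OF AE_ddir[OF lip] d])
  have lim: "(\<lambda>n. \<integral>u. slope f v (x + \<delta> *\<^sub>R u) (1 / Suc n) \<partial>unif_ball) \<longlonglongrightarrow> (\<integral>u. ddir f v (x + \<delta> *\<^sub>R u) \<partial>unif_ball)"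
  proof (rule integral_dominated_convergence[where w="\<lambda>_. K * norm v"])
    show "AE u in unif_ball. (\<lambda>n. slope f v (x + \<delta> *\<^sub>R u) (1 / Suc n)) \<longlonglongrightarrow> ddir f v (x + \<delta> *\<^sub>R u)"
      using AE by eventually_elim (rule ddir_eq(1), blast)
    show "AE u in unif_ball. norm (slope f v (x + \<delta> *\<^sub>R u) (1 / Suc n)) \<le> K * norm v" for n
      using slope_bound[OF lip] by simp
    show "(\<lambda>u. ddir f v (x + \<delta> *\<^sub>R u)) \<in> borel_measurable unif_ball" by (simp add: measurable_unif_ball)
    show "(\<lambda>u. slope f v (x + \<delta> *\<^sub>R u) (1 / Suc n)) \<in> borel_measurable unif_ball" for n
      unfolding slope_def measurable_unif_ball by measurable
  qed simp
  have "(\<lambda>n. slope (smoothing \<delta> f) v x (1 / Suc n)) \<longlonglongrightarrow>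
    DIM('a) / \<delta> * (\<integral>w. f (x + \<delta> *\<^sub>R w) * (w \<bullet> v) \<partial>unif_sphere)"
    by (rule ddir_eq(1)[OF smoothing_slope[OF lip d]])
  then have "(\<integral>u. ddir f v (x + \<delta> *\<^sub>R u) \<partial>unif_ball) = DIM('a) / \<delta> * (\<integral>w. f (x + \<delta> *\<^sub>R w) * (w \<bullet> v) \<partial>unif_sphere)"
    using lim unfolding slope_smoothing[OF lip] by (rule LIMSEQ_unique[rotated])
  moreover have "integrable unif_ball (\<lambda>u. ddir f v (x + \<delta> *\<^sub>R u))"
  proof (rule U.integrable_const_bound[where B="K * norm v"])
    show "AE u in unif_ball. norm (ddir f v (x + \<delta> *\<^sub>R u)) \<le> K * norm v" using AE by eventually_elim simp
  qed (simp add: measurable_unif_ball)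
  ultimately show ?thesis by (simp add: has_bochner_integral_iff)
qed

text \<open>Built from partial derivatives, it is total and measurable; that it is the gradient
  almost everywhere is Rademacher's theorem.\<close>

definition grad :: "('a::euclidean_space \<Rightarrow> real) \<Rightarrow> 'a \<Rightarrow> 'a" where
  "grad f x = (\<Sum>b\<in>Basis. ddir f b x *\<^sub>R b)"

lemma grad_measurable:
  fixes f :: "'a::euclidean_space \<Rightarrow> real"
  assumes "continuous_on UNIV f"
  shows "grad f \<in> borel_measurable borel"
proof -
  note [measurable] = ddir_measurable[OF assms]
  show ?thesis unfolding grad_def[abs_def] by measurable
qed

lemma integrable_unif_sphere_bounded:
  fixes f :: "'a::euclidean_space \<Rightarrow> 'b::euclidean_space"
  assumes "f \<in> borel_measurable borel" "\<And>w. norm w = 1 \<Longrightarrow> norm (f w) \<le> C"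
  shows "integrable unif_sphere f"
proof -
  interpret S: prob_space "unif_sphere :: 'a measure" by (rule prob_space_unif_sphere)
  show ?thesis
  proof (rule S.integrable_const_bound[where B=C])
    show "AE w in unif_sphere. norm (f w) \<le> C" using AE_unif_sphere_norm by eventually_elim (rule assms(2))
    show "f \<in> borel_measurable unif_sphere"
      using assms(1) by (simp add: measurable_cong_sets[OF sets_unif_sphere refl])
  qed
qed

lemma lipschitz_on_sphere_bound:
  fixes f :: "'a::real_normed_vector \<Rightarrow> real"
  assumes lip: "K-lipschitz_on UNIV f" and w: "norm w = 1"
  shows "\<bar>f (x + \<delta> *\<^sub>R w)\<bar> \<le> \<bar>f x\<bar> + K * \<bar>\<delta>\<bar>"
  using lipschitz_onD[OF lip, of "x + \<delta> *\<^sub>R w" x] w by (simp add: dist_norm)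

text \<open>By \<open>integral_ddir_ball\<close> every ball average of \<open>ddir f v\<close> is
  linear in \<open>v\<close>, so the ball averages of the difference vanish, and the difference is
  bounded almost everywhere. This stands in for the usual integration by parts against test
  functions.\<close>

lemma AE_ddir_eq_grad:
  fixes f :: "'a::euclidean_space \<Rightarrow> real"
  assumes lip: "K-lipschitz_on UNIV f"
  shows "AE x in lborel. ddir f v x = grad f x \<bullet> v"
proof -
  have cont: "continuous_on UNIV f" by (rule lipschitz_on_continuous_on[OF lip])
  note [measurable] = ddir_measurable[OF cont] grad_measurable[OF cont] borel_measurable_continuous_onI[OF cont]
  have gv: "grad f x \<bullet> v = (\<Sum>b\<in>Basis. (v \<bullet> b) * ddir f b x)" for x
    unfolding grad_def inner_sum_left inner_scaleR_left by (simp add: inner_commute mult.commute)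
  have "AE x in lborel. ddir f v x - grad f x \<bullet> v = 0"
  proof (rule AE_zero_of_ball_averages[where C="K * norm v + (\<Sum>b\<in>Basis. \<bar>v \<bullet> b\<bar> * (K * norm (b::'a)))"])
    have "AE x in lborel. \<forall>b\<in>insert v Basis. \<bar>ddir f b x\<bar> \<le> K * norm b"
      using AE_ddir[OF lip] by (subst AE_ball_countable) (auto intro: countable_finite elim: eventually_mono)
    then show "AE x in lborel. \<bar>ddir f v x - grad f x \<bullet> v\<bar> \<le> K * norm v + (\<Sum>b\<in>Basis. \<bar>v \<bullet> b\<bar> * (K * norm (b::'a)))"
    proof eventually_elim
      case (elim x)
      have "\<bar>grad f x \<bullet> v\<bar> \<le> (\<Sum>b\<in>Basis. \<bar>(v \<bullet> b) * ddir f b x\<bar>)" unfolding gv by (rule sum_abs)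
      also have "\<dots> \<le> (\<Sum>b\<in>Basis. \<bar>v \<bullet> b\<bar> * (K * norm (b::'a)))"
        using elim by (intro sum_mono) (auto simp: abs_mult intro!: mult_left_mono)
      finally show ?case using elim by auto
    qed
    fix x :: 'a and r :: real assume r: "r > 0"
    define I where "I v = DIM('a) / r * (\<integral>w. f (x + r *\<^sub>R w) * (w \<bullet> v) \<partial>unif_sphere)" for v
    have int: "integrable unif_sphere (\<lambda>w. f (x + r *\<^sub>R w) * (w \<bullet> b))" for b
    proof (rule integrable_unif_sphere_bounded[where C="(\<bar>f x\<bar> + K * \<bar>r\<bar>) * norm b"])
      fix w :: 'a assume w: "norm w = 1"
      show "norm (f (x + r *\<^sub>R w) * (w \<bullet> b)) \<le> (\<bar>f x\<bar> + K * \<bar>r\<bar>) * norm b"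
        using lipschitz_on_sphere_bound[OF lip w, of x r] Cauchy_Schwarz_ineq2[of w b] w
        by (auto simp: abs_mult intro!: mult_mono)
    qed measurable
    have "I v = DIM('a) / r * (\<integral>w. (\<Sum>b\<in>Basis. (v \<bullet> b) * (f (x + r *\<^sub>R w) * (w \<bullet> b))) \<partial>unif_sphere)"
    proof -
      have "w \<bullet> v = (\<Sum>b\<in>Basis. (v \<bullet> b) * (w \<bullet> b))" for w
        by (subst euclidean_inner) (simp add: mult.commute)
      then show ?thesis unfolding I_def by (simp add: sum_distrib_left mult.left_commute)
    qed
    also have "(\<integral>w. (\<Sum>b\<in>Basis. (v \<bullet> b) * (f (x + r *\<^sub>R w) * (w \<bullet> b))) \<partial>unif_sphere) =
      (\<Sum>b\<in>Basis. (v \<bullet> b) * (\<integral>w. f (x + r *\<^sub>R w) * (w \<bullet> b) \<partial>unif_sphere))"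
      by (subst Bochner_Integration.integral_sum) (intro integrable_mult_right int, simp)
    also have "DIM('a) / r * \<dots> = (\<Sum>b\<in>Basis. (v \<bullet> b) * I b)"
      unfolding I_def sum_distrib_left by (simp add: mult.left_commute)
    finally have I: "I v = (\<Sum>b\<in>Basis. (v \<bullet> b) * I b)" .
    have "has_bochner_integral unif_ball (\<lambda>u. ddir f v (x + r *\<^sub>R u) - grad f (x + r *\<^sub>R u) \<bullet> v) (I v - (\<Sum>b\<in>Basis. (v \<bullet> b) * I b))"
      unfolding gv I_def
      by (intro has_bochner_integral_diff has_bochner_integral_sum has_bochner_integral_mult_right integral_ddir_ball[OF lip r])
    then show "(\<integral>u. ddir f v (x + r *\<^sub>R u) - grad f (x + r *\<^sub>R u) \<bullet> v \<partial>unif_ball) = 0"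
      using I by (simp add: has_bochner_integral_iff)
  qed measurable
  then show ?thesis by eventually_elim simp
qed

text \<open>A countable dense set of directions keeps the exceptional set null; the Lipschitz bound
  recovers all other directions.\<close>

theorem rademacher:
  fixes f :: "'a::euclidean_space \<Rightarrow> real"
  assumes lip: "K-lipschitz_on UNIV f"
  shows "AE x in lborel. GDERIV f x :> grad f x"
proof -
  obtain V :: "'a set" where V: "countable V" "\<And>X. open X \<Longrightarrow> X \<noteq> {} \<Longrightarrow> \<exists>v\<in>V. v \<in> X"
    using countable_dense_setE by metis
  have "AE x in lborel. \<forall>v\<in>V. (slope f v x \<longlongrightarrow> grad f x \<bullet> v) (at 0)"
    unfolding AE_ball_countable[OF V(1)]
  proof
    fix v assume "v \<in> V"
    show "AE x in lborel. (slope f v x \<longlongrightarrow> grad f x \<bullet> v) (at 0)"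
      using AE_ddir[OF lip, of v] AE_ddir_eq_grad[OF lip, of v] by eventually_elim simp
  qed
  then show ?thesis
    by eventually_elim (rule lipschitz_GDERIV_of_dense_directions[OF lip V(2)], auto)
qed

lemma GDERIV_slope:
  assumes "GDERIV f x :> G"
  shows "(slope f v x \<longlongrightarrow> G \<bullet> v) (at 0)"
proof -
  have "((\<lambda>t. f (x + t *\<^sub>R v)) has_derivative (\<lambda>t. (t *\<^sub>R v) \<bullet> G)) (at 0)"
  proof (rule has_derivative_compose[of "\<lambda>t. x + t *\<^sub>R v" "\<lambda>t. t *\<^sub>R v" 0 UNIV f "\<lambda>h. h \<bullet> G"])
    show "((\<lambda>t. x + t *\<^sub>R v) has_derivative (\<lambda>t. t *\<^sub>R v)) (at 0)" by (auto intro!: derivative_eq_intros)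
    show "(f has_derivative (\<lambda>h. h \<bullet> G)) (at (x + 0 *\<^sub>R v))" using assms by (simp add: gderiv_def)
  qed
  then have "((\<lambda>t. f (x + t *\<^sub>R v)) has_real_derivative (G \<bullet> v)) (at 0)"
    by (rule has_derivative_imp_has_field_derivative) (simp add: inner_commute)
  then show ?thesis unfolding has_field_derivative_iff slope_def by simp
qed

lemma GDERIV_norm_le:
  assumes lip: "K-lipschitz_on UNIV f" and G: "GDERIV f x :> G"
  shows "norm G \<le> K"
proof (cases "G = 0")
  case True then show ?thesis using lipschitz_on_nonneg[OF lip] by simp
next
  case False
  have "\<bar>G \<bullet> G\<bar> \<le> K * norm G"
    by (rule LIMSEQ_le_const2[OF tendsto_rabs[OF ddir_eq(1)[OF GDERIV_slope[OF G]]]]) (use slope_bound[OF lip] in auto)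
  then have "norm G * norm G \<le> K * norm G" by (simp add: power2_norm_eq_inner[symmetric] power2_eq_square)
  then show ?thesis using False by simp
qed

text \<open>The two representations have different uses: the ball average of gradients places
  \<open>G\<close> in the Goldstein set, the sphere integral makes the estimator unbiased.\<close>

lemma GDERIV_smoothing_inner:
  fixes f :: "'a::euclidean_space \<Rightarrow> real"
  assumes lip: "K-lipschitz_on UNIV f" and d: "\<delta> > 0" and G: "GDERIV (smoothing \<delta> f) x :> G"
  shows "has_bochner_integral unif_ball (\<lambda>u. grad f (x + \<delta> *\<^sub>R u) \<bullet> v) (G \<bullet> v)"
    and "DIM('a) / \<delta> * (\<integral>w. f (x + \<delta> *\<^sub>R w) * (w \<bullet> v) \<partial>unif_sphere) = G \<bullet> v"
proof -
  have cont: "continuous_on UNIV f" by (rule lipschitz_on_continuous_on[OF lip])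
  note [measurable] = ddir_measurable[OF cont] grad_measurable[OF cont]
  show eq: "DIM('a) / \<delta> * (\<integral>w. f (x + \<delta> *\<^sub>R w) * (w \<bullet> v) \<partial>unif_sphere) = G \<bullet> v"
    by (rule tendsto_unique[OF at_neq_bot smoothing_slope[OF lip d] GDERIV_slope[OF G]])
  show "has_bochner_integral unif_ball (\<lambda>u. grad f (x + \<delta> *\<^sub>R u) \<bullet> v) (G \<bullet> v)"
  proof (rule has_bochner_integralI_AE[OF integral_ddir_ball[OF lip d, of v x, unfolded eq]])
    show "AE u in unif_ball. ddir f v (x + \<delta> *\<^sub>R u) = grad f (x + \<delta> *\<^sub>R u) \<bullet> v"
      by (rule AE_unif_ball_affine[OF AE_ddir_eq_grad[OF lip] d])
    show "(\<lambda>u. grad f (x + \<delta> *\<^sub>R u) \<bullet> v) \<in> borel_measurable unif_ball"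
      unfolding measurable_unif_ball by measurable
  qed
qed

text \<open>The sphere formula is applied to \<open>x \<mapsto> a \<bullet> x\<close>, which
  smoothing changes only by a constant, so that the gradient remains \<open>a\<close>.\<close>

lemma integral_unif_sphere_inner_squared:
  fixes a :: "'a::euclidean_space"
  shows "DIM('a) * (\<integral>w. (a \<bullet> w)\<^sup>2 \<partial>unif_sphere) = (norm a)\<^sup>2"
proof -
  have lip: "(norm a)-lipschitz_on UNIV (\<lambda>x. a \<bullet> x)"
    by (rule lipschitz_onI) (auto simp: dist_norm inner_diff_right[symmetric] Cauchy_Schwarz_ineq2)
  interpret U: prob_space "unif_ball :: 'a measure" by (rule prob_space_unif_ball)
  have i: "integrable unif_ball (\<lambda>u. a \<bullet> u)"
    using integrable_unif_ball_lipschitz[OF lip, of 0 1] by simp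
  have "smoothing 1 (\<lambda>x. a \<bullet> x) x = a \<bullet> x + (\<integral>u. a \<bullet> u \<partial>unif_ball)" for x
    unfolding smoothing_def inner_add_right using i U.prob_space
    by (subst Bochner_Integration.integral_add) auto
  then have "smoothing 1 (\<lambda>x. a \<bullet> x) = (\<lambda>x. x \<bullet> a + (\<integral>u. a \<bullet> u \<partial>unif_ball))"
    by (simp add: fun_eq_iff inner_commute)
  then have "GDERIV (smoothing 1 (\<lambda>x. a \<bullet> x)) 0 :> a"
    unfolding gderiv_def by (auto intro!: derivative_eq_intros)
  from GDERIV_smoothing_inner(2)[OF lip _ this, of a] show ?thesis
    by (simp add: power2_eq_square inner_commute power2_norm_eq_inner[unfolded power2_eq_square])
qed

section \<open>The Goldstein subdifferential\<close>

text \<open>Limits of gradients along convergent differentiability points are the closure points of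
  this graph, so their closedness comes for free.\<close>

definition gradient_graph :: "('a::euclidean_space \<Rightarrow> real) \<Rightarrow> ('a \<times> 'a) set" where
  "gradient_graph f = {(p, G). GDERIV f p :> G}"

definition limit_gradients :: "real \<Rightarrow> ('a::euclidean_space \<Rightarrow> real) \<Rightarrow> 'a \<Rightarrow> 'a set" where
  "limit_gradients \<delta> f x = {g. \<exists>y\<in>cball x \<delta>. (y, g) \<in> closure (gradient_graph f)}"

lemma clarke_eq: "clarke f y = convex hull {g. (y, g) \<in> closure (gradient_graph f)}"
proof -
  have "(\<exists>X G. X \<longlonglongrightarrow> y \<and> (\<forall>k::nat. GDERIV f (X k) :> G k) \<and> G \<longlonglongrightarrow> g) \<longleftrightarrow>
      (y, g) \<in> closure (gradient_graph f)" (is "?L \<longleftrightarrow> ?R") for g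
  proof
    assume ?L
    then obtain X G where XG: "X \<longlonglongrightarrow> y" "\<And>k::nat. GDERIV f (X k) :> G k" "G \<longlonglongrightarrow> g" by blast
    then show ?R unfolding closure_sequential
      by (intro exI[of _ "\<lambda>k. (X k, G k)"]) (auto simp: gradient_graph_def intro: tendsto_Pair)
  next
    assume ?R
    then obtain Z where Z: "\<And>n. Z n \<in> gradient_graph f" "Z \<longlonglongrightarrow> (y, g)" unfolding closure_sequential by blast
    show ?L
      using Z(1) tendsto_fst[OF Z(2)] tendsto_snd[OF Z(2)]
      by (intro exI[of _ "\<lambda>n. fst (Z n)"] exI[of _ "\<lambda>n. snd (Z n)"]) (auto simp: gradient_graph_def case_prod_beta)
  qed
  then show ?thesis unfolding clarke_def by simp
qed

text \<open>Nested convex hulls collapse. What remains is the hull of a set that is compact for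
  Lipschitz \<open>f\<close>, to which strict separation applies.\<close>

lemma goldstein_eq: "goldstein \<delta> f x = convex hull (limit_gradients \<delta> f x)"
proof
  show "goldstein \<delta> f x \<subseteq> convex hull (limit_gradients \<delta> f x)"
    unfolding goldstein_def
  proof (rule hull_minimal[OF UN_least])
    fix y assume "y \<in> cball x \<delta>"
    then show "clarke f y \<subseteq> convex hull (limit_gradients \<delta> f x)"
      unfolding clarke_eq limit_gradients_def by (intro hull_mono) auto
  qed (rule convex_convex_hull)
  have "limit_gradients \<delta> f x \<subseteq> (\<Union>y\<in>cball x \<delta>. clarke f y)"
    unfolding limit_gradients_def clarke_eq by (force intro: hull_inc)
  then show "convex hull (limit_gradients \<delta> f x) \<subseteq> goldstein \<delta> f x"
    unfolding goldstein_def by (rule hull_mono)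
qed

lemma closure_gradient_graph_bounded:
  assumes lip: "K-lipschitz_on UNIV f" and "(y, g) \<in> closure (gradient_graph f)"
  shows "norm g \<le> K"
proof -
  have "gradient_graph f \<subseteq> UNIV \<times> cball 0 K"
    using GDERIV_norm_le[OF lip] by (auto simp: gradient_graph_def)
  then have "closure (gradient_graph f) \<subseteq> UNIV \<times> cball 0 K"
    by (rule closure_minimal) (intro closed_Times closed_UNIV closed_cball)
  then show ?thesis using assms(2) by auto
qed

text \<open>A compact slice of the closed graph is projected to its second component; the gradient
  bound \<open>K\<close> makes the slice bounded.\<close>

lemma compact_limit_gradients:
  assumes lip: "K-lipschitz_on UNIV f"
  shows "compact (limit_gradients \<delta> f x)"
proof -
  have "limit_gradients \<delta> f x = snd ` (closure (gradient_graph f) \<inter> (cball x \<delta> \<times> cball 0 K))"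
    using closure_gradient_graph_bounded[OF lip] by (force simp: limit_gradients_def)
  also have "compact \<dots>"
    by (intro compact_continuous_image continuous_intros closed_Int_compact compact_Times) auto
  finally show ?thesis .
qed

lemma limit_gradients_nonempty:
  fixes f :: "'a::euclidean_space \<Rightarrow> real"
  assumes lip: "K-lipschitz_on UNIV f" and d: "\<delta> > 0"
  shows "limit_gradients \<delta> f x \<noteq> {}"
proof -
  interpret U: prob_space "unif_ball :: 'a measure" by (rule prob_space_unif_ball)
  have "AE u in (unif_ball :: 'a measure). \<exists>u'. norm u' \<le> 1 \<and> GDERIV f (x + \<delta> *\<^sub>R u') :> grad f (x + \<delta> *\<^sub>R u')"
    using AE_unif_ball_affine[OF rademacher[OF lip] d, of x] AE_unif_ball_norm by eventually_elim blast
  then obtain u where u: "norm u \<le> 1" "GDERIV f (x + \<delta> *\<^sub>R u) :> grad f (x + \<delta> *\<^sub>R u)"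
    by (simp only: U.AE_const) blast
  have "(x + \<delta> *\<^sub>R u, grad f (x + \<delta> *\<^sub>R u)) \<in> closure (gradient_graph f)"
    using u(2) by (intro subsetD[OF closure_subset]) (simp add: gradient_graph_def)
  moreover have "x + \<delta> *\<^sub>R u \<in> cball x \<delta>" using u d by (simp add: dist_norm mult_left_le)
  ultimately show ?thesis unfolding limit_gradients_def by blast
qed

lemma smoothing_gradient_in_goldstein:
  fixes f :: "'a::euclidean_space \<Rightarrow> real"
  assumes lip: "K-lipschitz_on UNIV f" and d: "\<delta> > 0" and G: "GDERIV (smoothing \<delta> f) x :> G"
  shows "G \<in> goldstein \<delta> f x"
proof (rule ccontr)
  interpret U: prob_space "unif_ball :: 'a measure" by (rule prob_space_unif_ball)
  let ?C = "convex hull (limit_gradients \<delta> f x)"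
  assume "G \<notin> goldstein \<delta> f x"
  then have "G \<notin> ?C" by (simp add: goldstein_eq)
  moreover have "closed ?C"
    by (intro compact_imp_closed compact_convex_hull compact_limit_gradients[OF lip])
  ultimately obtain a b where ab: "a \<bullet> G < b" "\<And>g. g \<in> ?C \<Longrightarrow> b < a \<bullet> g"
    using separating_hyperplane_closed_point[of ?C G] convex_convex_hull by blast
  have "AE u in unif_ball. b \<le> grad f (x + \<delta> *\<^sub>R u) \<bullet> a"
    using AE_unif_ball_affine[OF rademacher[OF lip] d, of x] AE_unif_ball_norm
  proof eventually_elim
    case (elim u)
    have "(x + \<delta> *\<^sub>R u, grad f (x + \<delta> *\<^sub>R u)) \<in> closure (gradient_graph f)"
      using elim(1) by (intro subsetD[OF closure_subset]) (simp add: gradient_graph_def)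
    moreover have "x + \<delta> *\<^sub>R u \<in> cball x \<delta>" using elim d by (simp add: dist_norm mult_left_le)
    ultimately have "grad f (x + \<delta> *\<^sub>R u) \<in> ?C"
      by (intro hull_inc) (auto simp: limit_gradients_def)
    from ab(2)[OF this] show ?case by (simp add: inner_commute)
  qed
  then have "(\<integral>u. b \<partial>(unif_ball :: 'a measure)) \<le> (\<integral>u. grad f (x + \<delta> *\<^sub>R u) \<bullet> a \<partial>unif_ball)"
    using GDERIV_smoothing_inner(1)[OF lip d G, of a]
    by (intro integral_mono_AE) (auto simp: has_bochner_integral_iff)
  also have "\<dots> = G \<bullet> a" using GDERIV_smoothing_inner(1)[OF lip d G, of a] by (simp add: has_bochner_integral_iff)
  finally show False using ab(1) U.prob_space by (simp add: inner_commute)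
qed

lemma infdist_0_greatest:
  assumes "A \<noteq> {}" "\<And>z. z \<in> A \<Longrightarrow> b \<le> norm z"
  shows "b \<le> infdist 0 A"
  using assms by (simp add: infdist_def cINF_greatest)

text \<open>The expectation in the theorem requires this. The map is lower semicontinuous, because
  the Goldstein sets of nearby points stay within a small neighbourhood of the one at
  \<open>x\<close>.\<close>

lemma infdist_goldstein_measurable:
  fixes f :: "'a::euclidean_space \<Rightarrow> real"
  assumes lip: "K-lipschitz_on UNIV f" and d: "\<delta> > 0"
  shows "(\<lambda>x. infdist 0 (goldstein \<delta> f x)) \<in> borel_measurable borel"
proof (rule borel_measurableI_greater)
  fix a
  let ?R = "limit_gradients \<delta> f"
  let ?\<phi> = "\<lambda>x. infdist 0 (goldstein \<delta> f x)"
  have "open {x. a < ?\<phi> x}"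
  proof (subst open_contains_ball, intro ballI)
    fix x assume x: "x \<in> {x. a < ?\<phi> x}"
    \<comment> \<open>Half of the gap: after a loss of \<open>e\<close> the value is still above
      \<open>a\<close>.\<close>
    define e where "e = (?\<phi> x - a) / 2"
    have e: "e > 0" using x by (simp add: e_def)
    \<comment> \<open>Otherwise there are counterexamples approaching \<open>x\<close>, bounded in
      both components. A limit point lies in the closed graph over \<open>cball x \<delta>\<close>,
      so its gradient belongs to \<open>limit_gradients \<delta> f x\<close>, although all
      approximating gradients keep distance \<open>e\<close> from that set.\<close>
    have "\<exists>r>0. \<forall>x'\<in>ball x r. \<forall>g\<in>?R x'. infdist g (?R x) < e"
    proof (rule ccontr)
      assume *: "\<not> ?thesis"
      have "\<exists>x' y g. dist x x' < 1 / Suc n \<and> y \<in> cball x' \<delta> \<and> (y, g) \<in> closure (gradient_graph f) \<and> e \<le> infdist g (?R x)" for n :: nat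
      proof -
        have "\<not> (\<forall>x'\<in>ball x (1 / Suc n). \<forall>g\<in>?R x'. infdist g (?R x) < e)"
          using * by (metis of_nat_0_less_iff zero_less_Suc zero_less_divide_1_iff)
        then obtain x' g where "x' \<in> ball x (1 / Suc n)" "g \<in> ?R x'" "e \<le> infdist g (?R x)" by (auto simp: not_less)
        moreover obtain y where "y \<in> cball x' \<delta>" "(y, g) \<in> closure (gradient_graph f)"
          using \<open>g \<in> ?R x'\<close> unfolding limit_gradients_def mem_Collect_eq by blast
        ultimately show ?thesis by (intro exI[of _ x'] exI[of _ y] exI[of _ g]) simp
      qed
      then obtain X Y G where XYG: "\<And>n::nat. dist x (X n) < 1 / Suc n" "\<And>n. Y n \<in> cball (X n) \<delta>"
        "\<And>n. (Y n, G n) \<in> closure (gradient_graph f)" "\<And>n. e \<le> infdist (G n) (?R x)" by metis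
      have X: "X \<longlonglongrightarrow> x"
      proof (rule metric_LIMSEQ_I)
        fix r :: real assume "r > 0"
        then obtain N :: nat where N: "1 / Suc N < r" by (meson nat_approx_posE)
        have "dist (X n) x < r" if "n \<ge> N" for n
        proof -
          have "1 / real (Suc n) \<le> 1 / Suc N" using that by (simp add: frac_le)
          then show ?thesis using XYG(1)[of n] N by (simp add: dist_commute)
        qed
        then show "\<exists>N. \<forall>n\<ge>N. dist (X n) x < r" by blast
      qed
      have "(Y n, G n) \<in> closure (gradient_graph f) \<inter> (cball x (1 + \<delta>) \<times> cball 0 K)" for n
      proof -
        have "dist x (Y n) \<le> dist x (X n) + dist (X n) (Y n)" by (rule dist_triangle)
        moreover have "1 / real (Suc n) \<le> 1" by simp
        ultimately have "dist x (Y n) \<le> 1 + \<delta>" using XYG(1)[of n] XYG(2)[of n] unfolding mem_cball by linarith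
        then show ?thesis using XYG(3) closure_gradient_graph_bounded[OF lip XYG(3)] by simp
      qed
      moreover have "compact (closure (gradient_graph f) \<inter> (cball x (1 + \<delta>) \<times> cball 0 K))"
        by (intro closed_Int_compact compact_Times) auto
      ultimately obtain l s where ls: "l \<in> closure (gradient_graph f)" "strict_mono s" "((\<lambda>n. (Y n, G n)) \<circ> s) \<longlonglongrightarrow> l"
        unfolding compact_def by (blast dest: spec[of _ "\<lambda>n. (Y n, G n)"])
      obtain y g where l: "l = (y, g)" by (cases l)
      have Ys: "(\<lambda>n. Y (s n)) \<longlonglongrightarrow> y" and Gs: "(\<lambda>n. G (s n)) \<longlonglongrightarrow> g"
        using tendsto_fst[OF ls(3)] tendsto_snd[OF ls(3)] by (simp_all add: l comp_def)
      have Xs: "(\<lambda>n. X (s n)) \<longlonglongrightarrow> x" using LIMSEQ_subseq_LIMSEQ[OF X ls(2)] by (simp add: comp_def)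
      have "dist x y \<le> \<delta>"
        by (rule LIMSEQ_le_const2[OF tendsto_dist[OF Xs Ys]]) (use XYG(2) in auto)
      then have "g \<in> ?R x" using ls(1) unfolding limit_gradients_def l by (auto intro!: bexI[of _ y])
      then have "e \<le> dist (G (s n)) g" for n
        using infdist_le[of g "?R x" "G (s n)"] XYG(4)[of "s n"] by linarith
      moreover have "(\<lambda>n. dist (G (s n)) g) \<longlonglongrightarrow> dist g g" by (intro tendsto_intros Gs)
      ultimately have "e \<le> dist g g" by (intro LIMSEQ_le_const) auto
      then show False using e by simp
    qed
    then obtain r where r: "r > 0" "\<And>x' g. x' \<in> ball x r \<Longrightarrow> g \<in> ?R x' \<Longrightarrow> infdist g (?R x) < e" by blast
    have "x' \<in> {x. a < ?\<phi> x}" if x': "x' \<in> ball x r" for x'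
    proof -
      \<comment> \<open>The open \<open>e\<close>-neighbourhood of the hull is convex; once it
        contains \<open>limit_gradients \<delta> f x'\<close>, it contains the hull of that set
        too.\<close>
      let ?C = "\<Union>c\<in>convex hull ?R x. \<Union>z\<in>ball 0 e. {c + z}"
      have "?R x' \<subseteq> ?C"
      proof
        fix g assume "g \<in> ?R x'"
        then have "infdist g (?R x) < e" by (rule r(2)[OF x'])
        moreover obtain c where "c \<in> ?R x" "infdist g (?R x) = dist g c"
          by (rule infdist_attains_inf[OF compact_imp_closed[OF compact_limit_gradients[OF lip]] limit_gradients_nonempty[OF lip d]])
        ultimately show "g \<in> ?C"
          by (intro UN_I[of c] UN_I[of "g - c"]) (auto simp: hull_inc dist_norm norm_minus_commute)
      qed
      moreover have "convex ?C" by (intro convex_sums convex_convex_hull convex_ball)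
      ultimately have sub: "convex hull ?R x' \<subseteq> ?C" by (rule hull_minimal)
      have "?\<phi> x - e \<le> ?\<phi> x'"
      proof (rule infdist_0_greatest)
        show "goldstein \<delta> f x' \<noteq> {}" using limit_gradients_nonempty[OF lip d] by (simp add: goldstein_eq)
        fix z assume "z \<in> goldstein \<delta> f x'"
        then obtain c w where cw: "z = c + w" "c \<in> goldstein \<delta> f x" "norm w < e"
          using sub unfolding goldstein_eq by auto
        have "?\<phi> x \<le> dist 0 c" using cw(2) by (rule infdist_le)
        also have "\<dots> = norm (z - w)" using cw(1) by simp
        also have "\<dots> \<le> norm z + norm w" by (rule norm_triangle_ineq4)
        finally show "?\<phi> x - e \<le> norm z" using cw(3) by linarith
      qed
      then show ?thesis using e unfolding e_def by (simp add: field_simps)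
    qed
    then show "\<exists>r>0. ball x r \<subseteq> {x. a < ?\<phi> x}" using r(1) by blast
  qed
  then show "{x \<in> space borel. a < ?\<phi> x} \<in> sets borel" by simp
qed

section \<open>A variance bound on the sphere\<close>

text \<open>The second component is the derivative of the first with respect to
  \<open>\<theta>\<close>.\<close>

definition rotation :: "real \<Rightarrow> 'a::real_vector \<times> 'a \<Rightarrow> 'a \<times> 'a" where
  "rotation \<theta> z = (cos \<theta> *\<^sub>R fst z + sin \<theta> *\<^sub>R snd z, - sin \<theta> *\<^sub>R fst z + cos \<theta> *\<^sub>R snd z)"

lemma rotation_add: "rotation \<alpha> (rotation \<beta> z) = rotation (\<alpha> + \<beta>) z"
  by (simp add: rotation_def cos_add sin_add algebra_simps)

lemma norm_rotation: "norm (rotation \<theta> (z :: 'a::real_inner \<times> 'a)) = norm z"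
proof -
  obtain x y where z: "z = (x, y)" by (cases z)
  define s c where "s = sin \<theta>" and "c = cos \<theta>"
  have sc: "s * s + c * c = 1" unfolding s_def c_def by (metis power2_eq_square sin_cos_squared_add)
  have "(norm (rotation \<theta> z))\<^sup>2 = (s * s + c * c) * (x \<bullet> x) + (s * s + c * c) * (y \<bullet> y)"
    unfolding z rotation_def power2_norm_eq_inner s_def[symmetric] c_def[symmetric]
    by (simp add: inner_add_left inner_add_right inner_commute algebra_simps)
  also have "\<dots> = (norm z)\<^sup>2" unfolding sc by (simp add: z power2_norm_eq_inner)
  finally show ?thesis by simp
qed

lemma rotation_measurable [measurable]: "rotation \<theta> \<in> borel_measurable (borel :: ('a::euclidean_space \<times> 'a) measure)"
  unfolding rotation_def[abs_def]
  by (intro borel_measurable_continuous_onI continuous_intros)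

lemma nn_integral_shift:
  fixes h :: "'a::euclidean_space \<Rightarrow> ennreal"
  assumes [measurable]: "h \<in> borel_measurable borel"
  shows "(\<integral>\<^sup>+x. h (x + a) \<partial>lborel) = (\<integral>\<^sup>+x. h x \<partial>lborel)"
proof -
  have "(\<integral>\<^sup>+x. h x \<partial>lborel) = (\<integral>\<^sup>+x. h x \<partial>distr lborel borel ((+) a))" by (simp only: lborel_distr_plus)
  also have "\<dots> = (\<integral>\<^sup>+x. h (x + a) \<partial>lborel)" by (subst nn_integral_distr) (auto simp: add.commute)
  finally show ?thesis by simp
qed

lemma nn_integral_lborel_pair:
  fixes h :: "'a::euclidean_space \<times> 'a \<Rightarrow> ennreal"
  assumes [measurable]: "h \<in> borel_measurable borel"
  shows "(\<integral>\<^sup>+z. h z \<partial>lborel) = (\<integral>\<^sup>+y. (\<integral>\<^sup>+x. h (x, y) \<partial>lborel) \<partial>lborel)"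
    and "(\<integral>\<^sup>+z. h z \<partial>lborel) = (\<integral>\<^sup>+x. (\<integral>\<^sup>+y. h (x, y) \<partial>lborel) \<partial>lborel)"
proof -
  have h: "h \<in> borel_measurable (lborel \<Otimes>\<^sub>M lborel)" unfolding lborel_prod by simp
  show "(\<integral>\<^sup>+z. h z \<partial>lborel) = (\<integral>\<^sup>+y. (\<integral>\<^sup>+x. h (x, y) \<partial>lborel) \<partial>lborel)"
    using lborel_pair.nn_integral_snd[OF h] by (simp add: lborel_prod)
  show "(\<integral>\<^sup>+z. h z \<partial>lborel) = (\<integral>\<^sup>+x. (\<integral>\<^sup>+y. h (x, y) \<partial>lborel) \<partial>lborel)"
    using lborel.nn_integral_fst[OF h] by (simp add: lborel_prod)
qed

lemma measurable_pair_section: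
  fixes h :: "'a::euclidean_space \<times> 'a \<Rightarrow> ennreal"
  assumes "h \<in> borel_measurable borel"
  shows "(\<lambda>x. h (x, y)) \<in> borel_measurable borel" "(\<lambda>y. h (x, y)) \<in> borel_measurable borel"
proof -
  have 1: "(\<lambda>x. (x, y)) \<in> borel_measurable borel" "(\<lambda>y. (x, y)) \<in> borel_measurable borel" for x y :: 'a
    by (intro borel_measurable_continuous_onI continuous_intros)+
  show "(\<lambda>x. h (x, y)) \<in> borel_measurable borel" "(\<lambda>y. h (x, y)) \<in> borel_measurable borel"
    using measurable_compose[OF 1(1) assms] measurable_compose[OF 1(2) assms] by simp_all
qed

text \<open>With one component fixed a shear is a translation of the other, so Fubini and
  translation invariance suffice.\<close>

lemma nn_integral_shear:
  fixes h :: "'a::euclidean_space \<times> 'a \<Rightarrow> ennreal"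
  assumes hm: "h \<in> borel_measurable borel"
  shows "(\<integral>\<^sup>+z. h (fst z + t *\<^sub>R snd z, snd z) \<partial>lborel) = (\<integral>\<^sup>+z. h z \<partial>lborel)"
    and "(\<integral>\<^sup>+z. h (fst z, snd z + t *\<^sub>R fst z) \<partial>lborel) = (\<integral>\<^sup>+z. h z \<partial>lborel)"
proof -
  have "(\<lambda>z::'a\<times>'a. (fst z + t *\<^sub>R snd z, snd z)) \<in> borel_measurable borel"
    "(\<lambda>z::'a\<times>'a. (fst z, snd z + t *\<^sub>R fst z)) \<in> borel_measurable borel"
    by (intro borel_measurable_continuous_onI continuous_intros)+
  from measurable_compose[OF this(1) hm] measurable_compose[OF this(2) hm]
  have m: "(\<lambda>z. h (fst z + t *\<^sub>R snd z, snd z)) \<in> borel_measurable borel" "(\<lambda>z. h (fst z, snd z + t *\<^sub>R fst z)) \<in> borel_measurable borel"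
    by simp_all
  show "(\<integral>\<^sup>+z. h (fst z + t *\<^sub>R snd z, snd z) \<partial>lborel) = (\<integral>\<^sup>+z. h z \<partial>lborel)"
    unfolding nn_integral_lborel_pair(1)[OF m(1)] nn_integral_lborel_pair(1)[OF hm]
    by (simp add: nn_integral_shift[OF measurable_pair_section(1)[OF hm]])
  show "(\<integral>\<^sup>+z. h (fst z, snd z + t *\<^sub>R fst z) \<partial>lborel) = (\<integral>\<^sup>+z. h z \<partial>lborel)"
    unfolding nn_integral_lborel_pair(2)[OF m(2)] nn_integral_lborel_pair(2)[OF hm]
    by (simp add: nn_integral_shift[OF measurable_pair_section(2)[OF hm]])
qed

text \<open>A rotation is a product of three shears with factors \<open>tan (\<theta> / 2)\<close>,
  \<open>- sin \<theta>\<close> and \<open>tan (\<theta> / 2)\<close>. This avoids determinants and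
  explains the condition on \<open>cos (\<theta> / 2)\<close>.\<close>

lemma nn_integral_rotation:
  fixes h :: "'a::euclidean_space \<times> 'a \<Rightarrow> ennreal"
  assumes hm: "h \<in> borel_measurable borel" and c: "cos (\<theta> / 2) \<noteq> 0"
  shows "(\<integral>\<^sup>+z. h (rotation \<theta> z) \<partial>lborel) = (\<integral>\<^sup>+z. h z \<partial>lborel)"
proof -
  let ?t = "tan (\<theta> / 2)"
  define A where "A z = (fst z + ?t *\<^sub>R snd z, snd z)" for z :: "'a \<times> 'a"
  define B where "B z = (fst z, snd z + (- sin \<theta>) *\<^sub>R fst z)" for z :: "'a \<times> 'a"
  have AB: "A \<in> borel_measurable borel" "B \<in> borel_measurable borel"
    unfolding A_def[abs_def] B_def[abs_def] by (intro borel_measurable_continuous_onI continuous_intros)+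
  have s: "sin \<theta> = 2 * sin (\<theta> / 2) * cos (\<theta> / 2)" "cos \<theta> = 2 * (cos (\<theta> / 2))\<^sup>2 - 1"
    using sin_double[of "\<theta> / 2"] cos_double_cos[of "\<theta> / 2"] by simp_all
  have t1: "sin \<theta> * ?t = 1 - cos \<theta>"
  proof -
    have "sin \<theta> * ?t = 2 * (sin (\<theta> / 2))\<^sup>2" using c unfolding s tan_def by (simp add: power2_eq_square)
    then show ?thesis unfolding s(2) by (simp add: sin_squared_eq)
  qed
  have t2: "?t + ?t * cos \<theta> = sin \<theta>"
    using c unfolding s tan_def by (simp add: field_simps power2_eq_square)
  have t1': "?t * sin \<theta> = 1 - cos \<theta>" using t1 by (simp add: mult.commute)
  have "A (B (A z)) = rotation \<theta> z" for z
  proof -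
    obtain x y where z: "z = (x, y)" by (cases z)
    have 2: "y - sin \<theta> *\<^sub>R (x + ?t *\<^sub>R y) = - sin \<theta> *\<^sub>R x + cos \<theta> *\<^sub>R y"
    proof -
      have "y - sin \<theta> *\<^sub>R (x + ?t *\<^sub>R y) = - sin \<theta> *\<^sub>R x + (1 - sin \<theta> * ?t) *\<^sub>R y" by (simp add: algebra_simps)
      then show ?thesis by (simp add: t1)
    qed
    have "x + ?t *\<^sub>R y + ?t *\<^sub>R (- sin \<theta> *\<^sub>R x + cos \<theta> *\<^sub>R y) = (1 - ?t * sin \<theta>) *\<^sub>R x + (?t + ?t * cos \<theta>) *\<^sub>R y"
      by (simp add: algebra_simps)
    also have "\<dots> = cos \<theta> *\<^sub>R x + sin \<theta> *\<^sub>R y" unfolding t1' t2 by simp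
    finally show ?thesis using 2 by (simp add: A_def B_def rotation_def z)
  qed
  then have "(\<integral>\<^sup>+z. h (rotation \<theta> z) \<partial>lborel) = (\<integral>\<^sup>+z. h (A (B (A z))) \<partial>lborel)" by simp
  also have "\<dots> = (\<integral>\<^sup>+z. h (A (B z)) \<partial>lborel)"
    using measurable_compose[OF AB(2) measurable_compose[OF AB(1) hm]]
    by (rule nn_integral_shear(1)[of "\<lambda>z. h (A (B z))" ?t, folded A_def])
  also have "\<dots> = (\<integral>\<^sup>+z. h (A z) \<partial>lborel)"
    unfolding B_def using measurable_compose[OF AB(1) hm] by (rule nn_integral_shear(2)[of "\<lambda>z. h (A z)"])
  also have "\<dots> = (\<integral>\<^sup>+z. h z \<partial>lborel)"
    unfolding A_def by (rule nn_integral_shear(1)[OF hm])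
  finally show ?thesis .
qed

lemma distr_unif_ball_rotation:
  assumes c: "cos (\<theta> / 2) \<noteq> 0"
  shows "distr unif_ball borel (rotation \<theta>) = (unif_ball :: ('a::euclidean_space \<times> 'a) measure)"
proof (rule measure_eqI)
  fix S :: "('a \<times> 'a) set" assume "S \<in> sets (distr unif_ball borel (rotation \<theta>))"
  then have S[measurable]: "S \<in> sets borel" by simp
  let ?A = "cball (0 :: 'a \<times> 'a) 1"
  have [measurable]: "?A \<in> sets borel" by simp
  have pre: "rotation \<theta> -` S \<in> sets borel" by (rule measurable_sets_borel[OF rotation_measurable S])
  have "?A \<inter> rotation \<theta> -` S = rotation \<theta> -` (?A \<inter> S)"
    by (intro set_eqI) (simp add: norm_rotation)
  moreover have "emeasure lborel (rotation \<theta> -` (?A \<inter> S)) = (\<integral>\<^sup>+z. indicator (?A \<inter> S) (rotation \<theta> z) \<partial>lborel)"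
  proof -
    have "rotation \<theta> -` (?A \<inter> S) \<in> sets borel" by (rule measurable_sets_borel[OF rotation_measurable]) measurable
    then have "emeasure lborel (rotation \<theta> -` (?A \<inter> S)) = (\<integral>\<^sup>+z. indicator (rotation \<theta> -` (?A \<inter> S)) z \<partial>lborel)" by simp
    then show ?thesis by (simp add: indicator_def)
  qed
  moreover have "\<dots> = emeasure lborel (?A \<inter> S)"
    by (subst nn_integral_rotation[OF _ c]) auto
  ultimately have "emeasure lborel (?A \<inter> rotation \<theta> -` S) = emeasure lborel (?A \<inter> S)" by simp
  then show "emeasure (distr unif_ball borel (rotation \<theta>)) S = emeasure unif_ball S"
    unfolding unif_ball_def using pre S
    by (subst emeasure_distr) (auto simp: measurable_cong_sets[OF sets_uniform_measure refl])
qed simp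

lemma integral_unif_ball_rotation:
  fixes h :: "'a::euclidean_space \<times> 'a \<Rightarrow> real"
  assumes "h \<in> borel_measurable borel" "cos (\<theta> / 2) \<noteq> 0"
  shows "(\<integral>z. h (rotation \<theta> z) \<partial>unif_ball) = (\<integral>z. h z \<partial>unif_ball)"
proof -
  have "(\<integral>z. h z \<partial>unif_ball) = (\<integral>z. h z \<partial>distr unif_ball borel (rotation \<theta>))"
    by (simp only: distr_unif_ball_rotation[OF assms(2)])
  also have "\<dots> = (\<integral>z. h (rotation \<theta> z) \<partial>unif_ball)"
    using assms(1) by (intro integral_distr) (simp_all add: measurable_unif_ball)
  finally show ?thesis by simp
qed

lemma nn_integral_unif_ball:
  fixes h :: "'a::euclidean_space \<Rightarrow> ennreal"
  assumes [measurable]: "h \<in> borel_measurable borel"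
  shows "(\<integral>\<^sup>+z. h z \<partial>unif_ball) = (\<integral>\<^sup>+z. h z * indicator (cball 0 1) z \<partial>lborel) / emeasure lborel (cball (0::'a) 1)"
  unfolding unif_ball_def using emeasure_cball_pos[of 1 "0::'a"] emeasure_lborel_cball_finite[of "0::'a" 1]
  by (subst nn_integral_uniform_measure) auto

text \<open>For a fixed first component the ball restricts only the norm of the second, whose
  direction is therefore uniform and independent of its norm. The factor
  \<open>(norm (snd z))\<^sup>2\<close> is what expressions quadratic in \<open>snd z\<close> leave
  behind.\<close>

lemma nn_integral_unif_ball_polar:
  fixes h :: "'a::euclidean_space \<times> 'a \<Rightarrow> ennreal"
  assumes hm[measurable]: "h \<in> borel_measurable borel"
  shows "(\<integral>\<^sup>+z. ennreal ((norm (snd z))\<^sup>2) * h (fst z, sgn (snd z)) \<partial>unif_ball) =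
    (\<integral>\<^sup>+z. ennreal ((norm (snd z))\<^sup>2) * (\<integral>\<^sup>+w. h (fst z, w) \<partial>unif_sphere) \<partial>(unif_ball :: ('a \<times> 'a) measure))"
proof -
  interpret S: prob_space "unif_sphere :: 'a measure" by (rule prob_space_unif_sphere)
  have h2[measurable]: "h \<in> borel_measurable (borel \<Otimes>\<^sub>M borel)" using hm by (simp add: borel_prod)
  have h3[measurable]: "h \<in> borel_measurable (borel \<Otimes>\<^sub>M unif_sphere)"
    using h2 by (simp cong: measurable_cong_sets sets_pair_measure_cong)
  have int[measurable]: "(\<lambda>x. \<integral>\<^sup>+w. h (x, w) \<partial>unif_sphere) \<in> borel_measurable borel"
    by (intro S.borel_measurable_nn_integral) (use h3 in \<open>simp add: case_prod_beta\<close>)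
  have [measurable]: "cball (0 :: 'a \<times> 'a) 1 \<in> sets borel" by simp
  have fm[measurable]: "(fst :: 'a \<times> 'a \<Rightarrow> 'a) \<in> borel_measurable borel" "(snd :: 'a \<times> 'a \<Rightarrow> 'a) \<in> borel_measurable borel"
    by (intro borel_measurable_continuous_onI continuous_intros)+
  have m1[measurable]: "(\<lambda>z. h (fst z, sgn (snd z))) \<in> borel_measurable borel"
  proof -
    have "(\<lambda>z::'a\<times>'a. (fst z, sgn (snd z))) \<in> borel \<rightarrow>\<^sub>M borel \<Otimes>\<^sub>M borel" by measurable
    from measurable_compose[OF this h2] show ?thesis by simp
  qed
  have m2: "(\<lambda>z::'a\<times>'a. ennreal ((norm (snd z))\<^sup>2) * (\<integral>\<^sup>+w. h (fst z, w) \<partial>unif_sphere) * indicator (cball (0::'a\<times>'a) 1) z) \<in> borel_measurable borel"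
  proof -
    note [measurable] = measurable_compose[OF fm(1) int]
    show ?thesis by measurable
  qed
  have inner: "(\<integral>\<^sup>+y. ennreal ((norm y)\<^sup>2) * h (x, sgn y) * indicator (cball 0 1) (x, y::'a) \<partial>lborel) =
     (\<integral>\<^sup>+y. ennreal ((norm y)\<^sup>2) * (\<integral>\<^sup>+w. h (x, w) \<partial>unif_sphere) * indicator (cball 0 1) (x, y::'a) \<partial>lborel)" for x :: 'a
  proof -
    define k where "k r = ennreal (r\<^sup>2) * indicator {r. (norm x)\<^sup>2 + r\<^sup>2 \<le> 1} r" for r :: real
    have [measurable]: "k \<in> borel_measurable borel" unfolding k_def by measurable
    have [measurable]: "(\<lambda>w. h (x, w)) \<in> borel_measurable borel" by (rule measurable_pair_section[OF hm])
    have k: "k (norm y) = ennreal ((norm y)\<^sup>2) * indicator (cball 0 1) (x, y)" for y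
      by (simp add: k_def indicator_def norm_Pair real_sqrt_le_1_iff)
    have "(\<integral>\<^sup>+y. ennreal ((norm y)\<^sup>2) * h (x, sgn y) * indicator (cball 0 1) (x, y::'a) \<partial>lborel) =
        (\<integral>\<^sup>+y. (\<lambda>(r, w). k r * h (x, w)) (norm y, sgn y) \<partial>lborel)"
      by (simp add: k mult_ac)
    also have "\<dots> = (\<integral>\<^sup>+w. (\<integral>\<^sup>+y. (\<lambda>(r, w). k r * h (x, w)) (norm (y::'a), w) \<partial>lborel) \<partial>unif_sphere)"
      by (rule nn_integral_polar) measurable
    also have "\<dots> = (\<integral>\<^sup>+w. (\<integral>\<^sup>+y. k (norm (y::'a)) \<partial>lborel) * h (x, w) \<partial>unif_sphere)"
      by (simp add: nn_integral_multc)
    also have "\<dots> = (\<integral>\<^sup>+y. k (norm (y::'a)) \<partial>lborel) * (\<integral>\<^sup>+w. h (x, w) \<partial>unif_sphere)"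
      by (rule nn_integral_cmult) (simp add: measurable_cong_sets[OF sets_unif_sphere refl])
    also have "\<dots> = (\<integral>\<^sup>+y. k (norm (y::'a)) * (\<integral>\<^sup>+w. h (x, w) \<partial>unif_sphere) \<partial>lborel)"
      by (rule nn_integral_multc[symmetric]) measurable
    also have "\<dots> = (\<integral>\<^sup>+y. ennreal ((norm y)\<^sup>2) * (\<integral>\<^sup>+w. h (x, w) \<partial>unif_sphere) * indicator (cball 0 1) (x, y::'a) \<partial>lborel)"
      by (simp add: k mult_ac)
    finally show ?thesis .
  qed
  have "(\<integral>\<^sup>+z. ennreal ((norm (snd z))\<^sup>2) * h (fst z, sgn (snd z)) * indicator (cball 0 1) z \<partial>lborel) =
    (\<integral>\<^sup>+x. (\<integral>\<^sup>+y. ennreal ((norm y)\<^sup>2) * h (x, sgn y) * indicator (cball 0 1) (x, y::'a) \<partial>lborel) \<partial>lborel)"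
    by (subst nn_integral_lborel_pair(2)) simp_all
  also have "\<dots> = (\<integral>\<^sup>+x. (\<integral>\<^sup>+y. ennreal ((norm y)\<^sup>2) * (\<integral>\<^sup>+w. h (x, w) \<partial>unif_sphere) * indicator (cball 0 1) (x, y::'a) \<partial>lborel) \<partial>lborel)"
    by (simp only: inner)
  also have "\<dots> = (\<integral>\<^sup>+z. ennreal ((norm (snd z))\<^sup>2) * (\<integral>\<^sup>+w. h (fst z, w) \<partial>unif_sphere) * indicator (cball (0::'a\<times>'a) 1) z \<partial>lborel)"
    using nn_integral_lborel_pair(2)[OF m2] by simp
  finally show ?thesis by (simp add: nn_integral_unif_ball)
qed

text \<open>The point of the ball of radius \<open>norm z\<close> nearest to \<open>y\<close> is
  \<open>norm z *\<^sub>R sgn y\<close>, and nearest-point projection onto a ball does not increase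
  distances. The algebra compares the squares through the cosine \<open>c\<close>.\<close>

lemma scaled_sgn_diff_le:
  fixes y z :: "'a::real_inner"
  assumes "norm z \<le> norm y"
  shows "norm z * norm (sgn y - sgn z) \<le> norm (y - z)"
proof (cases "z = 0")
  case False
  then have nz: "y \<noteq> 0" using assms by auto
  define a b c where "a = norm y" and "b = norm z" and "c = sgn y \<bullet> sgn z"
  have ab: "0 < b" "b \<le> a" using False assms by (auto simp: a_def b_def)
  have c: "c \<le> 1" unfolding c_def using Cauchy_Schwarz_ineq2[of "sgn y" "sgn z"] False nz by (simp add: norm_sgn)
  have yz: "y = a *\<^sub>R sgn y" "z = b *\<^sub>R sgn z" using False nz by (simp_all add: a_def b_def sgn_div_norm)
  have one: "sgn y \<bullet> sgn y = 1" "sgn z \<bullet> sgn z = 1" using False nz by (simp_all add: norm_sgn norm_eq_1[symmetric])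
  have "(norm z * norm (sgn y - sgn z))\<^sup>2 = b\<^sup>2 * (2 - 2 * c)"
    unfolding power_mult_distrib power2_norm_eq_inner[of "sgn y - sgn z"] b_def[symmetric]
    by (simp add: inner_diff_left inner_diff_right one c_def inner_commute)
  also have "\<dots> \<le> a\<^sup>2 - 2 * a * b * c + b\<^sup>2"
  proof -
    have "0 \<le> (a - b) * ((a - b) + 2 * b * (1 - c))" using ab c by (intro mult_nonneg_nonneg add_nonneg_nonneg) auto
    then show ?thesis by (simp add: power2_eq_square algebra_simps)
  qed
  also have "\<dots> = (norm (y - z))\<^sup>2"
  proof -
    have "(norm (a *\<^sub>R sgn y - b *\<^sub>R sgn z))\<^sup>2 = a\<^sup>2 - 2 * a * b * c + b\<^sup>2"
      unfolding power2_norm_eq_inner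
      by (simp add: inner_diff_left inner_diff_right one c_def inner_commute power2_eq_square algebra_simps)
    then show ?thesis using yz by simp
  qed
  finally show ?thesis by (rule power2_le_imp_le) simp
qed simp

text \<open>This extension from the sphere is homogeneous of degree one. Radial motion changes it at
  rate at most \<open>k\<close> by the bound on \<open>q\<close>, motion along the sphere at rate at
  most \<open>k\<close> by the Lipschitz constant; hence \<open>2 * k\<close>.\<close>

lemma lipschitz_homogeneous_extension:
  fixes q :: "'a::real_inner \<Rightarrow> real"
  assumes lip: "k-lipschitz_on UNIV q" and bnd: "\<And>w. norm w \<le> 1 \<Longrightarrow> \<bar>q w\<bar> \<le> k"
  shows "(2 * k)-lipschitz_on UNIV (\<lambda>x. norm x * q (sgn x))"
proof (rule lipschitz_onI)
  show k: "0 \<le> 2 * k" using lipschitz_on_nonneg[OF lip] by simp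
  have main: "\<bar>norm y * q (sgn y) - norm z * q (sgn z)\<bar> \<le> 2 * k * norm (y - z)" if le: "norm z \<le> norm y" for y z :: 'a
  proof -
    have "norm (sgn y) \<le> 1" by (simp add: norm_sgn)
    then have b: "\<bar>q (sgn y)\<bar> \<le> k" by (rule bnd)
    have "\<bar>norm y * q (sgn y) - norm z * q (sgn z)\<bar> = \<bar>(norm y - norm z) * q (sgn y) + norm z * (q (sgn y) - q (sgn z))\<bar>"
      by (simp add: algebra_simps)
    also have "\<dots> \<le> (norm y - norm z) * \<bar>q (sgn y)\<bar> + norm z * \<bar>q (sgn y) - q (sgn z)\<bar>"
      using le by (intro order_trans[OF abs_triangle_ineq]) (simp add: abs_mult)
    also have "\<dots> \<le> norm (y - z) * k + norm z * (k * norm (sgn y - sgn z))"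
      using b lipschitz_onD[OF lip, of "sgn y" "sgn z"] le k
      by (intro add_mono mult_mono norm_triangle_ineq2) (auto simp: dist_norm)
    also have "norm z * (k * norm (sgn y - sgn z)) = k * (norm z * norm (sgn y - sgn z))" by simp
    also have "\<dots> \<le> k * norm (y - z)" using scaled_sgn_diff_le[OF le] k by (intro mult_left_mono) auto
    finally show ?thesis by (simp add: algebra_simps)
  qed
  fix y z :: 'a
  show "dist (norm y * q (sgn y)) (norm z * q (sgn z)) \<le> 2 * k * dist y z"
    using main[of z y] main[of y z] by (cases "norm z \<le> norm y") (auto simp: dist_norm norm_minus_commute abs_minus_commute)
qed

lemma AE_unif_ball_fst:
  assumes "AE x in lborel. P (x :: 'a::euclidean_space)"
  shows "AE z in (unif_ball :: ('a \<times> 'a) measure). P (fst z)"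
proof -
  obtain N where N: "{x. \<not> P x} \<subseteq> N" "N \<in> null_sets lborel"
    using assms unfolding eventually_ae_filter by auto
  have "emeasure (lborel \<Otimes>\<^sub>M lborel) (N \<times> (UNIV :: 'a set)) = emeasure lborel N * emeasure lborel (UNIV :: 'a set)"
    using N by (intro lborel.emeasure_pair_measure_Times) auto
  then have "N \<times> (UNIV :: 'a set) \<in> null_sets (lborel \<Otimes>\<^sub>M lborel)"
    using N by (auto simp: null_sets_def)
  then have "N \<times> (UNIV :: 'a set) \<in> null_sets lborel" unfolding lborel_prod .
  then have "AE z in lborel. z \<notin> N \<times> (UNIV :: 'a set)" by (rule AE_not_in)
  then have "AE z :: 'a \<times> 'a in lborel. P (fst z)" by eventually_elim (use N(1) in auto)
  from AE_unif_ball_affine[OF this, of 1 0] show ?thesis by simp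
qed

lemma integrable_unif_ball_bounded:
  fixes f :: "'a::euclidean_space \<Rightarrow> real"
  assumes "f \<in> borel_measurable borel" "\<And>u. norm u \<le> 1 \<Longrightarrow> \<bar>f u\<bar> \<le> C"
  shows "integrable unif_ball f"
proof -
  interpret U: prob_space "unif_ball :: 'a measure" by (rule prob_space_unif_ball)
  show ?thesis
  proof (rule U.integrable_const_bound[where B=C])
    show "AE u in unif_ball. norm (f u) \<le> C" using AE_unif_ball_norm by eventually_elim (simp add: assms(2))
  qed (simp add: measurable_unif_ball assms(1))
qed

text \<open>The path \<open>\<theta> \<mapsto> cos \<theta> x + sin \<theta> y\<close> leads from \<open>x\<close> to \<open>- x\<close>, and the pair of its position and
  velocity is uniform on the ball of the product space at every time. Cutting it into \<open>N\<close> equal steps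
  and letting \<open>N \<rightarrow> \<infinity>\<close> turns the increments of \<open>H\<close> into derivatives.\<close>

lemma odd_lipschitz_path_inequality:
  fixes H :: "'a::euclidean_space \<Rightarrow> real"
  assumes lip: "k-lipschitz_on UNIV H" and odd: "\<And>x. H (- x) = - H x"
  shows "4 * (\<integral>z. (H (fst z))\<^sup>2 \<partial>(unif_ball :: ('a \<times> 'a) measure)) \<le> pi\<^sup>2 * (\<integral>z. (grad H (fst z) \<bullet> snd z)\<^sup>2 \<partial>unif_ball)"
proof -
  interpret U: prob_space "unif_ball :: ('a \<times> 'a) measure" by (rule prob_space_unif_ball)
  have cont: "continuous_on UNIV H" by (rule lipschitz_on_continuous_on[OF lip])
  have k: "0 \<le> k" by (rule lipschitz_on_nonneg[OF lip])
  note [measurable] = borel_measurable_continuous_onI[OF cont] grad_measurable[OF cont]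
  have fm[measurable]: "(fst :: 'a \<times> 'a \<Rightarrow> 'a) \<in> borel_measurable borel" "(snd :: 'a \<times> 'a \<Rightarrow> 'a) \<in> borel_measurable borel"
    by (intro borel_measurable_continuous_onI continuous_intros)+
  define D where "D \<alpha> z = H (fst z) - H (fst (rotation \<alpha> z))" for \<alpha> and z :: "'a \<times> 'a"
  have Dm[measurable]: "D \<alpha> \<in> borel_measurable borel" for \<alpha> unfolding D_def[abs_def] by measurable
  have le1: "norm (fst z) \<le> 1" "norm (snd z) \<le> 1" if "norm z \<le> 1" for z :: "'a \<times> 'a"
    using that norm_fst_le[of "fst z" "snd z"] norm_snd_le[of "snd z" "fst z"] by (auto intro: order_trans)
  \<comment> \<open>Linear in the angle: this bounds \<open>N * D (pi / N)\<close> independently of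
    \<open>N\<close> and supplies the domination for the limit.\<close>
  have Db: "\<bar>D \<alpha> z\<bar> \<le> 2 * k * \<bar>\<alpha>\<bar>" if z: "norm z \<le> 1" for \<alpha> z
  proof -
    have c: "\<bar>1 - cos \<alpha>\<bar> \<le> \<bar>\<alpha>\<bar>"
    proof -
      have "1 - cos \<alpha> = 2 * sin (\<alpha> / 2) * sin (\<alpha> / 2)" using cos_double_sin[of "\<alpha> / 2"] by (simp add: power2_eq_square)
      then have "\<bar>1 - cos \<alpha>\<bar> = 2 * \<bar>sin (\<alpha> / 2)\<bar> * \<bar>sin (\<alpha> / 2)\<bar>" by (simp add: abs_mult)
      also have "\<dots> \<le> 2 * \<bar>\<alpha> / 2\<bar> * 1" by (intro mult_mono abs_sin_x_le_abs_x abs_sin_le_one) auto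
      finally show ?thesis by simp
    qed
    have "fst z - fst (rotation \<alpha> z) = (1 - cos \<alpha>) *\<^sub>R fst z - sin \<alpha> *\<^sub>R snd z"
      by (simp add: rotation_def algebra_simps)
    then have "norm (fst z - fst (rotation \<alpha> z)) \<le> \<bar>1 - cos \<alpha>\<bar> * norm (fst z) + \<bar>sin \<alpha>\<bar> * norm (snd z)"
      using norm_triangle_ineq4[of "(1 - cos \<alpha>) *\<^sub>R fst z" "sin \<alpha> *\<^sub>R snd z"] by simp
    also have "\<dots> \<le> \<bar>\<alpha>\<bar> * 1 + \<bar>\<alpha>\<bar> * 1"
      using le1[OF z] c abs_sin_x_le_abs_x[of \<alpha>] by (intro add_mono mult_mono) auto
    finally have "k * norm (fst z - fst (rotation \<alpha> z)) \<le> k * (\<bar>\<alpha>\<bar> * 1 + \<bar>\<alpha>\<bar> * 1)"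
      using k by (rule mult_left_mono)
    then show ?thesis
      using lipschitz_onD[OF lip, of "fst z" "fst (rotation \<alpha> z)"] by (simp add: D_def dist_norm algebra_simps)
  qed
  have Hb: "\<bar>H x\<bar> \<le> k" if "norm x \<le> 1" for x
  proof -
    have "H 0 = 0" using odd[of 0] by simp
    then have "\<bar>H x\<bar> \<le> k * norm x" using lipschitz_onD[OF lip, of x 0] by (simp add: dist_norm)
    also have "\<dots> \<le> k * 1" using that k by (intro mult_left_mono) auto
    finally show ?thesis by simp
  qed
  have iH: "integrable unif_ball (\<lambda>z::'a\<times>'a. (H (fst z))\<^sup>2)"
  proof (rule integrable_unif_ball_bounded[where C="k\<^sup>2"])
    fix z :: "'a \<times> 'a" assume "norm z \<le> 1"
    then show "\<bar>(H (fst z))\<^sup>2\<bar> \<le> k\<^sup>2" using Hb[of "fst z"] le1[of z] k by (simp add: abs_le_square_iff[symmetric])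
  qed measurable
  have step: "4 * (\<integral>z. (H (fst z))\<^sup>2 \<partial>(unif_ball :: ('a \<times> 'a) measure)) \<le> (\<integral>z. (real (Suc n) * D (pi / Suc n) z)\<^sup>2 \<partial>unif_ball)" for n
  proof -
    define N where "N = Suc n"
    define \<alpha> where "\<alpha> = pi / real N"
    have rot: "(\<integral>z. (D \<alpha> (rotation (j * \<alpha>) z))\<^sup>2 \<partial>unif_ball) = (\<integral>z. (D \<alpha> z)\<^sup>2 \<partial>unif_ball)"
      "integrable unif_ball (\<lambda>z. (D \<alpha> (rotation (j * \<alpha>) z))\<^sup>2)" if "j < N" for j :: nat
    proof -
      \<comment> \<open>All angles in use stay below \<open>pi\<close>, so the half angle has a
        positive cosine and the rotation preserves the law.\<close>
      have "real j * \<alpha> < pi" using that unfolding \<alpha>_def by (simp add: field_simps)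
      moreover have "0 \<le> real j * \<alpha>" unfolding \<alpha>_def by simp
      ultimately have "cos (real j * \<alpha> / 2) > 0" by (intro cos_gt_zero_pi) auto
      then show "(\<integral>z. (D \<alpha> (rotation (j * \<alpha>) z))\<^sup>2 \<partial>unif_ball) = (\<integral>z. (D \<alpha> z)\<^sup>2 \<partial>unif_ball)"
        by (intro integral_unif_ball_rotation[of "\<lambda>z. (D \<alpha> z)\<^sup>2"]) auto
      show "integrable unif_ball (\<lambda>z. (D \<alpha> (rotation (j * \<alpha>) z))\<^sup>2)"
      proof (rule integrable_unif_ball_bounded[where C="(2 * k * \<bar>\<alpha>\<bar>)\<^sup>2"])
        fix z :: "'a \<times> 'a" assume "norm z \<le> 1"
        then show "\<bar>(D \<alpha> (rotation (j * \<alpha>) z))\<^sup>2\<bar> \<le> (2 * k * \<bar>\<alpha>\<bar>)\<^sup>2"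
          using Db[of "rotation (j * \<alpha>) z" \<alpha>] k by (simp add: norm_rotation abs_le_square_iff[symmetric] abs_mult)
      qed measurable
    qed
    \<comment> \<open>After the total angle \<open>pi\<close> the first component is
      \<open>- fst z\<close>; oddness turns the telescoped difference into
      \<open>2 * H (fst z)\<close>.\<close>
    have tele: "2 * H (fst z) = (\<Sum>j<N. D \<alpha> (rotation (j * \<alpha>) z))" for z
    proof -
      have "(\<Sum>j<N. D \<alpha> (rotation (j * \<alpha>) z)) = (\<Sum>j<N. H (fst (rotation (real j * \<alpha>) z)) - H (fst (rotation (real (Suc j) * \<alpha>) z)))"
        by (intro sum.cong) (auto simp: D_def rotation_add algebra_simps)
      also have "\<dots> = H (fst (rotation (real 0 * \<alpha>) z)) - H (fst (rotation (real N * \<alpha>) z))"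
        by (rule sum_lessThan_telescope')
      also have "real N * \<alpha> = pi" by (simp add: \<alpha>_def N_def)
      finally show ?thesis by (simp add: rotation_def odd)
    qed
    have "4 * (\<integral>z. (H (fst z))\<^sup>2 \<partial>(unif_ball :: ('a \<times> 'a) measure)) = (\<integral>z. (2 * H (fst z))\<^sup>2 \<partial>(unif_ball :: ('a \<times> 'a) measure))"
      by (simp add: power_mult_distrib)
    also have "\<dots> \<le> (\<integral>z. real N * (\<Sum>j<N. (D \<alpha> (rotation (j * \<alpha>) z))\<^sup>2) \<partial>unif_ball)"
    proof (rule integral_mono)
      \<comment> \<open>Cauchy-Schwarz for \<open>N\<close> summands; by rotation invariance all of
        them have the same mean square.\<close>
      show "(2 * H (fst z))\<^sup>2 \<le> real N * (\<Sum>j<N. (D \<alpha> (rotation (j * \<alpha>) z))\<^sup>2)" for z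
        unfolding tele using sum_squared_le_sum_of_squares[of "\<lambda>j. D \<alpha> (rotation (j * \<alpha>) z)" "{..<N}"] by (simp add: mult.commute)
    qed (use iH rot in \<open>auto simp: power_mult_distrib intro!: integrable_mult_right Bochner_Integration.integrable_sum\<close>)
    also have "\<dots> = real N * (\<Sum>j<N. \<integral>z. (D \<alpha> z)\<^sup>2 \<partial>unif_ball)"
      using rot by (subst integral_mult_right_zero, subst Bochner_Integration.integral_sum) auto
    also have "\<dots> = (\<integral>z. (real N * D \<alpha> z)\<^sup>2 \<partial>unif_ball)"
    proof -
      have "(real N * D \<alpha> z)\<^sup>2 = real N * (real N * (D \<alpha> z)\<^sup>2)" for z by (simp add: power2_eq_square)
      then show ?thesis by simp
    qed
    finally show ?thesis unfolding N_def \<alpha>_def .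
  qed
  have lim: "(\<lambda>n. \<integral>z. (real (Suc n) * D (pi / Suc n) z)\<^sup>2 \<partial>unif_ball) \<longlonglongrightarrow> (\<integral>z. (pi * - (grad H (fst z) \<bullet> snd z))\<^sup>2 \<partial>unif_ball)"
  proof (rule integral_dominated_convergence[where w="\<lambda>_. (2 * k * pi)\<^sup>2"])
    show "(\<lambda>z. (pi * - (grad H (fst z) \<bullet> snd z))\<^sup>2) \<in> borel_measurable unif_ball"
      unfolding measurable_unif_ball by measurable
    show "(\<lambda>z. (real (Suc n) * D (pi / Suc n) z)\<^sup>2) \<in> borel_measurable unif_ball" for n
      unfolding measurable_unif_ball by measurable
    show "AE z in unif_ball. norm ((real (Suc n) * D (pi / Suc n) z)\<^sup>2) \<le> (2 * k * pi)\<^sup>2" for n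
      using AE_unif_ball_norm
    proof eventually_elim
      case (elim z)
      have "\<bar>real (Suc n) * D (pi / Suc n) z\<bar> \<le> real (Suc n) * (2 * k * \<bar>pi / Suc n\<bar>)"
        unfolding abs_mult using Db[OF elim, of "pi / Suc n"] by (intro mult_mono) auto
      also have "\<dots> = 2 * k * pi" by simp
      finally show ?case using k by (simp add: abs_le_square_iff[symmetric] abs_mult)
    qed
    show "AE z in unif_ball. (\<lambda>n. (real (Suc n) * D (pi / Suc n) z)\<^sup>2) \<longlonglongrightarrow> (pi * - (grad H (fst z) \<bullet> snd z))\<^sup>2"
      using AE_unif_ball_fst[OF rademacher[OF lip]]
    proof eventually_elim
      case (elim z)
      have "((\<lambda>t. H (cos t *\<^sub>R fst z + sin t *\<^sub>R snd z)) has_derivative (\<lambda>t. (t *\<^sub>R snd z) \<bullet> grad H (fst z))) (at 0)"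
      proof (rule has_derivative_compose[of "\<lambda>t. cos t *\<^sub>R fst z + sin t *\<^sub>R snd z" "\<lambda>t. t *\<^sub>R snd z" 0 UNIV H "\<lambda>h. h \<bullet> grad H (fst z)"])
        show "((\<lambda>t. cos t *\<^sub>R fst z + sin t *\<^sub>R snd z) has_derivative (\<lambda>t. t *\<^sub>R snd z)) (at 0)"
          by (auto intro!: derivative_eq_intros)
        show "(H has_derivative (\<lambda>h. h \<bullet> grad H (fst z))) (at (cos 0 *\<^sub>R fst z + sin 0 *\<^sub>R snd z))"
          using elim by (simp add: gderiv_def)
      qed
      then have der: "((\<lambda>t. H (cos t *\<^sub>R fst z + sin t *\<^sub>R snd z)) has_real_derivative (grad H (fst z) \<bullet> snd z)) (at 0)"
        by (rule has_derivative_imp_has_field_derivative) (simp add: inner_commute)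
      define Q where "Q t = (H (cos t *\<^sub>R fst z + sin t *\<^sub>R snd z) - H (fst z)) / t" for t
      have Q: "(Q \<longlongrightarrow> grad H (fst z) \<bullet> snd z) (at 0)"
        using der unfolding has_field_derivative_iff Q_def[abs_def] by simp
      have "(\<lambda>n. pi / real (Suc n)) \<longlonglongrightarrow> 0"
        using tendsto_mult_left[OF LIMSEQ_inverse_real_of_nat, of pi] by (simp add: divide_inverse)
      then have "filterlim (\<lambda>n. pi / real (Suc n)) (at 0) sequentially"
        by (intro filterlim_atI) auto
      from filterlim_compose[OF Q this]
      have "(\<lambda>n. (pi * - Q (pi / Suc n))\<^sup>2) \<longlonglongrightarrow> (pi * - (grad H (fst z) \<bullet> snd z))\<^sup>2"
        by (intro tendsto_intros)
      moreover have "pi * - Q (pi / Suc n) = real (Suc n) * D (pi / Suc n) z" for n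
        unfolding D_def rotation_def Q_def by (simp add: field_simps)
      ultimately show ?case by (simp only:)
    qed
  qed simp
  have "4 * (\<integral>z. (H (fst z))\<^sup>2 \<partial>(unif_ball :: ('a \<times> 'a) measure)) \<le> (\<integral>z. (pi * - (grad H (fst z) \<bullet> snd z))\<^sup>2 \<partial>unif_ball)"
    by (rule LIMSEQ_le_const[OF lim]) (use step in auto)
  then show ?thesis by (simp add: power_mult_distrib)
qed

text \<open>The odd function \<open>q\<close> has Lipschitz constant and bound \<open>2 * K\<close>,
  so its extension \<open>H\<close> has constant \<open>4 * K\<close>. In the path inequality
  averaging over the direction of \<open>snd z\<close> replaces the squared inner product by
  \<open>(norm (grad H (fst z)))\<^sup>2 / DIM('a)\<close>, the source of the dimension factor; the
  mean squared radius \<open>I\<close> occurs on both sides and cancels.\<close>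

theorem sphere_variance_bound:
  fixes h :: "'a::euclidean_space \<Rightarrow> real"
  assumes lip: "K-lipschitz_on UNIV h"
  shows "DIM('a) * (\<integral>w. (h w - h (- w))\<^sup>2 \<partial>unif_sphere) \<le> 4 * pi\<^sup>2 * K\<^sup>2"
proof -
  interpret U: prob_space "unif_ball :: ('a \<times> 'a) measure" by (rule prob_space_unif_ball)
  interpret S: prob_space "unif_sphere :: 'a measure" by (rule prob_space_unif_sphere)
  have K: "0 \<le> K" by (rule lipschitz_on_nonneg[OF lip])
  define q where "q w = h w - h (- w)" for w
  define H where "H x = norm x * q (sgn x)" for x
  have qlip: "(2 * K)-lipschitz_on UNIV q"
  proof (rule lipschitz_onI)
    fix x y :: 'a
    have "dist (h x) (h y) \<le> K * dist x y" "dist (h (- x)) (h (- y)) \<le> K * dist (- x) (- y)"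
      by (rule lipschitz_onD[OF lip]; simp)+
    then show "dist (q x) (q y) \<le> 2 * K * dist x y" unfolding q_def dist_minus by (simp add: dist_real_def)
  qed (use K in simp)
  have qb: "\<bar>q w\<bar> \<le> 2 * K" if "norm w \<le> 1" for w
  proof -
    have "\<bar>q w\<bar> \<le> K * norm (w - - w)" using lipschitz_onD[OF lip, of w "- w"] by (simp add: q_def dist_norm)
    also have "norm (w - - w) = 2 * norm w" by (metis diff_minus_eq_add norm_scaleR abs_numeral scaleR_2)
    also have "K * (2 * norm w) \<le> K * (2 * 1)" using that K by (intro mult_left_mono) auto
    finally show ?thesis by simp
  qed
  have Hlip: "(2 * (2 * K))-lipschitz_on UNIV H"
    unfolding H_def by (rule lipschitz_homogeneous_extension[OF qlip qb])
  have Hodd: "H (- x) = - H x" for x by (simp add: H_def q_def sgn_minus algebra_simps)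
  have qcont: "continuous_on UNIV q" and Hcont: "continuous_on UNIV H"
    using qlip Hlip by (auto intro: lipschitz_on_continuous_on)
  note [measurable] = borel_measurable_continuous_onI[OF qcont] borel_measurable_continuous_onI[OF Hcont] grad_measurable[OF Hcont]
  have fm[measurable]: "(fst :: 'a \<times> 'a \<Rightarrow> 'a) \<in> borel_measurable borel" "(snd :: 'a \<times> 'a \<Rightarrow> 'a) \<in> borel_measurable borel"
    by (intro borel_measurable_continuous_onI continuous_intros)+
  have le1: "norm (fst z) \<le> 1" "norm (snd z) \<le> 1" if "norm z \<le> 1" for z :: "'a \<times> 'a"
    using that norm_fst_le[of "fst z" "snd z"] norm_snd_le[of "snd z" "fst z"] by (auto intro: order_trans)
  define I where "I = (\<integral>z. (norm (snd z))\<^sup>2 \<partial>(unif_ball :: ('a \<times> 'a) measure))"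
  have iI: "integrable unif_ball (\<lambda>z::'a\<times>'a. (norm (snd z))\<^sup>2)"
    by (rule integrable_unif_ball_bounded[where C=1]) (use le1 in \<open>auto simp: power_le_one\<close>)
  have I: "I > 0"
  proof -
    have "AE z in (unif_ball :: ('a \<times> 'a) measure). fst z \<noteq> 0"
      by (rule AE_unif_ball_fst[OF AE_lborel_singleton])
    then have nz: "\<not> (AE z in (unif_ball :: ('a \<times> 'a) measure). (norm (fst z))\<^sup>2 = 0)"
    proof (intro notI)
      assume 1: "AE z in (unif_ball :: ('a \<times> 'a) measure). fst z \<noteq> 0" and 2: "AE z in (unif_ball :: ('a \<times> 'a) measure). (norm (fst z))\<^sup>2 = 0"
      from 1 2 have "AE z in (unif_ball :: ('a \<times> 'a) measure). False" by eventually_elim auto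
      then show False by simp
    qed
    have "integrable unif_ball (\<lambda>z::'a\<times>'a. (norm (fst z))\<^sup>2)"
      by (rule integrable_unif_ball_bounded[where C=1]) (use le1 in \<open>auto simp: power_le_one\<close>)
    then have "(\<integral>z. (norm (fst z))\<^sup>2 \<partial>(unif_ball :: ('a \<times> 'a) measure)) \<noteq> 0"
      using nz by (subst integral_nonneg_eq_0_iff_AE) auto
    moreover have "0 \<le> (\<integral>z. (norm (fst z))\<^sup>2 \<partial>(unif_ball :: ('a \<times> 'a) measure))" by (rule integral_nonneg_AE) auto
    \<comment> \<open>A quarter turn exchanges the two components up to sign.\<close>
    moreover have "I = (\<integral>z. (norm (fst z))\<^sup>2 \<partial>(unif_ball :: ('a \<times> 'a) measure))"
      using integral_unif_ball_rotation[of "\<lambda>z::'a\<times>'a. (norm (snd z))\<^sup>2" "pi/2"]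
      by (simp add: I_def rotation_def cos_45)
    ultimately show ?thesis by linarith
  qed
  have polar: "(\<integral>\<^sup>+z. ennreal ((norm (snd z))\<^sup>2 * (q (sgn (snd z)))\<^sup>2) \<partial>(unif_ball :: ('a \<times> 'a) measure)) =
      ennreal (I * (\<integral>w. (q w)\<^sup>2 \<partial>unif_sphere))"
  proof -
    have "(\<integral>\<^sup>+z. ennreal ((norm (snd z))\<^sup>2 * (q (sgn (snd z)))\<^sup>2) \<partial>(unif_ball :: ('a \<times> 'a) measure)) =
      (\<integral>\<^sup>+z. ennreal ((norm (snd z))\<^sup>2) * (\<lambda>p. ennreal ((q (snd p))\<^sup>2)) (fst z, sgn (snd z)) \<partial>(unif_ball :: ('a \<times> 'a) measure))"
      by (simp add: ennreal_mult)
    also have "\<dots> = (\<integral>\<^sup>+z. ennreal ((norm (snd z))\<^sup>2) * (\<integral>\<^sup>+w. ennreal ((q w)\<^sup>2) \<partial>unif_sphere) \<partial>(unif_ball :: ('a \<times> 'a) measure))"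
      by (subst nn_integral_unif_ball_polar) simp_all
    also have "(\<integral>\<^sup>+w. ennreal ((q w)\<^sup>2) \<partial>unif_sphere) = ennreal (\<integral>w. (q w)\<^sup>2 \<partial>unif_sphere)"
    proof (rule nn_integral_eq_integral)
      show "integrable unif_sphere (\<lambda>w. (q w)\<^sup>2)"
      proof (rule integrable_unif_sphere_bounded[where C="(2 * K)\<^sup>2"])
        fix w :: 'a assume "norm w = 1"
        then have "\<bar>q w\<bar> \<le> \<bar>2 * K\<bar>" using qb[of w] by simp
        then show "norm ((q w)\<^sup>2) \<le> (2 * K)\<^sup>2" unfolding abs_le_square_iff by simp
      qed measurable
    qed simp
    also have "(\<integral>\<^sup>+z. ennreal ((norm (snd z))\<^sup>2) * ennreal (\<integral>w. (q w)\<^sup>2 \<partial>unif_sphere) \<partial>(unif_ball :: ('a \<times> 'a) measure)) =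
      (\<integral>\<^sup>+z. ennreal ((norm (snd z))\<^sup>2) \<partial>(unif_ball :: ('a \<times> 'a) measure)) * ennreal (\<integral>w. (q w)\<^sup>2 \<partial>unif_sphere)"
      by (rule nn_integral_multc) (simp add: measurable_unif_ball)
    also have "(\<integral>\<^sup>+z. ennreal ((norm (snd z))\<^sup>2) \<partial>(unif_ball :: ('a \<times> 'a) measure)) = ennreal I"
      unfolding I_def using iI by (intro nn_integral_eq_integral) auto
    finally show ?thesis using I by (simp add: ennreal_mult)
  qed
  have "(\<integral>z. (H (fst z))\<^sup>2 \<partial>(unif_ball :: ('a \<times> 'a) measure)) = (\<integral>z. (H (snd z))\<^sup>2 \<partial>(unif_ball :: ('a \<times> 'a) measure))"
    using integral_unif_ball_rotation[of "\<lambda>z::'a\<times>'a. (H (fst z))\<^sup>2" "pi/2"] by (simp add: rotation_def cos_45)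
  also have "\<dots> = I * (\<integral>w. (q w)\<^sup>2 \<partial>unif_sphere)"
  proof -
    have "(\<integral>z. (H (snd z))\<^sup>2 \<partial>(unif_ball :: ('a \<times> 'a) measure)) =
      enn2real (\<integral>\<^sup>+z. ennreal ((H (snd z))\<^sup>2) \<partial>(unif_ball :: ('a \<times> 'a) measure))"
      by (rule integral_eq_nn_integral) (auto simp: measurable_unif_ball)
    also have "\<dots> = enn2real (ennreal (I * (\<integral>w. (q w)\<^sup>2 \<partial>unif_sphere)))"
      using polar by (simp add: H_def power_mult_distrib)
    also have "\<dots> = I * (\<integral>w. (q w)\<^sup>2 \<partial>unif_sphere)"
      using I by (simp add: integral_nonneg_AE)
    finally show ?thesis .
  qed
  finally have HI: "(\<integral>z. (H (fst z))\<^sup>2 \<partial>(unif_ball :: ('a \<times> 'a) measure)) = I * (\<integral>w. (q w)\<^sup>2 \<partial>unif_sphere)" .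
  define J where "J = (\<integral>z. (grad H (fst z) \<bullet> snd z)\<^sup>2 \<partial>(unif_ball :: ('a \<times> 'a) measure))"
  have gle: "AE z in (unif_ball :: ('a \<times> 'a) measure). norm (grad H (fst z)) \<le> 4 * K"
    using AE_unif_ball_fst[OF rademacher[OF Hlip]] by eventually_elim (use GDERIV_norm_le[OF Hlip] in auto)
  have "ennreal J \<le> (\<integral>\<^sup>+z. ennreal ((grad H (fst z) \<bullet> snd z)\<^sup>2) \<partial>(unif_ball :: ('a \<times> 'a) measure))"
  proof -
    have "J = enn2real (\<integral>\<^sup>+z. ennreal ((grad H (fst z) \<bullet> snd z)\<^sup>2) \<partial>(unif_ball :: ('a \<times> 'a) measure))"
      unfolding J_def by (rule integral_eq_nn_integral) (auto simp: measurable_unif_ball)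
    moreover have "ennreal (enn2real e) \<le> e" for e by (cases e rule: ennreal_cases) auto
    ultimately show ?thesis by simp
  qed
  also have "\<dots> = (\<integral>\<^sup>+z. ennreal ((norm (snd z))\<^sup>2) * (\<lambda>p. ennreal ((grad H (fst p) \<bullet> snd p)\<^sup>2)) (fst z, sgn (snd z)) \<partial>(unif_ball :: ('a \<times> 'a) measure))"
  proof (rule nn_integral_cong)
    fix z :: "'a \<times> 'a"
    have "snd z = norm (snd z) *\<^sub>R sgn (snd z)" by (cases "snd z = 0") (simp_all add: sgn_div_norm)
    then have "grad H (fst z) \<bullet> snd z = norm (snd z) * (grad H (fst z) \<bullet> sgn (snd z))"
      by (metis inner_scaleR_right)
    then show "ennreal ((grad H (fst z) \<bullet> snd z)\<^sup>2) = ennreal ((norm (snd z))\<^sup>2) * (\<lambda>p. ennreal ((grad H (fst p) \<bullet> snd p)\<^sup>2)) (fst z, sgn (snd z))"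
      by (simp add: power_mult_distrib ennreal_mult)
  qed
  also have "\<dots> = (\<integral>\<^sup>+z. ennreal ((norm (snd z))\<^sup>2) * (\<integral>\<^sup>+w. ennreal ((grad H (fst z) \<bullet> w)\<^sup>2) \<partial>unif_sphere) \<partial>(unif_ball :: ('a \<times> 'a) measure))"
    by (subst nn_integral_unif_ball_polar) simp_all
  also have "\<dots> \<le> (\<integral>\<^sup>+z. ennreal ((norm (snd z))\<^sup>2) * ennreal ((4 * K)\<^sup>2 / DIM('a)) \<partial>(unif_ball :: ('a \<times> 'a) measure))"
  proof (rule nn_integral_mono_AE)
    show "AE z in (unif_ball :: ('a \<times> 'a) measure). ennreal ((norm (snd z))\<^sup>2) * (\<integral>\<^sup>+w. ennreal ((grad H (fst z) \<bullet> w)\<^sup>2) \<partial>unif_sphere)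
      \<le> ennreal ((norm (snd z))\<^sup>2) * ennreal ((4 * K)\<^sup>2 / DIM('a))"
      using gle
    proof eventually_elim
      case (elim z)
      have "(\<integral>\<^sup>+w. ennreal ((grad H (fst z) \<bullet> w)\<^sup>2) \<partial>unif_sphere) = ennreal (\<integral>w. (grad H (fst z) \<bullet> w)\<^sup>2 \<partial>unif_sphere)"
      proof (rule nn_integral_eq_integral)
        show "integrable unif_sphere (\<lambda>w. (grad H (fst z) \<bullet> w)\<^sup>2)"
        proof (rule integrable_unif_sphere_bounded[where C="(norm (grad H (fst z)))\<^sup>2"])
          fix w :: 'a assume "norm w = 1"
          then show "norm ((grad H (fst z) \<bullet> w)\<^sup>2) \<le> (norm (grad H (fst z)))\<^sup>2"
            using Cauchy_Schwarz_ineq2[of "grad H (fst z)" w] by (simp add: abs_le_square_iff[symmetric])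
        qed measurable
      qed simp
      also have "(\<integral>w. (grad H (fst z) \<bullet> w)\<^sup>2 \<partial>unif_sphere) = (norm (grad H (fst z)))\<^sup>2 / DIM('a)"
        using integral_unif_sphere_inner_squared[of "grad H (fst z)"] by (simp add: field_simps)
      also have "ennreal \<dots> \<le> ennreal ((4 * K)\<^sup>2 / DIM('a))"
        using elim by (intro ennreal_leI divide_right_mono power_mono) auto
      finally show ?case by (intro mult_left_mono) auto
    qed
  qed
  also have "\<dots> = (\<integral>\<^sup>+z. ennreal ((norm (snd z))\<^sup>2) \<partial>(unif_ball :: ('a \<times> 'a) measure)) * ennreal ((4 * K)\<^sup>2 / DIM('a))"
    by (rule nn_integral_multc) (simp add: measurable_unif_ball)
  also have "(\<integral>\<^sup>+z. ennreal ((norm (snd z))\<^sup>2) \<partial>(unif_ball :: ('a \<times> 'a) measure)) = ennreal I"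
    unfolding I_def using iI by (intro nn_integral_eq_integral) auto
  finally have "ennreal J \<le> ennreal I * ennreal ((4 * K)\<^sup>2 / DIM('a))" .
  also have "\<dots> = ennreal (I * ((4 * K)\<^sup>2 / DIM('a)))" using I by (intro ennreal_mult[symmetric]) auto
  finally have "ennreal J \<le> ennreal (I * ((4 * K)\<^sup>2 / DIM('a)))" .
  moreover have "0 \<le> I * ((4 * K)\<^sup>2 / DIM('a))" using I by simp
  ultimately have J: "J \<le> I * ((4 * K)\<^sup>2 / DIM('a))" by (simp only: ennreal_le_iff)
  have "4 * (I * (\<integral>w. (q w)\<^sup>2 \<partial>unif_sphere)) \<le> pi\<^sup>2 * J"
    using odd_lipschitz_path_inequality[OF Hlip Hodd] unfolding HI J_def .
  also have "\<dots> \<le> pi\<^sup>2 * (I * ((4 * K)\<^sup>2 / DIM('a)))" using J by (intro mult_left_mono) auto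
  finally have "I * (4 * (\<integral>w. (q w)\<^sup>2 \<partial>unif_sphere)) \<le> I * (pi\<^sup>2 * ((4 * K)\<^sup>2 / DIM('a)))" by (simp add: mult_ac)
  then have "4 * (\<integral>w. (q w)\<^sup>2 \<partial>unif_sphere) \<le> pi\<^sup>2 * ((4 * K)\<^sup>2 / DIM('a))"
    by (rule mult_le_cancel_left_pos[OF I, THEN iffD1])
  then show ?thesis unfolding q_def by (simp add: field_simps power_mult_distrib)
qed

section \<open>Moments of the gradient estimator\<close>

text \<open>The oracle is measurable in \<open>\<xi>\<close> for fixed points, yet it is evaluated
  at random iterates. Simple approximations of the point reduce this to finitely many fixed points,
  and continuity permits the limit.\<close>

lemma caratheodory_measurable:
  fixes F :: "'a::euclidean_space \<Rightarrow> 'b \<Rightarrow> real"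
  assumes F: "\<And>x. F x \<in> borel_measurable M" and cont: "\<And>\<xi>. \<xi> \<in> space M \<Longrightarrow> continuous_on UNIV (\<lambda>x. F x \<xi>)"
  shows "(\<lambda>p. F (fst p) (snd p)) \<in> borel_measurable (borel \<Otimes>\<^sub>M M)"
proof -
  have "(\<lambda>x::'a. x) \<in> borel_measurable borel" by simp
  from borel_measurable_implies_sequence_metric[OF this, of 0] obtain s :: "nat \<Rightarrow> 'a \<Rightarrow> 'a"
    where s: "\<And>i. simple_function borel (s i)" "\<And>x. (\<lambda>i. s i x) \<longlonglongrightarrow> x" by auto
  show ?thesis
  proof (rule borel_measurable_LIMSEQ_metric)
    fix i
    have "finite (range (s i))" using s(1)[of i] by (simp add: simple_function_def)
    show "(\<lambda>p. F (s i (fst p)) (snd p)) \<in> borel_measurable (borel \<Otimes>\<^sub>M M)"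
    proof (rule measurable_compose_countable'[where I="range (s i)" and f="\<lambda>x p. F x (snd p)" and g="\<lambda>p. s i (fst p)"])
      show "(\<lambda>p. F x (snd p)) \<in> borel_measurable (borel \<Otimes>\<^sub>M M)" for x
        by (rule measurable_compose[OF measurable_snd F])
      have "s i \<in> borel \<rightarrow>\<^sub>M count_space (range (s i))"
      proof (rule measurable_count_space_eq2[OF \<open>finite _\<close>, THEN iffD2], intro conjI ballI)
        show "s i -` {a} \<inter> space borel \<in> sets borel" for a
          using simple_functionD(2)[OF s(1)[of i], of "{a}"] by simp
      qed simp
      from measurable_compose[OF measurable_fst this]
      show "(\<lambda>p. s i (fst p)) \<in> borel \<Otimes>\<^sub>M M \<rightarrow>\<^sub>M count_space (range (s i))" .
      show "countable (range (s i))" using \<open>finite _\<close> by (rule countable_finite)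
    qed
  next
    fix p :: "'a \<times> 'b" assume "p \<in> space (borel \<Otimes>\<^sub>M M)"
    then have "isCont (\<lambda>x. F x (snd p)) (fst p)"
      using cont by (auto simp: space_pair_measure continuous_on_eq_continuous_at)
    then show "(\<lambda>i. F (s i (fst p)) (snd p)) \<longlonglongrightarrow> F (fst p) (snd p)"
      using s(2) by (rule isCont_tendsto_compose)
  qed
qed

lemma distr_unif_sphere_uminus:
  "distr unif_sphere borel uminus = (unif_sphere :: 'a::euclidean_space measure)"
proof (rule measure_eqI)
  fix B :: "'a set" assume "B \<in> sets (distr unif_sphere borel uminus)"
  then have B[measurable]: "B \<in> sets borel" by simp
  have um: "(uminus :: 'a \<Rightarrow> 'a) \<in> borel_measurable borel" by measurable
  have B': "uminus -` B \<in> sets borel" by (rule measurable_sets_borel[OF um B])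
  have sm: "cball 0 1 \<inter> sgn -` C \<in> sets borel" if "C \<in> sets borel" for C :: "'a set"
    using measurable_sets_borel[OF borel_measurable_sgn_euclidean that] by auto
  have "emeasure lborel (cball 0 1 \<inter> sgn -` B) = (\<integral>\<^sup>+x. indicator (cball 0 1 \<inter> sgn -` B) x \<partial>lborel)"
    using sm[OF B] by simp
  also have "\<dots> = ennreal (\<bar>- 1\<bar> ^ DIM('a)) * (\<integral>\<^sup>+x. indicator (cball 0 1 \<inter> sgn -` B) ((- 1) *\<^sub>R x) \<partial>lborel)"
    using sm[OF B] by (intro nn_integral_lborel_scaleR) auto
  also have "(\<lambda>x. indicator (cball 0 1 \<inter> sgn -` B) ((- 1) *\<^sub>R x) :: ennreal) = indicator (cball 0 1 \<inter> sgn -` uminus -` B)"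
    by (auto simp: fun_eq_iff indicator_def sgn_minus)
  finally have "emeasure lborel (cball 0 1 \<inter> sgn -` B) = emeasure lborel (cball 0 1 \<inter> sgn -` uminus -` B)"
    using sm[OF B'] by simp
  then have "emeasure unif_sphere (uminus -` B) = emeasure unif_sphere B"
    by (simp add: emeasure_unif_sphere[OF B] emeasure_unif_sphere[OF B'])
  then show "emeasure (distr unif_sphere borel uminus) B = emeasure unif_sphere B"
    by (subst emeasure_distr) (auto simp: measurable_cong_sets[OF sets_unif_sphere refl])
qed simp

lemma measurable_unif_sphere: "borel_measurable unif_sphere = (borel_measurable borel :: ('a::euclidean_space \<Rightarrow> 'b::topological_space) set)"
  by (rule measurable_cong_sets) simp_all

lemma integral_unif_sphere_uminus:
  fixes h :: "'a::euclidean_space \<Rightarrow> real"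
  assumes "h \<in> borel_measurable borel"
  shows "(\<integral>w. h (- w) \<partial>unif_sphere) = (\<integral>w. h w \<partial>unif_sphere)"
proof -
  have "(\<integral>w. h w \<partial>unif_sphere) = (\<integral>w. h w \<partial>distr unif_sphere borel uminus)"
    by (simp only: distr_unif_sphere_uminus)
  also have "\<dots> = (\<integral>w. h (- w) \<partial>unif_sphere)"
    using assms by (intro integral_distr) (simp_all add: measurable_unif_sphere)
  finally show ?thesis by simp
qed

lemma smoothing_lipschitz:
  fixes f :: "'a::euclidean_space \<Rightarrow> real"
  assumes lip: "K-lipschitz_on UNIV f"
  shows "K-lipschitz_on UNIV (smoothing \<delta> f)"
proof (rule lipschitz_onI)
  interpret U: prob_space "unif_ball :: 'a measure" by (rule prob_space_unif_ball)
  fix x y :: 'a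
  have "smoothing \<delta> f x - smoothing \<delta> f y = (\<integral>u. f (x + \<delta> *\<^sub>R u) - f (y + \<delta> *\<^sub>R u) \<partial>unif_ball)"
    unfolding smoothing_def by (intro Bochner_Integration.integral_diff[symmetric] integrable_unif_ball_lipschitz[OF lip])
  also have "\<bar>\<dots>\<bar> \<le> (\<integral>u. K * dist x y \<partial>(unif_ball :: 'a measure))"
  proof (intro order_trans[OF integral_abs_bound] integral_mono)
    fix u :: 'a
    show "\<bar>f (x + \<delta> *\<^sub>R u) - f (y + \<delta> *\<^sub>R u)\<bar> \<le> K * dist x y"
      using lipschitz_onD[OF lip, of "x + \<delta> *\<^sub>R u" "y + \<delta> *\<^sub>R u"] by (simp add: dist_real_def)
  qed (simp_all add: integrable_unif_ball_lipschitz[OF lip])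
  finally show "dist (smoothing \<delta> f x) (smoothing \<delta> f y) \<le> K * dist x y"
    using U.prob_space by (simp add: dist_real_def)
qed (rule lipschitz_on_nonneg[OF lip])

text \<open>Together these bounds justify \<open>\<Delta> + L * \<delta>\<close> as the initial gap
  of the smoothed function.\<close>

lemma smoothing_bounds:
  fixes f :: "'a::euclidean_space \<Rightarrow> real"
  assumes lip: "K-lipschitz_on UNIV f" and \<delta>: "\<delta> \<ge> 0"
  shows "smoothing \<delta> f x \<le> f x + K * \<delta>"
    and "bdd_below (range f) \<Longrightarrow> (INF y. f y) \<le> smoothing \<delta> f x"
proof -
  interpret U: prob_space "unif_ball :: 'a measure" by (rule prob_space_unif_ball)
  have K: "0 \<le> K" by (rule lipschitz_on_nonneg[OF lip])
  have "smoothing \<delta> f x \<le> (\<integral>u. f x + K * \<delta> \<partial>(unif_ball :: 'a measure))"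
    unfolding smoothing_def
  proof (intro integral_mono_AE integrable_unif_ball_lipschitz[OF lip])
    show "AE u in unif_ball. f (x + \<delta> *\<^sub>R u) \<le> f x + K * \<delta>"
      using AE_unif_ball_norm
    proof eventually_elim
      case (elim u)
      have "f (x + \<delta> *\<^sub>R u) - f x \<le> K * (\<delta> * norm u)"
        using lipschitz_onD[OF lip, of "x + \<delta> *\<^sub>R u" x] \<delta> by (simp add: dist_norm)
      also have "\<dots> \<le> K * (\<delta> * 1)" using elim K \<delta> by (intro mult_left_mono) auto
      finally show ?case by simp
    qed
  qed simp
  then show "smoothing \<delta> f x \<le> f x + K * \<delta>" using U.prob_space by simp
  assume "bdd_below (range f)"
  then have "(\<integral>u. (INF y. f y) \<partial>(unif_ball :: 'a measure)) \<le> smoothing \<delta> f x"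
    unfolding smoothing_def by (intro integral_mono integrable_unif_ball_lipschitz[OF lip]) (auto intro: cINF_lower)
  then show "(INF y. f y) \<le> smoothing \<delta> f x" using U.prob_space by simp
qed

section \<open>The stochastic oracle and the two-point estimator\<close>

locale zo_oracle = \<Xi>: prob_space \<Xi> for \<Xi> :: "'xi measure" +
  fixes F :: "'a::euclidean_space \<Rightarrow> 'xi \<Rightarrow> real" and Lip :: "'xi \<Rightarrow> real" and L \<delta> :: real
  assumes L: "L > 0" and \<delta>: "\<delta> > 0"
    and F_integrable: "integrable \<Xi> (F x)"
    and F_lipschitz: "\<xi> \<in> space \<Xi> \<Longrightarrow> \<bar>F x \<xi> - F y \<xi>\<bar> \<le> Lip \<xi> * norm (x - y)"
    and Lip2_integrable: "integrable \<Xi> (\<lambda>\<xi>. (Lip \<xi>)\<^sup>2)"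
    and Lip2_le: "(\<integral>\<xi>. (Lip \<xi>)\<^sup>2 \<partial>\<Xi>) \<le> L\<^sup>2"
begin

sublocale S: prob_space "unif_sphere :: 'a measure" by (rule prob_space_unif_sphere)
sublocale Q: pair_prob_space \<Xi> "unif_sphere :: 'a measure" ..

abbreviation "f \<equiv> objective \<Xi> F"
abbreviation M0 :: "('xi \<times> 'a) measure" where "M0 \<equiv> \<Xi> \<Otimes>\<^sub>M unif_sphere"

lemma Lip_nonneg: "\<xi> \<in> space \<Xi> \<Longrightarrow> 0 \<le> Lip \<xi>"
  using F_lipschitz[of \<xi> "SOME b. b \<in> Basis" 0] SOME_Basis norm_Basis by (smt (verit) diff_zero mult_cancel_left1)

lemma F_lipschitz_on: "\<xi> \<in> space \<Xi> \<Longrightarrow> (Lip \<xi>)-lipschitz_on UNIV (\<lambda>x. F x \<xi>)"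
  using F_lipschitz Lip_nonneg by (intro lipschitz_onI) (auto simp: dist_norm)

lemma F_measurable: "F x \<in> borel_measurable \<Xi>"
  using F_integrable by (rule borel_measurable_integrable)

text \<open>Being nonnegative, \<open>Lip\<close> is the root of its square, whose integrability is
  assumed.\<close>

lemma Lip_measurable [measurable]: "Lip \<in> borel_measurable \<Xi>"
proof -
  have "(\<lambda>\<xi>. sqrt ((Lip \<xi>)\<^sup>2)) \<in> borel_measurable \<Xi>"
    using measurable_compose[OF borel_measurable_integrable[OF Lip2_integrable] borel_measurable_sqrt] .
  then show ?thesis by (rule measurable_cong[THEN iffD1, rotated]) (use Lip_nonneg in auto)
qed

text \<open>Expanding \<open>(Lip \<xi> - L)\<^sup>2 \<ge> 0\<close> bounds \<open>Lip \<xi>\<close>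
  by \<open>((Lip \<xi>)\<^sup>2 / L + L) / 2\<close>, whose mean is at most
  \<open>L\<close>.\<close>

lemma Lip_integrable: "integrable \<Xi> Lip" and Lip_le: "(\<integral>\<xi>. Lip \<xi> \<partial>\<Xi>) \<le> L"
proof -
  have le: "Lip \<xi> \<le> ((Lip \<xi>)\<^sup>2 / L + L) / 2" for \<xi>
  proof -
    have "0 \<le> (Lip \<xi> - L)\<^sup>2" by simp
    then have "2 * L * Lip \<xi> \<le> (Lip \<xi>)\<^sup>2 + L\<^sup>2" by (simp add: power2_eq_square algebra_simps)
    then show ?thesis using L by (simp add: field_simps power2_eq_square)
  qed
  have int: "integrable \<Xi> (\<lambda>\<xi>. ((Lip \<xi>)\<^sup>2 / L + L) / 2)"
    using Lip2_integrable by simp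
  show i: "integrable \<Xi> Lip"
  proof (rule Bochner_Integration.integrable_bound[OF int])
    show "AE \<xi> in \<Xi>. norm (Lip \<xi>) \<le> norm (((Lip \<xi>)\<^sup>2 / L + L) / 2)"
      using le Lip_nonneg by (intro AE_I2) (smt (verit) real_norm_def)
  qed simp
  have "(\<integral>\<xi>. Lip \<xi> \<partial>\<Xi>) \<le> (\<integral>\<xi>. ((Lip \<xi>)\<^sup>2 / L + L) / 2 \<partial>\<Xi>)"
    using i int le by (intro integral_mono) auto
  also have "\<dots> = ((\<integral>\<xi>. (Lip \<xi>)\<^sup>2 \<partial>\<Xi>) / L + L) / 2"
    using Lip2_integrable \<Xi>.prob_space by simp
  also have "\<dots> \<le> (L\<^sup>2 / L + L) / 2" using Lip2_le L by (intro divide_right_mono add_right_mono) auto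
  also have "\<dots> = L" using L by (simp add: power2_eq_square)
  finally show "(\<integral>\<xi>. Lip \<xi> \<partial>\<Xi>) \<le> L" .
qed

lemma f_lipschitz: "L-lipschitz_on UNIV f"
proof (rule lipschitz_onI)
  fix x y
  have "f x - f y = (\<integral>\<xi>. F x \<xi> - F y \<xi> \<partial>\<Xi>)"
    unfolding objective_def using F_integrable by simp
  also have "\<bar>\<dots>\<bar> \<le> (\<integral>\<xi>. Lip \<xi> * norm (x - y) \<partial>\<Xi>)"
    using F_integrable Lip_integrable F_lipschitz
    by (intro order_trans[OF integral_abs_bound] integral_mono) auto
  also have "\<dots> = (\<integral>\<xi>. Lip \<xi> \<partial>\<Xi>) * norm (x - y)" by simp
  also have "\<dots> \<le> L * norm (x - y)" using Lip_le by (intro mult_right_mono) auto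
  finally show "dist (f x) (f y) \<le> L * dist x y" by (simp add: dist_norm)
qed (use L in simp)

lemma F_measurable_pair: "(\<lambda>p. F (fst p) (snd p)) \<in> borel_measurable (borel \<Otimes>\<^sub>M \<Xi>)"
  by (rule caratheodory_measurable[OF F_measurable lipschitz_on_continuous_on[OF F_lipschitz_on]])

lemma zo_grad_eq: "zo_grad F \<delta> x s =
  (DIM('a) / (2 * \<delta>) * (F (x + \<delta> *\<^sub>R snd s) (fst s) - F (x - \<delta> *\<^sub>R snd s) (fst s))) *\<^sub>R snd s"
  by (simp add: zo_grad_def case_prod_beta)

lemma zo_grad_measurable_pair: "(\<lambda>p. zo_grad F \<delta> (fst p) (snd p)) \<in> borel_measurable (borel \<Otimes>\<^sub>M M0)"
proof -
  have w[measurable]: "(\<lambda>p. snd (snd p)) \<in> borel_measurable (borel \<Otimes>\<^sub>M M0)" "(\<lambda>p. fst (snd p)) \<in> (borel \<Otimes>\<^sub>M M0) \<rightarrow>\<^sub>M \<Xi>"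
    using measurable_compose[OF measurable_snd measurable_snd] measurable_compose[OF measurable_snd measurable_fst]
    by (auto simp: measurable_cong_sets[OF refl sets_unif_sphere])
  have F[measurable]: "(\<lambda>p. F (fst p + r *\<^sub>R snd (snd p)) (fst (snd p))) \<in> borel_measurable (borel \<Otimes>\<^sub>M M0)" for r
    using measurable_compose[OF _ F_measurable_pair, of "\<lambda>p. (fst p + r *\<^sub>R snd (snd p), fst (snd p))" "borel \<Otimes>\<^sub>M M0"]
    by simp
  have "(\<lambda>p. F (fst p - \<delta> *\<^sub>R snd (snd p)) (fst (snd p))) \<in> borel_measurable (borel \<Otimes>\<^sub>M M0)"
    using F[of "- \<delta>"] by simp
  note [measurable] = this
  show ?thesis unfolding zo_grad_eq by measurable
qed

lemma zo_grad_measurable: "zo_grad F \<delta> x \<in> borel_measurable M0"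
proof -
  have "(\<lambda>s. (x, s)) \<in> M0 \<rightarrow>\<^sub>M borel \<Otimes>\<^sub>M M0" by measurable
  from measurable_compose[OF this zo_grad_measurable_pair] show ?thesis by simp
qed

lemma AE_M0: "AE s in M0. fst s \<in> space \<Xi> \<and> norm (snd s) = 1"
proof -
  have "AE \<xi> in \<Xi>. AE w in unif_sphere. \<xi> \<in> space \<Xi> \<and> norm (w::'a) = 1"
    using AE_unif_sphere_norm by auto
  moreover have "{s \<in> space M0. norm (snd s) = 1} \<in> sets M0"
    by measurable
  ultimately have "AE s in M0. norm (snd s) = 1"
    by (intro Q.AE_pair_measure) auto
  then show ?thesis by (auto simp: space_pair_measure elim: AE_mp intro: AE_I2)
qed

lemma integral_M0_fst:
  assumes "integrable \<Xi> h"
  shows "integrable M0 (\<lambda>s. h (fst s) :: real)" "(\<integral>s. h (fst s) \<partial>M0) = (\<integral>\<xi>. h \<xi> \<partial>\<Xi>)"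
proof -
  have ds: "distr M0 \<Xi> fst = \<Xi>" by (rule S.distr_pair_fst)
  have hm: "h \<in> borel_measurable \<Xi>" using assms by (rule borel_measurable_integrable)
  show "integrable M0 (\<lambda>s. h (fst s))"
    using integrable_distr_eq[of fst M0 \<Xi> h] hm assms ds by simp
  show "(\<integral>s. h (fst s) \<partial>M0) = (\<integral>\<xi>. h \<xi> \<partial>\<Xi>)"
    using integral_distr[of fst M0 \<Xi> h] hm ds by simp
qed

lemma zo_grad_bound:
  assumes "fst s \<in> space \<Xi>" "norm (snd s) = 1"
  shows "norm (zo_grad F \<delta> x s) \<le> DIM('a) * Lip (fst s)"
proof -
  have "\<bar>F (x + \<delta> *\<^sub>R snd s) (fst s) - F (x - \<delta> *\<^sub>R snd s) (fst s)\<bar> \<le> Lip (fst s) * norm ((2 * \<delta>) *\<^sub>R snd s)"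
    using F_lipschitz[OF assms(1), of "x + \<delta> *\<^sub>R snd s" "x - \<delta> *\<^sub>R snd s"] by (simp add: scaleR_2 scaleR_scaleR[symmetric] del: scaleR_scaleR)
  also have "\<dots> = Lip (fst s) * (2 * \<delta>)" using assms \<delta> by simp
  finally have "DIM('a) / (2 * \<delta>) * \<bar>F (x + \<delta> *\<^sub>R snd s) (fst s) - F (x - \<delta> *\<^sub>R snd s) (fst s)\<bar> \<le> DIM('a) / (2 * \<delta>) * (Lip (fst s) * (2 * \<delta>))"
    using \<delta> by (intro mult_left_mono) auto
  also have "\<dots> = DIM('a) * Lip (fst s)" using \<delta> by simp
  finally show ?thesis using assms \<delta> by (simp add: zo_grad_eq abs_mult)
qed

lemma zo_grad_lipschitz:
  assumes "fst s \<in> space \<Xi>" "norm (snd s) = 1"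
  shows "norm (zo_grad F \<delta> x s - zo_grad F \<delta> y s) \<le> DIM('a) / \<delta> * Lip (fst s) * norm (x - y)"
proof -
  let ?w = "snd s" and ?\<xi> = "fst s"
  have eq: "zo_grad F \<delta> x s - zo_grad F \<delta> y s = (DIM('a) / (2 * \<delta>) *
      ((F (x + \<delta> *\<^sub>R ?w) ?\<xi> - F (y + \<delta> *\<^sub>R ?w) ?\<xi>) - (F (x - \<delta> *\<^sub>R ?w) ?\<xi> - F (y - \<delta> *\<^sub>R ?w) ?\<xi>))) *\<^sub>R ?w"
    unfolding zo_grad_eq scaleR_diff_left[symmetric] by (simp add: algebra_simps)
  have "\<bar>(F (x + \<delta> *\<^sub>R ?w) ?\<xi> - F (y + \<delta> *\<^sub>R ?w) ?\<xi>) - (F (x - \<delta> *\<^sub>R ?w) ?\<xi> - F (y - \<delta> *\<^sub>R ?w) ?\<xi>)\<bar> \<le> 2 * (Lip ?\<xi> * norm (x - y))"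
    using F_lipschitz[OF assms(1), of "x + \<delta> *\<^sub>R ?w" "y + \<delta> *\<^sub>R ?w"] F_lipschitz[OF assms(1), of "x - \<delta> *\<^sub>R ?w" "y - \<delta> *\<^sub>R ?w"]
    by (simp add: abs_le_iff)
  then have "DIM('a) / (2 * \<delta>) * \<bar>(F (x + \<delta> *\<^sub>R ?w) ?\<xi> - F (y + \<delta> *\<^sub>R ?w) ?\<xi>) - (F (x - \<delta> *\<^sub>R ?w) ?\<xi> - F (y - \<delta> *\<^sub>R ?w) ?\<xi>)\<bar> \<le>
    DIM('a) / (2 * \<delta>) * (2 * (Lip ?\<xi> * norm (x - y)))"
    using \<delta> by (intro mult_left_mono) auto
  then show ?thesis using assms \<delta> by (simp add: eq abs_mult)
qed

lemma zo_grad_diff_moment: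
  shows "integrable M0 (\<lambda>s. (norm (zo_grad F \<delta> x s - zo_grad F \<delta> y s))\<^sup>2)"
    and "(\<integral>s. (norm (zo_grad F \<delta> x s - zo_grad F \<delta> y s))\<^sup>2 \<partial>M0) \<le> (DIM('a) * L / \<delta>)\<^sup>2 * (norm (x - y))\<^sup>2"
proof -
  let ?B = "\<lambda>s. (DIM('a) / \<delta> * norm (x - y))\<^sup>2 * (Lip (fst s))\<^sup>2"
  have le: "AE s in M0. (norm (zo_grad F \<delta> x s - zo_grad F \<delta> y s))\<^sup>2 \<le> ?B s"
    using AE_M0
  proof eventually_elim
    case (elim s)
    then have "(norm (zo_grad F \<delta> x s - zo_grad F \<delta> y s))\<^sup>2 \<le> (DIM('a) / \<delta> * Lip (fst s) * norm (x - y))\<^sup>2"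
      by (intro power_mono zo_grad_lipschitz) auto
    then show ?case by (simp add: power_mult_distrib power_divide mult_ac)
  qed
  have i: "integrable M0 ?B" using integral_M0_fst(1)[OF Lip2_integrable] by simp
  note [measurable] = zo_grad_measurable
  show int: "integrable M0 (\<lambda>s. (norm (zo_grad F \<delta> x s - zo_grad F \<delta> y s))\<^sup>2)"
    by (rule Bochner_Integration.integrable_bound[OF i]) (use le in \<open>auto elim: eventually_mono\<close>)
  have "(\<integral>s. (norm (zo_grad F \<delta> x s - zo_grad F \<delta> y s))\<^sup>2 \<partial>M0) \<le> (\<integral>s. ?B s \<partial>M0)"
    by (rule integral_mono_AE[OF int i le])
  also have "\<dots> = (DIM('a) / \<delta> * norm (x - y))\<^sup>2 * (\<integral>\<xi>. (Lip \<xi>)\<^sup>2 \<partial>\<Xi>)"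
    using integral_M0_fst(2)[OF Lip2_integrable] by simp
  also have "\<dots> \<le> (DIM('a) / \<delta> * norm (x - y))\<^sup>2 * L\<^sup>2" using Lip2_le by (intro mult_left_mono) auto
  finally show "(\<integral>s. (norm (zo_grad F \<delta> x s - zo_grad F \<delta> y s))\<^sup>2 \<partial>M0) \<le> (DIM('a) * L / \<delta>)\<^sup>2 * (norm (x - y))\<^sup>2"
    by (simp add: power_mult_distrib power_divide mult_ac)
qed

text \<open>For fixed \<open>\<xi>\<close> the two-point difference is that of the map
  \<open>w \<mapsto> F (x + \<delta> *\<^sub>R w) \<xi>\<close> with Lipschitz constant
  \<open>Lip \<xi> * \<delta>\<close>. The sphere bound gains a factor of order
  \<open>1 / DIM('a)\<close> over the pointwise \<open>zo_grad_bound\<close>, which only provides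
  integrability here.\<close>

lemma zo_grad_moment:
  shows "integrable M0 (\<lambda>s. (norm (zo_grad F \<delta> x s))\<^sup>2)"
    and "(\<integral>s. (norm (zo_grad F \<delta> x s))\<^sup>2 \<partial>M0) \<le> pi\<^sup>2 * DIM('a) * L\<^sup>2"
proof -
  note [measurable] = zo_grad_measurable
  have iB: "integrable M0 (\<lambda>s. DIM('a)\<^sup>2 * (Lip (fst s))\<^sup>2)" using integral_M0_fst(1)[OF Lip2_integrable] by simp
  show int: "integrable M0 (\<lambda>s. (norm (zo_grad F \<delta> x s))\<^sup>2)"
  proof (rule Bochner_Integration.integrable_bound[OF iB])
    show "AE s in M0. norm ((norm (zo_grad F \<delta> x s))\<^sup>2) \<le> norm (DIM('a)\<^sup>2 * (Lip (fst s))\<^sup>2)"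
      using AE_M0
    proof eventually_elim
      case (elim s)
      then have "(norm (zo_grad F \<delta> x s))\<^sup>2 \<le> (DIM('a) * Lip (fst s))\<^sup>2" by (intro power_mono zo_grad_bound) auto
      then show ?case by (simp add: power_mult_distrib)
    qed
  qed measurable
  have "(\<integral>s. (norm (zo_grad F \<delta> x s))\<^sup>2 \<partial>M0) = (\<integral>\<xi>. (\<integral>w. (norm (zo_grad F \<delta> x (\<xi>, w)))\<^sup>2 \<partial>unif_sphere) \<partial>\<Xi>)"
    using Q.integral_fst'[OF int] by simp
  also have "\<dots> \<le> (\<integral>\<xi>. pi\<^sup>2 * DIM('a) * (Lip \<xi>)\<^sup>2 \<partial>\<Xi>)"
  proof (rule integral_mono)
    show "integrable \<Xi> (\<lambda>\<xi>. \<integral>w. (norm (zo_grad F \<delta> x (\<xi>, w)))\<^sup>2 \<partial>unif_sphere)"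
      using Q.integrable_fst'[OF int] by simp
    fix \<xi> assume \<xi>: "\<xi> \<in> space \<Xi>"
    define h where "h w = F (x + \<delta> *\<^sub>R w) \<xi>" for w
    have lip: "(Lip \<xi> * \<bar>\<delta>\<bar>)-lipschitz_on UNIV h"
      unfolding h_def by (rule lipschitz_on_scale_shift[OF F_lipschitz_on[OF \<xi>]])
    note [measurable] = borel_measurable_continuous_onI[OF lipschitz_on_continuous_on[OF lip]]
    have "(\<integral>w. (norm (zo_grad F \<delta> x (\<xi>, w)))\<^sup>2 \<partial>unif_sphere) = (\<integral>w. (DIM('a) / (2 * \<delta>))\<^sup>2 * (h w - h (- w))\<^sup>2 \<partial>unif_sphere)"
    proof (rule integral_cong_AE)
      show "AE w in unif_sphere. (norm (zo_grad F \<delta> x (\<xi>, w)))\<^sup>2 = (DIM('a) / (2 * \<delta>))\<^sup>2 * (h w - h (- w))\<^sup>2"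
        using AE_unif_sphere_norm
      proof eventually_elim
        case (elim w)
        then have "norm (zo_grad F \<delta> x (\<xi>, w)) = \<bar>DIM('a) / (2 * \<delta>) * (h w - h (- w))\<bar>"
          unfolding zo_grad_eq norm_scaleR h_def by simp
        then show ?case by (simp only: power2_abs power_mult_distrib)
      qed
      have "(\<lambda>w. (\<xi>, w)) \<in> unif_sphere \<rightarrow>\<^sub>M M0" using \<xi> by measurable
      from measurable_compose[OF this zo_grad_measurable]
      show "(\<lambda>w. (norm (zo_grad F \<delta> x (\<xi>, w)))\<^sup>2) \<in> borel_measurable unif_sphere" by simp
      show "(\<lambda>w. (DIM('a) / (2 * \<delta>))\<^sup>2 * (h w - h (- w))\<^sup>2) \<in> borel_measurable unif_sphere"
        unfolding measurable_unif_sphere by measurable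
    qed
    also have "\<dots> = (DIM('a) / (2 * \<delta>))\<^sup>2 * (\<integral>w. (h w - h (- w))\<^sup>2 \<partial>unif_sphere)" by simp
    also have "\<dots> = DIM('a) / (2 * \<delta>)\<^sup>2 * (DIM('a) * (\<integral>w. (h w - h (- w))\<^sup>2 \<partial>unif_sphere))"
      by (simp add: power2_eq_square)
    also have "\<dots> \<le> DIM('a) / (2 * \<delta>)\<^sup>2 * (4 * pi\<^sup>2 * (Lip \<xi> * \<bar>\<delta>\<bar>)\<^sup>2)"
      by (intro mult_left_mono sphere_variance_bound lip) auto
    also have "\<dots> = pi\<^sup>2 * DIM('a) * (Lip \<xi>)\<^sup>2" using \<delta> by (simp add: power2_eq_square)
    finally show "(\<integral>w. (norm (zo_grad F \<delta> x (\<xi>, w)))\<^sup>2 \<partial>unif_sphere) \<le> pi\<^sup>2 * DIM('a) * (Lip \<xi>)\<^sup>2" .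
  qed (use Lip2_integrable in simp)
  also have "\<dots> = pi\<^sup>2 * DIM('a) * (\<integral>\<xi>. (Lip \<xi>)\<^sup>2 \<partial>\<Xi>)" by simp
  also have "\<dots> \<le> pi\<^sup>2 * DIM('a) * L\<^sup>2" using Lip2_le by (intro mult_left_mono) auto
  finally show "(\<integral>s. (norm (zo_grad F \<delta> x s))\<^sup>2 \<partial>M0) \<le> pi\<^sup>2 * DIM('a) * L\<^sup>2" .
qed

lemma zo_grad_integrable: "integrable M0 (zo_grad F \<delta> x)"
proof (rule Bochner_Integration.integrable_bound[OF integrable_mult_right[OF integral_M0_fst(1)[OF Lip_integrable], of "real DIM('a)"]])
  show "AE s in M0. norm (zo_grad F \<delta> x s) \<le> norm (DIM('a) * Lip (fst s))"
    using AE_M0 by eventually_elim (use zo_grad_bound Lip_nonneg in auto)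
qed (rule zo_grad_measurable)

text \<open>Averaging over \<open>\<xi>\<close> replaces \<open>F\<close> by \<open>f\<close>. By
  the symmetry of the sphere both halves of the two-point difference contribute equally, which
  leaves the sphere formula for \<open>G\<close>.\<close>

lemma zo_grad_unbiased:
  assumes G: "GDERIV (smoothing \<delta> f) x :> G"
  shows "(\<integral>s. zo_grad F \<delta> x s \<partial>M0) = G"
proof (rule euclidean_eqI)
  fix v :: 'a
  note fm[measurable] = borel_measurable_continuous_onI[OF lipschitz_on_continuous_on[OF f_lipschitz]]
  have int: "integrable M0 (\<lambda>s. zo_grad F \<delta> x s \<bullet> v)" using zo_grad_integrable by simp
  have inner_int: "integrable unif_sphere (\<lambda>w. f (x + r *\<^sub>R w) * (w \<bullet> v))" for r
  proof (rule integrable_unif_sphere_bounded[where C="(\<bar>f x\<bar> + L * \<bar>r\<bar>) * norm v"])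
    fix w :: 'a assume w: "norm w = 1"
    show "norm (f (x + r *\<^sub>R w) * (w \<bullet> v)) \<le> (\<bar>f x\<bar> + L * \<bar>r\<bar>) * norm v"
      using lipschitz_on_sphere_bound[OF f_lipschitz w, of x r] Cauchy_Schwarz_ineq2[of w v] w
      by (auto simp: abs_mult intro!: mult_mono)
  qed measurable
  have "(\<integral>s. zo_grad F \<delta> x s \<partial>M0) \<bullet> v = (\<integral>s. zo_grad F \<delta> x s \<bullet> v \<partial>M0)"
    using zo_grad_integrable by (rule integral_inner_left[symmetric])
  also have "\<dots> = (\<integral>w. (\<integral>\<xi>. zo_grad F \<delta> x (\<xi>, w) \<bullet> v \<partial>\<Xi>) \<partial>unif_sphere)"
  proof -
    have "integrable M0 (\<lambda>(\<xi>, w). zo_grad F \<delta> x (\<xi>, w) \<bullet> v)"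
      unfolding case_prod_unfold prod.collapse by (rule int)
    from Q.integral_snd[OF this] show ?thesis unfolding case_prod_unfold prod.collapse by simp
  qed
  also have "\<dots> = (\<integral>w. DIM('a) / (2 * \<delta>) * (f (x + \<delta> *\<^sub>R w) * (w \<bullet> v) - f (x - \<delta> *\<^sub>R w) * (w \<bullet> v)) \<partial>unif_sphere)"
  proof (rule Bochner_Integration.integral_cong[OF refl])
    fix w :: 'a
    have "(\<integral>\<xi>. zo_grad F \<delta> x (\<xi>, w) \<bullet> v \<partial>\<Xi>) = (\<integral>\<xi>. (DIM('a) / (2 * \<delta>) * (w \<bullet> v)) * (F (x + \<delta> *\<^sub>R w) \<xi> - F (x - \<delta> *\<^sub>R w) \<xi>) \<partial>\<Xi>)"
      by (simp add: zo_grad_eq mult_ac)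
    also have "\<dots> = (DIM('a) / (2 * \<delta>) * (w \<bullet> v)) * (f (x + \<delta> *\<^sub>R w) - f (x - \<delta> *\<^sub>R w))"
      unfolding objective_def using F_integrable by (subst integral_mult_right_zero) simp
    finally show "(\<integral>\<xi>. zo_grad F \<delta> x (\<xi>, w) \<bullet> v \<partial>\<Xi>) = DIM('a) / (2 * \<delta>) * (f (x + \<delta> *\<^sub>R w) * (w \<bullet> v) - f (x - \<delta> *\<^sub>R w) * (w \<bullet> v))"
      by (simp add: algebra_simps)
  qed
  also have "\<dots> = DIM('a) / (2 * \<delta>) * ((\<integral>w. f (x + \<delta> *\<^sub>R w) * (w \<bullet> v) \<partial>unif_sphere) - (\<integral>w. f (x - \<delta> *\<^sub>R w) * (w \<bullet> v) \<partial>unif_sphere))"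
    using inner_int[of \<delta>] inner_int[of "- \<delta>"] by simp
  also have "(\<integral>w. f (x - \<delta> *\<^sub>R w) * (w \<bullet> v) \<partial>unif_sphere) = - (\<integral>w. f (x + \<delta> *\<^sub>R w) * (w \<bullet> v) \<partial>unif_sphere)"
    using integral_unif_sphere_uminus[of "\<lambda>w. f (x + \<delta> *\<^sub>R w) * (w \<bullet> v)"] by simp
  also have "DIM('a) / (2 * \<delta>) * ((\<integral>w. f (x + \<delta> *\<^sub>R w) * (w \<bullet> v) \<partial>unif_sphere) - - (\<integral>w. f (x + \<delta> *\<^sub>R w) * (w \<bullet> v) \<partial>unif_sphere)) =
     DIM('a) / \<delta> * (\<integral>w. f (x + \<delta> *\<^sub>R w) * (w \<bullet> v) \<partial>unif_sphere)"
    using \<delta> by (simp add: field_simps)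
  also have "\<dots> = G \<bullet> v" by (rule GDERIV_smoothing_inner(2)[OF f_lipschitz \<delta> G])
  finally show "(\<integral>s. zo_grad F \<delta> x s \<partial>M0) \<bullet> v = G \<bullet> v" .
qed

end

section \<open>Square integrable random vectors\<close>

lemma AM_GM_inner: "\<bar>x \<bullet> y\<bar> \<le> (norm x)\<^sup>2 + (norm (y::'a::real_inner))\<^sup>2"
proof -
  have "\<bar>x \<bullet> y\<bar> \<le> norm x * norm y" by (rule Cauchy_Schwarz_ineq2)
  moreover have "2 * (norm x * norm y) \<le> (norm x)\<^sup>2 + (norm y)\<^sup>2" using sum_squares_bound[of "norm x" "norm y"] by simp
  moreover have "0 \<le> norm x * norm y" by simp
  ultimately show ?thesis by linarith
qed

lemma norm_add_squared: "(norm (x + y))\<^sup>2 = (norm x)\<^sup>2 + 2 * (x \<bullet> y) + (norm (y::'a::real_inner))\<^sup>2"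
  unfolding power2_norm_eq_inner by (simp add: inner_add_left inner_add_right inner_commute)

lemma norm_diff_squared: "(norm (x - y))\<^sup>2 = (norm x)\<^sup>2 - 2 * (x \<bullet> y) + (norm (y::'a::real_inner))\<^sup>2"
  unfolding power2_norm_eq_inner by (simp add: inner_diff_left inner_diff_right inner_commute)

lemma norm_add_squared_le: "(norm (x + y))\<^sup>2 \<le> 2 * (norm x)\<^sup>2 + 2 * (norm (y::'a::real_inner))\<^sup>2"
  using norm_add_squared[of x y] norm_diff_squared[of x y] zero_le_power2[of "norm (x - y)"] by linarith

context prob_space
begin

definition square_integrable :: "('a \<Rightarrow> 'b::euclidean_space) \<Rightarrow> bool" where
  "square_integrable X \<longleftrightarrow> X \<in> borel_measurable M \<and> integrable M (\<lambda>\<omega>. (norm (X \<omega>))\<^sup>2)"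

lemma square_integrableD:
  "square_integrable X \<Longrightarrow> X \<in> borel_measurable M"
  "square_integrable X \<Longrightarrow> integrable M (\<lambda>\<omega>. (norm (X \<omega>))\<^sup>2)"
  by (auto simp: square_integrable_def)

lemma square_integrable_bound:
  assumes "X \<in> borel_measurable M" "integrable M B" "\<And>\<omega>. \<omega> \<in> space M \<Longrightarrow> (norm (X \<omega>))\<^sup>2 \<le> B \<omega>"
  shows "square_integrable X"
  unfolding square_integrable_def
proof
  note [measurable] = assms(1)
  show "integrable M (\<lambda>\<omega>. (norm (X \<omega>))\<^sup>2)"
    by (rule Bochner_Integration.integrable_bound[OF assms(2)]) (use assms(3) in \<open>auto intro!: AE_I2 order_trans[OF assms(3) abs_ge_self]\<close>)
qed (rule assms(1))

lemma square_integrable_add: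
  assumes X: "square_integrable X" and Y: "square_integrable Y"
  shows "square_integrable (\<lambda>\<omega>. X \<omega> + Y \<omega>)"
  using square_integrableD[OF X] square_integrableD[OF Y]
  by (intro square_integrable_bound[where B="\<lambda>\<omega>. 2 * (norm (X \<omega>))\<^sup>2 + 2 * (norm (Y \<omega>))\<^sup>2"] norm_add_squared_le) auto

lemma square_integrable_scaleR:
  assumes X: "square_integrable X"
  shows "square_integrable (\<lambda>\<omega>. c *\<^sub>R X \<omega>)"
  using square_integrableD[OF X] by (auto simp: square_integrable_def power_mult_distrib)

lemma square_integrable_diff:
  assumes X: "square_integrable X" and Y: "square_integrable Y"
  shows "square_integrable (\<lambda>\<omega>. X \<omega> - Y \<omega>)"
  using square_integrable_add[OF X square_integrable_scaleR[OF Y, of "-1"]] by simp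

lemma square_integrable_bounded:
  assumes "X \<in> borel_measurable M" "\<And>\<omega>. \<omega> \<in> space M \<Longrightarrow> norm (X \<omega>) \<le> C"
  shows "square_integrable X"
  using assms by (intro square_integrable_bound[where B="\<lambda>_. C\<^sup>2"]) (auto intro: power_mono)

lemma square_integrable_const: "square_integrable (\<lambda>_. c)"
  by (rule square_integrable_bounded[where C="norm c"]) auto

lemma square_integrable_sum:
  assumes "\<And>i. i \<in> I \<Longrightarrow> square_integrable (X i)"
  shows "square_integrable (\<lambda>\<omega>. \<Sum>i\<in>I. X i \<omega>)"
  using assms
  by (induction I rule: infinite_finite_induct) (auto intro: square_integrable_add square_integrable_const)

lemma square_integrable_inner:
  assumes X: "square_integrable X" and Y: "square_integrable Y"
  shows "integrable M (\<lambda>\<omega>. X \<omega> \<bullet> Y \<omega>)"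
proof (rule Bochner_Integration.integrable_bound[OF Bochner_Integration.integrable_add[OF square_integrableD(2)[OF X] square_integrableD(2)[OF Y]]])
  note [measurable] = square_integrableD(1)[OF X] square_integrableD(1)[OF Y]
  show "(\<lambda>\<omega>. X \<omega> \<bullet> Y \<omega>) \<in> borel_measurable M" by measurable
  show "AE \<omega> in M. norm (X \<omega> \<bullet> Y \<omega>) \<le> norm ((norm (X \<omega>))\<^sup>2 + (norm (Y \<omega>))\<^sup>2)"
    using AM_GM_inner by (intro AE_I2) (auto intro: order_trans[OF _ abs_ge_self])
qed

lemma square_integrable_norm:
  assumes X: "square_integrable X"
  shows "integrable M (\<lambda>\<omega>. norm (X \<omega>))"
proof (rule Bochner_Integration.integrable_bound)
  note [measurable] = square_integrableD(1)[OF X]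
  show "integrable M (\<lambda>\<omega>. 1 + (norm (X \<omega>))\<^sup>2)" using square_integrableD(2)[OF X] by simp
  have "norm x \<le> 1 + (norm x)\<^sup>2" for x :: 'b
  proof -
    have "2 * norm x \<le> 1 + (norm x)\<^sup>2" using sum_squares_bound[of 1 "norm x"] by simp
    then show ?thesis using norm_ge_zero[of x] by linarith
  qed
  then show "AE \<omega> in M. norm (norm (X \<omega>)) \<le> norm (1 + (norm (X \<omega>))\<^sup>2)"
    by (intro AE_I2) (simp add: order_trans[OF _ abs_ge_self])
  show "(\<lambda>\<omega>. norm (X \<omega>)) \<in> borel_measurable M" by measurable
qed

text \<open>Independence of two random elements of possibly different types, which \<^const>\<open>indep_var\<close> does not
  allow.\<close>

definition independent_pair :: "'n measure \<Rightarrow> ('a \<Rightarrow> 'n) \<Rightarrow> 'k measure \<Rightarrow> ('a \<Rightarrow> 'k) \<Rightarrow> bool" where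
  "independent_pair N Y K Z \<longleftrightarrow> Y \<in> M \<rightarrow>\<^sub>M N \<and> Z \<in> M \<rightarrow>\<^sub>M K \<and>
     distr M (N \<Otimes>\<^sub>M K) (\<lambda>\<omega>. (Y \<omega>, Z \<omega>)) = distr M N Y \<Otimes>\<^sub>M distr M K Z"

lemma independent_pair_compose:
  assumes ind: "indep_var S X T Y" and f[measurable]: "f \<in> S \<rightarrow>\<^sub>M N" and g[measurable]: "g \<in> T \<rightarrow>\<^sub>M K"
  shows "independent_pair N (\<lambda>\<omega>. f (X \<omega>)) K (\<lambda>\<omega>. g (Y \<omega>))"
proof -
  have XY[measurable]: "X \<in> M \<rightarrow>\<^sub>M S" "Y \<in> M \<rightarrow>\<^sub>M T" using indep_var_rv1[OF ind] indep_var_rv2[OF ind] by auto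
  have gY: "(\<lambda>\<omega>. g (Y \<omega>)) \<in> M \<rightarrow>\<^sub>M K" by measurable
  interpret K: prob_space "distr M K (\<lambda>\<omega>. g (Y \<omega>))" by (rule prob_space_distr[OF gY])
  have eqs: "distr M N (\<lambda>\<omega>. f (X \<omega>)) = distr (distr M S X) N f" "distr M K (\<lambda>\<omega>. g (Y \<omega>)) = distr (distr M T Y) K g"
    by (subst distr_distr; simp add: comp_def)+
  have "distr M N (\<lambda>\<omega>. f (X \<omega>)) \<Otimes>\<^sub>M distr M K (\<lambda>\<omega>. g (Y \<omega>)) =
      distr (distr M S X \<Otimes>\<^sub>M distr M T Y) (N \<Otimes>\<^sub>M K) (\<lambda>(x, y). (f x, g y))"
    unfolding eqs by (rule pair_measure_distr) (use K.sigma_finite_measure_axioms eqs(2) in simp_all)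
  also have "distr M S X \<Otimes>\<^sub>M distr M T Y = distr M (S \<Otimes>\<^sub>M T) (\<lambda>\<omega>. (X \<omega>, Y \<omega>))"
    using ind unfolding indep_var_distribution_eq by simp
  also have "distr \<dots> (N \<Otimes>\<^sub>M K) (\<lambda>(x, y). (f x, g y)) = distr M (N \<Otimes>\<^sub>M K) (\<lambda>\<omega>. (f (X \<omega>), g (Y \<omega>)))"
    by (subst distr_distr) (auto simp: comp_def)
  finally show ?thesis unfolding independent_pair_def by simp
qed

text \<open>Fubini for the product law takes the place of conditioning on the past: for each fixed
  \<open>y\<close> the inner integral over the fresh sample vanishes.\<close>

lemma independent_mean_zero:
  fixes h :: "'n \<times> 'k \<Rightarrow> 'b::euclidean_space"
  assumes ind: "independent_pair N Y K Z"
    and h[measurable]: "h \<in> borel_measurable (N \<Otimes>\<^sub>M K)" and u[measurable]: "u \<in> borel_measurable N"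
    and sqh: "square_integrable (\<lambda>\<omega>. h (Y \<omega>, Z \<omega>))" and squ: "square_integrable (\<lambda>\<omega>. u (Y \<omega>))"
    and mean: "\<And>y. y \<in> space N \<Longrightarrow> integrable (distr M K Z) (\<lambda>s. h (y, s)) \<and> (\<integral>s. h (y, s) \<partial>distr M K Z) = 0"
  shows "(\<integral>\<omega>. u (Y \<omega>) \<bullet> h (Y \<omega>, Z \<omega>) \<partial>M) = 0"
proof -
  have Y[measurable]: "Y \<in> M \<rightarrow>\<^sub>M N" and Z[measurable]: "Z \<in> M \<rightarrow>\<^sub>M K"
    using ind by (auto simp: independent_pair_def)
  interpret N: prob_space "distr M N Y" by (rule prob_space_distr[OF Y])
  interpret K: prob_space "distr M K Z" by (rule prob_space_distr[OF Z])
  interpret Q: pair_prob_space "distr M N Y" "distr M K Z" ..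
  have D: "distr M N Y \<Otimes>\<^sub>M distr M K Z = distr M (N \<Otimes>\<^sub>M K) (\<lambda>\<omega>. (Y \<omega>, Z \<omega>))"
    using ind by (simp add: independent_pair_def)
  let ?\<phi> = "\<lambda>p. u (fst p) \<bullet> h p"
  have "integrable M (\<lambda>\<omega>. u (Y \<omega>) \<bullet> h (Y \<omega>, Z \<omega>))" by (rule square_integrable_inner[OF squ sqh])
  then have int: "integrable (distr M N Y \<Otimes>\<^sub>M distr M K Z) ?\<phi>"
    unfolding D by (subst integrable_distr_eq) auto
  have "(\<integral>\<omega>. u (Y \<omega>) \<bullet> h (Y \<omega>, Z \<omega>) \<partial>M) = (\<integral>p. ?\<phi> p \<partial>distr M (N \<Otimes>\<^sub>M K) (\<lambda>\<omega>. (Y \<omega>, Z \<omega>)))"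
    by (subst integral_distr) auto
  also have "\<dots> = (\<integral>y. (\<integral>s. ?\<phi> (y, s) \<partial>distr M K Z) \<partial>distr M N Y)"
    unfolding D[symmetric] by (rule Q.integral_fst'[OF int, symmetric])
  also have "\<dots> = (\<integral>y. 0 \<partial>distr M N Y)"
    by (intro Bochner_Integration.integral_cong refl) (use mean in simp)
  finally show ?thesis by simp
qed

text \<open>The bound \<open>V\<close> may depend on the past, because the variance bound for a
  difference of estimators is proportional to the squared length of the last step.\<close>

lemma independent_second_moment:
  fixes h :: "'n \<times> 'k \<Rightarrow> 'b::euclidean_space"
  assumes ind: "independent_pair N Y K Z"
    and h[measurable]: "h \<in> borel_measurable (N \<Otimes>\<^sub>M K)"
    and V[measurable]: "V \<in> borel_measurable N" and Vint: "integrable M (\<lambda>\<omega>. V (Y \<omega>))"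
    and le: "\<And>y. y \<in> space N \<Longrightarrow> integrable (distr M K Z) (\<lambda>s. (norm (h (y, s)))\<^sup>2) \<and> (\<integral>s. (norm (h (y, s)))\<^sup>2 \<partial>distr M K Z) \<le> V y"
  shows "square_integrable (\<lambda>\<omega>. h (Y \<omega>, Z \<omega>))"
    and "(\<integral>\<omega>. (norm (h (Y \<omega>, Z \<omega>)))\<^sup>2 \<partial>M) \<le> (\<integral>\<omega>. V (Y \<omega>) \<partial>M)"
proof -
  have Y[measurable]: "Y \<in> M \<rightarrow>\<^sub>M N" and Z[measurable]: "Z \<in> M \<rightarrow>\<^sub>M K"
    using ind by (auto simp: independent_pair_def)
  interpret K: prob_space "distr M K Z" by (rule prob_space_distr[OF Z])
  have D: "distr M N Y \<Otimes>\<^sub>M distr M K Z = distr M (N \<Otimes>\<^sub>M K) (\<lambda>\<omega>. (Y \<omega>, Z \<omega>))"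
    using ind unfolding independent_pair_def by metis
  have V0: "0 \<le> V y" if "y \<in> space N" for y
  proof -
    have "0 \<le> (\<integral>s. (norm (h (y, s)))\<^sup>2 \<partial>distr M K Z)" by (rule integral_nonneg_AE) simp
    then show ?thesis using le[OF that] by linarith
  qed
  have "(\<integral>\<^sup>+\<omega>. ennreal ((norm (h (Y \<omega>, Z \<omega>)))\<^sup>2) \<partial>M) = (\<integral>\<^sup>+p. ennreal ((norm (h p))\<^sup>2) \<partial>distr M (N \<Otimes>\<^sub>M K) (\<lambda>\<omega>. (Y \<omega>, Z \<omega>)))"
    by (subst nn_integral_distr) auto
  also have "\<dots> = (\<integral>\<^sup>+y. (\<integral>\<^sup>+s. ennreal ((norm (h (y, s)))\<^sup>2) \<partial>distr M K Z) \<partial>distr M N Y)"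
    unfolding D[symmetric] by (rule K.nn_integral_fst[symmetric]) measurable
  also have "\<dots> \<le> (\<integral>\<^sup>+y. ennreal (V y) \<partial>distr M N Y)"
  proof (rule nn_integral_mono)
    fix y assume "y \<in> space (distr M N Y)"
    then have y: "y \<in> space N" by simp
    then have "(\<integral>\<^sup>+s. ennreal ((norm (h (y, s)))\<^sup>2) \<partial>distr M K Z) = ennreal (\<integral>s. (norm (h (y, s)))\<^sup>2 \<partial>distr M K Z)"
      using le[OF y] by (intro nn_integral_eq_integral) auto
    then show "(\<integral>\<^sup>+s. ennreal ((norm (h (y, s)))\<^sup>2) \<partial>distr M K Z) \<le> ennreal (V y)"
      using le[OF y] by (simp add: ennreal_leI)
  qed
  also have "\<dots> = (\<integral>\<^sup>+\<omega>. ennreal (V (Y \<omega>)) \<partial>M)" by (subst nn_integral_distr) auto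
  also have "\<dots> = ennreal (\<integral>\<omega>. V (Y \<omega>) \<partial>M)"
    using Vint V0 measurable_space[OF Y] by (intro nn_integral_eq_integral) auto
  finally have main: "(\<integral>\<^sup>+\<omega>. ennreal ((norm (h (Y \<omega>, Z \<omega>)))\<^sup>2) \<partial>M) \<le> ennreal (\<integral>\<omega>. V (Y \<omega>) \<partial>M)" .
  have int: "integrable M (\<lambda>\<omega>. (norm (h (Y \<omega>, Z \<omega>)))\<^sup>2)"
    by (rule integrableI_nonneg) (use main in \<open>auto simp: le_less_trans\<close>)
  then show "square_integrable (\<lambda>\<omega>. h (Y \<omega>, Z \<omega>))" by (simp add: square_integrable_def)
  have "0 \<le> (\<integral>\<omega>. V (Y \<omega>) \<partial>M)" using V0 measurable_space[OF Y] by (intro integral_nonneg_AE AE_I2) auto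
  then show "(\<integral>\<omega>. (norm (h (Y \<omega>, Z \<omega>)))\<^sup>2 \<partial>M) \<le> (\<integral>\<omega>. V (Y \<omega>) \<partial>M)"
    using main nn_integral_eq_integral[OF int] by simp
qed

text \<open>The summands are uncorrelated: for two indices \<open>i\<close> and \<open>j\<close> the
  sample \<open>Z i\<close> is counted as part of the past of \<open>Z j\<close>, so
  \<open>independent_mean_zero\<close> applies with the \<open>i\<close>-th summand as the known
  factor. Hence the division by \<open>n\<close> in the second moment.\<close>

lemma independent_batch:
  fixes h :: "'n \<times> 'k \<Rightarrow> 'b::euclidean_space" and n :: nat
  assumes n: "n > 0"
    and ind: "\<And>i. i < n \<Longrightarrow> independent_pair N Y K (Z i)"
    and cross: "\<And>i j. i < n \<Longrightarrow> j < n \<Longrightarrow> i \<noteq> j \<Longrightarrow> independent_pair (N \<Otimes>\<^sub>M K) (\<lambda>\<omega>. (Y \<omega>, Z i \<omega>)) K (Z j)"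
    and law: "\<And>i. i < n \<Longrightarrow> distr M K (Z i) = D"
    and h[measurable]: "h \<in> borel_measurable (N \<Otimes>\<^sub>M K)"
    and V[measurable]: "V \<in> borel_measurable N" and Vint: "integrable M (\<lambda>\<omega>. V (Y \<omega>))"
    and le: "\<And>y. y \<in> space N \<Longrightarrow> integrable D (\<lambda>s. (norm (h (y, s)))\<^sup>2) \<and> (\<integral>s. (norm (h (y, s)))\<^sup>2 \<partial>D) \<le> V y"
    and mean: "\<And>y. y \<in> space N \<Longrightarrow> integrable D (\<lambda>s. h (y, s)) \<and> (\<integral>s. h (y, s) \<partial>D) = 0"
  defines "\<zeta> \<equiv> (\<lambda>\<omega>. (1 / real n) *\<^sub>R (\<Sum>i<n. h (Y \<omega>, Z i \<omega>)))"
  shows "square_integrable \<zeta>"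
    and "(\<integral>\<omega>. (norm (\<zeta> \<omega>))\<^sup>2 \<partial>M) \<le> (\<integral>\<omega>. V (Y \<omega>) \<partial>M) / n"
    and "\<And>u. u \<in> borel_measurable N \<Longrightarrow> square_integrable (\<lambda>\<omega>. u (Y \<omega>)) \<Longrightarrow> (\<integral>\<omega>. u (Y \<omega>) \<bullet> \<zeta> \<omega> \<partial>M) = 0"
proof -
  define H where "H i \<omega> = h (Y \<omega>, Z i \<omega>)" for i \<omega>
  have sq: "square_integrable (H i)" and mom: "(\<integral>\<omega>. (norm (H i \<omega>))\<^sup>2 \<partial>M) \<le> (\<integral>\<omega>. V (Y \<omega>) \<partial>M)" if "i < n" for i
    unfolding H_def using le law[OF that]
    by (intro independent_second_moment[OF ind[OF that] h V Vint]; simp)+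
  have sqs: "square_integrable (\<lambda>\<omega>. \<Sum>i<n. H i \<omega>)" by (intro square_integrable_sum sq) auto
  show sq\<zeta>: "square_integrable \<zeta>"
    unfolding \<zeta>_def H_def[symmetric] by (intro square_integrable_scaleR sqs)
  have cr: "(\<integral>\<omega>. H i \<omega> \<bullet> H j \<omega> \<partial>M) = 0" if ij: "i < n" "j < n" "i \<noteq> j" for i j
  proof -
    have "(\<lambda>p. h (fst (fst p), snd p)) \<in> borel_measurable ((N \<Otimes>\<^sub>M K) \<Otimes>\<^sub>M K)" by measurable
    from independent_mean_zero[OF cross[OF ij] this h] show ?thesis
      using sq[OF ij(1)] sq[OF ij(2)] mean law[OF ij(2)] unfolding H_def by (auto simp: space_pair_measure)
  qed
  have "(\<integral>\<omega>. (norm (\<Sum>i<n. H i \<omega>))\<^sup>2 \<partial>M) = (\<integral>\<omega>. (\<Sum>i<n. \<Sum>j<n. H i \<omega> \<bullet> H j \<omega>) \<partial>M)"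
    unfolding power2_norm_eq_inner by (subst inner_sum_left, subst inner_sum_right) (rule refl)
  also have "\<dots> = (\<Sum>i<n. \<Sum>j<n. (\<integral>\<omega>. H i \<omega> \<bullet> H j \<omega> \<partial>M))"
  proof -
    have "integrable M (\<lambda>\<omega>. H i \<omega> \<bullet> H j \<omega>)" if "i < n" "j < n" for i j
      using that by (intro square_integrable_inner sq)
    note ij = this
    have "(\<integral>\<omega>. (\<Sum>i<n. \<Sum>j<n. H i \<omega> \<bullet> H j \<omega>) \<partial>M) = (\<Sum>i<n. \<integral>\<omega>. (\<Sum>j<n. H i \<omega> \<bullet> H j \<omega>) \<partial>M)"
      by (intro Bochner_Integration.integral_sum Bochner_Integration.integrable_sum ij) auto
    also have "\<dots> = (\<Sum>i<n. \<Sum>j<n. \<integral>\<omega>. H i \<omega> \<bullet> H j \<omega> \<partial>M)"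
      by (intro sum.cong refl Bochner_Integration.integral_sum ij) auto
    finally show ?thesis .
  qed
  also have "\<dots> = (\<Sum>i<n. (\<integral>\<omega>. H i \<omega> \<bullet> H i \<omega> \<partial>M))"
  proof (rule sum.cong[OF refl])
    fix i assume i: "i \<in> {..<n}"
    have "(\<Sum>j<n. (\<integral>\<omega>. H i \<omega> \<bullet> H j \<omega> \<partial>M)) = (\<Sum>j<n. if j = i then (\<integral>\<omega>. H i \<omega> \<bullet> H i \<omega> \<partial>M) else 0)"
      using i cr by (intro sum.cong) auto
    then show "(\<Sum>j<n. (\<integral>\<omega>. H i \<omega> \<bullet> H j \<omega> \<partial>M)) = (\<integral>\<omega>. H i \<omega> \<bullet> H i \<omega> \<partial>M)" using i by simp
  qed
  also have "\<dots> \<le> (\<Sum>i<n. (\<integral>\<omega>. V (Y \<omega>) \<partial>M))"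
    using mom by (intro sum_mono) (simp add: power2_norm_eq_inner)
  finally have S: "(\<integral>\<omega>. (norm (\<Sum>i<n. H i \<omega>))\<^sup>2 \<partial>M) \<le> n * (\<integral>\<omega>. V (Y \<omega>) \<partial>M)" by simp
  have "(\<integral>\<omega>. (norm (\<zeta> \<omega>))\<^sup>2 \<partial>M) = (1 / real n)\<^sup>2 * (\<integral>\<omega>. (norm (\<Sum>i<n. H i \<omega>))\<^sup>2 \<partial>M)"
    unfolding \<zeta>_def H_def[symmetric] by (simp add: power_divide)
  also have "\<dots> \<le> (1 / real n)\<^sup>2 * (n * (\<integral>\<omega>. V (Y \<omega>) \<partial>M))" using S by (intro mult_left_mono) auto
  also have "\<dots> = (\<integral>\<omega>. V (Y \<omega>) \<partial>M) / n" using n by (simp add: power2_eq_square)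
  finally show "(\<integral>\<omega>. (norm (\<zeta> \<omega>))\<^sup>2 \<partial>M) \<le> (\<integral>\<omega>. V (Y \<omega>) \<partial>M) / n" .
  fix u :: "'n \<Rightarrow> 'b" assume u: "u \<in> borel_measurable N" "square_integrable (\<lambda>\<omega>. u (Y \<omega>))"
  have z: "(\<integral>\<omega>. u (Y \<omega>) \<bullet> H i \<omega> \<partial>M) = 0" if "i < n" for i
    unfolding H_def using mean law[OF that] sq[OF that, unfolded H_def]
    by (intro independent_mean_zero[OF ind[OF that] h u(1) _ u(2)]) auto
  have "(\<integral>\<omega>. u (Y \<omega>) \<bullet> \<zeta> \<omega> \<partial>M) = (1 / real n) * (\<integral>\<omega>. (\<Sum>i<n. u (Y \<omega>) \<bullet> H i \<omega>) \<partial>M)"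
    unfolding \<zeta>_def H_def[symmetric] by (simp add: inner_sum_right)
  also have "(\<integral>\<omega>. (\<Sum>i<n. u (Y \<omega>) \<bullet> H i \<omega>) \<partial>M) = (\<Sum>i<n. (\<integral>\<omega>. u (Y \<omega>) \<bullet> H i \<omega> \<partial>M))"
    using sq u(2) by (intro Bochner_Integration.integral_sum square_integrable_inner) auto
  also have "\<dots> = 0" using z by simp
  finally show "(\<integral>\<omega>. u (Y \<omega>) \<bullet> \<zeta> \<omega> \<partial>M) = 0" by simp
qed

end

section \<open>Functions with Lipschitz gradient\<close>

lemma gradient_lipschitz_descent:
  fixes h :: "'a::euclidean_space \<Rightarrow> real"
  assumes G: "\<And>x. GDERIV h x :> g x" and lip: "k-lipschitz_on UNIV g"
  shows "\<bar>h z - h x - g x \<bullet> (z - x)\<bar> \<le> k / 2 * (norm (z - x))\<^sup>2"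
proof -
  let ?p = "z - x"
  have der: "((\<lambda>t. h (x + t *\<^sub>R ?p)) has_real_derivative (g (x + t *\<^sub>R ?p) \<bullet> ?p)) (at t)" for t
  proof -
    have "((\<lambda>t. h (x + t *\<^sub>R ?p)) has_derivative (\<lambda>s. (s *\<^sub>R ?p) \<bullet> g (x + t *\<^sub>R ?p))) (at t)"
    proof (rule has_derivative_compose[of "\<lambda>t. x + t *\<^sub>R ?p" "\<lambda>s. s *\<^sub>R ?p" t UNIV h "\<lambda>u. u \<bullet> g (x + t *\<^sub>R ?p)"])
      show "((\<lambda>t. x + t *\<^sub>R ?p) has_derivative (\<lambda>s. s *\<^sub>R ?p)) (at t)" by (auto intro!: derivative_eq_intros)
      show "(h has_derivative (\<lambda>u. u \<bullet> g (x + t *\<^sub>R ?p))) (at (x + t *\<^sub>R ?p))" using G by (simp add: gderiv_def)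
    qed
    then show ?thesis by (rule has_derivative_imp_has_field_derivative) (simp add: inner_commute)
  qed
  have bnd: "\<bar>g (x + t *\<^sub>R ?p) \<bullet> ?p - g x \<bullet> ?p\<bar> \<le> k * t * (norm ?p)\<^sup>2" if "0 \<le> t" for t
  proof -
    have "\<bar>(g (x + t *\<^sub>R ?p) - g x) \<bullet> ?p\<bar> \<le> norm (g (x + t *\<^sub>R ?p) - g x) * norm ?p" by (rule Cauchy_Schwarz_ineq2)
    also have "\<dots> \<le> (k * norm (t *\<^sub>R ?p)) * norm ?p"
      using lipschitz_onD[OF lip, of "x + t *\<^sub>R ?p" x] by (intro mult_right_mono) (auto simp: dist_norm)
    finally show ?thesis using that by (simp add: inner_diff_left power2_eq_square mult_ac)
  qed
  have mono: "s * (h z - h x - g x \<bullet> ?p) \<le> k / 2 * (norm ?p)\<^sup>2" if s: "\<bar>s\<bar> = 1" for s :: real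
  proof -
    \<comment> \<open>\<open>s\<close> is a sign, so one monotonicity argument yields both the upper
      and the lower bound.\<close>
    define \<phi> where "\<phi> t = s * (h (x + t *\<^sub>R ?p) - t * (g x \<bullet> ?p)) - k / 2 * t\<^sup>2 * (norm ?p)\<^sup>2" for t
    have "\<phi> 1 \<le> \<phi> 0"
    proof (rule DERIV_nonpos_imp_nonincreasing[of 0 1 \<phi>])
      fix t :: real assume t: "0 \<le> t" "t \<le> 1"
      have "(\<phi> has_real_derivative (s * (g (x + t *\<^sub>R ?p) \<bullet> ?p - g x \<bullet> ?p) - k * t * (norm ?p)\<^sup>2)) (at t)"
        unfolding \<phi>_def[abs_def] by (auto intro!: derivative_eq_intros der)
      moreover have "s * (g (x + t *\<^sub>R ?p) \<bullet> ?p - g x \<bullet> ?p) \<le> \<bar>s * (g (x + t *\<^sub>R ?p) \<bullet> ?p - g x \<bullet> ?p)\<bar>" by (rule abs_ge_self)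
      then have "s * (g (x + t *\<^sub>R ?p) \<bullet> ?p - g x \<bullet> ?p) - k * t * (norm ?p)\<^sup>2 \<le> 0"
        using bnd[OF t(1)] s by (simp add: abs_mult)
      ultimately show "\<exists>y. (\<phi> has_real_derivative y) (at t) \<and> y \<le> 0" by blast
    qed simp
    then show ?thesis by (simp add: \<phi>_def algebra_simps)
  qed
  have "1 * (h z - h x - g x \<bullet> ?p) \<le> k / 2 * (norm ?p)\<^sup>2" "(- 1) * (h z - h x - g x \<bullet> ?p) \<le> k / 2 * (norm ?p)\<^sup>2"
    by (rule mono; simp)+
  then show ?thesis by (intro abs_leI) (simp_all only: mult_1_left mult_minus1)
qed

text \<open>The upper parabola at \<open>x\<close> and the lower parabola at \<open>y\<close> are compared at the point where their
  gap is smallest.\<close>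

lemma gradient_lipschitz_interpolation:
  fixes h :: "'a::euclidean_space \<Rightarrow> real"
  assumes G: "\<And>x. GDERIV h x :> g x" and lip: "k-lipschitz_on UNIV g" and k: "k > 0"
  shows "h y \<le> h x + (g x + g y) \<bullet> (y - x) / 2 + k / 4 * (norm (y - x))\<^sup>2 - (norm (g y - g x))\<^sup>2 / (4 * k)"
proof -
  \<comment> \<open>\<open>z\<close> is the midpoint of \<open>x\<close> and \<open>y\<close>
    shifted by the \<open>s\<close> for which the gradient of the gap,
    \<open>g x - g y + k *\<^sub>R (z - x) + k *\<^sub>R (z - y)\<close>, vanishes.\<close>
  define p where "p = (1/2) *\<^sub>R (y - x)"
  define s where "s = (1 / (2 * k)) *\<^sub>R (g y - g x)"
  define z where "z = x + p + s"
  have zx: "z - x = p + s" by (simp add: z_def)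
  have zy: "z - y = s - p"
  proof -
    have "p + p = 2 *\<^sub>R p" by (rule scaleR_2[symmetric])
    also have "\<dots> = y - x" by (simp add: p_def)
    finally have "y = x + (p + p)" by simp
    then show ?thesis by (simp add: z_def)
  qed
  have \<gamma>: "g y - g x = (2 * k) *\<^sub>R s" and yx: "y - x = 2 *\<^sub>R p" using k by (simp_all add: s_def p_def)
  have gy: "g y = g x + (2 * k) *\<^sub>R s" using \<gamma> by (simp add: algebra_simps)
  have 1: "h z \<le> h x + g x \<bullet> (p + s) + k / 2 * (norm (p + s))\<^sup>2"
    using gradient_lipschitz_descent[OF G lip, of z x] unfolding zx by linarith
  have 2: "h y \<le> h z - g y \<bullet> (s - p) + k / 2 * (norm (s - p))\<^sup>2"
    using gradient_lipschitz_descent[OF G lip, of z y] unfolding zy by linarith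
  define a b e P S where "a = g x \<bullet> p" and "b = g x \<bullet> s" and "e = p \<bullet> s" and "P = (norm p)\<^sup>2" and "S = (norm s)\<^sup>2"
  have t: "g x \<bullet> (p + s) = a + b" "(norm (p + s))\<^sup>2 = P + 2 * e + S" "(norm (s - p))\<^sup>2 = S - 2 * e + P"
    "g y \<bullet> (s - p) = b - a + 2 * k * S - 2 * k * e"
    "(g x + g y) \<bullet> (2 *\<^sub>R p) = 4 * a + 4 * k * e" "(norm (2 *\<^sub>R p))\<^sup>2 = 4 * P" "(norm ((2 * k) *\<^sub>R s))\<^sup>2 = 4 * k * (k * S)"
    unfolding norm_add_squared norm_diff_squared gy a_def b_def e_def P_def S_def
    by (simp_all add: inner_add_left inner_add_right inner_diff_right inner_commute power_mult_distrib
        power2_norm_eq_inner[symmetric] power2_eq_square[of k] algebra_simps)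
  have "g x \<bullet> (p + s) + k / 2 * (norm (p + s))\<^sup>2 - g y \<bullet> (s - p) + k / 2 * (norm (s - p))\<^sup>2 =
     (g x + g y) \<bullet> (2 *\<^sub>R p) / 2 + k / 4 * (norm (2 *\<^sub>R p))\<^sup>2 - (norm ((2 * k) *\<^sub>R s))\<^sup>2 / (4 * k)"
    unfolding t using k by (simp add: field_simps)
  then show ?thesis using 1 2 unfolding \<gamma> yx by linarith
qed

section \<open>Runs of the algorithm\<close>

lemma zo_batch_sample:
  "zo_batch F \<delta> x (sample z t n) = (1 / real n) *\<^sub>R (\<Sum>i<n. zo_grad F \<delta> x (z t i))"
  by (simp add: zo_batch_def sample_def interv_sum_list_conv_sum_set_nat atLeast0LessThan comp_def)

lemma gfm_plus_cong:
  assumes "\<And>s i. s \<le> t \<Longrightarrow> z s i = z' s i"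
  shows "gfm_plus F \<delta> x0 \<eta> m b b' z t = gfm_plus F \<delta> x0 \<eta> m b b' z' t"
  using assms
proof (induction t)
  case (Suc t)
  have "gfm_plus F \<delta> x0 \<eta> m b b' z t = gfm_plus F \<delta> x0 \<eta> m b b' z' t"
    by (rule Suc.IH) (use Suc.prems in auto)
  moreover have "sample z (Suc t) n = sample z' (Suc t) n" for n using Suc.prems by (simp add: sample_def)
  ultimately show ?case by (simp add: Let_def case_prod_beta)
next
  case 0
  then have "z 0 = z' 0" by auto
  then show ?case by (simp add: sample_def)
qed

text \<open>Of the relations among the parameters only the bound on the step size is recorded, as a
  Lipschitz constant of \<open>g\<close>; the one between \<open>b\<close>, \<open>m\<close> and
  \<open>\<eta>\<close> enters when whole epochs are treated.\<close>

locale gfm = zo_oracle \<Xi> F Lip L \<delta> + P: prob_space P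
  for \<Xi> :: "'xi measure" and F :: "'a::euclidean_space \<Rightarrow> 'xi \<Rightarrow> real" and Lip L \<delta> and P :: "'p measure" +
  fixes Z :: "nat \<Rightarrow> nat \<Rightarrow> 'p \<Rightarrow> 'xi \<times> 'a" and x0 :: 'a and \<eta> :: real and m b b' :: nat and g :: "'a \<Rightarrow> 'a"
  assumes indep: "P.indep_vars (\<lambda>_. M0) (\<lambda>(t, i). Z t i) UNIV"
    and law: "distr P M0 (Z t i) = M0"
    and \<eta>: "\<eta> > 0" and b: "b > 0" and b': "b' > 0"
    and G: "GDERIV (smoothing \<delta> f) x :> g x"
    and g_lipschitz: "(1 / \<eta>)-lipschitz_on UNIV g"
begin

definition Zv :: "'p \<Rightarrow> nat \<times> nat \<Rightarrow> 'xi \<times> 'a" where "Zv \<omega> = (\<lambda>(t, i). Z t i \<omega>)"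

text \<open>A function of the array of samples rather than of \<open>\<omega>\<close>: measurability
  with respect to some of the coordinates then yields independence from all others.\<close>

definition state :: "nat \<Rightarrow> (nat \<times> nat \<Rightarrow> 'xi \<times> 'a) \<Rightarrow> 'a \<times> 'a" where
  "state t \<rho> = gfm_plus F \<delta> x0 \<eta> m b b' (\<lambda>s i. \<rho> (s, i)) t"

definition X :: "nat \<Rightarrow> 'p \<Rightarrow> 'a" where "X t \<omega> = fst (state t (Zv \<omega>))"
definition V :: "nat \<Rightarrow> 'p \<Rightarrow> 'a" where "V t \<omega> = snd (state t (Zv \<omega>))"
definition E :: "nat \<Rightarrow> 'p \<Rightarrow> 'a" where "E t \<omega> = V t \<omega> - g (X t \<omega>)"

abbreviation sq :: "('p \<Rightarrow> 'a) \<Rightarrow> bool" where "sq \<equiv> P.square_integrable"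

lemma X_eq: "X t \<omega> = gfm_iterate F \<delta> x0 \<eta> m b b' (\<lambda>t i. Z t i \<omega>) t"
  by (simp add: X_def state_def Zv_def gfm_iterate_def)

lemma X_0: "X 0 \<omega> = x0"
  by (simp add: X_def state_def)

lemma X_Suc: "X (Suc t) \<omega> = X t \<omega> - \<eta> *\<^sub>R V t \<omega>"
  by (simp add: X_def V_def state_def Let_def case_prod_beta)

lemma V_restart:
  assumes "t mod m = 0"
  shows "V t \<omega> = (1 / real b') *\<^sub>R (\<Sum>i<b'. zo_grad F \<delta> (X t \<omega>) (Z t i \<omega>))"
  using assms
  by (cases t) (simp_all add: X_def V_def state_def Let_def case_prod_beta zo_batch_sample Zv_def)

lemma V_update:
  assumes "Suc t mod m \<noteq> 0"
  shows "V (Suc t) \<omega> = V t \<omega> + (1 / real b) *\<^sub>R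
    (\<Sum>i<b. zo_grad F \<delta> (X t \<omega> - \<eta> *\<^sub>R V t \<omega>) (Z (Suc t) i \<omega>) - zo_grad F \<delta> (X t \<omega>) (Z (Suc t) i \<omega>))"
  using assms
  by (simp add: X_def V_def state_def Let_def case_prod_beta zo_batch_sample Zv_def sum_subtractf scaleR_diff_right)

lemma Z_measurable [measurable]: "Z t i \<in> P \<rightarrow>\<^sub>M M0"
  using indep unfolding P.indep_vars_def by (auto dest: bspec[of _ _ "(t, i)"])

lemma Zv_measurable: "Zv \<in> P \<rightarrow>\<^sub>M PiM UNIV (\<lambda>_. M0)"
proof (rule measurable_PiM_single')
  show "(\<lambda>\<omega>. Zv \<omega> k) \<in> P \<rightarrow>\<^sub>M M0" for k
    using Z_measurable[of "fst k" "snd k"] by (simp add: Zv_def case_prod_beta)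
  then show "Zv \<in> space P \<rightarrow> (\<Pi>\<^sub>E k\<in>UNIV. space M0)" by (auto dest: measurable_space)
qed

lemma g_measurable [measurable]: "g \<in> borel_measurable borel"
  using g_lipschitz by (intro borel_measurable_continuous_onI lipschitz_on_continuous_on)

lemma zo_grad_comp_measurable:
  assumes "Y \<in> M \<rightarrow>\<^sub>M borel" "S \<in> M \<rightarrow>\<^sub>M M0"
  shows "(\<lambda>\<omega>. zo_grad F \<delta> (Y \<omega>) (S \<omega>)) \<in> M \<rightarrow>\<^sub>M borel"
proof -
  have "(\<lambda>\<omega>. (Y \<omega>, S \<omega>)) \<in> M \<rightarrow>\<^sub>M borel \<Otimes>\<^sub>M M0" using assms by (rule measurable_Pair)
  from measurable_compose[OF this zo_grad_measurable_pair] show ?thesis by simp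
qed

text \<open>The index set \<open>A\<close> is left open, since both the whole array and the samples
  up to a given time are needed.\<close>

lemma state_measurable:
  assumes "{..t} \<times> UNIV \<subseteq> A"
  shows "state t \<in> PiM A (\<lambda>_. M0) \<rightarrow>\<^sub>M borel \<Otimes>\<^sub>M borel"
  using assms
proof (induction t)
  case 0
  have Z: "(\<lambda>\<rho>. \<rho> (0, i)) \<in> PiM A (\<lambda>_. M0) \<rightarrow>\<^sub>M M0" for i :: nat
    using 0 by (intro measurable_component_singleton) auto
  have [measurable]: "(\<lambda>\<rho>. zo_grad F \<delta> x0 (\<rho> (0, i))) \<in> PiM A (\<lambda>_. M0) \<rightarrow>\<^sub>M borel" for i :: nat
    by (rule zo_grad_comp_measurable[OF _ Z]) simp
  have "(\<lambda>\<rho>. (x0, (1 / real b') *\<^sub>R (\<Sum>i<b'. zo_grad F \<delta> x0 (\<rho> (0, i))))) \<in> PiM A (\<lambda>_. M0) \<rightarrow>\<^sub>M borel \<Otimes>\<^sub>M borel"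
    by measurable
  then show ?case by (simp add: state_def[abs_def] zo_batch_sample)
next
  case (Suc t)
  have IH: "state t \<in> PiM A (\<lambda>_. M0) \<rightarrow>\<^sub>M borel \<Otimes>\<^sub>M borel"
    by (rule Suc.IH) (use Suc.prems in auto)
  have x[measurable]: "(\<lambda>\<rho>. fst (state t \<rho>)) \<in> PiM A (\<lambda>_. M0) \<rightarrow>\<^sub>M borel" "(\<lambda>\<rho>. snd (state t \<rho>)) \<in> PiM A (\<lambda>_. M0) \<rightarrow>\<^sub>M borel"
    by (rule measurable_compose[OF IH measurable_fst] measurable_compose[OF IH measurable_snd])+
  have Z: "(\<lambda>\<rho>. \<rho> (Suc t, i)) \<in> PiM A (\<lambda>_. M0) \<rightarrow>\<^sub>M M0" for i :: nat
    using Suc.prems by (intro measurable_component_singleton) auto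
  have [measurable]: "(\<lambda>\<rho>. zo_grad F \<delta> (fst (state t \<rho>)) (\<rho> (Suc t, i))) \<in> PiM A (\<lambda>_. M0) \<rightarrow>\<^sub>M borel"
    "(\<lambda>\<rho>. zo_grad F \<delta> (fst (state t \<rho>) - \<eta> *\<^sub>R snd (state t \<rho>)) (\<rho> (Suc t, i))) \<in> PiM A (\<lambda>_. M0) \<rightarrow>\<^sub>M borel" for i :: nat
    by (rule zo_grad_comp_measurable[OF _ Z]; measurable)+
  have "state (Suc t) = (\<lambda>\<rho>. (fst (state t \<rho>) - \<eta> *\<^sub>R snd (state t \<rho>),
     if Suc t mod m = 0 then (1 / real b') *\<^sub>R (\<Sum>i<b'. zo_grad F \<delta> (fst (state t \<rho>) - \<eta> *\<^sub>R snd (state t \<rho>)) (\<rho> (Suc t, i)))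
     else snd (state t \<rho>) + (1 / real b) *\<^sub>R (\<Sum>i<b. zo_grad F \<delta> (fst (state t \<rho>) - \<eta> *\<^sub>R snd (state t \<rho>)) (\<rho> (Suc t, i)))
       - (1 / real b) *\<^sub>R (\<Sum>i<b. zo_grad F \<delta> (fst (state t \<rho>)) (\<rho> (Suc t, i)))))"
    by (simp add: state_def fun_eq_iff Let_def case_prod_beta zo_batch_sample)
  also have "\<dots> \<in> PiM A (\<lambda>_. M0) \<rightarrow>\<^sub>M borel \<Otimes>\<^sub>M borel"
    by (cases "Suc t mod m = 0") (simp_all only: if_True if_False simp_thms, measurable)
  finally show ?case .
qed

lemma state_restrict:
  assumes "{..t} \<times> UNIV \<subseteq> A"
  shows "state t (restrict \<rho> A) = state t \<rho>"
  unfolding state_def using assms by (intro gfm_plus_cong) auto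

lemma XV_measurable [measurable]:
  "X t \<in> borel_measurable P" "V t \<in> borel_measurable P"
proof -
  have "(\<lambda>\<omega>. state t (Zv \<omega>)) \<in> P \<rightarrow>\<^sub>M borel \<Otimes>\<^sub>M borel"
    by (rule measurable_compose[OF Zv_measurable state_measurable]) simp
  from measurable_compose[OF this measurable_fst] measurable_compose[OF this measurable_snd]
  show "X t \<in> borel_measurable P" "V t \<in> borel_measurable P" by (simp_all add: X_def[abs_def] V_def[abs_def])
qed

lemma independent_past:
  assumes \<phi>: "\<phi> \<in> PiM A (\<lambda>_. M0) \<rightarrow>\<^sub>M N" and k: "(t, i) \<notin> A"
  shows "P.independent_pair N (\<lambda>\<omega>. \<phi> (restrict (Zv \<omega>) A)) M0 (Z t i)"
proof -
  have *: "P.indep_var (PiM A (\<lambda>_. M0)) (\<lambda>\<omega>. restrict (\<lambda>k. (\<lambda>(t, i). Z t i) k \<omega>) A)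
    (PiM {(t, i)} (\<lambda>_. M0)) (\<lambda>\<omega>. restrict (\<lambda>k. (\<lambda>(t, i). Z t i) k \<omega>) {(t, i)})"
    by (rule P.indep_var_restrict[OF indep]) (use k in auto)
  have "(\<lambda>\<rho>. \<rho> (t, i)) \<in> PiM {(t, i)} (\<lambda>_. M0) \<rightarrow>\<^sub>M M0" by (rule measurable_component_singleton) simp
  from P.independent_pair_compose[OF * \<phi> this]
  show ?thesis by (simp add: Zv_def case_prod_beta')
qed

lemma independent_past_cross:
  assumes \<phi>: "\<phi> \<in> PiM A (\<lambda>_. M0) \<rightarrow>\<^sub>M N" and k: "(t, i) \<notin> A" "(t, j) \<notin> A" "i \<noteq> j"
  shows "P.independent_pair (N \<Otimes>\<^sub>M M0) (\<lambda>\<omega>. (\<phi> (restrict (Zv \<omega>) A), Z t i \<omega>)) M0 (Z t j)"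
proof -
  let ?B = "insert (t, i) A"
  have 1: "(\<lambda>\<rho>. \<phi> (restrict \<rho> A)) \<in> PiM ?B (\<lambda>_. M0) \<rightarrow>\<^sub>M N"
    by (rule measurable_compose[OF measurable_restrict_subset \<phi>]) auto
  have 2: "(\<lambda>\<rho>. \<rho> (t, i)) \<in> PiM ?B (\<lambda>_. M0) \<rightarrow>\<^sub>M M0" by (rule measurable_component_singleton) simp
  have "P.independent_pair (N \<Otimes>\<^sub>M M0) (\<lambda>\<omega>. (\<lambda>\<rho>. (\<phi> (restrict \<rho> A), \<rho> (t, i))) (restrict (Zv \<omega>) ?B)) M0 (Z t j)"
    using k by (intro independent_past measurable_Pair 1 2) auto
  moreover have "restrict (restrict (Zv \<omega>) ?B) A = restrict (Zv \<omega>) A" for \<omega>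
    by (simp add: restrict_restrict Int_absorb1 subset_insertI)
  ultimately show ?thesis by (simp add: Zv_def)
qed

lemma batch_estimate:
  fixes h :: "'n \<times> ('xi \<times> 'a) \<Rightarrow> 'a" and W :: "'n \<Rightarrow> real" and n t :: nat
  assumes n: "n > 0" and \<phi>: "\<phi> \<in> PiM A (\<lambda>_. M0) \<rightarrow>\<^sub>M N" and A: "\<And>i. (t, i) \<notin> A"
    and Y: "\<And>\<omega>. Y \<omega> = \<phi> (restrict (Zv \<omega>) A)"
    and h: "h \<in> borel_measurable (N \<Otimes>\<^sub>M M0)" and W: "W \<in> borel_measurable N" "integrable P (\<lambda>\<omega>. W (Y \<omega>))"
    and le: "\<And>y. integrable M0 (\<lambda>s. (norm (h (y, s)))\<^sup>2)" "\<And>y. (\<integral>s. (norm (h (y, s)))\<^sup>2 \<partial>M0) \<le> W y"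
    and mean: "\<And>y. integrable M0 (\<lambda>s. h (y, s))" "\<And>y. (\<integral>s. h (y, s) \<partial>M0) = 0"
  defines "\<zeta> \<equiv> (\<lambda>\<omega>. (1 / real n) *\<^sub>R (\<Sum>i<n. h (Y \<omega>, Z t i \<omega>)))"
  shows "sq \<zeta>"
    and "(\<integral>\<omega>. (norm (\<zeta> \<omega>))\<^sup>2 \<partial>P) \<le> (\<integral>\<omega>. W (Y \<omega>) \<partial>P) / n"
    and "\<And>u. u \<in> borel_measurable N \<Longrightarrow> sq (\<lambda>\<omega>. u (Y \<omega>)) \<Longrightarrow> (\<integral>\<omega>. u (Y \<omega>) \<bullet> \<zeta> \<omega> \<partial>P) = 0"
proof -
  have ind: "P.independent_pair N Y M0 (Z t i)" for i
    unfolding Y[abs_def] by (rule independent_past[OF \<phi> A])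
  have cross: "P.independent_pair (N \<Otimes>\<^sub>M M0) (\<lambda>\<omega>. (Y \<omega>, Z t i \<omega>)) M0 (Z t j)" if "i \<noteq> j" for i j
    unfolding Y by (rule independent_past_cross[OF \<phi> A A that])
  note batch = P.independent_batch[where Z="Z t" and n=n and Y=Y and N=N and K=M0 and D=M0 and h=h and V=W,
    OF n ind cross law h W(1) W(2) conjI[OF le] conjI[OF mean]]
  show "sq \<zeta>" unfolding \<zeta>_def by (rule batch(1))
  show "(\<integral>\<omega>. (norm (\<zeta> \<omega>))\<^sup>2 \<partial>P) \<le> (\<integral>\<omega>. W (Y \<omega>) \<partial>P) / n" unfolding \<zeta>_def by (rule batch(2))
  show "(\<integral>\<omega>. u (Y \<omega>) \<bullet> \<zeta> \<omega> \<partial>P) = 0" if "u \<in> borel_measurable N" "sq (\<lambda>\<omega>. u (Y \<omega>))" for u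
    unfolding \<zeta>_def using that by (rule batch(3)[rotated])
qed

section \<open>The error of the gradient estimate\<close>

lemma norm_g_le: "norm (g x) \<le> L"
  by (rule GDERIV_norm_le[OF smoothing_lipschitz[OF f_lipschitz] G])

text \<open>Centring subtracts \<open>(norm (g x))\<^sup>2\<close> from the second moment, so the
  variance inherits its bound.\<close>

lemma zo_grad_centered:
  shows "integrable M0 (\<lambda>s. zo_grad F \<delta> x s - g x)" "(\<integral>s. zo_grad F \<delta> x s - g x \<partial>M0) = 0"
    "integrable M0 (\<lambda>s. (norm (zo_grad F \<delta> x s - g x))\<^sup>2)"
    "(\<integral>s. (norm (zo_grad F \<delta> x s - g x))\<^sup>2 \<partial>M0) \<le> pi\<^sup>2 * DIM('a) * L\<^sup>2"
proof -
  note i = zo_grad_integrable[of x] and u = zo_grad_unbiased[OF G, of x]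
  show "integrable M0 (\<lambda>s. zo_grad F \<delta> x s - g x)" using i by simp
  show "(\<integral>s. zo_grad F \<delta> x s - g x \<partial>M0) = 0" using i u Q.prob_space by simp
  have e: "(norm (zo_grad F \<delta> x s - g x))\<^sup>2 = (norm (zo_grad F \<delta> x s))\<^sup>2 - 2 * (zo_grad F \<delta> x s \<bullet> g x) + (norm (g x))\<^sup>2" for s
    by (rule norm_diff_squared)
  show "integrable M0 (\<lambda>s. (norm (zo_grad F \<delta> x s - g x))\<^sup>2)"
    unfolding e using i zo_grad_moment(1)[of x] by simp
  have "(\<integral>s. (norm (zo_grad F \<delta> x s - g x))\<^sup>2 \<partial>M0) = (\<integral>s. (norm (zo_grad F \<delta> x s))\<^sup>2 \<partial>M0) - 2 * ((\<integral>s. zo_grad F \<delta> x s \<partial>M0) \<bullet> g x) + (norm (g x))\<^sup>2"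
    unfolding e using i zo_grad_moment(1)[of x] Q.prob_space by simp
  also have "\<dots> \<le> (\<integral>s. (norm (zo_grad F \<delta> x s))\<^sup>2 \<partial>M0)" unfolding u by (simp add: power2_norm_eq_inner)
  also have "\<dots> \<le> pi\<^sup>2 * DIM('a) * L\<^sup>2" by (rule zo_grad_moment(2))
  finally show "(\<integral>s. (norm (zo_grad F \<delta> x s - g x))\<^sup>2 \<partial>M0) \<le> pi\<^sup>2 * DIM('a) * L\<^sup>2" .
qed

lemma zo_grad_diff_centered:
  shows "integrable M0 (\<lambda>s. zo_grad F \<delta> x s - zo_grad F \<delta> y s - (g x - g y))"
    "(\<integral>s. zo_grad F \<delta> x s - zo_grad F \<delta> y s - (g x - g y) \<partial>M0) = 0"
    "integrable M0 (\<lambda>s. (norm (zo_grad F \<delta> x s - zo_grad F \<delta> y s - (g x - g y)))\<^sup>2)"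
    "(\<integral>s. (norm (zo_grad F \<delta> x s - zo_grad F \<delta> y s - (g x - g y)))\<^sup>2 \<partial>M0) \<le> (DIM('a) * L / \<delta>)\<^sup>2 * (norm (x - y))\<^sup>2"
proof -
  let ?D = "\<lambda>s. zo_grad F \<delta> x s - zo_grad F \<delta> y s"
  have i: "integrable M0 ?D" using zo_grad_integrable by simp
  have u: "(\<integral>s. ?D s \<partial>M0) = g x - g y" using zo_grad_integrable by (simp add: zo_grad_unbiased[OF G])
  show "integrable M0 (\<lambda>s. ?D s - (g x - g y))" using i by simp
  show "(\<integral>s. ?D s - (g x - g y) \<partial>M0) = 0" using i u Q.prob_space by (subst Bochner_Integration.integral_diff) auto
  have e: "(norm (?D s - (g x - g y)))\<^sup>2 = (norm (?D s))\<^sup>2 - 2 * (?D s \<bullet> (g x - g y)) + (norm (g x - g y))\<^sup>2" for s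
    by (rule norm_diff_squared)
  have i2: "integrable M0 (\<lambda>s. ?D s \<bullet> (g x - g y))" using i by (rule integrable_inner_left)
  note m1 = zo_grad_diff_moment(1)[of x y]
  show "integrable M0 (\<lambda>s. (norm (?D s - (g x - g y)))\<^sup>2)"
    unfolding e using i2 m1 by (intro Bochner_Integration.integrable_add Bochner_Integration.integrable_diff integrable_mult_right) auto
  have "(\<integral>s. (norm (?D s - (g x - g y)))\<^sup>2 \<partial>M0) = (\<integral>s. (norm (?D s))\<^sup>2 \<partial>M0) - 2 * (\<integral>s. ?D s \<bullet> (g x - g y) \<partial>M0) + (norm (g x - g y))\<^sup>2"
    unfolding e using i2 m1 Q.prob_space
    by (subst Bochner_Integration.integral_add; (subst Bochner_Integration.integral_diff)?; (intro Bochner_Integration.integrable_diff integrable_mult_right)?; simp)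
  also have "(\<integral>s. ?D s \<bullet> (g x - g y) \<partial>M0) = (g x - g y) \<bullet> (g x - g y)"
    using integral_inner_left[OF i, of "g x - g y"] u by simp
  also have "(\<integral>s. (norm (?D s))\<^sup>2 \<partial>M0) - 2 * ((g x - g y) \<bullet> (g x - g y)) + (norm (g x - g y))\<^sup>2 \<le> (\<integral>s. (norm (?D s))\<^sup>2 \<partial>M0)"
    by (simp add: power2_norm_eq_inner)
  also have "\<dots> \<le> (DIM('a) * L / \<delta>)\<^sup>2 * (norm (x - y))\<^sup>2" by (rule zo_grad_diff_moment(2))
  finally show "(\<integral>s. (norm (?D s - (g x - g y)))\<^sup>2 \<partial>M0) \<le> (DIM('a) * L / \<delta>)\<^sup>2 * (norm (x - y))\<^sup>2" .
qed

lemma g_comp_sq: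
  assumes "Y \<in> borel_measurable P"
  shows "sq (\<lambda>\<omega>. g (Y \<omega>))"
  using measurable_compose[OF assms g_measurable] by (intro P.square_integrable_bounded[where C=L]) (auto simp: norm_g_le)

text \<open>\<open>state t\<close> already contains the batch drawn at time \<open>t\<close>,
  whereas the iterate \<open>X t\<close> is fixed before it; a restart relies on this
  separation.\<close>

lemma X_past:
  obtains \<phi> where "\<phi> \<in> PiM ({..<t} \<times> UNIV) (\<lambda>_. M0) \<rightarrow>\<^sub>M borel"
    "\<And>\<omega>. X t \<omega> = \<phi> (restrict (Zv \<omega>) ({..<t} \<times> UNIV))"
proof (cases t)
  case 0
  then show thesis by (intro that[of "\<lambda>_. x0"]) (simp_all add: X_0)
next
  case (Suc s)
  have sub: "{..s} \<times> UNIV \<subseteq> {..<t} \<times> (UNIV :: nat set)" using Suc by auto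
  note st = state_measurable[OF sub]
  have "(\<lambda>\<rho>. fst (state s \<rho>) - \<eta> *\<^sub>R snd (state s \<rho>)) \<in> PiM ({..<t} \<times> UNIV) (\<lambda>_. M0) \<rightarrow>\<^sub>M borel"
    using measurable_compose[OF st measurable_fst] measurable_compose[OF st measurable_snd] by measurable
  then show thesis
  proof (rule that)
    fix \<omega>
    have "X t \<omega> = X s \<omega> - \<eta> *\<^sub>R V s \<omega>" by (simp add: Suc X_Suc)
    then show "X t \<omega> = fst (state s (restrict (Zv \<omega>) ({..<t} \<times> UNIV))) - \<eta> *\<^sub>R snd (state s (restrict (Zv \<omega>) ({..<t} \<times> UNIV)))"
      by (simp add: X_def V_def state_restrict[OF sub])
  qed
qed

lemma restart:
  assumes t: "t mod m = 0"
  shows "sq (E t)" "(\<integral>\<omega>. (norm (E t \<omega>))\<^sup>2 \<partial>P) \<le> pi\<^sup>2 * DIM('a) * L\<^sup>2 / b'"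
    "(\<integral>\<omega>. g (X t \<omega>) \<bullet> E t \<omega> \<partial>P) = 0"
proof -
  obtain \<phi> where \<phi>: "\<phi> \<in> PiM ({..<t} \<times> UNIV) (\<lambda>_. M0) \<rightarrow>\<^sub>M borel"
    "\<And>\<omega>. X t \<omega> = \<phi> (restrict (Zv \<omega>) ({..<t} \<times> UNIV))" by (rule X_past[of t]) (rule that, assumption+)
  define h where "h p = zo_grad F \<delta> (fst p) (snd p) - g (fst p)" for p
  have h: "h \<in> borel_measurable (borel \<Otimes>\<^sub>M M0)"
    unfolding h_def[abs_def] using zo_grad_measurable_pair by measurable
  have A: "(t, i) \<notin> {..<t} \<times> UNIV" for i :: nat by simp
  have E: "E t = (\<lambda>\<omega>. (1 / real b') *\<^sub>R (\<Sum>i<b'. h (X t \<omega>, Z t i \<omega>)))"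
    using b' by (simp add: fun_eq_iff E_def V_restart[OF t] h_def sum_subtractf scaleR_diff_right sum_constant_scaleR)
  note batch = batch_estimate[where W="\<lambda>_. pi\<^sup>2 * DIM('a) * L\<^sup>2" and h=h and n=b' and t=t, OF b' \<phi>(1) A \<phi>(2) h]
  show "sq (E t)" unfolding E
    by (rule batch(1)) (simp_all add: h_def zo_grad_centered)
  have "(\<integral>\<omega>. (norm (E t \<omega>))\<^sup>2 \<partial>P) \<le> (\<integral>\<omega>. pi\<^sup>2 * DIM('a) * L\<^sup>2 \<partial>P) / b'" unfolding E
    by (rule batch(2)) (simp_all add: h_def zo_grad_centered)
  then show "(\<integral>\<omega>. (norm (E t \<omega>))\<^sup>2 \<partial>P) \<le> pi\<^sup>2 * DIM('a) * L\<^sup>2 / b'" using P.prob_space by simp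
  show "(\<integral>\<omega>. g (X t \<omega>) \<bullet> E t \<omega> \<partial>P) = 0" unfolding E
    by (rule batch(3)) (simp_all add: h_def zo_grad_centered g_comp_sq)
qed

text \<open>The past is the pair \<open>(X t, V t)\<close>, which determines \<open>E t\<close> and
  also the next iterate. Hence the increment from the fresh batch is orthogonal to
  \<open>E t\<close> and to the next gradient, and its second moment is controlled by the step
  \<open>\<eta> *\<^sub>R V t\<close>.\<close>

lemma update:
  assumes t: "Suc t mod m \<noteq> 0" and sqV: "sq (V t)"
  shows "sq (\<lambda>\<omega>. E (Suc t) \<omega> - E t \<omega>)"
    "(\<integral>\<omega>. (norm (E (Suc t) \<omega> - E t \<omega>))\<^sup>2 \<partial>P) \<le> (DIM('a) * L / \<delta>)\<^sup>2 * \<eta>\<^sup>2 / b * (\<integral>\<omega>. (norm (V t \<omega>))\<^sup>2 \<partial>P)"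
    "sq (E t) \<Longrightarrow> (\<integral>\<omega>. E t \<omega> \<bullet> (E (Suc t) \<omega> - E t \<omega>) \<partial>P) = 0"
    "(\<integral>\<omega>. g (X (Suc t) \<omega>) \<bullet> (E (Suc t) \<omega> - E t \<omega>) \<partial>P) = 0"
proof -
  let ?A = "{..t} \<times> (UNIV :: nat set)"
  let ?N = "borel \<Otimes>\<^sub>M borel :: ('a \<times> 'a) measure"
  define Y where "Y \<omega> = (X t \<omega>, V t \<omega>)" for \<omega>
  define y' where "y' y = fst y - \<eta> *\<^sub>R snd y" for y :: "'a \<times> 'a"
  define h where "h p = zo_grad F \<delta> (y' (fst p)) (snd p) - zo_grad F \<delta> (fst (fst p)) (snd p) - (g (y' (fst p)) - g (fst (fst p)))" for p
  define W where "W y = (DIM('a) * L / \<delta>)\<^sup>2 * (norm (y' y - fst y))\<^sup>2" for y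
  have Y: "Y \<omega> = state t (restrict (Zv \<omega>) ?A)" for \<omega>
    by (simp add: Y_def X_def V_def state_restrict)
  have st: "state t \<in> PiM ?A (\<lambda>_. M0) \<rightarrow>\<^sub>M ?N" by (rule state_measurable) simp
  have y'm[measurable]: "y' \<in> ?N \<rightarrow>\<^sub>M borel" unfolding y'_def[abs_def] by measurable
  have 1: "(\<lambda>p. zo_grad F \<delta> (y' (fst p)) (snd p)) \<in> ?N \<Otimes>\<^sub>M M0 \<rightarrow>\<^sub>M borel"
    "(\<lambda>p. zo_grad F \<delta> (fst (fst p)) (snd p)) \<in> ?N \<Otimes>\<^sub>M M0 \<rightarrow>\<^sub>M borel"
    by (rule zo_grad_comp_measurable; measurable)+
  note [measurable] = 1
  have h: "h \<in> borel_measurable (?N \<Otimes>\<^sub>M M0)" unfolding h_def[abs_def] by measurable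
  have Wm: "W \<in> borel_measurable ?N" unfolding W_def[abs_def] by measurable
  have WY: "W (Y \<omega>) = (DIM('a) * L / \<delta>)\<^sup>2 * \<eta>\<^sup>2 * (norm (V t \<omega>))\<^sup>2" for \<omega>
    by (simp add: W_def Y_def y'_def power_mult_distrib)
  have Wi: "integrable P (\<lambda>\<omega>. W (Y \<omega>))"
    unfolding WY using P.square_integrableD(2)[OF sqV] by simp
  have A: "(Suc t, i) \<notin> ?A" for i by simp
  have X': "X (Suc t) \<omega> = y' (Y \<omega>)" for \<omega> by (simp add: X_Suc y'_def Y_def)
  have E: "E (Suc t) \<omega> - E t \<omega> = (1 / real b) *\<^sub>R (\<Sum>i<b. h (Y \<omega>, Z (Suc t) i \<omega>))" for \<omega>
    using b by (simp add: E_def X' V_update[OF t] h_def Y_def y'_def sum_subtractf scaleR_diff_right sum_constant_scaleR)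
  note batch = batch_estimate[where W=W and h=h and n=b and t="Suc t" and Y=Y, OF b st A Y h Wm Wi]
  show "sq (\<lambda>\<omega>. E (Suc t) \<omega> - E t \<omega>)" unfolding E
    by (rule batch(1)) (simp_all add: h_def W_def zo_grad_diff_centered)
  have "(\<integral>\<omega>. (norm (E (Suc t) \<omega> - E t \<omega>))\<^sup>2 \<partial>P) \<le> (\<integral>\<omega>. W (Y \<omega>) \<partial>P) / b" unfolding E
    by (rule batch(2)) (simp_all add: h_def W_def zo_grad_diff_centered)
  then show "(\<integral>\<omega>. (norm (E (Suc t) \<omega> - E t \<omega>))\<^sup>2 \<partial>P) \<le> (DIM('a) * L / \<delta>)\<^sup>2 * \<eta>\<^sup>2 / b * (\<integral>\<omega>. (norm (V t \<omega>))\<^sup>2 \<partial>P)"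
    unfolding WY by simp
  have u: "(\<integral>\<omega>. u (Y \<omega>) \<bullet> (E (Suc t) \<omega> - E t \<omega>) \<partial>P) = 0" if "u \<in> borel_measurable ?N" "sq (\<lambda>\<omega>. u (Y \<omega>))" for u
    unfolding E by (rule batch(3)[OF _ _ _ _ that]) (simp_all add: h_def W_def zo_grad_diff_centered)
  show "(\<integral>\<omega>. E t \<omega> \<bullet> (E (Suc t) \<omega> - E t \<omega>) \<partial>P) = 0" if "sq (E t)"
    using u[of "\<lambda>y. snd y - g (fst y)"] that by (simp add: Y_def E_def[abs_def])
  show "(\<integral>\<omega>. g (X (Suc t) \<omega>) \<bullet> (E (Suc t) \<omega> - E t \<omega>) \<partial>P) = 0"
    using u[of "\<lambda>y. g (y' y)"] g_comp_sq[OF XV_measurable(1), of "Suc t"] by (simp add: X'[symmetric])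
qed

lemma sq_state: "sq (X t)" "sq (V t)" "sq (E t)"
proof -
  have "sq (X t) \<and> sq (V t) \<and> sq (E t)"
  proof (induction t)
    case 0
    have E: "sq (E 0)" by (rule restart) simp
    have "V 0 = (\<lambda>\<omega>. E 0 \<omega> + g (X 0 \<omega>))" by (simp add: E_def fun_eq_iff)
    then have "sq (V 0)" using P.square_integrable_add[OF E g_comp_sq[OF XV_measurable(1)]] by simp
    moreover have "sq (X 0)" using P.square_integrable_const[of x0] by (simp add: X_0[abs_def])
    ultimately show ?case using E by simp
  next
    case (Suc t)
    then have "sq (X (Suc t))"
      unfolding X_Suc[abs_def] by (intro P.square_integrable_diff P.square_integrable_scaleR) auto
    moreover have E: "sq (E (Suc t))"
    proof (cases "Suc t mod m = 0")
      case True then show ?thesis by (rule restart)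
    next
      case False
      from P.square_integrable_add[OF update(1)[OF False]] Suc show ?thesis by force
    qed
    moreover have "V (Suc t) = (\<lambda>\<omega>. E (Suc t) \<omega> + g (X (Suc t) \<omega>))" by (simp add: E_def fun_eq_iff)
    then have "sq (V (Suc t))" using P.square_integrable_add[OF E g_comp_sq[OF XV_measurable(1)]] by simp
    ultimately show ?case by simp
  qed
  then show "sq (X t)" "sq (V t)" "sq (E t)" by auto
qed

text \<open>Dividing the function values by \<open>\<eta>\<close> eliminates the step size from all inequalities between these
  quantities.\<close>

definition Fr :: "nat \<Rightarrow> real" where "Fr t = (\<integral>\<omega>. smoothing \<delta> f (X t \<omega>) \<partial>P) / \<eta>"
definition Gr :: "nat \<Rightarrow> real" where "Gr t = (\<integral>\<omega>. (norm (g (X t \<omega>)))\<^sup>2 \<partial>P)"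
definition Vr :: "nat \<Rightarrow> real" where "Vr t = (\<integral>\<omega>. (norm (V t \<omega>))\<^sup>2 \<partial>P)"
definition Er :: "nat \<Rightarrow> real" where "Er t = (\<integral>\<omega>. (norm (E t \<omega>))\<^sup>2 \<partial>P)"

section \<open>One-step inequalities in the mean\<close>

lemma sq_g: "sq (\<lambda>\<omega>. g (X t \<omega>))"
  by (rule g_comp_sq[OF XV_measurable(1)])

lemma smoothing_integrable: "integrable P (\<lambda>\<omega>. smoothing \<delta> f (X t \<omega>))"
proof (rule Bochner_Integration.integrable_bound)
  note lip = smoothing_lipschitz[OF f_lipschitz, of \<delta>]
  show "integrable P (\<lambda>\<omega>. \<bar>smoothing \<delta> f 0\<bar> + L * norm (X t \<omega>))"
    using P.square_integrable_norm[OF sq_state(1)] by simp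
  have "\<bar>smoothing \<delta> f x\<bar> \<le> \<bar>smoothing \<delta> f 0\<bar> + L * norm x" for x
    using lipschitz_onD[OF lip, of x 0] by (simp add: dist_norm)
  then show "AE \<omega> in P. norm (smoothing \<delta> f (X t \<omega>)) \<le> norm (\<bar>smoothing \<delta> f 0\<bar> + L * norm (X t \<omega>))"
    by (intro AE_I2) (simp add: order_trans[OF _ abs_ge_self])
  show "(\<lambda>\<omega>. smoothing \<delta> f (X t \<omega>)) \<in> borel_measurable P"
    by (rule measurable_compose[OF XV_measurable(1) borel_measurable_continuous_onI[OF lipschitz_on_continuous_on[OF lip]]])
qed

lemma V_eq: "V t \<omega> = g (X t \<omega>) + E t \<omega>"
  by (simp add: E_def)

lemma Vr_eq: "Vr t = Gr t + 2 * (\<integral>\<omega>. g (X t \<omega>) \<bullet> E t \<omega> \<partial>P) + Er t"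
  unfolding Vr_def Gr_def Er_def V_eq norm_add_squared
  using P.square_integrableD(2)[OF sq_g] P.square_integrableD(2)[OF sq_state(3)] P.square_integrable_inner[OF sq_g sq_state(3)]
  by simp

lemma Vr_nonneg: "0 \<le> Vr t" and Er_nonneg: "0 \<le> Er t"
  unfolding Vr_def Er_def by simp_all

text \<open>With \<open>1 / \<eta>\<close> as Lipschitz constant the terms in \<open>V\<close>
  combine to \<open>- (norm g)\<^sup>2 / 2 + (norm e)\<^sup>2 / 2\<close>, and nothing is left to
  compensate later errors. It is therefore used only for the last step of an epoch.\<close>

lemma descent: "Fr (Suc t) \<le> Fr t - Gr t / 2 + Er t / 2"
proof -
  have pt: "smoothing \<delta> f (X (Suc t) \<omega>) / \<eta> \<le> smoothing \<delta> f (X t \<omega>) / \<eta> - (norm (g (X t \<omega>)))\<^sup>2 / 2 + (norm (E t \<omega>))\<^sup>2 / 2" for \<omega>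
  proof -
    let ?g = "g (X t \<omega>)" and ?v = "V t \<omega>"
    have "smoothing \<delta> f (X (Suc t) \<omega>) - smoothing \<delta> f (X t \<omega>) - ?g \<bullet> (- \<eta> *\<^sub>R ?v) \<le> (1 / \<eta>) / 2 * (norm (- \<eta> *\<^sub>R ?v))\<^sup>2"
      using gradient_lipschitz_descent[OF G g_lipschitz, of "X (Suc t) \<omega>" "X t \<omega>"] unfolding X_Suc by (simp add: abs_le_iff)
    then have "smoothing \<delta> f (X (Suc t) \<omega>) \<le> smoothing \<delta> f (X t \<omega>) + \<eta> * (- (?g \<bullet> ?v) + (norm ?v)\<^sup>2 / 2)"
      using \<eta> by (simp add: power_mult_distrib power2_eq_square algebra_simps)
    also have "- (?g \<bullet> ?v) + (norm ?v)\<^sup>2 / 2 = - (norm ?g)\<^sup>2 / 2 + (norm (E t \<omega>))\<^sup>2 / 2"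
      unfolding V_eq norm_add_squared by (simp add: inner_add_right power2_norm_eq_inner field_simps)
    finally show ?thesis using \<eta> by (simp add: field_simps)
  qed
  have "Fr (Suc t) = (\<integral>\<omega>. smoothing \<delta> f (X (Suc t) \<omega>) / \<eta> \<partial>P)" by (simp add: Fr_def)
  also have "\<dots> \<le> (\<integral>\<omega>. smoothing \<delta> f (X t \<omega>) / \<eta> - (norm (g (X t \<omega>)))\<^sup>2 / 2 + (norm (E t \<omega>))\<^sup>2 / 2 \<partial>P)"
    using smoothing_integrable P.square_integrableD(2)[OF sq_g] P.square_integrableD(2)[OF sq_state(3)] pt
    by (intro integral_mono) auto
  also have "\<dots> = Fr t - Gr t / 2 + Er t / 2"
    unfolding Fr_def Gr_def Er_def
    using smoothing_integrable P.square_integrableD(2)[OF sq_g] P.square_integrableD(2)[OF sq_state(3)] by simp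
  finally show ?thesis .
qed

text \<open>The interpolation inequality leaves
  \<open>- (g' \<bullet> e) / 2 - (norm g')\<^sup>2 / 4\<close> with the new gradient
  \<open>g'\<close> and the old error \<open>e\<close>. In the mean the fresh increment is
  orthogonal to \<open>g'\<close>, so \<open>e\<close> may be replaced by the new error, and
  \<open>Vr_eq\<close> turns the two terms into \<open>- Vr / 4 + Er / 4\<close> at the new
  time.\<close>

lemma interpolated_descent:
  assumes t: "Suc t mod m \<noteq> 0"
  shows "Fr (Suc t) + Vr (Suc t) / 4 - Er (Suc t) / 4 \<le> Fr t - Gr t / 2 + Er t / 4"
proof -
  let ?I = "\<lambda>\<omega>. g (X (Suc t) \<omega>) \<bullet> E t \<omega>"
  have pt: "smoothing \<delta> f (X (Suc t) \<omega>) / \<eta> \<le> smoothing \<delta> f (X t \<omega>) / \<eta> - (norm (g (X t \<omega>)))\<^sup>2 / 2 + (norm (E t \<omega>))\<^sup>2 / 4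
      - ?I \<omega> / 2 - (norm (g (X (Suc t) \<omega>)))\<^sup>2 / 4" for \<omega>
  proof -
    let ?g = "g (X t \<omega>)" and ?g' = "g (X (Suc t) \<omega>)" and ?v = "V t \<omega>"
    have "X (Suc t) \<omega> - X t \<omega> = - \<eta> *\<^sub>R ?v" by (simp add: X_Suc)
    then have "smoothing \<delta> f (X (Suc t) \<omega>) \<le> smoothing \<delta> f (X t \<omega>) + (?g + ?g') \<bullet> (- \<eta> *\<^sub>R ?v) / 2 +
        (1 / \<eta>) / 4 * (norm (- \<eta> *\<^sub>R ?v))\<^sup>2 - (norm (?g' - ?g))\<^sup>2 / (4 * (1 / \<eta>))"
      using gradient_lipschitz_interpolation[OF G g_lipschitz, of "X (Suc t) \<omega>" "X t \<omega>"] \<eta> by simp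
    also have "\<dots> = smoothing \<delta> f (X t \<omega>) + \<eta> * (- ((?g + ?g') \<bullet> ?v) / 2 + (norm ?v)\<^sup>2 / 4 - (norm (?g' - ?g))\<^sup>2 / 4)"
      using \<eta> by (simp add: power_mult_distrib power2_eq_square field_simps)
    also have "- ((?g + ?g') \<bullet> ?v) / 2 + (norm ?v)\<^sup>2 / 4 - (norm (?g' - ?g))\<^sup>2 / 4 =
      - (norm ?g)\<^sup>2 / 2 + (norm (E t \<omega>))\<^sup>2 / 4 - ?I \<omega> / 2 - (norm ?g')\<^sup>2 / 4"
      unfolding V_eq norm_add_squared norm_diff_squared
      by (simp add: inner_add_left inner_add_right inner_commute power2_norm_eq_inner field_simps)
    finally show ?thesis using \<eta> by (simp add: field_simps)
  qed
  note int = smoothing_integrable P.square_integrableD(2)[OF sq_g] P.square_integrableD(2)[OF sq_state(3)]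
    P.square_integrable_inner[OF sq_g sq_state(3)]
  have "Fr (Suc t) = (\<integral>\<omega>. smoothing \<delta> f (X (Suc t) \<omega>) / \<eta> \<partial>P)" by (simp add: Fr_def)
  also have "\<dots> \<le> (\<integral>\<omega>. smoothing \<delta> f (X t \<omega>) / \<eta> - (norm (g (X t \<omega>)))\<^sup>2 / 2 + (norm (E t \<omega>))\<^sup>2 / 4
      - ?I \<omega> / 2 - (norm (g (X (Suc t) \<omega>)))\<^sup>2 / 4 \<partial>P)"
    using int pt by (intro integral_mono) auto
  also have "\<dots> = Fr t - Gr t / 2 + Er t / 4 - (\<integral>\<omega>. ?I \<omega> \<partial>P) / 2 - Gr (Suc t) / 4"
    unfolding Fr_def Gr_def Er_def using int by simp
  also have "(\<integral>\<omega>. ?I \<omega> \<partial>P) = (\<integral>\<omega>. g (X (Suc t) \<omega>) \<bullet> E (Suc t) \<omega> \<partial>P)"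
    using update(4)[OF t sq_state(2)] int by (simp add: inner_diff_right)
  finally show ?thesis using Vr_eq[of "Suc t"] by linarith
qed

text \<open>The error increment is orthogonal to the old error, so the mean squares add.\<close>

lemma error_update:
  assumes t: "Suc t mod m \<noteq> 0"
  shows "Er (Suc t) \<le> Er t + (DIM('a) * L / \<delta>)\<^sup>2 * \<eta>\<^sup>2 / b * Vr t"
proof -
  note u = update[OF t sq_state(2)]
  have "Er (Suc t) = (\<integral>\<omega>. (norm (E t \<omega> + (E (Suc t) \<omega> - E t \<omega>)))\<^sup>2 \<partial>P)" by (simp add: Er_def)
  also have "\<dots> = Er t + 2 * (\<integral>\<omega>. E t \<omega> \<bullet> (E (Suc t) \<omega> - E t \<omega>) \<partial>P) + (\<integral>\<omega>. (norm (E (Suc t) \<omega> - E t \<omega>))\<^sup>2 \<partial>P)"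
    unfolding norm_add_squared Er_def
    using P.square_integrableD(2)[OF sq_state(3)] P.square_integrableD(2)[OF u(1)] P.square_integrable_inner[OF sq_state(3) u(1)]
    by (subst Bochner_Integration.integral_add; (subst Bochner_Integration.integral_add)?; (intro Bochner_Integration.integrable_add integrable_mult_right)?; simp)
  also have "\<dots> \<le> Er t + (DIM('a) * L / \<delta>)\<^sup>2 * \<eta>\<^sup>2 / b * Vr t"
    using u(2) u(3)[OF sq_state(3)] by (simp add: Vr_def)
  finally show ?thesis .
qed

lemma restart_Vr: "t mod m = 0 \<Longrightarrow> Vr t = Gr t + Er t"
  using Vr_eq restart(3) by simp

lemma restart_Er: "t mod m = 0 \<Longrightarrow> Er t \<le> pi\<^sup>2 * DIM('a) * L\<^sup>2 / b'"
  unfolding Er_def by (rule restart(2))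

text \<open>From \<open>0 \<le> (\<beta> - 2 * a * norm x)\<^sup>2\<close>. The weight
  \<open>a\<close> says how much of \<open>Gr t / \<beta>\<close> is available: \<open>1 / 2\<close>
  at ordinary steps, \<open>1 / 4\<close> at the start of an epoch of at least two steps.\<close>

lemma gradient_norm_le:
  assumes "\<beta> > 0" "a > 0"
  shows "(\<integral>\<omega>. norm (g (X t \<omega>)) \<partial>P) \<le> \<beta> / (4 * a) + a * Gr t / \<beta>"
proof -
  have "norm x \<le> \<beta> / (4 * a) + a * (norm x)\<^sup>2 / \<beta>" for x :: 'a
  proof -
    have "0 \<le> (\<beta> - 2 * a * norm x)\<^sup>2" by simp
    then have "4 * a * \<beta> * norm x \<le> \<beta>\<^sup>2 + 4 * a\<^sup>2 * (norm x)\<^sup>2" by (simp add: power2_eq_square algebra_simps)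
    then show ?thesis using assms by (simp add: field_simps power2_eq_square)
  qed
  then have "(\<integral>\<omega>. norm (g (X t \<omega>)) \<partial>P) \<le> (\<integral>\<omega>. \<beta> / (4 * a) + a * (norm (g (X t \<omega>)))\<^sup>2 / \<beta> \<partial>P)"
    using P.square_integrableD(2)[OF sq_g] P.square_integrable_norm[OF sq_g] by (intro integral_mono) auto
  also have "\<dots> = \<beta> / (4 * a) + a * Gr t / \<beta>"
    unfolding Gr_def using P.square_integrableD(2)[OF sq_g] P.prob_space by simp
  finally show ?thesis .
qed

text \<open>For the parameters of the theorem \<open>noise\<close> holds because
  \<open>est_lip\<close> times \<open>\<eta>\<close> is \<open>sqrt b' / m\<close> and
  \<open>b\<close> is at least \<open>2 * b' / m\<close>. The number \<open>\<beta>\<close> is the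
  scale of the gradient norm, and \<open>s\<close> bounds the error at a restart.\<close>

context
  fixes \<beta> s :: real
  assumes m: "m > 0" and noise: "(DIM('a) * L / \<delta>)\<^sup>2 * \<eta>\<^sup>2 / b \<le> 1 / (2 * real m)"
    and \<beta>: "\<beta> > 0" and s: "pi\<^sup>2 * DIM('a) * L\<^sup>2 / b' \<le> s"
begin

text \<open>The weight \<open>(l - k) / 2\<close> is half the number of remaining steps of the epoch, each of which
  inherits the present error.\<close>

lemma epoch_potential:
  assumes t0: "t0 mod m = 0" and l: "l \<le> m" and k: "k < l"
  shows "Fr (t0 + k) + Vr (t0 + k) / 4 + real (l - k) / 2 * Er (t0 + k) \<le>
    Fr t0 + Vr t0 / 4 + real l / 2 * Er t0 - (\<Sum>j<k. Gr (t0 + j)) / 2"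
  using k
proof (induction k)
  case (Suc k)
  let ?t = "t0 + k"
  define r where "r = real (l - Suc k) / 2"
  \<comment> \<open>The new error carries the weight \<open>r\<close> plus the \<open>1 / 4\<close>
    of the interpolated descent. Their sum is at most \<open>m / 2\<close>, so after multiplication
    with the noise \<open>1 / (2 * m)\<close> at most \<open>Vr / 4\<close> results, which the
    potential holds in store.\<close>
  have r: "0 \<le> r" "r + 1 / 4 \<le> real m / 2" "real (l - k) / 2 = r + 1 / 2"
    using Suc.prems l by (auto simp: r_def field_simps of_nat_diff)
  have "Suc ?t mod m \<noteq> 0"
    using Suc.prems l t0 by (metis add_Suc_right add_cancel_right_left le_trans mod_add_left_eq mod_less nat.distinct(1) not_less less_imp_le_nat order_less_le_trans add_0)
  note ID = interpolated_descent[OF this] and EU = error_update[OF this]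
  have "Er (Suc ?t) \<le> Er ?t + 1 / (2 * real m) * Vr ?t"
    using EU mult_right_mono[OF noise Vr_nonneg, of ?t] by linarith
  then have "(r + 1 / 4) * Er (Suc ?t) \<le> (r + 1 / 4) * (Er ?t + 1 / (2 * real m) * Vr ?t)"
    using r by (intro mult_left_mono) auto
  also have "\<dots> = (r + 1 / 4) * Er ?t + (r + 1 / 4) * (1 / (2 * real m)) * Vr ?t" by (simp add: algebra_simps)
  also have "(r + 1 / 4) * (1 / (2 * real m)) * Vr ?t \<le> 1 / 4 * Vr ?t"
  proof (rule mult_right_mono[OF _ Vr_nonneg])
    show "(r + 1 / 4) * (1 / (2 * real m)) \<le> 1 / 4" using r(2) m by (simp add: field_simps)
  qed
  finally have "(r + 1 / 4) * Er (Suc ?t) \<le> (r + 1 / 4) * Er ?t + Vr ?t / 4" by simp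
  with ID have "Fr (Suc ?t) + Vr (Suc ?t) / 4 + r * Er (Suc ?t) \<le> Fr ?t + Vr ?t / 4 + (r + 1 / 2) * Er ?t - Gr ?t / 2"
    by (simp add: algebra_simps)
  moreover have "Fr ?t + Vr ?t / 4 + (r + 1 / 2) * Er ?t \<le> Fr t0 + Vr t0 / 4 + real l / 2 * Er t0 - (\<Sum>j<k. Gr (t0 + j)) / 2"
  proof -
    have "k < l" using Suc.prems by simp
    from Suc.IH[OF this] show ?thesis unfolding r(3) .
  qed
  ultimately show ?case
    unfolding r_def[symmetric] sum.lessThan_Suc add_Suc_right add_divide_distrib by linarith
qed simp

text \<open>The last step may cross a restart and uses \<open>descent\<close>. For
  \<open>l \<ge> 2\<close> the potential starts with \<open>Vr t0 / 4\<close>, which is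
  \<open>Gr t0 / 4 + Er t0 / 4\<close> and consumes half of the gain \<open>Gr t0 / 2\<close> of the
  first step. That step is estimated with weight \<open>1 / 4\<close>, at the price
  \<open>\<beta>\<close> instead of \<open>\<beta> / 2\<close>. The factors \<open>3 / 4\<close> and
  \<open>5 / 8\<close> come from \<open>l = 2\<close>, the worst case.\<close>

lemma epoch_bound:
  assumes t0: "t0 mod m = 0" and l: "0 < l" "l \<le> m"
  shows "(\<Sum>j<l. \<integral>\<omega>. norm (g (X (t0 + j) \<omega>)) \<partial>P) \<le>
    3 / 4 * \<beta> * l + (Fr t0 - Fr (t0 + l)) / \<beta> + 5 / 8 * l * s / \<beta>"
proof -
  let ?N = "\<lambda>t. \<integral>\<omega>. norm (g (X t \<omega>)) \<partial>P"
  have Es: "Er t0 \<le> s" using restart_Er[OF t0] s by simp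
  have s0: "0 \<le> s" using Es Er_nonneg[of t0] by linarith
  have half: "?N t \<le> \<beta> / 2 + Gr t / 2 / \<beta>" for t using gradient_norm_le[of \<beta> "1/2" t] \<beta> by simp
  show ?thesis
  proof (cases "l = 1")
    case True
    \<comment> \<open>An epoch of one step never uses the potential, so its full gain is available
      and weight \<open>1 / 2\<close> applies.\<close>
    have "Gr t0 / 2 \<le> Fr t0 - Fr (Suc t0) + s / 2" using descent[of t0] Es by linarith
    then have "Gr t0 / 2 / \<beta> \<le> (Fr t0 - Fr (Suc t0) + s / 2) / \<beta>" using \<beta> by (intro divide_right_mono) auto
    moreover define q where "q = s / \<beta>"
    ultimately have "?N t0 \<le> \<beta> / 2 + (Fr t0 - Fr (Suc t0)) / \<beta> + q / 2"
      using half[of t0] by (simp add: add_divide_distrib)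
    moreover have "0 \<le> q" using s0 \<beta> by (simp add: q_def)
    ultimately have "?N t0 \<le> 3 / 4 * \<beta> + (Fr t0 - Fr (Suc t0)) / \<beta> + 5 / 8 * q" using \<beta> by linarith
    then show ?thesis using True by (simp add: q_def)
  next
    case False
    then obtain k where k: "l = Suc k" "0 < k" using l by (cases l) auto
    have "Fr (t0 + k) + Vr (t0 + k) / 4 + 1 / 2 * Er (t0 + k) \<le>
      Fr t0 + Vr t0 / 4 + real l / 2 * Er t0 - (\<Sum>j<k. Gr (t0 + j)) / 2"
      using epoch_potential[OF t0 l(2), of k] k by simp
    moreover have "Fr (t0 + l) \<le> Fr (t0 + k) - Gr (t0 + k) / 2 + Er (t0 + k) / 2"
      using descent[of "t0 + k"] k by simp
    ultimately have "(\<Sum>j<l. Gr (t0 + j)) / 2 \<le> Fr t0 - Fr (t0 + l) + Vr t0 / 4 + real l / 2 * Er t0"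
      using Vr_nonneg[of "t0 + k"] by (simp add: k)
    also have "Vr t0 = Gr t0 + Er t0" by (rule restart_Vr[OF t0])
    also have "Fr t0 - Fr (t0 + l) + (Gr t0 + Er t0) / 4 + real l / 2 * Er t0 =
      Fr t0 - Fr (t0 + l) + Gr t0 / 4 + (real l / 2 + 1 / 4) * Er t0" by (simp add: algebra_simps)
    also have "(real l / 2 + 1 / 4) * Er t0 \<le> (real l / 2 + 1 / 4) * s" using Es by (intro mult_left_mono) auto
    also have "(real l / 2 + 1 / 4) * s \<le> 5 / 8 * l * s" using k s0 by (intro mult_right_mono) auto
    finally have main: "(\<Sum>j<l. Gr (t0 + j)) / 2 - Gr t0 / 4 \<le> Fr t0 - Fr (t0 + l) + 5 / 8 * l * s" by linarith
    have split: "(\<Sum>j<l. h j) = h 0 + (\<Sum>j<k. h (Suc j))" for h :: "nat \<Rightarrow> real"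
      unfolding k by (rule sum.lessThan_Suc_shift)
    have "(\<Sum>j<l. ?N (t0 + j)) \<le> (\<beta> + Gr t0 / 4 / \<beta>) + (\<Sum>j<k. \<beta> / 2 + Gr (t0 + Suc j) / 2 / \<beta>)"
      unfolding split[of "\<lambda>j. ?N (t0 + j)"]
      using gradient_norm_le[of \<beta> "1/4" t0] \<beta> by (intro add_mono sum_mono half) auto
    also have "\<dots> = \<beta> + k * \<beta> / 2 + (Gr t0 / 4 + (\<Sum>j<k. Gr (t0 + Suc j)) / 2) / \<beta>"
      by (simp add: sum.distrib sum_divide_distrib add_divide_distrib)
    also have "Gr t0 / 4 + (\<Sum>j<k. Gr (t0 + Suc j)) / 2 = (\<Sum>j<l. Gr (t0 + j)) / 2 - Gr t0 / 4"
      unfolding split[of "\<lambda>j. Gr (t0 + j)"] by simp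
    also have "((\<Sum>j<l. Gr (t0 + j)) / 2 - Gr t0 / 4) / \<beta> \<le> (Fr t0 - Fr (t0 + l) + 5 / 8 * l * s) / \<beta>"
      using main \<beta> by (intro divide_right_mono) auto
    also have "\<beta> + k * \<beta> / 2 \<le> 3 / 4 * \<beta> * l"
    proof -
      have "1 + real k / 2 \<le> 3 / 4 * real l" using k by simp
      from mult_left_mono[OF this, of \<beta>] show ?thesis using \<beta> by (simp add: algebra_simps)
    qed
    finally show ?thesis by (simp add: add_divide_distrib)
  qed
qed

text \<open>\<open>T\<close> need not be a multiple of \<open>m\<close>; \<open>epoch_bound\<close>
  also covers a shorter last epoch, which the induction splits off.\<close>

lemma gradient_norm_sum:
  "(\<Sum>t<T. \<integral>\<omega>. norm (g (X t \<omega>)) \<partial>P) \<le> 3 / 4 * \<beta> * T + (Fr 0 - Fr T) / \<beta> + 5 / 8 * T * s / \<beta>"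
proof (induction T rule: less_induct)
  case (less T)
  show ?case
  proof (cases "T = 0")
    case False
    \<comment> \<open>With \<open>T - 1\<close> in place of \<open>T\<close> the last epoch begins
      strictly before \<open>T\<close> and has between \<open>1\<close> and \<open>m\<close>
      steps.\<close>
    define t0 where "t0 = m * ((T - 1) div m)"
    define l where "l = T - t0"
    have "t0 \<le> T - 1" unfolding t0_def by (rule times_div_less_eq_dividend)
    moreover have "T - 1 < t0 + m" unfolding t0_def using m dividend_less_times_div[of m "T - 1"] by simp
    moreover have "t0 mod m = 0" by (simp add: t0_def)
    ultimately have l: "t0 < T" "0 < l" "l \<le> m" "T = t0 + l" "t0 mod m = 0" using False unfolding l_def by linarith+
    have "(\<Sum>t<t0 + n. h t) = (\<Sum>t<t0. h t) + (\<Sum>j<n. h (t0 + j))" for h :: "nat \<Rightarrow> real" and n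
      by (induction n) (simp_all add: algebra_simps)
    then have "(\<Sum>t<T. \<integral>\<omega>. norm (g (X t \<omega>)) \<partial>P) = (\<Sum>t<t0. \<integral>\<omega>. norm (g (X t \<omega>)) \<partial>P) + (\<Sum>j<l. \<integral>\<omega>. norm (g (X (t0 + j) \<omega>)) \<partial>P)"
      unfolding l(4) .
    also have "\<dots> \<le> (3 / 4 * \<beta> * t0 + (Fr 0 - Fr t0) / \<beta> + 5 / 8 * t0 * s / \<beta>) + (3 / 4 * \<beta> * l + (Fr t0 - Fr (t0 + l)) / \<beta> + 5 / 8 * l * s / \<beta>)"
      by (intro add_mono less.IH epoch_bound l)
    also have "\<dots> = 3 / 4 * \<beta> * T + (Fr 0 - Fr T) / \<beta> + 5 / 8 * T * s / \<beta>"
      unfolding l(4) using \<beta> by (simp add: field_simps)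
    finally show ?thesis .
  qed simp
qed

end

end

section \<open>Parameters and complexity\<close>

text \<open>Machin's formula with \<open>arctan (1 / 5) \<le> 1 / 5\<close>. The value is tailored
  to the final estimate: with \<open>sqrt (2 * pi) \<ge> 12 / 5\<close> it gives
  \<open>15 * pi\<^sup>2 \<le> 64 * sqrt (2 * pi)\<close>, since
  \<open>15 * (16 / 5)\<^sup>2 = 64 * (12 / 5)\<close>.\<close>

lemma pi_le: "pi \<le> 16 / 5"
proof -
  have "arctan (1 / 5) \<le> 1 / 5"
  proof -
    have "0 - arctan 0 \<le> (1 / 5) - arctan (1 / 5)"
    proof (rule DERIV_nonneg_imp_nondecreasing[of 0 "1/5" "\<lambda>x. x - arctan x"])
      fix x :: real
      have "((\<lambda>x. x - arctan x) has_real_derivative (1 - inverse (1 + x\<^sup>2))) (at x)"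
        by (auto intro!: derivative_eq_intros)
      moreover have "inverse (1 + x\<^sup>2) \<le> 1" by (rule inverse_le_1_iff[THEN iffD2]) simp
      ultimately show "\<exists>y. ((\<lambda>x. x - arctan x) has_real_derivative y) (at x) \<and> 0 \<le> y" by fastforce
    qed simp
    then show ?thesis by simp
  qed
  moreover have "0 \<le> arctan (1 / 239)" by simp
  ultimately show ?thesis using machin by linarith
qed

lemma sqrt_two_pi: "12 / 5 \<le> sqrt (2 * pi)" "sqrt (2 * pi) \<le> 3"
proof -
  show "12 / 5 \<le> sqrt (2 * pi)" by (rule real_le_rsqrt) (use pi_gt3 in \<open>simp add: power2_eq_square\<close>)
  show "sqrt (2 * pi) \<le> 3" by (rule real_le_lsqrt) (use pi_less_4 in \<open>simp_all add: power2_eq_square\<close>)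
qed

text \<open>The quotient is \<open>T / m\<close> rounded up, the number of restarts.\<close>

lemma count_multiples:
  assumes "m > 0"
  shows "(\<Sum>t<T. if t mod m = 0 then 1 else 0 :: nat) = (T + m - 1) div m"
proof (induction T)
  case 0
  then show ?case using assms by simp
next
  case (Suc T)
  have "Suc (T + m - 1) = T + m" using assms by simp
  then have "(Suc T + m - 1) div m = (T + m - 1) div m + (if T mod m = 0 then 1 else 0)"
    using div_Suc[of "T + m - 1" m] by (simp add: mod_simps)
  then show ?case using Suc by simp
qed

lemma gfm_cost_le:
  assumes m: "m > 0"
  shows "real (gfm_cost T m b b') \<le> 2 * real b' * (real T / real m + 1) + 4 * real b * real T"
proof -
  have "gfm_cost T m b b' \<le> (\<Sum>t<T. 2 * b' * (if t mod m = 0 then 1 else 0) + 4 * b)"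
    unfolding gfm_cost_def by (intro sum_mono) auto
  also have "\<dots> = 2 * b' * ((T + m - 1) div m) + 4 * b * T"
    by (simp add: sum.distrib sum_distrib_left[symmetric] count_multiples[OF m] del: mult_Suc_right)
  finally have "real (gfm_cost T m b b') \<le> 2 * real b' * real ((T + m - 1) div m) + 4 * real b * real T"
    by (metis (mono_tags) of_nat_le_iff of_nat_add of_nat_mult of_nat_numeral)
  also have "real ((T + m - 1) div m) \<le> real (T + m - 1) / real m"
  proof -
    have "(T + m - 1) div m * m \<le> T + m - 1" by (rule div_times_less_eq_dividend)
    then have "real ((T + m - 1) div m) * real m \<le> real (T + m - 1)" by (metis of_nat_le_iff of_nat_mult)
    then show ?thesis using m by (subst pos_le_divide_eq) auto
  qed
  also have "\<dots> \<le> real (T + m) / real m" using m by (intro divide_right_mono) auto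
  also have "\<dots> = real T / real m + 1" using m by (simp add: add_divide_distrib)
  finally show ?thesis by (simp add: mult_left_mono)
qed

lemma length_zo_queries: "length (zo_queries \<delta> x S) = 2 * length S"
  by (induction S) (auto simp: zo_queries_def)

lemma length_gfm_queries: "length (gfm_queries F \<delta> x0 \<eta> m b b' z T) = gfm_cost T m b b'"
proof -
  have "length (gfm_queries F \<delta> x0 \<eta> m b b' z T) = (\<Sum>t\<leftarrow>[0..<T]. if t mod m = 0 then 2 * b' else 4 * b)"
    unfolding gfm_queries_def Let_def length_concat map_map
    by (intro arg_cong[of _ _ sum_list] map_cong refl) (simp add: length_zo_queries sample_def)
  also have "\<dots> = gfm_cost T m b b'"
    unfolding gfm_cost_def by (simp add: interv_sum_list_conv_sum_set_nat atLeast0LessThan)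
  finally show ?thesis .
qed

lemma real_nat_ceiling:
  assumes "0 \<le> (x::real)"
  shows "x \<le> real (nat \<lceil>x\<rceil>)" "real (nat \<lceil>x\<rceil>) \<le> x + 1"
  using assms by (simp_all add: real_nat_ceiling_ge of_nat_nat)

lemma gfm_parameters:
  fixes c L \<delta> \<epsilon> :: real and d :: nat
  assumes pos: "d \<ge> 1" "L > 0" "\<delta> > 0" "\<epsilon> > 0" "c > 0"
  defines "b' \<equiv> par_b' d L \<epsilon>" and "m \<equiv> par_m c d L \<delta> \<epsilon>" and "b \<equiv> par_b c d L \<delta> \<epsilon>" and "\<eta> \<equiv> par_eta c d L \<delta> \<epsilon>"
  shows "b' > 0" "m > 0" "b > 0" "\<eta> > 0"
    and "2 * est_var d L / \<epsilon>\<^sup>2 \<le> b'" "b' \<le> 2 * est_var d L / \<epsilon>\<^sup>2 + 1"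
    and "sm_lip c d L \<delta> * sqrt b' / est_lip d L \<delta> \<le> m" "m \<le> sm_lip c d L \<delta> * sqrt b' / est_lip d L \<delta> + 1"
    and "2 * real b' / m \<le> b" "b \<le> 2 * real b' / m + 1"
    and "\<eta> = sqrt b' / (m * est_lip d L \<delta>)"
proof -
  have v: "0 < 2 * est_var d L / \<epsilon>\<^sup>2" using pos by (simp add: est_var_def)
  show b': "b' > 0" unfolding b'_def par_b'_def using v by simp
  show "2 * est_var d L / \<epsilon>\<^sup>2 \<le> b'" "b' \<le> 2 * est_var d L / \<epsilon>\<^sup>2 + 1"
    unfolding b'_def par_b'_def using v by (intro real_nat_ceiling; simp)+
  have l: "0 < est_lip d L \<delta>" "0 < sm_lip c d L \<delta>" using pos by (simp_all add: est_lip_def sm_lip_def)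
  then have a: "0 < sm_lip c d L \<delta> * sqrt b' / est_lip d L \<delta>" using b' by simp
  show m: "m > 0" unfolding m_def par_m_def b'_def[symmetric] using a by simp
  show "sm_lip c d L \<delta> * sqrt b' / est_lip d L \<delta> \<le> m" "m \<le> sm_lip c d L \<delta> * sqrt b' / est_lip d L \<delta> + 1"
    unfolding m_def par_m_def b'_def[symmetric] using a by (intro real_nat_ceiling; simp)+
  have q: "0 < 2 * real b' / m" using b' m by simp
  show "b > 0" unfolding b_def par_b_def b'_def[symmetric] m_def[symmetric] using q by simp
  show "2 * real b' / m \<le> b" "b \<le> 2 * real b' / m + 1"
    unfolding b_def par_b_def b'_def[symmetric] m_def[symmetric] using q by (intro real_nat_ceiling; simp)+
  show e: "\<eta> = sqrt b' / (m * est_lip d L \<delta>)" by (simp add: \<eta>_def par_eta_def b'_def m_def)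
  show "\<eta> > 0" unfolding e using b' m l by simp
qed

text \<open>Everything is measured by \<open>R\<close>, the expression in the complexity bound. The
  condition \<open>\<epsilon> \<le> L\<close> gives \<open>q \<ge> 1\<close>, so that
  \<open>1\<close>, \<open>b'\<close> and \<open>U * M\<close> are dominated by multiples of
  \<open>R\<close>. The constant \<open>c\<close> enters through \<open>m\<close>, to which the
  bound on \<open>T\<close> is proportional up to rounding.\<close>

lemma gfm_cost_bound:
  fixes c L \<delta> \<epsilon> \<Delta> :: real and d :: nat
  assumes pos: "d \<ge> 1" "L > 0" "\<delta> > 0" "\<epsilon> > 0" "c > 0" and \<Delta>: "\<Delta> \<ge> 0" and small: "\<epsilon> \<le> L"
  shows "real (gfm_cost (par_T c d L \<delta> \<epsilon> \<Delta>) (par_m c d L \<delta> \<epsilon>) (par_b c d L \<delta> \<epsilon>) (par_b' d L \<epsilon>))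
    \<le> (1600 + 16 * c) * (real d powr (3/2) * (L ^ 3 / \<epsilon> ^ 3 + \<Delta> * L\<^sup>2 / (\<delta> * \<epsilon> ^ 3)))"
proof -
  define b' m b \<eta> T where "b' = par_b' d L \<epsilon>" and "m = par_m c d L \<delta> \<epsilon>" and "b = par_b c d L \<delta> \<epsilon>"
    and "\<eta> = par_eta c d L \<delta> \<epsilon>" and "T = par_T c d L \<delta> \<epsilon> \<Delta>"
  note par = gfm_parameters[OF pos, folded b'_def m_def b_def \<eta>_def]
  define q where "q = L / \<epsilon>"
  define D where "D = sqrt d"
  define M where "M = est_lip d L \<delta>"
  define \<Delta>' where "\<Delta>' = \<Delta> + L * \<delta>"
  define U where "U = 4 * \<Delta>' / \<epsilon>\<^sup>2"
  define R where "R = D ^ 3 * (q\<^sup>2 / (\<delta> * \<epsilon>) * \<Delta>')"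
  have q: "1 \<le> q" using pos small by (simp add: q_def)
  have D: "1 \<le> D" "D\<^sup>2 = d" using pos by (simp_all add: D_def)
  have M: "0 < M" "M = D\<^sup>2 * L / \<delta>" using pos by (simp_all add: M_def est_lip_def D)
  have \<Delta>': "0 < \<Delta>'" using pos \<Delta> by (simp add: \<Delta>'_def add_nonneg_pos)
  have U: "0 < U" using \<Delta>' pos by (simp add: U_def)
  have R_eq: "real d powr (3/2) * (L ^ 3 / \<epsilon> ^ 3 + \<Delta> * L\<^sup>2 / (\<delta> * \<epsilon> ^ 3)) = R"
  proof -
    have "real d powr (3/2) = real d powr (1 + 1/2)" by simp
    also have "\<dots> = D ^ 3" using pos unfolding powr_add D_def
      by (simp add: powr_half_sqrt power3_eq_cube)
    finally show ?thesis
      unfolding R_def q_def \<Delta>'_def using pos by (simp add: field_simps power2_eq_square power3_eq_cube)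
  qed
  have R_ge: "D ^ 3 * q ^ 3 \<le> R"
  proof -
    have "q ^ 3 \<le> q\<^sup>2 / (\<delta> * \<epsilon>) * \<Delta>'"
      unfolding q_def \<Delta>'_def using pos \<Delta> by (simp add: field_simps power2_eq_square power3_eq_cube)
    then show ?thesis unfolding R_def using D by (intro mult_left_mono) auto
  qed
  have Dq: "D\<^sup>2 * q\<^sup>2 \<le> D ^ 3 * q ^ 3" using D(1) q by (intro mult_mono power_increasing) auto
  have Dq1: "1 \<le> D\<^sup>2 * q\<^sup>2" using D(1) q by (metis one_le_power mult_ge1_I)
  have v: "2 * est_var d L / \<epsilon>\<^sup>2 = 32 * sqrt (2 * pi) * (D\<^sup>2 * q\<^sup>2)"
    by (simp add: est_var_def q_def D power_divide)
  \<comment> \<open>The coefficient \<open>32 * sqrt (2 * pi)\<close> is at most \<open>96\<close>;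
    one more unit pays for rounding up, since \<open>D\<^sup>2 * q\<^sup>2 \<ge> 1\<close>.\<close>
  have b'_le: "real b' \<le> 97 * (D\<^sup>2 * q\<^sup>2)"
  proof -
    have "32 * sqrt (2 * pi) * (D\<^sup>2 * q\<^sup>2) \<le> 96 * (D\<^sup>2 * q\<^sup>2)" using sqrt_two_pi(2) by (intro mult_right_mono) auto
    then show ?thesis using par(6) Dq1 unfolding v by linarith
  qed
  have b'1: "1 \<le> sqrt b'" using par(1) by simp
  have sb': "sqrt b' \<le> 10 * (D * q)"
  proof (rule real_le_lsqrt)
    show "real b' \<le> (10 * (D * q))\<^sup>2" using b'_le Dq1 by (simp add: power_mult_distrib)
  qed (use D q in auto)
  have \<eta>_inv: "1 / \<eta> = m * M / sqrt b'" unfolding par(11) M_def[symmetric] by simp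
  have T_le: "T \<le> U * (m * M / sqrt b') + 1"
  proof -
    have eq: "4 * (\<Delta> + L * \<delta>) / (\<eta> * \<epsilon>\<^sup>2) = U * (1 / \<eta>)" by (simp add: U_def \<Delta>'_def)
    have "0 \<le> U * (1 / \<eta>)" using U par(4) by simp
    then show ?thesis
      unfolding T_def par_T_def \<eta>_def[symmetric] eq \<eta>_inv[symmetric] by (rule real_nat_ceiling(2))
  qed
  have m1: "1 \<le> real m" using par(2) by simp
  have t1: "real b' * (real T / m) \<le> U * M * sqrt b' + b'"
  proof -
    have "real T / m \<le> (U * (m * M / sqrt b') + 1) / m" using T_le m1 by (intro divide_right_mono) auto
    also have "\<dots> = U * M / sqrt b' + 1 / m" using m1 by (simp add: add_divide_distrib)
    finally have "real b' * (real T / m) \<le> real b' * (U * M / sqrt b' + 1 / m)" by (intro mult_left_mono) auto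
    also have "\<dots> = U * M * (real b' / sqrt b') + b' / m" by (simp add: algebra_simps)
    also have "real b' / sqrt b' = sqrt b'" by (simp add: real_div_sqrt)
    also have "real b' / m \<le> b'" using m1 by (simp add: divide_le_eq mult_le_cancel_left1)
    finally show ?thesis by simp
  qed
  have t2: "real T \<le> U * (c * M / D + M) + 1"
  proof -
    have "sm_lip c d L \<delta> * sqrt b' / M = c * sqrt b' / D"
    proof -
      have "real d = D * D" using D(2) by (simp add: power2_eq_square)
      then show ?thesis unfolding M_def est_lip_def sm_lip_def D_def[symmetric] using pos D(1) by (simp add: field_simps)
    qed
    then have "real m \<le> c * sqrt b' / D + 1" using par(8) unfolding M_def[symmetric] by simp
    then have "real m * M / sqrt b' \<le> (c * sqrt b' / D + 1) * M / sqrt b'"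
      using M(1) b'1 by (intro divide_right_mono mult_right_mono) auto
    also have "\<dots> = c * M / D + M / sqrt b'" using b'1 by (simp add: field_simps)
    also have "M / sqrt b' \<le> M" using M(1) b'1 by (simp add: divide_le_eq mult_le_cancel_left1)
    finally have "U * (real m * M / sqrt b') \<le> U * (c * M / D + M)" using U by (intro mult_left_mono) auto
    then show ?thesis using T_le by simp
  qed
  have UM: "U * M * sqrt b' \<le> 40 * R"
  proof -
    have "U * M * sqrt b' \<le> U * M * (10 * (D * q))" using sb' U M(1) by (intro mult_left_mono) auto
    also have "\<dots> = 40 * R"
      unfolding U_def M(2) R_def q_def using pos by (simp add: field_simps power2_eq_square power3_eq_cube)
    finally show ?thesis .
  qed
  have UM1: "U * M \<le> 4 * R" "U * (c * M / D) \<le> c * (4 * R)"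
  proof -
    have e: "4 * R = U * M * (D * q)"
      unfolding U_def M(2) R_def q_def using pos by (simp add: field_simps power2_eq_square power3_eq_cube)
    have "1 \<le> D * q" using D q by (metis mult_ge1_I)
    then show "U * M \<le> 4 * R" unfolding e using U M(1) by simp
    moreover have "M / D \<le> M" using M(1) D(1) by (simp add: divide_le_eq mult_le_cancel_left1)
    then have "c * (U * (M / D)) \<le> c * (U * M)" using U pos by (intro mult_left_mono) auto
    ultimately show "U * (c * M / D) \<le> c * (4 * R)" using pos by (smt (verit) mult.left_commute mult_left_mono times_divide_eq_right)
  qed
  have b'R: "real b' \<le> 97 * R" and R1: "1 \<le> R" using b'_le Dq Dq1 R_ge by linarith+
  have "real (gfm_cost T m b b') \<le> 2 * real b' * (real T / real m + 1) + 4 * real b * real T"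
    by (rule gfm_cost_le[OF par(2)])
  also have "\<dots> \<le> 2 * real b' * (real T / real m + 1) + 4 * (2 * real b' / m + 1) * real T"
    using par(10) by (intro add_left_mono mult_right_mono mult_left_mono) auto
  \<comment> \<open>Restarts contribute \<open>2\<close> and updates \<open>8\<close> times
    \<open>b' * T / m\<close>; the rounding of \<open>b\<close> adds \<open>4 * T\<close>.\<close>
  also have "\<dots> = 10 * (real b' * (real T / m)) + 2 * real b' + 4 * real T" by (simp add: algebra_simps)
  also have "\<dots> \<le> 10 * (U * M * sqrt b' + b') + 2 * real b' + 4 * (U * (c * M / D + M) + 1)"
    by (intro add_mono mult_left_mono t1 t2) auto
  also have "\<dots> = 10 * (U * M * sqrt b') + 12 * real b' + 4 * (U * (c * M / D)) + 4 * (U * M) + 4"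
    by (simp add: algebra_simps)
  also have "\<dots> \<le> 10 * (40 * R) + 12 * (97 * R) + 4 * (c * (4 * R)) + 4 * (4 * R) + 4 * R"
    using UM UM1 b'R R1 by linarith
  \<comment> \<open>The coefficients add up to \<open>1584 + 16 * c\<close>.\<close>
  also have "\<dots> \<le> (1600 + 16 * c) * R" using R1 by (simp add: algebra_simps)
  finally show ?thesis unfolding R_eq b'_def m_def b_def T_def .
qed

text \<open>Independence of \<open>\<tau>\<close> from the samples is given for \<sigma>-algebras;
  this passes it on to functions measurable with respect to them.\<close>

lemma (in prob_space) indep_var_if_indep_set:
  assumes ind: "indep_set (sets A) (sets B)" and sp: "space A = space M" "space B = space M"
    and X: "X \<in> A \<rightarrow>\<^sub>M M1" and Y: "Y \<in> B \<rightarrow>\<^sub>M M2"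
  shows "indep_var M1 X M2 Y"
proof -
  have ev: "sets A \<subseteq> events" "sets B \<subseteq> events"
    using ind unfolding indep_set_def indep_sets_def by (auto split: bool.splits)
  have SX: "sigma_sets (space M) {X -` E \<inter> space M |E. E \<in> sets M1} \<subseteq> sets A"
    unfolding sp(1)[symmetric] using measurable_sets[OF X] by (intro sets.sigma_sets_subset) auto
  have SY: "sigma_sets (space M) {Y -` E \<inter> space M |E. E \<in> sets M2} \<subseteq> sets B"
    unfolding sp(2)[symmetric] using measurable_sets[OF Y] by (intro sets.sigma_sets_subset) auto
  have "indep_set (sigma_sets (space M) {X -` E \<inter> space M |E. E \<in> sets M1})
      (sigma_sets (space M) {Y -` E \<inter> space M |E. E \<in> sets M2})"
    by (rule indep_setI[OF order_trans[OF SX ev(1)] order_trans[OF SY ev(2)]])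
      (rule indep_setD[OF ind subsetD[OF SX] subsetD[OF SY]])
  moreover have "X \<in> M \<rightarrow>\<^sub>M M1"
    using measurable_sets[OF X] measurable_space[OF X] ev(1) sp by (intro measurableI) auto
  moreover have "Y \<in> M \<rightarrow>\<^sub>M M2"
    using measurable_sets[OF Y] measurable_space[OF Y] ev(2) sp by (intro measurableI) auto
  ultimately show ?thesis by (simp add: indep_var_eq)
qed

context gfm
begin

lemma infdist_goldstein_le: "infdist 0 (goldstein \<delta> f x) \<le> norm (g x)"
  using infdist_le[OF smoothing_gradient_in_goldstein[OF f_lipschitz \<delta> G[of x]], of 0] by simp

text \<open>The expectation splits according to the value of \<open>\<tau>\<close>. As
  \<open>X t\<close> depends on the samples alone, the indicator of \<open>\<tau> = t\<close> is
  independent of it and contributes its probability \<open>1 / T\<close>.\<close>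

lemma random_iterate:
  fixes \<tau> :: "'p \<Rightarrow> nat" and \<phi> :: "'a \<Rightarrow> real"
  assumes T: "T > 0"
    and \<tau>: "distr P (count_space UNIV) \<tau> = measure_pmf (pmf_of_set {..<T})"
    and ind: "P.indep_set
         (sets (vimage_algebra (space P) Zv (PiM UNIV (\<lambda>_. M0))))
         (sets (vimage_algebra (space P) \<tau> (count_space UNIV)))"
    and \<phi>[measurable]: "\<phi> \<in> borel_measurable borel" and bnd: "\<And>x. 0 \<le> \<phi> x" "\<And>x. \<phi> x \<le> C"
  shows "integrable P (\<lambda>\<omega>. \<phi> (X (\<tau> \<omega>) \<omega>))"
    and "(\<integral>\<omega>. \<phi> (X (\<tau> \<omega>) \<omega>) \<partial>P) = (\<Sum>t<T. \<integral>\<omega>. \<phi> (X t \<omega>) \<partial>P) / T"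
proof -
  \<comment> \<open>Independence comprises that both families consist of events; measurability of
    \<open>\<tau>\<close> is obtained from this.\<close>
  have ev: "sets (vimage_algebra (space P) Zv (PiM UNIV (\<lambda>_. M0))) \<subseteq> P.events"
    "sets (vimage_algebra (space P) \<tau> (count_space UNIV)) \<subseteq> P.events"
    using ind unfolding P.indep_set_def P.indep_sets_def by (auto split: bool.splits)
  have \<tau>set: "\<tau> -` A \<inter> space P \<in> sets (vimage_algebra (space P) \<tau> (count_space UNIV))" for A
    by (rule in_vimage_algebra) simp
  have \<tau>m[measurable]: "\<tau> \<in> P \<rightarrow>\<^sub>M count_space UNIV"
    using \<tau>set ev(2) by (intro measurableI) auto
  have int\<phi>: "integrable P (\<lambda>\<omega>. \<phi> (X t \<omega>))" for t
    by (rule P.integrable_const_bound[where B=C]) (use bnd in auto)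
  have prob: "P.prob (\<tau> -` {t} \<inter> space P) = 1 / T" if "t < T" for t
  proof -
    have "P.prob (\<tau> -` {t} \<inter> space P) = measure (distr P (count_space UNIV) \<tau>) {t}"
      by (simp add: measure_distr)
    also have "\<dots> = 1 / T" unfolding \<tau> using that T by (simp add: measure_pmf_single lessThan_empty_iff)
    finally show ?thesis .
  qed
  have AEt: "AE \<omega> in P. \<tau> \<omega> < T"
  proof -
    have "AE t in measure_pmf (pmf_of_set {..<T}). t < T" using T by (simp add: AE_measure_pmf_iff lessThan_empty_iff)
    then show ?thesis unfolding \<tau>[symmetric] by (subst (asm) AE_distr_iff) auto
  qed
  have summand: "(\<integral>\<omega>. indicator (\<tau> -` {t} \<inter> space P) \<omega> * \<phi> (X t \<omega>) \<partial>P) = (\<integral>\<omega>. \<phi> (X t \<omega>) \<partial>P) / T"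
    "integrable P (\<lambda>\<omega>. indicator (\<tau> -` {t} \<inter> space P) \<omega> * \<phi> (X t \<omega>))" if t: "t < T" for t
  proof -
    let ?A = "\<tau> -` {t} \<inter> space P" and ?Y = "\<lambda>\<omega>. \<phi> (X t \<omega>)"
    let ?FZ = "vimage_algebra (space P) Zv (PiM UNIV (\<lambda>_. M0))" and ?F\<tau> = "vimage_algebra (space P) \<tau> (count_space UNIV)"
    have Zsp: "Zv \<in> space P \<rightarrow> space (PiM UNIV (\<lambda>_. M0))" using Zv_measurable by (auto dest: measurable_space)
    have "(\<lambda>\<omega>. fst (state t (Zv \<omega>))) \<in> ?FZ \<rightarrow>\<^sub>M borel"
      using measurable_compose[OF measurable_vimage_algebra1[OF Zsp] measurable_compose[OF state_measurable measurable_fst]] by simp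
    from measurable_compose[OF this \<phi>] have Y: "?Y \<in> borel_measurable ?FZ" by (simp add: X_def)
    have A: "indicator ?A \<in> borel_measurable ?F\<tau>" using \<tau>set[of "{t}"] by (intro borel_measurable_indicator)
    have "P.indep_var borel ?Y borel (indicator ?A :: 'p \<Rightarrow> real)"
      by (rule P.indep_var_if_indep_set[OF ind _ _ Y A]) simp_all
    note iv = this
    have iA: "integrable P (indicator ?A :: 'p \<Rightarrow> real)"
      by (rule P.integrable_const_bound[where B=1])
        (use \<tau>set[of "{t}"] ev(2) in \<open>auto intro!: borel_measurable_indicator\<close>)
    show "(\<integral>\<omega>. indicator ?A \<omega> * ?Y \<omega> \<partial>P) = (\<integral>\<omega>. ?Y \<omega> \<partial>P) / T"
      using P.indep_var_lebesgue_integral[OF iv int\<phi> iA] prob[OF t] by (simp add: mult.commute)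
    show "integrable P (\<lambda>\<omega>. indicator ?A \<omega> * ?Y \<omega>)"
      using P.indep_var_integrable[OF iv int\<phi> iA] by (simp add: mult.commute)
  qed
  have eq: "AE \<omega> in P. (\<Sum>t<T. indicator (\<tau> -` {t} \<inter> space P) \<omega> * \<phi> (X t \<omega>)) = \<phi> (X (\<tau> \<omega>) \<omega>)"
    using AEt AE_space
  proof eventually_elim
    case (elim \<omega>)
    have "(\<Sum>t<T. indicator (\<tau> -` {t} \<inter> space P) \<omega> * \<phi> (X t \<omega>)) = (\<Sum>t<T. if t = \<tau> \<omega> then \<phi> (X (\<tau> \<omega>) \<omega>) else 0)"
      using elim by (intro sum.cong) (auto simp: indicator_def)
    then show ?case using elim by simp
  qed
  have hb: "has_bochner_integral P (\<lambda>\<omega>. \<Sum>t<T. indicator (\<tau> -` {t} \<inter> space P) \<omega> * \<phi> (X t \<omega>)) (\<Sum>t<T. (\<integral>\<omega>. \<phi> (X t \<omega>) \<partial>P) / T)"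
    using summand by (intro has_bochner_integral_sum) (auto simp: has_bochner_integral_iff)
  have "(\<lambda>\<omega>. \<phi> (X (\<tau> \<omega>) \<omega>)) \<in> borel_measurable P"
    by (rule measurable_compose_countable[OF _ \<tau>m]) measurable
  from has_bochner_integralI_AE[OF hb this eq]
  show "integrable P (\<lambda>\<omega>. \<phi> (X (\<tau> \<omega>) \<omega>))" "(\<integral>\<omega>. \<phi> (X (\<tau> \<omega>) \<omega>) \<partial>P) = (\<Sum>t<T. \<integral>\<omega>. \<phi> (X t \<omega>) \<partial>P) / T"
    by (simp_all add: has_bochner_integral_iff sum_divide_distrib)
qed

end

text \<open>The asymptotic bound is a closed statement up to \<open>c\<close>: \<open>C\<close> and
  \<open>\<kappa>\<close> are chosen before all primed parameters, so it is uniform in dimension,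
  Lipschitz constant, radius and gap. The condition \<open>\<epsilon>' \<le> \<kappa> * L'\<close>
  expresses small target accuracy; the proof takes \<open>\<kappa> = 1\<close>.\<close>

theorem theorem1:
  fixes F :: "real ^ 'n \<Rightarrow> 'xi \<Rightarrow> real" and Lip :: "'xi \<Rightarrow> real" and \<Xi> :: "'xi measure"
    and P :: "'p measure" and Z :: "nat \<Rightarrow> nat \<Rightarrow> 'p \<Rightarrow> 'xi \<times> (real ^ 'n)" and \<tau> :: "'p \<Rightarrow> nat"
    and f :: "real ^ 'n \<Rightarrow> real" and x0 :: "real ^ 'n"
    and c L \<delta> \<epsilon> \<Delta> \<eta> :: real and d T m b b' :: nat
    and xout :: "'p \<Rightarrow> real ^ 'n"
  assumes d: "d = CARD('n)"
    and pos: "L > 0" "\<delta> > 0" "\<epsilon> > 0" "c > 0"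
    and smoothing_constant:
      "\<forall>K r (h :: real ^ 'n \<Rightarrow> real). K-lipschitz_on UNIV h \<and> r > 0 \<longrightarrow>
         (\<exists>G. (\<forall>x. GDERIV (smoothing r h) x :> G x) \<and>
              (c * sqrt (real d) * K / r)-lipschitz_on UNIV G)"
    and \<Xi>: "prob_space \<Xi>"
    and F_integrable: "\<forall>x. integrable \<Xi> (F x)"
    and F_lipschitz: "\<forall>\<xi>\<in>space \<Xi>. \<forall>x y. \<bar>F x \<xi> - F y \<xi>\<bar> \<le> Lip \<xi> * norm (x - y)"
    and Lip_moment: "integrable \<Xi> (\<lambda>\<xi>. (Lip \<xi>)\<^sup>2)" "(\<integral>\<xi>. (Lip \<xi>)\<^sup>2 \<partial>\<Xi>) \<le> L\<^sup>2"
    and f: "f = objective \<Xi> F" "bdd_below (range f)"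
    and \<Delta>: "\<Delta> = f x0 - (INF x. f x)"
    and params: "T = par_T c d L \<delta> \<epsilon> \<Delta>" "b' = par_b' d L \<epsilon>" "b = par_b c d L \<delta> \<epsilon>"
      "\<eta> = par_eta c d L \<delta> \<epsilon>" "m = par_m c d L \<delta> \<epsilon>"
    and P: "prob_space P"
    and samples_iid:
      "prob_space.indep_vars P (\<lambda>_. \<Xi> \<Otimes>\<^sub>M unif_sphere) (\<lambda>(t, i). Z t i) UNIV"
      "\<forall>t i. distr P (\<Xi> \<Otimes>\<^sub>M unif_sphere) (Z t i) = \<Xi> \<Otimes>\<^sub>M unif_sphere"
    and \<tau>_uniform: "distr P (count_space UNIV) \<tau> = measure_pmf (pmf_of_set {..<T})"
    and \<tau>_indep:
      "prob_space.indep_set P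
         (sets (vimage_algebra (space P) (\<lambda>\<omega> (t, i). Z t i \<omega>) (\<Pi>\<^sub>M (t, i)\<in>UNIV. \<Xi> \<Otimes>\<^sub>M unif_sphere)))
         (sets (vimage_algebra (space P) \<tau> (count_space UNIV)))"
    and xout: "xout = (\<lambda>\<omega>. gfm_iterate F \<delta> x0 \<eta> m b b' (\<lambda>t i. Z t i \<omega>) (\<tau> \<omega>))"
  shows "integrable P (\<lambda>\<omega>. infdist 0 (goldstein \<delta> f (xout \<omega>))) \<and>
      (\<integral>\<omega>. infdist 0 (goldstein \<delta> f (xout \<omega>)) \<partial>P) \<le> \<epsilon> \<and>
      (\<forall>\<omega>\<in>space P. length (gfm_queries F \<delta> x0 \<eta> m b b' (\<lambda>t i. Z t i \<omega>) T) = gfm_cost T m b b') \<and>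
      (\<exists>C>0. \<exists>\<kappa>>0. \<forall>d' L' \<delta>' \<epsilon>' \<Delta>'.
         d' \<ge> 1 \<and> L' > 0 \<and> \<delta>' > 0 \<and> \<Delta>' \<ge> 0 \<and> 0 < \<epsilon>' \<and> \<epsilon>' \<le> \<kappa> * L' \<longrightarrow>
         real (gfm_cost (par_T c d' L' \<delta>' \<epsilon>' \<Delta>') (par_m c d' L' \<delta>' \<epsilon>')
                 (par_b c d' L' \<delta>' \<epsilon>') (par_b' d' L' \<epsilon>'))
           \<le> C * (real d' powr (3/2) * (L' ^ 3 / \<epsilon>' ^ 3 + \<Delta>' * L'\<^sup>2 / (\<delta>' * \<epsilon>' ^ 3))))"
proof -
  let ?d = "DIM(real ^ 'n)"
  interpret \<Xi>: prob_space \<Xi> by (rule \<Xi>)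
  interpret zo_oracle \<Xi> F Lip L \<delta>
    using pos F_integrable F_lipschitz Lip_moment by unfold_locales auto
  have dd: "d = ?d" "d \<ge> 1" using d by (simp_all add: Suc_le_eq)
  note par = gfm_parameters[OF dd(2) pos(1,2,3,4), folded params(2,3,4,5)]
  \<comment> \<open>With these values the three terms of \<open>gradient_norm_sum\<close> sum to \<open>\<epsilon> / 2 + 3 * \<epsilon> / 8 + \<epsilon> / 8\<close> per step.\<close>
  define s where "s = 2 / 15 * \<epsilon>\<^sup>2"
  define \<beta> where "\<beta> = 2 * \<epsilon> / 3"
  define \<Delta>' where "\<Delta>' = \<Delta> + L * \<delta>"
  have fl: "L-lipschitz_on UNIV f" unfolding f(1) by (rule f_lipschitz)
  obtain g where g: "\<And>x. GDERIV (smoothing \<delta> f) x :> g x" "(sm_lip c d L \<delta>)-lipschitz_on UNIV g"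
    using smoothing_constant fl pos(2) unfolding sm_lip_def by blast
  have Ml: "0 < est_lip d L \<delta>" using pos dd by (simp add: est_lip_def)
  \<comment> \<open>Equality holds when the ceiling in \<open>m\<close> changes nothing, which is
    why no slack in the step size can be used.\<close>
  have "sm_lip c d L \<delta> \<le> 1 / \<eta>"
  proof -
    have "sm_lip c d L \<delta> * sqrt b' \<le> m * est_lip d L \<delta>" using par(7) Ml by (simp add: pos_divide_le_eq)
    then show ?thesis unfolding par(11) using par(1) by (simp add: field_simps)
  qed
  then have gl: "(1 / \<eta>)-lipschitz_on UNIV g" by (rule lipschitz_on_le[OF g(2)])
  interpret P: prob_space P by (rule P)
  interpret gfm \<Xi> F Lip L \<delta> P Z x0 \<eta> m b b' g
  proof unfold_locales
    show "P.indep_vars (\<lambda>_. M0) (\<lambda>(t, i). Z t i) UNIV" by (rule samples_iid(1))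
    show "distr P M0 (Z t i) = M0" for t i using samples_iid(2) by blast
    show "GDERIV (smoothing \<delta> (objective \<Xi> F)) x :> g x" for x using g(1) unfolding f(1) .
  qed (rule par(4) par(3) par(1) gl)+
  have noise: "(?d * L / \<delta>)\<^sup>2 * \<eta>\<^sup>2 / b \<le> 1 / (2 * real m)"
  proof -
    have "(?d * L / \<delta>)\<^sup>2 * \<eta>\<^sup>2 = (est_lip d L \<delta> * \<eta>)\<^sup>2" unfolding est_lip_def dd(1) by (rule power_mult_distrib[symmetric])
    also have "est_lip d L \<delta> * \<eta> = sqrt b' / m" unfolding par(11) using Ml by simp
    finally have "(?d * L / \<delta>)\<^sup>2 * \<eta>\<^sup>2 / b = real b' / (real m)\<^sup>2 / b" by (simp add: power_divide)
    also have "\<dots> \<le> 1 / (2 * real m)"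
      using par(1,2,3,9) by (simp add: field_simps power2_eq_square)
    finally show ?thesis .
  qed
  have variance: "pi\<^sup>2 * ?d * L\<^sup>2 / b' \<le> s"
  proof -
    \<comment> \<open>Cleared of denominators, this is the claim for \<open>b'\<close> without
      rounding, that is \<open>2 * est_var d L / \<epsilon>\<^sup>2\<close>.\<close>
    have "15 * pi\<^sup>2 \<le> 64 * sqrt (2 * pi)"
    proof -
      have "pi\<^sup>2 \<le> (16 / 5)\<^sup>2" using pi_le by (intro power_mono) auto
      then show ?thesis using sqrt_two_pi(1) by (simp add: power2_eq_square)
    qed
    then have "15 * pi\<^sup>2 * (d * L\<^sup>2) \<le> 64 * sqrt (2 * pi) * (d * L\<^sup>2)" by (rule mult_right_mono) simp
    also have "\<dots> = 2 * \<epsilon>\<^sup>2 * (2 * est_var d L / \<epsilon>\<^sup>2)" using pos by (simp add: est_var_def)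
    also have "\<dots> \<le> 2 * \<epsilon>\<^sup>2 * b'" using par(5) by (intro mult_left_mono) auto
    finally have "15 * (pi\<^sup>2 * d * L\<^sup>2) \<le> 2 * \<epsilon>\<^sup>2 * b'" by (simp add: mult_ac)
    then show ?thesis using par(1) by (simp add: s_def dd(1) divide_le_eq mult_ac)
  qed
  have \<beta>: "\<beta> > 0" using pos by (simp add: \<beta>_def)
  have INF: "(INF y. f y) \<le> f x" for x using f(2) by (rule cINF_lower) simp
  have \<Delta>'pos: "0 < \<Delta>'" unfolding \<Delta>'_def \<Delta> using INF[of x0] pos by (simp add: add_nonneg_pos)
  have T: "4 * \<Delta>' / (\<eta> * \<epsilon>\<^sup>2) \<le> T" "T > 0"
  proof -
    have "0 < 4 * \<Delta>' / (\<eta> * \<epsilon>\<^sup>2)" using \<Delta>'pos par(4) pos by simp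
    then show "4 * \<Delta>' / (\<eta> * \<epsilon>\<^sup>2) \<le> T" "T > 0"
      unfolding params(1) par_T_def params(4)[symmetric] \<Delta>'_def by (simp_all add: real_nat_ceiling_ge)
  qed
  have drop: "Fr 0 - Fr T \<le> \<Delta>' / \<eta>"
  proof -
    have "(\<integral>\<omega>. (INF y. f y) \<partial>P) \<le> (\<integral>\<omega>. smoothing \<delta> f (X T \<omega>) \<partial>P)"
      using smoothing_integrable smoothing_bounds(2)[OF fl _ f(2)] pos unfolding f(1) by (intro integral_mono) auto
    then have "(INF y. f y) / \<eta> \<le> Fr T" unfolding Fr_def f(1) using P.prob_space par(4) by (simp add: divide_right_mono)
    moreover have "Fr 0 \<le> (f x0 + L * \<delta>) / \<eta>"
      unfolding Fr_def X_0 using smoothing_bounds(1)[OF fl, of \<delta> x0] pos par(4) P.prob_space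
      by (simp add: f(1) divide_right_mono)
    ultimately show ?thesis unfolding \<Delta>'_def \<Delta> by (simp add: diff_divide_distrib add_divide_distrib)
  qed
  have total: "(\<Sum>t<T. \<integral>\<omega>. norm (g (X t \<omega>)) \<partial>P) \<le> T * \<epsilon>"
  proof -
    have "\<Delta>' / \<eta> \<le> T * \<epsilon>\<^sup>2 / 4"
      using T(1) par(4) pos by (simp add: field_simps)
    with drop have "Fr 0 - Fr T \<le> T * \<epsilon>\<^sup>2 / 4" by (rule order_trans)
    then have "(Fr 0 - Fr T) / \<beta> \<le> T * \<epsilon>\<^sup>2 / 4 / \<beta>" by (rule divide_right_mono) (use \<beta> in simp)
    then have "3 / 4 * \<beta> * T + (Fr 0 - Fr T) / \<beta> + 5 / 8 * T * s / \<beta> \<le> 3 / 4 * \<beta> * T + T * \<epsilon>\<^sup>2 / 4 / \<beta> + 5 / 8 * T * s / \<beta>"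
      by simp
    also have "\<dots> = T * \<epsilon>" unfolding \<beta>_def s_def using pos by (simp add: field_simps power2_eq_square)
    finally show ?thesis using gradient_norm_sum[OF par(2) noise \<beta> variance, of T] by linarith
  qed
  let ?\<phi> = "\<lambda>x. infdist 0 (goldstein \<delta> f x)"
  have \<phi>m: "?\<phi> \<in> borel_measurable borel" by (rule infdist_goldstein_measurable[OF fl pos(2)])
  have \<phi>le: "?\<phi> x \<le> norm (g x)" for x using infdist_goldstein_le unfolding f(1) .
  have ind: "P.indep_set (sets (vimage_algebra (space P) Zv (PiM UNIV (\<lambda>_. M0)))) (sets (vimage_algebra (space P) \<tau> (count_space UNIV)))"
  proof -
    have "Zv = (\<lambda>\<omega> (t, i). Z t i \<omega>)" by (simp add: Zv_def fun_eq_iff)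
    moreover have "(\<lambda>(t :: nat, i :: nat). M0) = (\<lambda>_. M0)" by auto
    ultimately show ?thesis using \<tau>_indep by simp
  qed
  have xo: "xout \<omega> = X (\<tau> \<omega>) \<omega>" for \<omega> by (simp add: xout X_eq)
  have \<phi>L: "?\<phi> x \<le> L" for x using \<phi>le norm_g_le order_trans by blast
  note rand = random_iterate[OF T(2) \<tau>_uniform ind \<phi>m infdist_nonneg \<phi>L]
  have "(\<Sum>t<T. \<integral>\<omega>. ?\<phi> (X t \<omega>) \<partial>P) \<le> (\<Sum>t<T. \<integral>\<omega>. norm (g (X t \<omega>)) \<partial>P)"
  proof (intro sum_mono integral_mono)
    show "integrable P (\<lambda>\<omega>. ?\<phi> (X t \<omega>))" for t
      using measurable_compose[OF XV_measurable(1) \<phi>m]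
      by (intro P.integrable_const_bound[where B=L]) (use \<phi>L infdist_nonneg[of 0 "goldstein \<delta> f _"] in auto)
  qed (auto simp: \<phi>le P.square_integrable_norm[OF sq_g])
  with total have "(\<Sum>t<T. \<integral>\<omega>. ?\<phi> (X t \<omega>) \<partial>P) / T \<le> \<epsilon>" using T(2) by (simp add: divide_le_eq mult.commute)
  with rand have "integrable P (\<lambda>\<omega>. ?\<phi> (xout \<omega>)) \<and> (\<integral>\<omega>. ?\<phi> (xout \<omega>) \<partial>P) \<le> \<epsilon>" by (simp add: xo)
  moreover have "\<exists>C>0. \<exists>\<kappa>>0. \<forall>d' L' \<delta>' \<epsilon>' \<Delta>'.
         d' \<ge> 1 \<and> L' > 0 \<and> \<delta>' > 0 \<and> \<Delta>' \<ge> 0 \<and> 0 < \<epsilon>' \<and> \<epsilon>' \<le> \<kappa> * L' \<longrightarrow>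
         real (gfm_cost (par_T c d' L' \<delta>' \<epsilon>' \<Delta>') (par_m c d' L' \<delta>' \<epsilon>')
                 (par_b c d' L' \<delta>' \<epsilon>') (par_b' d' L' \<epsilon>'))
           \<le> C * (real d' powr (3/2) * (L' ^ 3 / \<epsilon>' ^ 3 + \<Delta>' * L'\<^sup>2 / (\<delta>' * \<epsilon>' ^ 3)))"
    (is "\<exists>C>0. \<exists>\<kappa>>0. ?bound C \<kappa>")
  proof -
    have "?bound (1600 + 16 * c) 1"
      by (intro allI impI, elim conjE, rule gfm_cost_bound) (simp_all only: mult_1 pos(4))
    moreover have "1600 + 16 * c > 0" using pos(4) by simp
    ultimately show ?thesis using zero_less_one by blast
  qed
  ultimately show ?thesis unfolding length_gfm_queries by simp
qed

end
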